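(* Let $u\in W^{1,1}((0,T);H^1_0(\Omega))$ be the solution of the fractional diffusion problem and let $U\in\mathcal W(\mathcal M,\mathbf p)$ be its DG approximation with $U^0_-=u_0$, where $p_n\ge1$ for all $n$. Assume that $k_i\le k_j$ for $i\le j$. Let $\eta=\Pi u-u$, where $\Pi u\in\mathcal W(\mathcal M,\mathbf p)$ is the projection of $u$. Then $$\max_{1\le n\le N}\max\big\{\|U^{n-1}_+-u(t_{n-1})\|^2,\ \|U^{n}_--u(t_{n})\|^2\big\}+\min_{1\le n\le N}\left(t_n^{-1}k_n^{\min\{1,p_n-1\}}\right)\frac{\|u-U\|_{L_\infty(L_2)}^2}{\max_{1\le n\le N}p_n^2}\le C_{\alpha,T}\max_{1\le n\le N}k_n^{\alpha}\Big(\int_{t_{n-1}}^{t_n}\|\eta'\|_1\,dt\Big)^2,$$ where the constant $C_{\alpha,T}$ depends on $\alpha$ and $T$ (and the fixed data $\Omega$, $K$), but not on the mesh, the polynomial degrees, or $u$.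
   Context: Fix $-1<\alpha<0$, $T>0$, a bounded polyhedral domain $\Omega$, and a constant $K>0$ (the diffusivity). $\langle\cdot,\cdot\rangle$ and $\|\cdot\|$ are the inner product and norm of $L_2(\Omega)$; $\|\cdot\|_1$ is the norm of $H^1(\Omega)$. The operator $Au=-\mathrm{div}(K\nabla u)$ with homogeneous Dirichlet boundary conditions has a complete orthonormal eigensystem $\{\phi_m\}_{m\ge1}$ in $L_2(\Omega)$ with eigenvalues $0<\lambda_1\le\lambda_2\le\cdots$. The associated bilinear form on $H^1_0(\Omega)\times H^1_0(\Omega)$ is $A(v,w)=K\langle\nabla v,\nabla w\rangle=\sum_{m\ge1}\lambda_m\langle v,\phi_m\rangle\langle w,\phi_m\rangle$. With $\omega_{\alpha+1}(t)=t^{\alpha}/\Gamma(\alpha+1)$, the Riemann–Liouville fractional derivative of order $-\alpha$ is $\mathcal B_\alpha v(t)=\frac{\partial}{\partial t}\int_0^t\omega_{\alpha+1}(t-s)v(s)\,ds$. The fractional diffusion problem is $u'+\mathcal B_\alpha Au=f$ on $\Omega\times(0,T]$, $u|_{t=0}=u_0$, with homogeneous Dirichlet boundary conditions. $\mathcal M$ is a partition $0=t_0<t_1<\cdots<t_N=T$ with $I_n=(t_{n-1},t_n)$, $k_n=t_n-t_{n-1}$, and $\mathbf p=(p_1,\dots,p_N)$ is a vector of polynomial degrees. $\mathbb P_{p}$ is the space of polynomials in $t$ of degree $\le p$ with coefficients in $H^1_0(\Omega)$, and $\mathcal W(\mathcal M,\mathbf p)=\{v:[0,T]\to H^1_0(\Omega):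 v|_{I_n}\in\mathbb P_{p_n},\ 1\le n\le N\}$. One writes $v^n_-=v(t_n^-)$, $v^n_+=v(t_n^+)$ for one-sided limits, and $\|\phi\|_{L_\infty(L_2)}:=\max_{1\le n\le N}\sup_{t\in I_n}\|\phi(t)\|$. The DG approximation $U\in\mathcal W(\mathcal M,\mathbf p)$, with prescribed starting value $U^0_-$, is determined by: for every $1\le n\le N$ and every $X\in\mathbb P_{p_n}$, $$\langle U^{n-1}_+-U^{n-1}_-,X^{n-1}_+\rangle+\int_{t_{n-1}}^{t_n}\Big(\langle U',X\rangle+A(\mathcal B_\alpha U,X)\Big)\,dt=\int_{t_{n-1}}^{t_n}\langle f,X\rangle\,dt .$$ The projection $\Pi u\in\mathcal W(\mathcal M,\mathbf p)$ is defined by, for $1\le n\le N$: $\Pi u(t_n^-)=u(t_n)$ and $\int_{t_{n-1}}^{t_n}\langle u-\Pi u,v\rangle\,dt=0$ for all $v\in\mathbb P_{p_n-1}$. Derivatives $\eta'$ are taken with respect to $t$ on each $I_n$. *)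

theory Defs
  imports "HOL-Analysis.Analysis"
begin

section \<open>The Hilbert space of square-integrable functions\<close>

definition square_integrable :: "('a::euclidean_space \<Rightarrow> 'b::euclidean_space) \<Rightarrow> bool"
  where "square_integrable f \<longleftrightarrow>
    f \<in> borel_measurable lebesgue \<and> integrable lebesgue (\<lambda>x. (norm (f x))\<^sup>2)"

lemma square_integrable_measurable:
  "square_integrable f \<Longrightarrow> f \<in> borel_measurable lebesgue"
  by (simp add: square_integrable_def)

lemma square_integrable_iff_nn:
  "square_integrable f \<longleftrightarrow>
    f \<in> borel_measurable lebesgue \<and> (\<integral>\<^sup>+x. ennreal ((norm (f x))\<^sup>2) \<partial>lebesgue) < \<infinity>"
  by (auto simp: square_integrable_def integrable_iff_bounded)

lemma square_integrable_dominated: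
  assumes "square_integrable f" "g \<in> borel_measurable lebesgue"
    "AE x in lebesgue. norm (g x) \<le> c * norm (f x)"
  shows "square_integrable g"
  unfolding square_integrable_def
proof (intro conjI assms)
  have [measurable]: "g \<in> borel_measurable lebesgue" by fact
  have "integrable lebesgue (\<lambda>x. c\<^sup>2 * (norm (f x))\<^sup>2)"
    using assms(1) by (simp add: square_integrable_def)
  then show "integrable lebesgue (\<lambda>x. (norm (g x))\<^sup>2)"
  proof (rule Bochner_Integration.integrable_bound)
    show "AE x in lebesgue. norm ((norm (g x))\<^sup>2) \<le> norm (c\<^sup>2 * (norm (f x))\<^sup>2)"
      using assms(3)
    proof eventually_elim
      case (elim x)
      then have "(norm (g x))\<^sup>2 \<le> (c * norm (f x))\<^sup>2"
        by (intro power_mono) auto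
      then show ?case by (simp add: power_mult_distrib)
    qed
  qed measurable
qed

lemma square_integrable_zero: "square_integrable (\<lambda>x. 0)"
  by (simp add: square_integrable_def)

lemma square_integrable_scaleR:
  assumes "square_integrable f"
  shows "square_integrable (\<lambda>x. r *\<^sub>R f x)"
proof -
  have [measurable]: "f \<in> borel_measurable lebesgue"
    using assms by (rule square_integrable_measurable)
  have "(\<lambda>x. r *\<^sub>R f x) \<in> borel_measurable lebesgue" by measurable
  then show ?thesis using assms by (simp add: square_integrable_def power_mult_distrib)
qed

lemma square_integrable_add:
  assumes "square_integrable f" "square_integrable g"
  shows "square_integrable (\<lambda>x. f x + g x)"
  unfolding square_integrable_def
proof (intro conjI)
  have [measurable]: "f \<in> borel_measurable lebesgue" "g \<in> borel_measurable lebesgue"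
    using assms by (auto simp: square_integrable_def)
  show "(\<lambda>x. f x + g x) \<in> borel_measurable lebesgue" by measurable
  have "integrable lebesgue (\<lambda>x. 2 * (norm (f x))\<^sup>2 + 2 * (norm (g x))\<^sup>2)"
    using assms by (simp add: square_integrable_def)
  then show "integrable lebesgue (\<lambda>x. (norm (f x + g x))\<^sup>2)"
  proof (rule Bochner_Integration.integrable_bound, goal_cases)
    case 2
    have "(norm (f x + g x))\<^sup>2 \<le> 2 * (norm (f x))\<^sup>2 + 2 * (norm (g x))\<^sup>2" for x
    proof -
      have "(norm (f x + g x))\<^sup>2 \<le> (norm (f x) + norm (g x))\<^sup>2"
        by (intro power_mono norm_triangle_ineq) auto
      also have "\<dots> \<le> 2 * (norm (f x))\<^sup>2 + 2 * (norm (g x))\<^sup>2"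
        using zero_le_power2[of "norm (f x) - norm (g x)"]
        by (simp add: power2_sum power2_diff)
      finally show ?thesis .
    qed
    then show ?case by (intro AE_I2) auto
  qed measurable
qed

lemma square_integrable_uminus:
  "square_integrable f \<Longrightarrow> square_integrable (\<lambda>x. - f x)"
  using square_integrable_scaleR[of f "-1"] by simp

lemma square_integrable_diff:
  "square_integrable f \<Longrightarrow> square_integrable g \<Longrightarrow> square_integrable (\<lambda>x. f x - g x)"
  using square_integrable_add[OF _ square_integrable_uminus, of f g] by simp

lemma integrable_inner_square_integrable:
  assumes "square_integrable f" "square_integrable g"
  shows "integrable lebesgue (\<lambda>x. f x \<bullet> g x)"
proof -
  have [measurable]: "f \<in> borel_measurable lebesgue" "g \<in> borel_measurable lebesgue"
    using assms by (auto simp: square_integrable_def)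
  have "integrable lebesgue (\<lambda>x. (norm (f x))\<^sup>2 + (norm (g x))\<^sup>2)"
    using assms by (simp add: square_integrable_def)
  then show ?thesis
  proof (rule Bochner_Integration.integrable_bound, goal_cases)
    case 2
    have "\<bar>f x \<bullet> g x\<bar> \<le> (norm (f x))\<^sup>2 + (norm (g x))\<^sup>2" for x
    proof -
      have "\<bar>f x \<bullet> g x\<bar> \<le> norm (f x) * norm (g x)" by (rule Cauchy_Schwarz_ineq2)
      also have "\<dots> \<le> (norm (f x))\<^sup>2 + (norm (g x))\<^sup>2"
        using zero_le_power2[of "norm (f x) - norm (g x)"]
          mult_nonneg_nonneg[OF norm_ge_zero norm_ge_zero, of "f x" "g x"]
        unfolding power2_diff by linarith
      finally show ?thesis .
    qed
    then show ?case by (intro AE_I2) auto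
  qed measurable
qed

definition ae_eq_L2 :: "('a::euclidean_space \<Rightarrow> 'b::euclidean_space) \<Rightarrow> ('a \<Rightarrow> 'b) \<Rightarrow> bool"
  where "ae_eq_L2 f g \<longleftrightarrow>
    square_integrable f \<and> square_integrable g \<and> (AE x in lebesgue. f x = g x)"

quotient_type (overloaded) ('a, 'b) L2 =
  "'a::euclidean_space \<Rightarrow> 'b::euclidean_space" / partial: ae_eq_L2
proof (rule part_equivpI)
  show "\<exists>f::'a \<Rightarrow> 'b. ae_eq_L2 f f"
    using square_integrable_zero by (auto simp: ae_eq_L2_def)
  show "symp (ae_eq_L2 :: ('a \<Rightarrow> 'b) \<Rightarrow> _)"
    by (auto intro!: sympI simp: ae_eq_L2_def elim: eventually_mono)
  show "transp (ae_eq_L2 :: ('a \<Rightarrow> 'b) \<Rightarrow> _)"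
  proof (rule transpI)
    fix f g h :: "'a \<Rightarrow> 'b"
    assume "ae_eq_L2 f g" "ae_eq_L2 g h"
    then show "ae_eq_L2 f h"
      by (auto simp: ae_eq_L2_def elim: eventually_elim2)
  qed
qed

lemma ae_eq_L2_self: "ae_eq_L2 f f \<longleftrightarrow> square_integrable f"
  by (simp add: ae_eq_L2_def)

lemma square_integrable_rep: "square_integrable (rep_L2 v)"
  using Quotient_rep_reflp[OF Quotient_L2, of v] by (simp add: ae_eq_L2_self)

lemma measurable_rep_L2 [measurable]: "rep_L2 v \<in> borel_measurable lebesgue"
  using square_integrable_rep by (rule square_integrable_measurable)

lemma abs_rep_L2: "abs_L2 (rep_L2 v) = v"
  by (rule Quotient_abs_rep[OF Quotient_L2])

lemma rep_abs_L2: "square_integrable f \<Longrightarrow> AE x in lebesgue. rep_L2 (abs_L2 f) x = f x"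
  using Quotient_rep_abs[OF Quotient_L2, of f] by (auto simp: ae_eq_L2_def)

lemma abs_L2_eqI:
  "square_integrable f \<Longrightarrow> square_integrable g \<Longrightarrow> AE x in lebesgue. f x = g x \<Longrightarrow>
    abs_L2 f = abs_L2 g"
  by (rule Quotient_rel_abs[OF Quotient_L2]) (simp add: ae_eq_L2_def)

instantiation L2 :: (euclidean_space, euclidean_space) real_inner
begin

lift_definition zero_L2 :: "('a, 'b) L2" is "\<lambda>x. 0"
  by (simp add: ae_eq_L2_self square_integrable_zero)

lift_definition plus_L2 :: "('a, 'b) L2 \<Rightarrow> ('a, 'b) L2 \<Rightarrow> ('a, 'b) L2" is "\<lambda>f g x. f x + g x"
  by (auto simp: ae_eq_L2_def intro: square_integrable_add elim: eventually_elim2)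

lift_definition minus_L2 :: "('a, 'b) L2 \<Rightarrow> ('a, 'b) L2 \<Rightarrow> ('a, 'b) L2" is "\<lambda>f g x. f x - g x"
  by (auto simp: ae_eq_L2_def intro: square_integrable_diff elim: eventually_elim2)

lift_definition uminus_L2 :: "('a, 'b) L2 \<Rightarrow> ('a, 'b) L2" is "\<lambda>f x. - f x"
  by (auto simp: ae_eq_L2_def intro: square_integrable_uminus)

lift_definition scaleR_L2 :: "real \<Rightarrow> ('a, 'b) L2 \<Rightarrow> ('a, 'b) L2" is "\<lambda>r f x. r *\<^sub>R f x"
  by (auto simp: ae_eq_L2_def intro: square_integrable_scaleR elim: eventually_mono)

lift_definition inner_L2 :: "('a, 'b) L2 \<Rightarrow> ('a, 'b) L2 \<Rightarrow> real"
  is "\<lambda>f g. LINT x|lebesgue. f x \<bullet> g x"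
proof goal_cases
  case (1 f f' g g')
  then have [measurable]: "f \<in> borel_measurable lebesgue" "f' \<in> borel_measurable lebesgue"
    "g \<in> borel_measurable lebesgue" "g' \<in> borel_measurable lebesgue"
    by (auto simp: ae_eq_L2_def square_integrable_def)
  have "AE x in lebesgue. f x \<bullet> g x = f' x \<bullet> g' x"
    using 1 by (auto simp: ae_eq_L2_def elim: eventually_elim2)
  then show ?case by (intro integral_cong_AE) measurable
qed

definition norm_L2 :: "('a, 'b) L2 \<Rightarrow> real"
  where "norm_L2 v = sqrt (v \<bullet> v)"

definition dist_L2 :: "('a, 'b) L2 \<Rightarrow> ('a, 'b) L2 \<Rightarrow> real"
  where "dist_L2 v w = norm (v - w)"

definition sgn_L2 :: "('a, 'b) L2 \<Rightarrow> ('a, 'b) L2"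
  where "sgn_L2 v = inverse (norm v) *\<^sub>R v"

definition uniformity_L2 :: "(('a, 'b) L2 \<times> ('a, 'b) L2) filter"
  where "uniformity_L2 = (INF e\<in>{0<..}. principal {(v, w). dist v w < e})"

definition open_L2 :: "('a, 'b) L2 set \<Rightarrow> bool"
  where "open_L2 U \<longleftrightarrow> (\<forall>v\<in>U. eventually (\<lambda>(v', w). v' = v \<longrightarrow> w \<in> U) uniformity)"

instance
proof
  fix u v w :: "('a, 'b) L2" and a b :: real
  show "u + v + w = u + (v + w)"
    by transfer (auto simp: ae_eq_L2_def add.assoc intro!: square_integrable_add)
  show "u + v = v + u"
    by transfer (auto simp: ae_eq_L2_def add.commute intro!: square_integrable_add)
  show "0 + u = u"
    by transfer (auto simp: ae_eq_L2_def)
  show "- u + u = 0"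
    by transfer (auto simp: ae_eq_L2_def square_integrable_zero)
  show "u - v = u + - v"
    by transfer (auto simp: ae_eq_L2_def intro!: square_integrable_diff)
  show "a *\<^sub>R (u + v) = a *\<^sub>R u + a *\<^sub>R v"
    by transfer (auto simp: ae_eq_L2_def scaleR_add_right
        intro!: square_integrable_add square_integrable_scaleR)
  show "(a + b) *\<^sub>R u = a *\<^sub>R u + b *\<^sub>R u"
    by transfer (auto simp: ae_eq_L2_def scaleR_add_left
        intro!: square_integrable_add square_integrable_scaleR)
  show "a *\<^sub>R b *\<^sub>R u = (a * b) *\<^sub>R u"
    by transfer (auto simp: ae_eq_L2_def intro!: square_integrable_scaleR)
  show "1 *\<^sub>R u = u"
    by transfer (auto simp: ae_eq_L2_def)
  show "dist u v = norm (u - v)"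
    by (simp add: dist_L2_def)
  show "sgn u = inverse (norm u) *\<^sub>R u"
    by (simp add: sgn_L2_def)
  show "uniformity = (INF e\<in>{0<..}. principal {(v :: ('a, 'b) L2, w). dist v w < e})"
    by (simp add: uniformity_L2_def)
  show "open U \<longleftrightarrow> (\<forall>v\<in>U. eventually (\<lambda>(v', w). v' = v \<longrightarrow> w \<in> U) uniformity)"
    for U :: "('a, 'b) L2 set"
    by (simp add: open_L2_def)
  show "u \<bullet> v = v \<bullet> u"
    by transfer (simp add: inner_commute)
  show "(u + v) \<bullet> w = u \<bullet> w + v \<bullet> w"
    by transfer (auto simp: ae_eq_L2_def inner_add_left integrable_inner_square_integrable)
  show "(a *\<^sub>R u) \<bullet> v = a * (u \<bullet> v)"
    by transfer simp
  show "0 \<le> u \<bullet> u"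
    by transfer simp
  show "u \<bullet> u = 0 \<longleftrightarrow> u = 0"
  proof transfer
    fix f :: "'a \<Rightarrow> 'b"
    assume "ae_eq_L2 f f"
    then have f: "square_integrable f" by (simp add: ae_eq_L2_self)
    have "(LINT x|lebesgue. f x \<bullet> f x) = 0 \<longleftrightarrow> (AE x in lebesgue. f x \<bullet> f x = 0)"
      by (intro integral_nonneg_eq_0_iff_AE integrable_inner_square_integrable f) simp
    then show "(LINT x|lebesgue. f x \<bullet> f x) = 0 \<longleftrightarrow> ae_eq_L2 f (\<lambda>x. 0)"
      using f by (simp add: ae_eq_L2_def square_integrable_zero)
  qed
  show "norm u = sqrt (u \<bullet> u)"
    by (simp add: norm_L2_def)
qed

end

lemma abs_L2_add:
  "square_integrable f \<Longrightarrow> square_integrable g \<Longrightarrow> abs_L2 f + abs_L2 g = abs_L2 (\<lambda>x. f x + g x)"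
  by (simp add: plus_L2.abs_eq ae_eq_L2_self)

lemma abs_L2_diff:
  "square_integrable f \<Longrightarrow> square_integrable g \<Longrightarrow> abs_L2 f - abs_L2 g = abs_L2 (\<lambda>x. f x - g x)"
  by (simp add: minus_L2.abs_eq ae_eq_L2_self)

lemma abs_L2_scaleR:
  "square_integrable f \<Longrightarrow> r *\<^sub>R abs_L2 f = abs_L2 (\<lambda>x. r *\<^sub>R f x)"
  by (simp add: scaleR_L2.abs_eq ae_eq_L2_self)

lemma square_integrable_sum:
  "finite I \<Longrightarrow> (\<And>i. i \<in> I \<Longrightarrow> square_integrable (f i)) \<Longrightarrow> square_integrable (\<lambda>x. \<Sum>i\<in>I. f i x)"
  by (induction I rule: finite_induct)
     (auto simp: square_integrable_zero intro!: square_integrable_add)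

lemma abs_L2_sum:
  "finite I \<Longrightarrow> (\<And>i. i \<in> I \<Longrightarrow> square_integrable (f i)) \<Longrightarrow>
    (\<Sum>i\<in>I. abs_L2 (f i)) = abs_L2 (\<lambda>x. \<Sum>i\<in>I. f i x)"
  by (induction I rule: finite_induct)
     (auto simp: zero_L2.abs_eq abs_L2_add square_integrable_sum)

lemma power2_norm_abs_L2:
  "square_integrable f \<Longrightarrow> (norm (abs_L2 f))\<^sup>2 = (LINT x|lebesgue. (norm (f x))\<^sup>2)"
  by (simp add: power2_norm_eq_inner inner_L2.abs_eq ae_eq_L2_self)

lemma power2_norm_L2: "(norm v)\<^sup>2 = (LINT x|lebesgue. (norm (rep_L2 v x))\<^sup>2)"
  using power2_norm_abs_L2[OF square_integrable_rep, of v] by (simp add: abs_rep_L2)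

lemma nn_integral_rep_L2:
  "(\<integral>\<^sup>+x. ennreal ((norm (rep_L2 v x))\<^sup>2) \<partial>lebesgue) = ennreal ((norm v)\<^sup>2)"
  using square_integrable_rep[of v]
  by (simp add: power2_norm_L2 nn_integral_eq_integral square_integrable_def)

lemma rep_L2_diff: "AE x in lebesgue. rep_L2 (v - w) x = rep_L2 v x - rep_L2 w x"
proof -
  have "v - w = abs_L2 (\<lambda>x. rep_L2 v x - rep_L2 w x)"
    using abs_L2_diff[OF square_integrable_rep square_integrable_rep, of v w]
    by (simp add: abs_rep_L2)
  then show ?thesis
    using rep_abs_L2[OF square_integrable_diff[OF square_integrable_rep square_integrable_rep]]
    by metis
qed

lemma nn_integral_rep_L2_diff:
  "(\<integral>\<^sup>+x. ennreal ((norm (rep_L2 v x - rep_L2 w x))\<^sup>2) \<partial>lebesgue) = ennreal ((norm (v - w))\<^sup>2)"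
  unfolding nn_integral_rep_L2[symmetric]
  by (rule nn_integral_cong_AE) (use rep_L2_diff[of v w] in eventually_elim, simp)

lemma L2_Cauchy_limit:
  fixes X :: "nat \<Rightarrow> ('a::euclidean_space, 'b::euclidean_space) L2"
  assumes "Cauchy X" and geom: "\<And>n. (norm (X (Suc n) - X n))\<^sup>2 \<le> (1/8) ^ n"
  shows "convergent X"
proof -
  define F where "F n = rep_L2 (X n)" for n
  have [measurable]: "F n \<in> borel_measurable lebesgue" for n
    by (simp add: F_def measurable_rep_L2)
  have "(\<integral>\<^sup>+x. (\<Sum>n. ennreal (4 ^ n * (norm (F (Suc n) x - F n x))\<^sup>2)) \<partial>lebesgue)
      = (\<Sum>n. \<integral>\<^sup>+x. ennreal (4 ^ n * (norm (F (Suc n) x - F n x))\<^sup>2) \<partial>lebesgue)"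
    by (intro nn_integral_suminf) measurable
  also have "\<dots> = (\<Sum>n. ennreal (4 ^ n * (norm (X (Suc n) - X n))\<^sup>2))"
  proof (intro suminf_cong)
    fix n
    have "(\<integral>\<^sup>+x. ennreal (4 ^ n * (norm (F (Suc n) x - F n x))\<^sup>2) \<partial>lebesgue)
      = (\<integral>\<^sup>+x. ennreal (4 ^ n) * ennreal ((norm (F (Suc n) x - F n x))\<^sup>2) \<partial>lebesgue)"
      by (simp add: ennreal_mult)
    also have "\<dots> = ennreal (4 ^ n) * (\<integral>\<^sup>+x. ennreal ((norm (F (Suc n) x - F n x))\<^sup>2) \<partial>lebesgue)"
      by (intro nn_integral_cmult) measurable
    also have "\<dots> = ennreal (4 ^ n * (norm (X (Suc n) - X n))\<^sup>2)"
      unfolding F_def nn_integral_rep_L2_diff by (simp add: ennreal_mult)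
    finally show "(\<integral>\<^sup>+x. ennreal (4 ^ n * (norm (F (Suc n) x - F n x))\<^sup>2) \<partial>lebesgue)
      = ennreal (4 ^ n * (norm (X (Suc n) - X n))\<^sup>2)" .
  qed
  also have "\<dots> \<le> (\<Sum>n. ennreal ((1/2) ^ n))"
  proof (intro suminf_le ennreal_leI)
    fix n
    have "4 ^ n * (norm (X (Suc n) - X n))\<^sup>2 \<le> 4 ^ n * (1/8::real) ^ n"
      by (intro mult_left_mono geom) simp
    also have "\<dots> = (1/2) ^ n" by (simp flip: power_mult_distrib)
    finally show "4 ^ n * (norm (X (Suc n) - X n))\<^sup>2 \<le> (1/2) ^ n" .
  qed auto
  also have "\<dots> = ennreal (\<Sum>n. (1/2) ^ n)"
    by (intro suminf_ennreal2) (auto intro: summable_geometric)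
  also have "\<dots> < \<infinity>" by simp
  finally have "AE x in lebesgue. (\<Sum>n. ennreal (4 ^ n * (norm (F (Suc n) x - F n x))\<^sup>2)) \<noteq> \<infinity>"
    by (intro nn_integral_noteq_infinite) auto
  then have AE: "AE x in lebesgue. convergent (\<lambda>n. F n x)"
  proof eventually_elim
    case (elim x)
    define S where "S = (\<Sum>n. ennreal (4 ^ n * (norm (F (Suc n) x - F n x))\<^sup>2))"
    have "S \<noteq> \<infinity>" using elim by (simp only: S_def not_False_eq_True)
    then obtain s where s: "S = ennreal s" "s \<ge> 0"
      by (metis ennreal_cases infinity_ennreal_def)
    define c where "c = sqrt s"
    have le: "norm (F (Suc n) x - F n x) \<le> c * (1/2) ^ n" for n
    proof -
      define a where "a n = ennreal (4 ^ n * (norm (F (Suc n) x - F n x))\<^sup>2)" for n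
      have "sum a {n} \<le> suminf a"
        by (rule sum_le_suminf) auto
      then have "ennreal (4 ^ n * (norm (F (Suc n) x - F n x))\<^sup>2) \<le> S"
        unfolding S_def a_def[abs_def] by simp
      then have "4 ^ n * (norm (F (Suc n) x - F n x))\<^sup>2 \<le> s"
        using s by simp
      moreover have "(2 ^ n)\<^sup>2 = (4 ^ n :: real)"
        by (simp add: power2_eq_square flip: power_mult_distrib)
      ultimately have "(2 ^ n * norm (F (Suc n) x - F n x))\<^sup>2 \<le> s"
        by (simp add: power_mult_distrib)
      then have "sqrt ((2 ^ n * norm (F (Suc n) x - F n x))\<^sup>2) \<le> c"
        unfolding c_def by (rule real_sqrt_le_mono)
      then have "2 ^ n * norm (F (Suc n) x - F n x) \<le> c"
        by simp
      then show ?thesis by (simp add: field_simps)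
    qed
    have "summable (\<lambda>n. c * (1/2) ^ n)"
      by (intro summable_mult summable_geometric) simp
    then have "summable (\<lambda>n. F (Suc n) x - F n x)"
      by (rule summable_comparison_test') (use le in auto)
    then have "convergent (\<lambda>n. \<Sum>i<n. F (Suc i) x - F i x)"
      by (simp add: summable_iff_convergent)
    then have "convergent (\<lambda>n. F n x - F 0 x)"
      using sum_lessThan_telescope[of "\<lambda>n. F n x"] by simp
    then have "convergent (\<lambda>n. (F n x - F 0 x) + F 0 x)"
      by (intro convergent_add convergent_const)
    then show ?case by simp
  qed
  define f where "f x = lim (\<lambda>n. F n x)" for x
  have [measurable]: "f \<in> borel_measurable lebesgue"
    unfolding f_def by measurable
  have lim: "AE x in lebesgue. (\<lambda>n. F n x) \<longlonglongrightarrow> f x"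
    using AE by eventually_elim (simp add: f_def convergent_LIMSEQ_iff)
  have fatou: "(\<integral>\<^sup>+x. ennreal ((norm (f x - F n x))\<^sup>2) \<partial>lebesgue) \<le> ennreal (e\<^sup>2)"
    if e: "\<And>m. m \<ge> n \<Longrightarrow> norm (X m - X n) \<le> e" for n e
  proof -
    have "(\<integral>\<^sup>+x. ennreal ((norm (f x - F n x))\<^sup>2) \<partial>lebesgue)
      = (\<integral>\<^sup>+x. liminf (\<lambda>m. ennreal ((norm (F m x - F n x))\<^sup>2)) \<partial>lebesgue)"
    proof (rule nn_integral_cong_AE)
      show "AE x in lebesgue. ennreal ((norm (f x - F n x))\<^sup>2)
          = liminf (\<lambda>m. ennreal ((norm (F m x - F n x))\<^sup>2))"
        using lim
      proof eventually_elim
        case (elim x)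
        have "(\<lambda>m. ennreal ((norm (F m x - F n x))\<^sup>2)) \<longlonglongrightarrow> ennreal ((norm (f x - F n x))\<^sup>2)"
          by (intro tendsto_intros elim) 
        then show ?case by (intro lim_imp_Liminf[symmetric] trivial_limit_sequentially)
      qed
    qed
    also have "\<dots> \<le> liminf (\<lambda>m. \<integral>\<^sup>+x. ennreal ((norm (F m x - F n x))\<^sup>2) \<partial>lebesgue)"
      by (intro nn_integral_liminf) measurable
    also have "\<dots> = liminf (\<lambda>m. ennreal ((norm (X m - X n))\<^sup>2))"
      by (simp add: F_def nn_integral_rep_L2_diff)
    also have "\<dots> \<le> ennreal (e\<^sup>2)"
    proof (rule Liminf_le)
      show "\<forall>\<^sub>F m in sequentially. ennreal ((norm (X m - X n))\<^sup>2) \<le> ennreal (e\<^sup>2)"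
        using eventually_ge_at_top[of n]
        by eventually_elim (intro ennreal_leI power_mono e, auto)
    qed simp
    finally show ?thesis .
  qed
  have ev: "\<exists>N. \<forall>n\<ge>N. \<forall>m\<ge>n. norm (X m - X n) \<le> e" if "e > 0" for e
    using \<open>Cauchy X\<close> that unfolding Cauchy_def dist_norm
    by (meson le_trans less_imp_le)
  have "square_integrable f"
  proof -
    obtain n where n: "\<And>m. m \<ge> n \<Longrightarrow> norm (X m - X n) \<le> 1"
      using ev[of 1] by auto
    have "square_integrable (\<lambda>x. f x - F n x)"
      unfolding square_integrable_iff_nn using le_less_trans[OF fatou[of n 1, OF n]] by simp
    from square_integrable_add[OF this square_integrable_rep[of "X n"]]
    show ?thesis by (simp add: F_def)
  qed
  have dist: "norm (abs_L2 f - X n) \<le> e" if e: "\<And>m. m \<ge> n \<Longrightarrow> norm (X m - X n) \<le> e" for n e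
  proof -
    have "abs_L2 f - X n = abs_L2 (\<lambda>x. f x - F n x)"
      using abs_L2_diff[OF \<open>square_integrable f\<close> square_integrable_rep[of "X n"]]
      by (simp add: F_def abs_rep_L2)
    moreover have sq: "square_integrable (\<lambda>x. f x - F n x)"
      unfolding F_def by (intro square_integrable_diff \<open>square_integrable f\<close> square_integrable_rep)
    ultimately have "ennreal ((norm (abs_L2 f - X n))\<^sup>2)
      = (\<integral>\<^sup>+x. ennreal ((norm (f x - F n x))\<^sup>2) \<partial>lebesgue)"
      using sq by (simp add: power2_norm_abs_L2 nn_integral_eq_integral square_integrable_def)
    also have "\<dots> \<le> ennreal (e\<^sup>2)" by (rule fatou) (rule e)
    finally have "(norm (abs_L2 f - X n))\<^sup>2 \<le> e\<^sup>2" by simp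
    moreover have "e \<ge> 0" using e[of n] by simp
    ultimately show ?thesis by (rule power2_le_imp_le)
  qed
  have "X \<longlonglongrightarrow> abs_L2 f"
  proof (rule metric_LIMSEQ_I)
    fix r :: real
    assume "r > 0"
    then obtain N where N: "\<forall>n\<ge>N. \<forall>m\<ge>n. norm (X m - X n) \<le> r/2"
      using ev[of "r/2"] by auto
    have "dist (X n) (abs_L2 f) < r" if "n \<ge> N" for n
    proof -
      have "norm (abs_L2 f - X n) \<le> r/2" by (rule dist) (use N that in blast)
      then show ?thesis using \<open>r > 0\<close> by (simp add: dist_norm norm_minus_commute)
    qed
    then show "\<exists>N. \<forall>n\<ge>N. dist (X n) (abs_L2 f) < r" by blast
  qed
  then show ?thesis by (rule convergentI)
qed

instance L2 :: (euclidean_space, euclidean_space) banach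
proof
  fix X :: "nat \<Rightarrow> ('a, 'b) L2"
  assume X: "Cauchy X"
  have "\<exists>r. strict_mono r \<and> (\<forall>n. \<forall>m\<ge>r n. norm (X m - X (r n)) \<le> (1/8) ^ n)"
  proof -
    have ex: "\<exists>k. \<forall>m\<ge>k. \<forall>m'\<ge>k. norm (X m - X m') \<le> (1/8) ^ n" for n
      using metric_CauchyD[OF X, of "(1/8) ^ n"] by (auto simp: dist_norm) (meson less_imp_le)
    then obtain k where k: "\<And>n m m'. m \<ge> k n \<Longrightarrow> m' \<ge> k n \<Longrightarrow> norm (X m - X m') \<le> (1/8) ^ n"
      by metis
    define r where "r n = n + (\<Sum>i\<le>n. k i)" for n
    have "strict_mono r" by (intro strict_mono_Suc_iff[THEN iffD2]) (simp add: r_def)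
    moreover have "r n \<ge> k n" for n
      unfolding r_def using member_le_sum[of n "{..n}" k] by simp
    ultimately show ?thesis using k by (meson order_trans order_refl)
  qed
  then obtain r where r: "strict_mono r"
    "\<And>n m. m \<ge> r n \<Longrightarrow> norm (X m - X (r n)) \<le> (1/8) ^ n" by blast
  have "convergent (X \<circ> r)"
  proof (rule L2_Cauchy_limit)
    show "Cauchy (X \<circ> r)" using X r(1) by (rule Cauchy_subseq_Cauchy)
    fix n
    have "norm (X (r (Suc n)) - X (r n)) \<le> (1/8) ^ n"
      using r by (simp add: strict_mono_less_eq)
    then have "(norm (X (r (Suc n)) - X (r n)))\<^sup>2 \<le> ((1/8) ^ n)\<^sup>2"
      by (intro power_mono) auto
    also have "\<dots> \<le> (1/8::real) ^ n"
      by (simp add: power2_eq_square mult_left_le power_le_one)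
    finally show "(norm ((X \<circ> r) (Suc n) - (X \<circ> r) n))\<^sup>2 \<le> (1/8) ^ n" by simp
  qed
  then obtain l where "(X \<circ> r) \<longlonglongrightarrow> l" by (auto simp: convergent_def)
  then show "convergent X"
    using Cauchy_converges_subseq[of X r l] X r(1) by (auto simp: convergent_def)
qed

lemma square_integrable_indicator:
  assumes "E \<in> lmeasurable"
  shows "square_integrable (\<lambda>x. indicator E x *\<^sub>R b)"
proof -
  have [measurable]: "E \<in> sets lebesgue" using assms by auto
  have "(\<lambda>x. (norm (indicator E x *\<^sub>R b))\<^sup>2) = (\<lambda>x. indicator E x * (norm b)\<^sup>2)"
    by (auto simp: indicator_def)
  moreover have "integrable lebesgue (\<lambda>x. indicator E x * (norm b)\<^sup>2)"
    using assms by (intro integrable_mult_left integrable_real_indicator)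
      (auto simp: fmeasurable_def)
  moreover have "(\<lambda>x. indicator E x *\<^sub>R b) \<in> borel_measurable lebesgue" by measurable
  ultimately show ?thesis by (simp add: square_integrable_def)
qed

lemma norm_indicator_diff:
  assumes "E \<in> lmeasurable" "D \<in> lmeasurable"
  shows "(norm (abs_L2 (\<lambda>x. indicator E x *\<^sub>R b) - abs_L2 (\<lambda>x. indicator D x *\<^sub>R b)))\<^sup>2
    = measure lebesgue (sym_diff E D) * (norm b)\<^sup>2"
proof -
  have "(norm (abs_L2 (\<lambda>x. indicator E x *\<^sub>R b) - abs_L2 (\<lambda>x. indicator D x *\<^sub>R b)))\<^sup>2
    = (LINT x|lebesgue. (norm (indicator E x *\<^sub>R b - indicator D x *\<^sub>R b))\<^sup>2)"
    by (simp add: abs_L2_diff power2_norm_abs_L2 square_integrable_diff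
        square_integrable_indicator assms)
  also have "\<dots> = (LINT x|lebesgue. indicator (sym_diff E D) x * (norm b)\<^sup>2)"
    by (intro Bochner_Integration.integral_cong) (auto simp: indicator_def)
  also have "\<dots> = measure lebesgue (sym_diff E D) * (norm b)\<^sup>2"
    by simp
  finally show ?thesis .
qed

lemma L2_separable:
  "\<exists>Q :: ('a::euclidean_space, 'b::euclidean_space) L2 set. countable Q \<and> closure Q = UNIV"
proof -
  obtain \<B> :: "'a set set" where \<B>: "countable \<B>" "topological_basis \<B>"
    using ex_countable_basis by blast
  define ind :: "'a set \<Rightarrow> 'b \<Rightarrow> ('a, 'b) L2" where "ind E b = abs_L2 (\<lambda>x. indicator E x *\<^sub>R b)" for E b
  define G where "G = (\<lambda>(\<F>, b). ind (\<Union>\<F>) b) ` ({\<F>. finite \<F> \<and> \<F> \<subseteq> \<B>} \<times> Basis)"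
  have "countable G"
    unfolding G_def using \<B>(1)
    by (intro countable_image countable_SIGMA countable_Collect_finite_subset)
       (auto intro: countable_finite)
  define val where "val xs = (\<Sum>(r, g)\<leftarrow>xs. real_of_rat r *\<^sub>R g)" for xs :: "(rat \<times> ('a, 'b) L2) list"
  define Q where "Q = val ` lists (UNIV \<times> G)"
  have "countable Q"
    unfolding Q_def using \<open>countable G\<close>
    by (intro countable_image countable_lists countable_SIGMA) auto
  have C_add: "u + v \<in> closure Q" if uv: "u \<in> closure Q" "v \<in> closure Q" for u v
  proof -
    obtain a b where a: "\<And>n. a n \<in> Q" "a \<longlonglongrightarrow> u" and b: "\<And>n. b n \<in> Q" "b \<longlonglongrightarrow> v"
      using uv unfolding closure_sequential by blast
    have "a n + b n \<in> Q" for n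
    proof -
      obtain xs ys where "xs \<in> lists (UNIV \<times> G)" "a n = val xs" "ys \<in> lists (UNIV \<times> G)" "b n = val ys"
        using a(1)[of n] b(1)[of n] unfolding Q_def by blast
      then have "a n + b n = val (xs @ ys)" "xs @ ys \<in> lists (UNIV \<times> G)"
        by (simp_all add: val_def)
      then show ?thesis unfolding Q_def by blast
    qed
    moreover have "(\<lambda>n. a n + b n) \<longlonglongrightarrow> u + v"
      by (intro tendsto_add a b)
    ultimately show ?thesis
      unfolding closure_sequential by (intro exI[of _ "\<lambda>n. a n + b n"]) blast
  qed
  have C_zero: "0 \<in> closure Q"
  proof -
    have "val [] \<in> Q" unfolding Q_def by blast
    then show ?thesis using closure_subset by (auto simp: val_def)
  qed
  have C_sum: "(\<Sum>i\<in>I. w i) \<in> closure Q" if "finite I" "\<And>i. i \<in> I \<Longrightarrow> w i \<in> closure Q"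
    for w :: "'i \<Rightarrow> ('a, 'b) L2" and I
    using that by (induction I rule: finite_induct) (auto simp: C_zero intro: C_add)
  have C_lim: "w \<in> closure Q" if "\<And>n. a n \<in> closure Q" "a \<longlonglongrightarrow> w" for a w
    using that closed_closure[of Q] unfolding closed_sequential_limits by blast
  have C_G: "c *\<^sub>R g \<in> closure Q" if "g \<in> G" for c g
  proof -
    have "\<exists>r. \<bar>real_of_rat r - c\<bar> < inverse (real (Suc n))" for n
      using of_rat_dense[of "c - inverse (real (Suc n))" "c + inverse (real (Suc n))"]
      by (auto simp: abs_less_iff) (metis add.commute diff_less_eq less_diff_eq minus_diff_eq)
    then obtain r where r: "\<And>n. \<bar>real_of_rat (r n) - c\<bar> < inverse (real (Suc n))" by metis
    have "(\<lambda>n. real_of_rat (r n) - c) \<longlonglongrightarrow> 0"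
      by (rule Lim_null_comparison[OF _ LIMSEQ_inverse_real_of_nat])
         (use r in \<open>auto intro!: always_eventually less_imp_le\<close>)
    then have "(\<lambda>n. real_of_rat (r n)) \<longlonglongrightarrow> c" by (simp add: LIM_zero_iff)
    then have lim: "(\<lambda>n. real_of_rat (r n) *\<^sub>R g) \<longlonglongrightarrow> c *\<^sub>R g" by (intro tendsto_intros)
    have "real_of_rat (r n) *\<^sub>R g \<in> Q" for n
    proof -
      have "val [(r n, g)] \<in> Q" unfolding Q_def using \<open>g \<in> G\<close> by (intro imageI) simp
      then show ?thesis by (simp add: val_def)
    qed
    with lim show ?thesis
      unfolding closure_sequential by (intro exI[of _ "\<lambda>n. real_of_rat (r n) *\<^sub>R g"]) blast
  qed
  have ind_approx: "\<exists>\<F>. finite \<F> \<and> \<F> \<subseteq> \<B> \<and> \<Union>\<F> \<in> lmeasurable \<and> measure lebesgue (sym_diff E (\<Union>\<F>)) < e"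
    if E: "E \<in> lmeasurable" and "e > 0" for E e
  proof -
    have [measurable]: "E \<in> sets lebesgue" using E by auto
    obtain T where T: "open T" "E \<subseteq> T" "T - E \<in> lmeasurable" "emeasure lebesgue (T - E) < ennreal (e/2)"
      using sets_lebesgue_outer_open[of E "e/2"] \<open>e > 0\<close> by auto
    have "T = E \<union> (T - E)" using T by blast
    then have Tm: "T \<in> lmeasurable" using E T(3) by (metis fmeasurable.Un)
    obtain \<D> where \<D>: "\<D> \<subseteq> \<B>" "\<Union>\<D> = T"
      using \<B>(2) T(1) unfolding topological_basis_def by blast
    then have "countable \<D>" using \<B>(1) countable_subset by blast
    show ?thesis
    proof (cases "\<D> = {}")
      case True
      then have "E = {}" using \<D> T by auto
      then show ?thesis using \<open>e > 0\<close> by (intro exI[of _ "{}"]) simp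
    next
      case False
      define D where "D n = \<Union>(from_nat_into \<D> ` {..n})" for n :: nat
      have Dopen: "open (D n)" for n
      proof -
        have "open (from_nat_into \<D> i)" for i
          using from_nat_into[OF False, of i] \<D>(1) topological_basis_open[OF \<B>(2)] by (meson subsetD)
        then show ?thesis unfolding D_def by (intro open_Union) auto
      qed
      have DT: "(\<Union>n. D n) = T"
      proof -
        have "(\<Union>n. D n) = \<Union>(range (from_nat_into \<D>))"
          by (auto simp: D_def)
        then show ?thesis
          by (simp add: range_from_nat_into[OF False \<open>countable \<D>\<close>] \<D>(2))
      qed
      have Dm: "D n \<in> lmeasurable" for n
      proof (rule fmeasurableI2[OF Tm])
        show "D n \<subseteq> T" using DT by blast
        show "D n \<in> sets lebesgue" using Dopen by (simp add: borel_open)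
      qed
      have "(\<lambda>n. measure lebesgue (D n)) \<longlonglongrightarrow> measure lebesgue (\<Union>n. D n)"
      proof (rule Lim_measure_incseq)
        show "range D \<subseteq> sets lebesgue" using Dm by auto
        show "incseq D" unfolding D_def by (intro incseq_SucI) (auto simp: atMost_Suc)
        show "emeasure lebesgue (\<Union>n. D n) \<noteq> \<infinity>"
          unfolding DT using Tm by (auto simp: fmeasurable_def)
      qed
      then have "\<forall>\<^sub>F n in sequentially. measure lebesgue (D n) > measure lebesgue T - e/2"
        unfolding DT using \<open>e > 0\<close> by (intro order_tendstoD(1)) auto
      then obtain n where n: "measure lebesgue (D n) > measure lebesgue T - e/2"
        by (auto simp: eventually_sequentially)
      have "D n \<subseteq> T" using DT by blast
      have "measure lebesgue (sym_diff E (D n)) \<le> measure lebesgue ((T - E) \<union> (T - D n))"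
        using \<open>D n \<subseteq> T\<close> T(2,3) Tm Dm[of n] E
        by (intro measure_mono_fmeasurable) auto
      also have "\<dots> \<le> measure lebesgue (T - E) + measure lebesgue (T - D n)"
        using Tm Dm[of n] E by (intro measure_Un_le) auto
      also have "measure lebesgue (T - D n) = measure lebesgue T - measure lebesgue (D n)"
        using Tm Dm[of n] \<open>D n \<subseteq> T\<close> by (intro measurable_measure_Diff) auto
      also have "measure lebesgue (T - E) < e/2"
        using T(3,4) by (simp add: emeasure_eq_measure2 ennreal_less_iff)
      finally have "measure lebesgue (sym_diff E (D n)) < e" using n by linarith
      then show ?thesis
        using Dm[of n] \<D>(1) from_nat_into[OF False]
        by (intro exI[of _ "from_nat_into \<D> ` {..n}"] conjI)
           (auto simp: D_def[symmetric] simp del: UN_simps)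
    qed
  qed
  have C_ind: "c *\<^sub>R ind E b \<in> closure Q" if E: "E \<in> lmeasurable" and b: "b \<in> Basis" for c E b
  proof -
    have "\<exists>\<F>. finite \<F> \<and> \<F> \<subseteq> \<B> \<and> \<Union>\<F> \<in> lmeasurable \<and>
        measure lebesgue (sym_diff E (\<Union>\<F>)) < inverse (real (Suc n))" for n
      by (rule ind_approx[OF E]) simp
    then obtain \<F> where \<F>: "\<And>n. finite (\<F> n)" "\<And>n. \<F> n \<subseteq> \<B>" "\<And>n. \<Union>(\<F> n) \<in> lmeasurable"
      "\<And>n. measure lebesgue (sym_diff E (\<Union>(\<F> n))) < inverse (real (Suc n))"
      by metis
    have "(\<lambda>n. measure lebesgue (sym_diff E (\<Union>(\<F> n)))) \<longlonglongrightarrow> 0"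
      by (rule Lim_null_comparison[OF _ LIMSEQ_inverse_real_of_nat])
         (use \<F>(4) in \<open>auto intro!: always_eventually less_imp_le\<close>)
    then have "(\<lambda>n. sqrt (measure lebesgue (sym_diff E (\<Union>(\<F> n))))) \<longlonglongrightarrow> sqrt 0"
      by (rule tendsto_real_sqrt)
    moreover have "norm (ind (\<Union>(\<F> n)) b - ind E b) = sqrt (measure lebesgue (sym_diff E (\<Union>(\<F> n))))" for n
    proof -
      have "(norm (ind (\<Union>(\<F> n)) b - ind E b))\<^sup>2 = measure lebesgue (sym_diff E (\<Union>(\<F> n)))"
        using norm_indicator_diff[OF E \<F>(3)[of n], of b] b
        by (simp add: ind_def norm_minus_commute)
      then show ?thesis by (metis norm_ge_zero real_sqrt_unique)
    qed
    ultimately have "(\<lambda>n. norm (ind (\<Union>(\<F> n)) b - ind E b)) \<longlonglongrightarrow> 0" by simp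
    then have "(\<lambda>n. ind (\<Union>(\<F> n)) b) \<longlonglongrightarrow> ind E b"
      by (simp add: tendsto_norm_zero_iff LIM_zero_iff)
    then have "(\<lambda>n. c *\<^sub>R ind (\<Union>(\<F> n)) b) \<longlonglongrightarrow> c *\<^sub>R ind E b" by (intro tendsto_intros)
    moreover have "c *\<^sub>R ind (\<Union>(\<F> n)) b \<in> closure Q" for n
    proof (rule C_G)
      show "ind (\<Union>(\<F> n)) b \<in> G"
        unfolding G_def by (rule image_eqI[of _ _ "(\<F> n, b)"]) (use \<F>(1,2) b in auto)
    qed
    ultimately show ?thesis by (rule C_lim[rotated])
  qed
  have C_simple: "abs_L2 s \<in> closure Q"
    if s: "simple_function lebesgue s" "square_integrable s" for s :: "'a \<Rightarrow> 'b"
  proof -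
    define E where "E y = s -` {y}" for y
    have fin: "finite (range s)" using s(1) by (auto simp: simple_function_def)
    have Em: "E y \<in> lmeasurable" if "y \<noteq> 0" for y
    proof -
      have [measurable]: "E y \<in> sets lebesgue"
        using simple_functionD(2)[OF s(1), of "{y}"] by (simp add: E_def)
      have "integrable lebesgue (\<lambda>x. (norm (s x))\<^sup>2 / (norm y)\<^sup>2)"
        using s(2) by (simp add: square_integrable_def)
      then have "integrable lebesgue (indicator (E y) :: 'a \<Rightarrow> real)"
      proof (rule Bochner_Integration.integrable_bound)
        show "indicat_real (E y) \<in> borel_measurable lebesgue" by measurable
        show "AE x in lebesgue. norm (indicat_real (E y) x) \<le> norm ((norm (s x))\<^sup>2 / (norm y)\<^sup>2)"
          using that by (intro AE_I2) (simp add: E_def indicator_def)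
      qed
      then show ?thesis
        by (auto simp: integrable_indicator_iff fmeasurable_def)
    qed
    have s_eq: "s = (\<lambda>x. \<Sum>(y, b)\<in>(range s - {0}) \<times> Basis. (y \<bullet> b) *\<^sub>R indicator (E y) x *\<^sub>R b)"
    proof
      fix x
      have "(\<Sum>(y, b)\<in>(range s - {0}) \<times> Basis. (y \<bullet> b) *\<^sub>R indicator (E y) x *\<^sub>R b)
        = (\<Sum>y\<in>range s - {0}. indicator (E y) x *\<^sub>R (\<Sum>b\<in>Basis. (y \<bullet> b) *\<^sub>R b))"
        by (simp add: sum.cartesian_product[symmetric] scaleR_sum_right mult.commute)
      also have "\<dots> = (\<Sum>y\<in>range s - {0}. indicator (E y) x *\<^sub>R y)"
        by (simp add: euclidean_representation)
      also have "\<dots> = (\<Sum>y\<in>range s - {0}. if y = s x then y else 0)"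
        by (intro sum.cong) (auto simp: E_def indicator_def)
      also have "\<dots> = s x" using fin by (simp add: sum.delta)
      finally show "s x = (\<Sum>(y, b)\<in>(range s - {0}) \<times> Basis. (y \<bullet> b) *\<^sub>R indicator (E y) x *\<^sub>R b)" ..
    qed
    have "abs_L2 s = (\<Sum>p\<in>(range s - {0}) \<times> Basis.
        abs_L2 (\<lambda>x. (fst p \<bullet> snd p) *\<^sub>R indicator (E (fst p)) x *\<^sub>R snd p))"
      by (subst s_eq, subst abs_L2_sum)
         (use fin in \<open>auto simp: case_prod_beta' simp del: scaleR_scaleR
           intro!: square_integrable_scaleR square_integrable_indicator Em\<close>)
    also have "\<dots> = (\<Sum>p\<in>(range s - {0}) \<times> Basis. (fst p \<bullet> snd p) *\<^sub>R ind (E (fst p)) (snd p))"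
      unfolding ind_def
      by (intro sum.cong refl abs_L2_scaleR[symmetric] square_integrable_indicator Em) auto
    also have "\<dots> \<in> closure Q"
      using fin by (intro C_sum C_ind Em) auto
    finally show ?thesis .
  qed
  have "v \<in> closure Q" for v
  proof -
    define f where "f = rep_L2 v"
    have f: "square_integrable f" "v = abs_L2 f" and fm [measurable]: "f \<in> borel_measurable lebesgue"
      by (simp_all add: f_def square_integrable_rep abs_rep_L2)
    obtain s where s: "\<And>i. simple_function lebesgue (s i)" "\<And>x. (\<lambda>i. s i x) \<longlonglongrightarrow> f x"
      "\<And>i x. norm (s i x) \<le> 2 * norm (f x)"
      using borel_measurable_implies_sequence_metric[OF fm, of 0] by auto
    have sm [measurable]: "s i \<in> borel_measurable lebesgue" for i
      using s(1) by (rule borel_measurable_simple_function)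
    have ssq: "square_integrable (s i)" for i
      by (rule square_integrable_dominated[OF f(1), of _ 2]) (auto simp: s(3))
    have "(\<lambda>i. LINT x|lebesgue. (norm (s i x - f x))\<^sup>2) \<longlonglongrightarrow> (LINT x|lebesgue. (norm (f x - f x))\<^sup>2)"
    proof (rule integral_dominated_convergence[where w = "\<lambda>x. 9 * (norm (f x))\<^sup>2"])
      show "integrable lebesgue (\<lambda>x. 9 * (norm (f x))\<^sup>2)"
        using f(1) by (simp add: square_integrable_def)
      show "AE x in lebesgue. (\<lambda>i. (norm (s i x - f x))\<^sup>2) \<longlonglongrightarrow> (norm (f x - f x))\<^sup>2"
        by (intro AE_I2 tendsto_intros s(2))
      show "AE x in lebesgue. norm ((norm (s i x - f x))\<^sup>2) \<le> 9 * (norm (f x))\<^sup>2" for i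
      proof (rule AE_I2)
        fix x
        have "norm (s i x - f x) \<le> 3 * norm (f x)"
          using s(3)[of i x] norm_triangle_ineq4[of "s i x" "f x"] by linarith
        then have "(norm (s i x - f x))\<^sup>2 \<le> (3 * norm (f x))\<^sup>2" by (intro power_mono) auto
        then show "norm ((norm (s i x - f x))\<^sup>2) \<le> 9 * (norm (f x))\<^sup>2"
          by (simp add: power_mult_distrib)
      qed
    qed measurable
    moreover have "(LINT x|lebesgue. (norm (s i x - f x))\<^sup>2) = (norm (abs_L2 (s i) - v))\<^sup>2" for i
      unfolding f(2) by (simp add: abs_L2_diff power2_norm_abs_L2 square_integrable_diff ssq f(1))
    ultimately have "(\<lambda>i. (norm (abs_L2 (s i) - v))\<^sup>2) \<longlonglongrightarrow> 0" by simp
    then have "(\<lambda>i. abs_L2 (s i) - v) \<longlonglongrightarrow> 0"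
      by (simp add: tendsto_norm_zero_iff)
    then have "(\<lambda>i. abs_L2 (s i)) \<longlonglongrightarrow> v" by (simp add: LIM_zero_iff)
    then show ?thesis by (rule C_lim[rotated]) (rule C_simple[OF s(1) ssq])
  qed
  then show ?thesis using \<open>countable Q\<close> by blast
qed

instance L2 :: (euclidean_space, euclidean_space) second_countable_topology
proof
  obtain Q :: "('a, 'b) L2 set" where Q: "countable Q" "closure Q = UNIV"
    using L2_separable by blast
  define B where "B = (\<lambda>(q, n). ball q (inverse (real (Suc n)))) ` (Q \<times> UNIV)"
  have "topological_basis B"
  proof (rule topological_basisI)
    show "open U" if "U \<in> B" for U using that by (auto simp: B_def)
    fix U and v :: "('a, 'b) L2"
    assume "open U" "v \<in> U"
    then obtain e where e: "e > 0" "ball v e \<subseteq> U" using open_contains_ball by blast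
    obtain n where n: "inverse (real (Suc n)) < e/2" using e(1) reals_Archimedean[of "e/2"] by auto
    obtain q where q: "q \<in> Q" "dist q v < inverse (real (Suc n))"
      using Q(2) closure_approachable[of v Q] by (metis UNIV_I inverse_positive_iff_positive of_nat_0_less_iff zero_less_Suc)
    have "ball q (inverse (real (Suc n))) \<subseteq> U"
    proof
      fix w assume "w \<in> ball q (inverse (real (Suc n)))"
      then have "dist v w < e" using q(2) n dist_triangle[of v w q] by (simp add: dist_commute)
      then show "w \<in> U" using e(2) by auto
    qed
    moreover have "v \<in> ball q (inverse (real (Suc n)))" using q(2) by simp
    moreover have "ball q (inverse (real (Suc n))) \<in> B"
      unfolding B_def using q(1) by (intro image_eqI[of _ _ "(q, n)"]) auto
    ultimately show "\<exists>B'\<in>B. v \<in> B' \<and> B' \<subseteq> U" by blast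
  qed
  moreover have "countable B" unfolding B_def using Q(1) by (intro countable_image countable_SIGMA) auto
  ultimately show "\<exists>B :: ('a, 'b) L2 set set. countable B \<and> open = generate_topology B"
    using topological_basis_imp_subbasis by blast
qed

definition L2_on :: "'a::euclidean_space set \<Rightarrow> ('a, 'b::euclidean_space) L2 set"
  where "L2_on \<Omega> = {v. AE x in lebesgue. x \<notin> \<Omega> \<longrightarrow> rep_L2 v x = 0}"

section \<open>Test functions and Sobolev spaces\<close>

primrec Ck :: "nat \<Rightarrow> ('a::euclidean_space \<Rightarrow> real) \<Rightarrow> bool" where
  "Ck 0 \<phi> \<longleftrightarrow> continuous_on UNIV \<phi>"
| "Ck (Suc k) \<phi> \<longleftrightarrow>
    (\<exists>g. (\<forall>x. GDERIV \<phi> x :> g x) \<and> (\<forall>b\<in>Basis. Ck k (\<lambda>x. g x \<bullet> b)))"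

definition test_function :: "'a::euclidean_space set \<Rightarrow> ('a \<Rightarrow> real) \<Rightarrow> bool"
  where "test_function S \<phi> \<longleftrightarrow>
    (\<forall>k. Ck k \<phi>) \<and> (\<exists>C\<subseteq>S. compact C \<and> (\<forall>x. x \<notin> C \<longrightarrow> \<phi> x = 0))"

lemma square_integrable_compact_support:
  assumes "continuous_on UNIV f" "compact C" "\<And>x. x \<notin> C \<Longrightarrow> f x = 0"
  shows "square_integrable f"
proof -
  have "f \<in> borel_measurable borel"
    using assms(1) by (rule borel_measurable_continuous_onI)
  then have [measurable]: "f \<in> borel_measurable lebesgue"
    by (simp add: measurable_completion)
  have "integrable lborel (\<lambda>x. indicator C x *\<^sub>R (norm (f x))\<^sup>2)"
    by (intro borel_integrable_compact assms(2) continuous_intros continuous_on_subset[OF assms(1)])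
       auto
  moreover have "(\<lambda>x. indicator C x *\<^sub>R (norm (f x))\<^sup>2) = (\<lambda>x. (norm (f x))\<^sup>2)"
  proof
    fix x
    show "indicator C x *\<^sub>R (norm (f x))\<^sup>2 = (norm (f x))\<^sup>2"
      by (cases "x \<in> C") (simp_all add: assms(3))
  qed
  ultimately show ?thesis
    by (simp add: square_integrable_def integrable_completion borel_measurable_integrable)
qed

lemma test_function_square_integrable:
  assumes "test_function S \<phi>" and g: "\<And>x. GDERIV \<phi> x :> g x"
  shows "square_integrable \<phi>" "square_integrable g"
proof -
  obtain C where C: "compact C" "\<And>x. x \<notin> C \<Longrightarrow> \<phi> x = 0" and k: "\<And>k. Ck k \<phi>"
    using assms(1) by (auto simp: test_function_def)
  show "square_integrable \<phi>"
    by (rule square_integrable_compact_support[OF _ C]) (use k[of 0] in simp)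
  obtain g' where g': "\<And>x. GDERIV \<phi> x :> g' x" "\<And>b. b \<in> Basis \<Longrightarrow> continuous_on UNIV (\<lambda>x. g' x \<bullet> b)"
    using k[of "Suc 0"] by auto
  have uniq: "D = D'" if "GDERIV \<phi> x :> D" "GDERIV \<phi> x :> D'" for x D D'
  proof -
    have "(\<lambda>h. h \<bullet> D) = (\<lambda>h. h \<bullet> D')"
      using that unfolding gderiv_def by (rule has_derivative_unique)
    then show ?thesis by (metis vector_eq_ldot)
  qed
  have "g = g'" using uniq[OF g g'(1)] by blast
  moreover have "continuous_on UNIV (\<lambda>x. \<Sum>b\<in>Basis. (g' x \<bullet> b) *\<^sub>R b)"
    by (intro continuous_intros g'(2))
  ultimately have "continuous_on UNIV g"
    by (simp add: euclidean_representation)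
  moreover have "g x = 0" if "x \<notin> C" for x
  proof (rule uniq[OF g])
    have "((\<lambda>x. 0 :: real) has_derivative (\<lambda>h. h \<bullet> 0)) (at x)"
      by simp
    then show "GDERIV \<phi> x :> 0"
      unfolding gderiv_def
      by (rule has_derivative_transform_within_open[of _ _ _ _ "- C"])
         (use C that compact_imp_closed[OF C(1)] in auto)
  qed
  ultimately show "square_integrable g"
    by (intro square_integrable_compact_support[OF _ C(1)]) auto
qed

text \<open>
  A weakly differentiable function \<open>v\<close> is represented by the pair of \<open>v\<close> and its weak
  gradient, so that the norm of the product type is the \<open>H\<^sup>1\<close> norm, \<open>norm (fst v)\<close> is the
  \<open>L\<^sub>2\<close> norm and \<open>snd v\<close> is the gradient. Functions on \<open>\<Omega>\<close> are extended by zero.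
\<close>

type_synonym 'a jet = "('a, real) L2 \<times> ('a, 'a) L2"

definition H10 :: "'a::euclidean_space set \<Rightarrow> 'a jet set"
  where "H10 \<Omega> = closure {(abs_L2 \<phi>, abs_L2 g) | \<phi> g.
    test_function \<Omega> \<phi> \<and> (\<forall>x. GDERIV \<phi> x :> g x)}"

definition dirichlet_form :: "real \<Rightarrow> 'a::euclidean_space jet \<Rightarrow> 'a jet \<Rightarrow> real"
  where "dirichlet_form K v w = K * (snd v \<bullet> snd w)"

text \<open>A domain whose boundary consists of finitely many flat pieces.\<close>

definition polyhedral_domain :: "'a::euclidean_space set \<Rightarrow> bool"
  where "polyhedral_domain \<Omega> \<longleftrightarrow>
    \<Omega> \<noteq> {} \<and> open \<Omega> \<and> connected \<Omega> \<and> (\<exists>F. finite F \<and> (\<forall>P\<in>F. polytope P) \<and> frontier \<Omega> = \<Union>F)"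

section \<open>Functions of time with values in a Banach space\<close>

definition has_weak_derivative ::
    "real set \<Rightarrow> (real \<Rightarrow> 'b::{banach, second_countable_topology}) \<Rightarrow> (real \<Rightarrow> 'b) \<Rightarrow> bool"
  where "has_weak_derivative J v w \<longleftrightarrow>
    set_integrable lebesgue J v \<and> set_integrable lebesgue J w \<and>
    (\<forall>\<psi>. test_function J \<psi> \<longrightarrow>
      (LINT s:J|lebesgue. deriv \<psi> s *\<^sub>R v s) = - (LINT s:J|lebesgue. \<psi> s *\<^sub>R w s))"

definition W11 ::
    "real set \<Rightarrow> 'b::{banach, second_countable_topology} set \<Rightarrow> (real \<Rightarrow> 'b) set"
  where "W11 J X = {v. (AE s in lebesgue. s \<in> J \<longrightarrow> v s \<in> X) \<and>
    (\<exists>w. has_weak_derivative J v w \<and> (AE s in lebesgue. s \<in> J \<longrightarrow> w s \<in> X))}"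

definition omega :: "real \<Rightarrow> real \<Rightarrow> real"
  where "omega \<beta> t = t powr (\<beta> - 1) / Gamma \<beta>"

definition frac_integral ::
    "real \<Rightarrow> (real \<Rightarrow> 'b::{banach, second_countable_topology}) \<Rightarrow> real \<Rightarrow> 'b"
  where "frac_integral \<beta> v t = (LINT s:{0..t}|lebesgue. omega \<beta> (t - s) *\<^sub>R v s)"

definition riemann_liouville ::
    "real \<Rightarrow> (real \<Rightarrow> 'b::{banach, second_countable_topology}) \<Rightarrow> real \<Rightarrow> 'b"
  where "riemann_liouville \<alpha> v t = vector_derivative (frac_integral (\<alpha> + 1) v) (at t)"

text \<open>
  The equation is understood for almost every \<open>t\<close>, tested against \<open>H10 \<Omega>\<close>. The values
  \<open>u t\<close> of a \<open>W11\<close> function are those of its continuous representative.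
\<close>

definition frac_diffusion_solution ::
    "'a::euclidean_space set \<Rightarrow> real \<Rightarrow> real \<Rightarrow> real \<Rightarrow> (real \<Rightarrow> ('a, real) L2) \<Rightarrow> ('a, real) L2 \<Rightarrow>
      (real \<Rightarrow> 'a jet) \<Rightarrow> bool"
  where "frac_diffusion_solution \<Omega> K \<alpha> T f u0 u \<longleftrightarrow>
    continuous_on {0..T} u \<and> fst (u 0) = u0 \<and>
    (\<exists>u'. has_weak_derivative {0<..<T} u u' \<and>
      (AE t in lebesgue. t \<in> {0<..<T} \<longrightarrow>
        f t \<in> L2_on \<Omega> \<and>
        frac_integral (\<alpha> + 1) u differentiable (at t) \<and>
        (\<forall>v\<in>H10 \<Omega>. fst (u' t) \<bullet> fst v + dirichlet_form K (riemann_liouville \<alpha> u t) v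
          = f t \<bullet> fst v)))"

section \<open>The discontinuous Galerkin scheme\<close>

definition time_mesh :: "real \<Rightarrow> nat \<Rightarrow> (nat \<Rightarrow> real) \<Rightarrow> bool"
  where "time_mesh T N t \<longleftrightarrow>
    N \<ge> 1 \<and> t 0 = 0 \<and> t N = T \<and> (\<forall>n\<in>{1..N}. t (n - 1) < t n)"

definition subinterval :: "(nat \<Rightarrow> real) \<Rightarrow> nat \<Rightarrow> real set"
  where "subinterval t n = {t (n - 1)<..<t n}"

definition step :: "(nat \<Rightarrow> real) \<Rightarrow> nat \<Rightarrow> real"
  where "step t n = t n - t (n - 1)"

definition poly_space :: "'b::real_vector set \<Rightarrow> nat \<Rightarrow> (real \<Rightarrow> 'b) set"
  where "poly_space X p = {q. \<exists>c. (\<forall>i\<le>p. c i \<in> X) \<and> q = (\<lambda>s. \<Sum>i\<le>p. s ^ i *\<^sub>R c i)}"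

definition trial_space ::
    "'b::real_vector set \<Rightarrow> nat \<Rightarrow> (nat \<Rightarrow> real) \<Rightarrow> (nat \<Rightarrow> nat) \<Rightarrow> (real \<Rightarrow> 'b) set"
  where "trial_space X N t p = {v. (\<forall>s\<in>{0..t N}. v s \<in> X) \<and>
    (\<forall>n\<in>{1..N}. \<exists>q\<in>poly_space X (p n). \<forall>s\<in>subinterval t n. v s = q s)}"

definition left_lim :: "(real \<Rightarrow> 'b::t2_space) \<Rightarrow> real \<Rightarrow> 'b"
  where "left_lim v s = Lim (at_left s) v"

definition right_lim :: "(real \<Rightarrow> 'b::t2_space) \<Rightarrow> real \<Rightarrow> 'b"
  where "right_lim v s = Lim (at_right s) v"

text \<open>
  The starting value \<open>U0\<close> plays the role of the left limit at \<open>t 0 = 0\<close>; the values of a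
  trial function at the mesh points themselves are irrelevant.
\<close>

definition dg_solution ::
    "'a::euclidean_space set \<Rightarrow> real \<Rightarrow> real \<Rightarrow> nat \<Rightarrow> (nat \<Rightarrow> real) \<Rightarrow> (nat \<Rightarrow> nat) \<Rightarrow>
      (real \<Rightarrow> ('a, real) L2) \<Rightarrow> ('a, real) L2 \<Rightarrow> (real \<Rightarrow> 'a jet) \<Rightarrow> bool"
  where "dg_solution \<Omega> K \<alpha> N t p f U0 U \<longleftrightarrow>
    U \<in> trial_space (H10 \<Omega>) N t p \<and>
    (\<forall>n\<in>{1..N}. \<forall>X\<in>poly_space (H10 \<Omega>) (p n).
      (fst (right_lim U (t (n - 1))) - (if n = 1 then U0 else fst (left_lim U (t (n - 1)))))
          \<bullet> fst (X (t (n - 1)))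
        + (LINT s:subinterval t n|lebesgue. fst (vector_derivative U (at s)) \<bullet> fst (X s)
            + dirichlet_form K (riemann_liouville \<alpha> U s) (X s))
      = (LINT s:subinterval t n|lebesgue. f s \<bullet> fst (X s)))"

definition dg_projection ::
    "'a::euclidean_space set \<Rightarrow> nat \<Rightarrow> (nat \<Rightarrow> real) \<Rightarrow> (nat \<Rightarrow> nat) \<Rightarrow>
      (real \<Rightarrow> 'a jet) \<Rightarrow> (real \<Rightarrow> 'a jet) \<Rightarrow> bool"
  where "dg_projection \<Omega> N t p u P \<longleftrightarrow>
    P \<in> trial_space (H10 \<Omega>) N t p \<and>
    (\<forall>n\<in>{1..N}. left_lim P (t n) = u (t n) \<and>
      (\<forall>q\<in>poly_space (H10 \<Omega>) (p n - 1).
        (LINT s:subinterval t n|lebesgue. fst (u s - P s) \<bullet> fst (q s)) = 0))"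

definition Linf_L2 :: "nat \<Rightarrow> (nat \<Rightarrow> real) \<Rightarrow> (real \<Rightarrow> 'a::euclidean_space jet) \<Rightarrow> real"
  where "Linf_L2 N t v = (MAX n\<in>{1..N}. SUP s\<in>subinterval t n. norm (fst (v s)))"

end

theory Submission imports Defs "HOL-Real_Asymp.Real_Asymp" begin

text \<open>
  Split the error as \<open>U - u = \<theta> + \<eta>\<close> with \<open>\<theta> = U - P\<close> and \<open>\<eta> = P - u\<close>. Galerkin orthogonality and the
  moment conditions of the projection remove every contribution of \<open>\<eta>\<close> except the memory term, so testing
  with \<open>\<theta>\<close> gives an energy identity in which the pairing of \<open>\<nabla>\<theta>\<close> with the fractional derivative
  of \<open>\<nabla>\<theta> + \<nabla>\<eta>\<close> has to be bounded below. With \<open>\<beta> = \<alpha> + 1\<close>, the kernel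
  \<open>r powr (\<beta> - 1)\<close> is, up to constants, the integral over \<open>l > 0\<close> of \<open>l powr (- \<beta>)\<close> times the
  convolution kernel of \<open>1/(D + l)\<close>, and likewise times that of \<open>D/(D + l)\<^sup>2\<close>, where \<open>D\<close> is the time
  derivative. The first representation makes the \<open>\<theta>\<close> part coercive. In the second one, one factor
  \<open>D/(D + l)\<close> is moved from \<open>\<eta>\<close> onto \<open>\<theta>\<close>, where the coercive part absorbs it, and what remains of
  \<open>\<eta>\<close> is controlled interval by interval through the variation of \<open>\<eta>\<close>; the monotonicity of the steps
  enters here. A polynomial inverse inequality and the Poincare inequality turn the coercive part into the
  bound for the maximum norm.
\<close>

section \<open>Weak derivatives of continuous functions\<close>

text \<open>The obstacle is that \<eta> jumps at the mesh points. Its fractional derivative behaves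
  there like a one-sided power of order \<beta> - 1, which is not square integrable for \<beta>
  \<le> 1/2, so only its pairing with \<theta> can be estimated. Moving all of D/(D + l) onto
  \<theta> would leave \<eta> itself, whose norm does not decay in l, while the weight l powr (-
  \<beta>) is not integrable at infinity. With D^2/(D + l)^2 one factor stays on \<eta>. The square
  integral of D/(D + l) \<eta> is then at most a sum over the intervals of terms 3 B_n^2 min(k_n,
  1/l), where B_n bounds \<eta> up to t_n. The weighted l-integral of min(k, 1/l) is of order k powr
  \<beta>, and B_n^2 is at most a constant times k_n powr (1 - \<beta>), so each interval
  contributes a multiple of its length; this is the origin of k_n powr \<alpha> in the theorem. The
  price is a factor \<beta> between the two representations, matched by the parameter of a Young
  inequality. Derivatives of fractional integrals exist only almost everywhere, hence they are moved
  onto the polynomial test functions.\<close>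

lemma Ck_Suc_imp: "Ck (Suc k) \<phi> \<Longrightarrow> Ck k \<phi>"
proof (induction k arbitrary: \<phi>)
  case 0
  then obtain g where "\<And>x. GDERIV \<phi> x :> g x" by auto
  then show ?case
    by (auto simp: continuous_on_eq_continuous_at gderiv_def intro: has_derivative_continuous)
next
  case (Suc k)
  then obtain g where "\<And>x. GDERIV \<phi> x :> g x" "\<And>b. b \<in> Basis \<Longrightarrow> Ck (Suc k) (\<lambda>x. g x \<bullet> b)"
    unfolding Ck.simps(2)[of "Suc k"] by blast
  with Suc.IH show ?case unfolding Ck.simps(2)[of k] by blast
qed

lemma Ck_const: "Ck k (\<lambda>x. c)"
proof (induction k arbitrary: c)
  case (Suc k)
  then show ?case by (auto intro!: exI[of _ "\<lambda>x. 0"] GDERIV_const)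
qed simp

lemma Ck_add: "Ck k \<phi> \<Longrightarrow> Ck k \<psi> \<Longrightarrow> Ck k (\<lambda>x. \<phi> x + \<psi> x)"
proof (induction k arbitrary: \<phi> \<psi>)
  case 0
  then show ?case by (simp add: continuous_on_add)
next
  case (Suc k)
  then obtain f g where f: "\<And>x. GDERIV \<phi> x :> f x" "\<And>b. b \<in> Basis \<Longrightarrow> Ck k (\<lambda>x. f x \<bullet> b)"
    and g: "\<And>x. GDERIV \<psi> x :> g x" "\<And>b. b \<in> Basis \<Longrightarrow> Ck k (\<lambda>x. g x \<bullet> b)"
    unfolding Ck.simps by blast
  show ?case unfolding Ck.simps
    by (rule exI[of _ "\<lambda>x. f x + g x"])
       (use f g Suc.IH in \<open>auto intro!: GDERIV_add simp: inner_add_left\<close>)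
qed

lemma Ck_mult: "Ck k \<phi> \<Longrightarrow> Ck k \<psi> \<Longrightarrow> Ck k (\<lambda>x. \<phi> x * \<psi> x)"
proof (induction k arbitrary: \<phi> \<psi>)
  case 0
  then show ?case by (simp add: continuous_on_mult)
next
  case (Suc k)
  then obtain f g where f: "\<And>x. GDERIV \<phi> x :> f x" "\<And>b. b \<in> Basis \<Longrightarrow> Ck k (\<lambda>x. f x \<bullet> b)"
    and g: "\<And>x. GDERIV \<psi> x :> g x" "\<And>b. b \<in> Basis \<Longrightarrow> Ck k (\<lambda>x. g x \<bullet> b)"
    unfolding Ck.simps by blast
  have 0: "Ck k \<phi>" "Ck k \<psi>" using Suc.prems Ck_Suc_imp by blast+
  show ?case unfolding Ck.simps
    by (rule exI[of _ "\<lambda>x. \<phi> x *\<^sub>R g x + \<psi> x *\<^sub>R f x"])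
       (use f g 0 Suc.IH in \<open>auto intro!: GDERIV_mult Ck_add simp: inner_add_left\<close>)
qed

lemma Ck_cmult: "Ck k \<phi> \<Longrightarrow> Ck k (\<lambda>x. c * \<phi> x)"
  by (rule Ck_mult[OF Ck_const])

section \<open>Smooth functions of one real variable: a bump and its primitive\<close>

lemma GDERIV_real_iff: "GDERIV f x :> D \<longleftrightarrow> (f has_real_derivative D) (at x)"
proof -
  have "(\<lambda>h. h \<bullet> D) = (*) D" by (simp add: fun_eq_iff)
  then show ?thesis by (simp add: gderiv_def has_field_derivative_def)
qed

lemma Ck_Suc_realI:
  fixes \<phi> :: "real \<Rightarrow> real"
  assumes "\<And>x. (\<phi> has_real_derivative \<phi>' x) (at x)" "Ck k \<phi>'"
  shows "Ck (Suc k) \<phi>"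
  using assms by (auto simp: GDERIV_real_iff)

lemma Ck_affine: "Ck k \<phi> \<Longrightarrow> Ck k (\<lambda>x::real. \<phi> (c * x + d))"
proof (induction k arbitrary: \<phi>)
  case 0
  then show ?case
    by (auto intro!: continuous_intros continuous_on_compose2[of UNIV \<phi>])
next
  case (Suc k)
  then have "\<exists>f. (\<forall>x. (\<phi> has_real_derivative f x) (at x)) \<and> Ck k f"
    unfolding Ck.simps GDERIV_real_iff by simp
  then obtain f where f: "\<And>x. (\<phi> has_real_derivative f x) (at x)" "Ck k f"
    by blast
  show ?case
  proof (rule Ck_Suc_realI)
    show "((\<lambda>x. \<phi> (c * x + d)) has_real_derivative c * f (c * x + d)) (at x)" for x
      by (rule DERIV_cong, rule DERIV_chain2[OF f(1)]) (auto intro!: derivative_eq_intros)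
    show "Ck k (\<lambda>x. c * f (c * x + d))"
      using Suc.IH[OF f(2)] by (rule Ck_cmult)
  qed
qed

text \<open>The functions p(1/x) exp(-1/x), continued by 0, form a family closed under
  differentiation. Carrying a general \<open>p\<close> is what lets the induction in
  \<open>Ck_flat_exp\<close> close; the bump itself is built from \<open>p = 1\<close>.\<close>

definition flat_exp :: "real poly \<Rightarrow> real \<Rightarrow> real"
  where "flat_exp p x = (if x > 0 then poly p (inverse x) * exp (- inverse x) else 0)"

lemma poly_times_exp_tendsto_0: "((\<lambda>y. poly p y * exp (- y)) \<longlongrightarrow> 0) at_top" for p :: "real poly"
proof -
  have "((\<lambda>y. \<Sum>i\<le>degree p. coeff p i * (y ^ i / exp y)) \<longlongrightarrow> (\<Sum>i\<le>degree p. coeff p i * 0)) at_top"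
    by (intro tendsto_intros tendsto_power_div_exp_0)
  then show ?thesis
    by (simp add: poly_altdef sum_distrib_right exp_minus divide_inverse mult.assoc)
qed

lemma flat_exp_tendsto_0: "(flat_exp p \<longlongrightarrow> 0) (at 0)"
proof (rule filterlim_split_at)
  show "(flat_exp p \<longlongrightarrow> 0) (at_left 0)"
    by (rule Lim_transform_eventually[OF tendsto_const])
       (auto simp: flat_exp_def eventually_at intro!: exI[of _ 1])
  have "((\<lambda>x. poly p (inverse x) * exp (- inverse x)) \<longlongrightarrow> 0) (at_right 0)"
    by (rule filterlim_compose[OF poly_times_exp_tendsto_0 filterlim_inverse_at_top_right])
  then show "(flat_exp p \<longlongrightarrow> 0) (at_right 0)"
    by (rule Lim_transform_eventually)
       (auto simp: flat_exp_def eventually_at intro!: exI[of _ 1])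
qed

lemma flat_exp_has_derivative:
  "(flat_exp p has_real_derivative flat_exp ([:0, 0, 1:] * (p - pderiv p)) x) (at x)"
proof (cases x "0 :: real" rule: linorder_cases)
  case less
  have "((\<lambda>x. 0) has_real_derivative 0) (at x)" by simp
  then have "(flat_exp p has_real_derivative 0) (at x)"
    by (rule has_field_derivative_transform_within_open[of _ _ _ "{..<0}"]) (use less in \<open>auto simp: flat_exp_def\<close>)
  then show ?thesis using less by (simp add: flat_exp_def)
next
  case equal
  \<comment> \<open>Division by h multiplies the polynomial in 1/h by its variable, so the
    difference quotient at 0 is again a member of the family and its limit is known.\<close>
  have "((\<lambda>h. flat_exp (pCons 0 p) h) \<longlongrightarrow> 0) (at 0)"
    by (rule flat_exp_tendsto_0)
  then have "((\<lambda>h. (flat_exp p (0 + h) - flat_exp p 0) / h) \<longlongrightarrow> 0) (at 0)"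
    by (rule Lim_transform_eventually)
       (auto simp: flat_exp_def eventually_at field_simps intro!: exI[of _ 1])
  then show ?thesis using equal by (simp add: DERIV_def flat_exp_def)
next
  case greater
  have inv: "(inverse has_real_derivative - (inverse x)\<^sup>2) (at x)"
    using DERIV_inverse[of x UNIV] greater by (simp add: power2_eq_square)
  have "((\<lambda>x. poly p (inverse x) * exp (- inverse x)) has_real_derivative
      poly p (inverse x) * (exp (- inverse x) * - (- (inverse x)\<^sup>2))
      + poly (pderiv p) (inverse x) * - (inverse x)\<^sup>2 * exp (- inverse x)) (at x)"
    by (rule DERIV_mult'[OF DERIV_chain2[OF poly_DERIV inv] DERIV_chain2[OF DERIV_exp DERIV_minus[OF inv]]])
  then have "((\<lambda>x. poly p (inverse x) * exp (- inverse x)) has_real_derivative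
      poly ([:0, 0, 1:] * (p - pderiv p)) (inverse x) * exp (- inverse x)) (at x)"
    by (rule DERIV_cong) (simp add: algebra_simps power2_eq_square)
  then have "(flat_exp p has_real_derivative
      poly ([:0, 0, 1:] * (p - pderiv p)) (inverse x) * exp (- inverse x)) (at x)"
    by (rule has_field_derivative_transform_within_open[of _ _ _ "{0<..}"]) (use greater in \<open>auto simp: flat_exp_def\<close>)
  then show ?thesis using greater by (simp add: flat_exp_def)
qed

lemma Ck_flat_exp: "Ck k (flat_exp p)"
proof (induction k arbitrary: p)
  case 0
  then show ?case
    using DERIV_isCont[OF flat_exp_has_derivative] by (auto simp: continuous_on_eq_continuous_at)
next
  case (Suc k)
  then show ?case by (rule Ck_Suc_realI[OF flat_exp_has_derivative])
qed

text \<open>\<open>\<rho>\<close> is a mollifier sitting to the right of 0 and \<open>R\<close> its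
  primitive. Differences of rescaled copies of \<open>R\<close> are smooth approximations of
  indicators of half-open intervals, and their derivatives are differences of mollifiers.\<close>

lemma smooth_step_exists:
  obtains \<rho> R :: "real \<Rightarrow> real" where
    "\<And>k. Ck k \<rho>" "\<And>x. \<rho> x \<ge> 0" "\<And>x. x \<notin> {0..1} \<Longrightarrow> \<rho> x = 0"
    "\<And>x. (R has_real_derivative \<rho> x) (at x)"
    "\<And>x. x \<le> 0 \<Longrightarrow> R x = 0" "\<And>x. x \<ge> 1 \<Longrightarrow> R x = 1"
    "(\<rho> has_integral 1) {0..1}"
proof -
  define r where "r x = flat_exp 1 x * flat_exp 1 ((-1) * x + 1)" for x
  have Ck: "Ck k r" for k
    unfolding r_def by (intro Ck_mult Ck_flat_exp Ck_affine)
  have cont: "continuous_on S r" for S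
    using Ck[of 0] continuous_on_subset by fastforce
  have r0: "r x \<ge> 0" "x \<notin> {0<..<1} \<Longrightarrow> r x = 0" for x
    by (auto simp: r_def flat_exp_def)
  \<comment> \<open>Starting at -1 makes every x \<ge> 0 an interior point, which yields a two-sided
    derivative also at 0.\<close>
  define I where "I x = integral {-1..x} r" for x
  have I_mono: "I x = 0" if "x \<le> 0" for x
    unfolding I_def using that integral_cong[of "{-1..x}" r "\<lambda>_. 0"] r0 by auto
  have I_split: "I x = I y + integral {y..x} r" if "-1 \<le> y" "y \<le> x" for x y
    unfolding I_def by (intro Henstock_Kurzweil_Integration.integral_combine[symmetric] that
        integrable_continuous_real cont)
  have I1: "I x = I 1" if "x \<ge> 1" for x
  proof -
    have "integral {1..x} r = 0" using integral_cong[of "{1..x}" r "\<lambda>_. 0"] r0 by auto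
    then show ?thesis using I_split[of 1 x] that by simp
  qed
  have "I 1 \<noteq> 0"
  proof
    assume "I 1 = 0"
    then have "integral {0..1} r = 0" using I_split[of 0 1] I_mono[of 0] by simp
    then have "\<forall>x\<in>{0..1}. r x = 0"
      by (subst (asm) integral_eq_0_iff) (auto simp: cont r0)
    then have "r (1/2) = 0" by simp
    then show False by (simp add: r_def flat_exp_def)
  qed
  have deriv: "(I has_real_derivative r x) (at x)" for x
  proof (cases "x < 0")
    case True
    have "((\<lambda>x. 0) has_real_derivative 0) (at x)" by simp
    then have "(I has_real_derivative 0) (at x)"
      by (rule has_field_derivative_transform_within_open[of _ _ _ "{..<0}"]) (use True I_mono in auto)
    then show ?thesis using True r0 by simp
  next
    case False
    have "(I has_real_derivative r x) (at x within {-1..x+1})"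
      unfolding I_def using False by (intro integral_has_real_derivative cont) auto
    then show ?thesis using False by (simp add: at_within_Icc_at)
  qed
  have int: "(r has_integral I 1) {0..1}"
    using I_split[of 0 1] I_mono[of 0] integrable_integral[OF integrable_continuous_real[OF cont], of 0 1] by simp
  have "I 1 > 0"
    using \<open>I 1 \<noteq> 0\<close> has_integral_nonneg[OF int] r0 by force
  show ?thesis
  proof (rule that[of "\<lambda>x. inverse (I 1) * r x" "\<lambda>x. inverse (I 1) * I x"])
    show "Ck k (\<lambda>x. inverse (I 1) * r x)" for k by (intro Ck_cmult Ck)
    show "inverse (I 1) * r x \<ge> 0" for x using \<open>I 1 > 0\<close> r0 by simp
    show "inverse (I 1) * r x = 0" if "x \<notin> {0..1}" for x using that r0(2)[of x] by auto
    show "((\<lambda>x. inverse (I 1) * I x) has_real_derivative inverse (I 1) * r x) (at x)" for x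
      by (rule DERIV_cmult[OF deriv])
    show "inverse (I 1) * I x = 0" if "x \<le> 0" for x using I_mono that by simp
    show "inverse (I 1) * I x = 1" if "x \<ge> 1" for x using I1[OF that] \<open>I 1 > 0\<close> by simp
    show "((\<lambda>x. inverse (I 1) * r x) has_integral 1) {0..1}"
      using has_integral_mult_right[OF int, of "inverse (I 1)"] \<open>I 1 > 0\<close> by simp
  qed
qed

text \<open>The defining identity is tested with smooth approximations of the indicator of
  \<open>{a<..b}\<close>. The derivative of such a test function averages \<open>v\<close> just to
  the right of \<open>a\<close> and of \<open>b\<close>, and continuity of \<open>v\<close> makes
  these averages converge to \<open>v a\<close> and \<open>v b\<close>.\<close>

lemma weak_derivative_imp_integral:
  fixes v w :: "real \<Rightarrow> 'b::{banach, second_countable_topology}"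
  assumes weak: "has_weak_derivative {A<..<B} v w"
    and cont: "continuous_on {A<..<B} v"
    and ab: "A < a" "a < b" "b < B"
  shows "v b - v a = (LINT s:{a..b}|lebesgue. w s)"
proof -
  obtain \<rho> R :: "real \<Rightarrow> real" where Ck: "\<And>k. Ck k \<rho>" and \<rho>0: "\<And>x. \<rho> x \<ge> 0"
    and \<rho>out: "\<And>x. x \<notin> {0..1} \<Longrightarrow> \<rho> x = 0"
    and R: "\<And>x. (R has_real_derivative \<rho> x) (at x)" "\<And>x. x \<le> 0 \<Longrightarrow> R x = 0" "\<And>x. x \<ge> 1 \<Longrightarrow> R x = 1"
    and int1: "(\<rho> has_integral 1) {0..1}"
    by (rule smooth_step_exists) (rule that)
  have \<rho>cont: "continuous_on UNIV \<rho>" using Ck[of 0] by simp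
  have [measurable]: "\<rho> \<in> borel_measurable borel" by (rule borel_measurable_continuous_onI[OF \<rho>cont])
  have Rmono: "R x \<le> R y" if "x \<le> y" for x y
    by (rule DERIV_nonneg_imp_nondecreasing[OF that]) (use R(1) \<rho>0 in blast)
  have R01: "0 \<le> R x" "R x \<le> 1" for x
    using Rmono[of "min x 0" x] Rmono[of x "max x 1"] R(2)[of "min x 0"] R(3)[of "max x 1"] by auto
  have Rcont: "continuous_on UNIV R"
    using DERIV_isCont[OF R(1)] by (auto simp: continuous_on_eq_continuous_at)
  have [measurable]: "R \<in> borel_measurable borel" by (rule borel_measurable_continuous_onI[OF Rcont])
  have CkR: "Ck k R" for k
    using Ck_Suc_imp[OF Ck_Suc_realI[OF R(1) Ck]] .
  have \<rho>int: "integrable lborel \<rho>" "integral\<^sup>L lborel \<rho> = 1"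
  proof -
    have "set_integrable lborel {0..1} \<rho>"
      unfolding set_integrable_def
      by (intro borel_integrable_compact compact_Icc continuous_on_subset[OF \<rho>cont]) simp
    moreover have ind: "(\<lambda>x. indicator {0..1} x *\<^sub>R \<rho> x) = \<rho>"
      using \<rho>out by (force simp: indicator_def fun_eq_iff)
    ultimately show "integrable lborel \<rho>" by (simp add: set_integrable_def)
    show "integral\<^sup>L lborel \<rho> = 1"
      using set_borel_integral_eq_integral(2)[OF \<open>set_integrable lborel {0..1} \<rho>\<close>] integral_unique[OF int1]
      unfolding set_lebesgue_integral_def ind by simp
  qed
  \<comment> \<open>The denominator n + 2 keeps \<open>b + e n\<close> below \<open>B\<close>
    already for n = 0, so that the supports \<open>{a..b + e n}\<close> are compact in the open
    interval.\<close>
  define e where "e n = (B - b) / (real n + 2)" for n :: nat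
  have e: "e n > 0" "b + e n < B" for n
  proof -
    show "e n > 0" using ab by (simp add: e_def)
    have "(B - b) / (real n + 2) < (B - b) / 1"
      using ab by (intro divide_strict_left_mono) auto
    then show "b + e n < B" by (simp add: e_def)
  qed
  have e0: "e \<longlonglongrightarrow> 0" unfolding e_def by real_asymp
  have e1: "e n \<le> e 0" for n
    unfolding e_def using ab by (intro divide_left_mono) auto
  define \<Psi> where "\<Psi> n s = R ((s - a) / e n) - R ((s - b) / e n)" for n s
  define \<psi> where "\<psi> n s = \<rho> ((s - a) / e n) / e n - \<rho> ((s - b) / e n) / e n" for n s
  have \<Psi>_deriv: "(\<Psi> n has_real_derivative \<psi> n s) (at s)" for n s
    unfolding \<Psi>_def \<psi>_def using e(1)[of n]
    by (auto intro!: derivative_eq_intros DERIV_chain2[OF R(1)])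
  have test: "test_function {A<..<B} (\<Psi> n)" for n
    unfolding test_function_def
  proof (intro conjI allI exI[of _ "{a..b + e n}"])
    have 1: "Ck k (\<lambda>s. R ((s - c) / e n))" for k c
      using Ck_affine[OF CkR, of k "inverse (e n)" "- c * inverse (e n)"]
      by (simp add: divide_inverse algebra_simps)
    show "Ck k (\<Psi> n)" for k
      unfolding \<Psi>_def[abs_def] using Ck_add[OF 1[of k a] Ck_cmult[OF 1[of k b], of "-1"]] by simp
    show "x \<notin> {a..b + e n} \<longrightarrow> \<Psi> n x = 0" for x
    proof
      assume "x \<notin> {a..b + e n}"
      then consider "x < a" | "x > b + e n" unfolding atLeastAtMost_iff not_le[symmetric] by blast
      then show "\<Psi> n x = 0"
      proof cases
        case 1
        then show ?thesis using ab e(1)[of n] by (simp add: \<Psi>_def R divide_nonpos_pos)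
      next
        case 2
        then have "(x - a) / e n \<ge> 1" "(x - b) / e n \<ge> 1" using ab e(1)[of n] by (simp_all add: le_divide_eq)
        then show ?thesis by (simp add: \<Psi>_def R)
      qed
    qed
    show "{a..b + e n} \<subseteq> {A<..<B}" using ab e(2)[of n] by auto
  qed simp
  have eq: "(LINT s:{A<..<B}|lebesgue. \<psi> n s *\<^sub>R v s) = - (LINT s:{A<..<B}|lebesgue. \<Psi> n s *\<^sub>R w s)" for n
  proof -
    have "deriv (\<Psi> n) = \<psi> n" using DERIV_imp_deriv[OF \<Psi>_deriv] by blast
    then show ?thesis using weak test[of n] unfolding has_weak_derivative_def by metis
  qed
  \<comment> \<open>By continuity the zero extension \<open>v'\<close> is Borel, so the
    substitutions below take place on \<open>lborel\<close>; \<open>w'\<close> is only Lebesgue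
    measurable and stays on \<open>lebesgue\<close>.\<close>
  define v' where "v' s = indicator {A<..<B} s *\<^sub>R v s" for s
  have [measurable]: "v' \<in> borel_measurable borel"
    unfolding v'_def by (rule borel_measurable_continuous_on_indicator[OF _ cont]) simp
  define w' where "w' s = indicator {A<..<B} s *\<^sub>R w s" for s
  have w': "integrable lebesgue w'"
    using weak unfolding has_weak_derivative_def set_integrable_def w'_def[abs_def] by blast
  then have [measurable]: "w' \<in> borel_measurable lebesgue" by auto
  \<comment> \<open>Substituting s = c + e n * x turns the averages into integrals against the fixed
    density \<open>\<rho>\<close>; they converge by dominated convergence because \<open>v\<close>
    is bounded on \<open>{c..c + e 0}\<close>.\<close>
  have lim_c: "integrable lborel (\<lambda>s. (\<rho> ((s - c) / e n) / e n) *\<^sub>R v' s)"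
      "(\<lambda>n. LINT s|lborel. (\<rho> ((s - c) / e n) / e n) *\<^sub>R v' s) \<longlonglongrightarrow> v c" if c: "A < c" "c \<le> b" for c n
  proof -
    have sub: "(\<lambda>x. (\<rho> ((c + e n * x - c) / e n) / e n) *\<^sub>R v' (c + e n * x))
        = (\<lambda>x. inverse (e n) *\<^sub>R (\<rho> x *\<^sub>R v' (c + e n * x)))" for n
      using e(1)[of n] by (simp add: field_simps)
    have S: "{c..c + e 0} \<subseteq> {A<..<B}" using c e(2)[of 0] by auto
    have "compact (v ` {c..c + e 0})"
      by (intro compact_continuous_image continuous_on_subset[OF cont] S) simp
    then have "bounded (v ` {c..c + e 0})" by (rule compact_imp_bounded)
    then obtain D where "\<forall>x\<in>v ` {c..c + e 0}. norm x \<le> D" unfolding bounded_iff by (rule exE)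
    then have D: "\<And>s. s \<in> {c..c + e 0} \<Longrightarrow> norm (v s) \<le> D" by (rule bspec) (rule imageI)
    have bound: "norm (\<rho> x *\<^sub>R v' (c + e n * x)) \<le> \<rho> x * D" for x n
    proof (cases "x \<in> {0..1}")
      case True
      then have "e n * x \<le> e 0 * 1" using e(1)[of n] e1[of n] by (intro mult_mono) auto
      then have "c + e n * x \<in> {c..c + e 0}" using True e(1)[of n] by auto
      then have "norm (v' (c + e n * x)) \<le> D" using D[of "c + e n * x"] subsetD[OF S, of "c + e n * x"] by (simp add: v'_def)
      then show ?thesis using \<rho>0[of x] by (simp add: mult_left_mono)
    qed (simp add: \<rho>out)
    have int: "integrable lborel (\<lambda>x. \<rho> x *\<^sub>R v' (c + e n * x))" for n
      by (rule Bochner_Integration.integrable_bound[OF integrable_mult_left[OF \<rho>int(1), of D]])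
         (use bound in \<open>auto intro: order_trans[OF _ abs_ge_self]\<close>)
    show "integrable lborel (\<lambda>s. (\<rho> ((s - c) / e n) / e n) *\<^sub>R v' s)" for n
      using lborel_integrable_real_affine_iff[of "e n" "\<lambda>s. (\<rho> ((s - c) / e n) / e n) *\<^sub>R v' s" c] e(1)[of n] int[of n]
      unfolding sub by (simp del: scaleR_scaleR)
    have val: "(LINT s|lborel. (\<rho> ((s - c) / e n) / e n) *\<^sub>R v' s) = (LINT x|lborel. \<rho> x *\<^sub>R v' (c + e n * x))" for n
      using lborel_integral_real_affine[of "e n" "\<lambda>s. (\<rho> ((s - c) / e n) / e n) *\<^sub>R v' s" c] e(1)[of n]
      unfolding sub by (simp del: scaleR_scaleR) simp
    have "(\<lambda>n. LINT x|lborel. \<rho> x *\<^sub>R v' (c + e n * x)) \<longlonglongrightarrow> (LINT x|lborel. \<rho> x *\<^sub>R v' c)"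
    proof (rule integral_dominated_convergence[where w = "\<lambda>x. \<rho> x * D"])
      show "integrable lborel (\<lambda>x. \<rho> x * D)" using \<rho>int by simp
      have cin: "c \<in> {A<..<B}" using c ab by auto
      have "isCont v c" using cin cont continuous_on_eq_continuous_at[of "{A<..<B}" v] by auto
      moreover have "\<forall>\<^sub>F s in nhds c. v' s = v s"
        using eventually_nhds_in_open[OF open_greaterThanLessThan cin] by eventually_elim (simp add: v'_def)
      ultimately have "isCont v' c" by (simp add: isCont_cong)
      then have "(\<lambda>n. v' (c + e n * x)) \<longlonglongrightarrow> v' c" for x
        by (rule isCont_tendsto_compose) 
           (use tendsto_add[OF tendsto_const[of c] tendsto_mult_left_zero[OF e0, of x]] in simp_all)
      then show "AE x in lborel. (\<lambda>n. \<rho> x *\<^sub>R v' (c + e n * x)) \<longlonglongrightarrow> \<rho> x *\<^sub>R v' c"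
        by (intro AE_I2 tendsto_intros)
      show "AE x in lborel. norm (\<rho> x *\<^sub>R v' (c + e n * x)) \<le> \<rho> x * D" for n
        using bound by simp
    qed measurable
    then show "(\<lambda>n. LINT s|lborel. (\<rho> ((s - c) / e n) / e n) *\<^sub>R v' s) \<longlonglongrightarrow> v c"
      unfolding val using \<rho>int c ab by (simp add: v'_def)
  qed
  have eq1: "(LINT s:{A<..<B}|lebesgue. \<psi> n s *\<^sub>R v s) = (LINT s|lborel. \<psi> n s *\<^sub>R v' s)" for n
  proof -
    have "(LINT s:{A<..<B}|lebesgue. \<psi> n s *\<^sub>R v s) = (LINT s|lebesgue. \<psi> n s *\<^sub>R v' s)"
      unfolding set_lebesgue_integral_def v'_def by (simp add: mult.commute)
    also have "\<dots> = (LINT s|lborel. \<psi> n s *\<^sub>R v' s)"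
      by (rule integral_completion) (simp add: \<psi>_def)
    finally show ?thesis .
  qed
  have eq2: "(LINT s:{A<..<B}|lebesgue. \<psi> n s *\<^sub>R v s) = (LINT s|lborel. (\<rho> ((s - a) / e n) / e n) *\<^sub>R v' s)
      - (LINT s|lborel. (\<rho> ((s - b) / e n) / e n) *\<^sub>R v' s)" for n
    unfolding eq1 unfolding \<psi>_def scaleR_left_diff_distrib
    by (rule Bochner_Integration.integral_diff; rule lim_c; use ab in simp)
  have "(\<lambda>n. LINT s:{A<..<B}|lebesgue. \<psi> n s *\<^sub>R v s) \<longlonglongrightarrow> v a - v b"
    unfolding eq2 by (intro tendsto_diff lim_c) (use ab in auto)
  moreover have "(\<lambda>n. LINT s:{A<..<B}|lebesgue. \<Psi> n s *\<^sub>R w s) \<longlonglongrightarrow> (LINT s:{a..b}|lebesgue. w s)"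
  proof -
    have "(\<lambda>n. LINT s|lebesgue. \<Psi> n s *\<^sub>R w' s) \<longlonglongrightarrow> (LINT s|lebesgue. indicator {a<..b} s *\<^sub>R w' s)"
    proof (rule integral_dominated_convergence[where w = "\<lambda>s. norm (w' s)"])
      show "(\<lambda>s. \<Psi> n s *\<^sub>R w' s) \<in> borel_measurable lebesgue" for n
      proof -
        have "\<Psi> n \<in> borel_measurable lborel" unfolding \<Psi>_def by measurable
        then have [measurable]: "\<Psi> n \<in> borel_measurable lebesgue" by (rule measurable_completion)
        show ?thesis by measurable
      qed
      have lim1: "(\<lambda>n. R ((s - c) / e n)) \<longlonglongrightarrow> indicator {c<..} s" for c s
      proof (cases "s > c")
        case True
        have "\<forall>\<^sub>F n in sequentially. e n < s - c" using e0 True by (intro order_tendstoD) auto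
        then have "\<forall>\<^sub>F n in sequentially. indicator {c<..} s = R ((s - c) / e n)"
          by eventually_elim (use True e(1) in \<open>simp add: R(3) le_divide_eq\<close>)
        then show ?thesis by (rule Lim_transform_eventually[OF tendsto_const])
      next
        case False
        then show ?thesis using e(1) by (simp add: R(2) divide_nonpos_pos)
      qed
      have "(\<lambda>n. \<Psi> n s) \<longlonglongrightarrow> indicator {a<..b} s" for s
      proof -
        have "(\<lambda>n. \<Psi> n s) \<longlonglongrightarrow> indicator {a<..} s - indicator {b<..} s"
          unfolding \<Psi>_def by (intro tendsto_diff lim1)
        moreover have "indicator {a<..} s - indicator {b<..} s = (indicator {a<..b} s :: real)"
          using ab by (auto simp: indicator_def)
        ultimately show ?thesis by simp
      qed
      then show "AE s in lebesgue. (\<lambda>n. \<Psi> n s *\<^sub>R w' s) \<longlonglongrightarrow> indicator {a<..b} s *\<^sub>R w' s"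
        by (intro AE_I2 tendsto_intros)
      have "\<bar>\<Psi> n s\<bar> \<le> 1" for n s
        unfolding \<Psi>_def using R01[of "(s - a) / e n"] R01[of "(s - b) / e n"] by linarith
      then show "AE s in lebesgue. norm (\<Psi> n s *\<^sub>R w' s) \<le> norm (w' s)" for n
        by (intro AE_I2) (simp add: mult_left_le_one_le)
      show "(\<lambda>s. indicator {a<..b} s *\<^sub>R w' s) \<in> borel_measurable lebesgue"
        by (intro borel_measurable_scaleR borel_measurable_indicator) simp_all
      show "integrable lebesgue (\<lambda>s. norm (w' s))" using w' by simp
    qed
    moreover have "(LINT s:{A<..<B}|lebesgue. \<Psi> n s *\<^sub>R w s) = (LINT s|lebesgue. \<Psi> n s *\<^sub>R w' s)" for n
      unfolding set_lebesgue_integral_def w'_def by (simp add: mult.commute)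
    moreover have "(LINT s|lebesgue. indicator {a<..b} s *\<^sub>R w' s) = (LINT s:{a..b}|lebesgue. w s)"
      unfolding set_lebesgue_integral_def
    proof (rule integral_cong_AE)
      have "indicator {a..b} s *\<^sub>R w s = indicator {a..b} s *\<^sub>R w' s" for s
        using ab by (auto simp: w'_def indicator_def)
      moreover have "(\<lambda>s. indicator {a..b} s *\<^sub>R w' s) \<in> borel_measurable lebesgue"
        by (intro borel_measurable_scaleR borel_measurable_indicator) simp_all
      ultimately show "(\<lambda>s. indicator {a..b} s *\<^sub>R w s) \<in> borel_measurable lebesgue" by (simp only:)
      show "AE s in lebesgue. indicator {a<..b} s *\<^sub>R w' s = indicator {a..b} s *\<^sub>R w s"
        by (rule AE_I'[of "{a}"]) (use ab in \<open>auto simp: w'_def indicator_def\<close>)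
      show "(\<lambda>s. indicator {a<..b} s *\<^sub>R w' s) \<in> borel_measurable lebesgue"
        by (intro borel_measurable_scaleR borel_measurable_indicator) simp_all
    qed
    ultimately show ?thesis by (simp only:)
  qed
  ultimately have "v a - v b = - (LINT s:{a..b}|lebesgue. w s)"
    unfolding eq by (rule LIMSEQ_unique[OF _ tendsto_minus])
  then show ?thesis by (simp add: algebra_simps)
qed

section \<open>The space of functions vanishing on the boundary\<close>

lemma subspace_closure_normed:
  fixes S :: "'a::real_normed_vector set"
  assumes "subspace S"
  shows "subspace (closure S)"
  unfolding subspace_def
proof (intro conjI ballI allI)
  show "0 \<in> closure S" using subspace_0[OF assms] closure_subset by blast
next
  fix x y assume "x \<in> closure S" "y \<in> closure S"
  then obtain f g where "\<And>n. f n \<in> S" "f \<longlonglongrightarrow> x" "\<And>n. g n \<in> S" "g \<longlonglongrightarrow> y"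
    unfolding closure_sequential by blast
  then show "x + y \<in> closure S"
    unfolding closure_sequential
    by (intro exI[of _ "\<lambda>n. f n + g n"] conjI allI subspace_add[OF assms] tendsto_add)
next
  fix c x assume "x \<in> closure S"
  then obtain f where "\<And>n. f n \<in> S" "f \<longlonglongrightarrow> x"
    unfolding closure_sequential by blast
  then show "c *\<^sub>R x \<in> closure S"
    unfolding closure_sequential
    by (intro exI[of _ "\<lambda>n. c *\<^sub>R f n"] conjI allI subspace_scale[OF assms] tendsto_scaleR tendsto_const)
qed

lemma test_function_add:
  assumes "test_function S \<phi>" "test_function S \<psi>"
  shows "test_function S (\<lambda>x. \<phi> x + \<psi> x)"
proof -
  obtain C D where "C \<subseteq> S" "compact C" "\<forall>x. x \<notin> C \<longrightarrow> \<phi> x = 0" "D \<subseteq> S" "compact D" "\<forall>x. x \<notin> D \<longrightarrow> \<psi> x = 0"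
    using assms unfolding test_function_def by blast
  then have "\<exists>C\<subseteq>S. compact C \<and> (\<forall>x. x \<notin> C \<longrightarrow> \<phi> x + \<psi> x = 0)"
    by (intro exI[of _ "C \<union> D"]) (simp add: compact_Un)
  then show ?thesis using assms unfolding test_function_def by (blast intro: Ck_add)
qed

lemma test_function_cmult:
  assumes "test_function S \<phi>"
  shows "test_function S (\<lambda>x. c * \<phi> x)"
  using assms unfolding test_function_def by (metis Ck_cmult mult_zero_right)

lemma test_function_zero: "test_function S (\<lambda>x. 0)"
  unfolding test_function_def by (auto intro: Ck_const exI[of _ "{}"])

lemma subspace_H10: "subspace (H10 \<Omega>)"
  unfolding H10_def
proof (rule subspace_closure_normed)
  let ?S = "{(abs_L2 \<phi>, abs_L2 g) | \<phi> g. test_function \<Omega> \<phi> \<and> (\<forall>x. GDERIV \<phi> x :> g x)}"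
  show "subspace ?S"
    unfolding subspace_def
  proof (intro conjI ballI allI)
    have "(0 :: 'a jet) = (abs_L2 (\<lambda>x. 0), abs_L2 (\<lambda>x. 0))"
      by (simp add: zero_prod_def zero_L2.abs_eq)
    then show "0 \<in> ?S" using test_function_zero GDERIV_const by blast
  next
    fix v w :: "'a jet"
    assume "v \<in> ?S" "w \<in> ?S"
    then obtain \<phi> g \<psi> h where v: "v = (abs_L2 \<phi>, abs_L2 g)" "test_function \<Omega> \<phi>" "\<And>x. GDERIV \<phi> x :> g x"
      and w: "w = (abs_L2 \<psi>, abs_L2 h)" "test_function \<Omega> \<psi>" "\<And>x. GDERIV \<psi> x :> h x"
      by blast
    have "v + w = (abs_L2 (\<lambda>x. \<phi> x + \<psi> x), abs_L2 (\<lambda>x. g x + h x))"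
      using test_function_square_integrable[OF v(2,3)] test_function_square_integrable[OF w(2,3)]
      by (simp add: v(1) w(1) abs_L2_add)
    then show "v + w \<in> ?S"
      using test_function_add[OF v(2) w(2)] GDERIV_add[OF v(3) w(3)] by blast
  next
    fix c and v :: "'a jet"
    assume "v \<in> ?S"
    then obtain \<phi> g where v: "v = (abs_L2 \<phi>, abs_L2 g)" "test_function \<Omega> \<phi>" "\<And>x. GDERIV \<phi> x :> g x"
      by blast
    have "c *\<^sub>R v = (abs_L2 (\<lambda>x. c * \<phi> x), abs_L2 (\<lambda>x. c *\<^sub>R g x))"
      using test_function_square_integrable[OF v(2,3)]
      by (simp add: v(1) abs_L2_scaleR)
    moreover have "GDERIV (\<lambda>x. c * \<phi> x) x :> c *\<^sub>R g x" for x
      using GDERIV_mult[OF GDERIV_const[of c x] v(3)[of x]] by simp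
    ultimately show "c *\<^sub>R v \<in> ?S" using test_function_cmult[OF v(2)] by blast
  qed
qed

text \<open>By translation invariance of the measure every difference quotient of \<open>F\<close>
  in the direction \<open>b\<close> has integral 0, and dominated convergence carries this over to
  the derivative. For compactly supported functions this takes the place of the divergence
  theorem.\<close>

lemma integral_directional_derivative_eq_0:
  fixes F :: "'a::euclidean_space \<Rightarrow> real"
  assumes deriv: "\<And>x. GDERIV F x :> G x" and cont: "continuous_on UNIV G"
    and supp: "\<And>x. norm x > R \<Longrightarrow> F x = 0"
  shows "(LINT x|lborel. G x \<bullet> b) = 0"
proof -
  \<comment> \<open>Off this ball both values of \<open>F\<close> in the difference quotient vanish,
    since \<open>h n \<le> 1\<close>. The mean value theorem evaluates the gradient at points of
    norm up to \<open>R + 2 * norm b\<close>, hence the larger radius for \<open>M\<close>.\<close>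
  define K where "K = cball (0::'a) (R + norm b)"
  have "compact ((\<lambda>x. norm (G x \<bullet> b)) ` cball 0 (R + 2 * norm b))"
    by (intro compact_continuous_image continuous_intros continuous_on_subset[OF cont]) auto
  then have "bounded ((\<lambda>x. norm (G x \<bullet> b)) ` cball 0 (R + 2 * norm b))" by (rule compact_imp_bounded)
  then obtain M0 where "\<forall>x\<in>cball 0 (R + 2 * norm b). \<bar>G x \<bullet> b\<bar> \<le> M0"
    unfolding bounded_iff by auto
  then have M0: "\<bar>G x \<bullet> b\<bar> \<le> M0" if "norm x \<le> R + 2 * norm b" for x
    using that by simp
  define M where "M = max M0 0"
  have M: "M \<ge> 0" "\<And>x. norm x \<le> R + 2 * norm b \<Longrightarrow> \<bar>G x \<bullet> b\<bar> \<le> M"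
    using M0 by (auto simp: M_def le_max_iff_disj)
  define h where "h n = inverse (real (Suc n))" for n
  have h: "h n > 0" "h n \<le> 1" for n unfolding h_def by (simp_all add: field_simps)
  have h0: "h \<longlonglongrightarrow> 0" unfolding h_def by (rule LIMSEQ_inverse_real_of_nat)
  define D where "D n x = (F (x + h n *\<^sub>R b) - F x) / h n" for n x
  have dF: "((\<lambda>r. F (x + r *\<^sub>R b)) has_real_derivative G (x + r *\<^sub>R b) \<bullet> b) (at r)" for x r
  proof -
    have "((\<lambda>r. x + r *\<^sub>R b) has_derivative (\<lambda>r. r *\<^sub>R b)) (at r)"
      by (auto intro!: derivative_eq_intros)
    from has_derivative_compose[OF this deriv[of "x + r *\<^sub>R b", unfolded gderiv_def]]
    have "((\<lambda>s. F (x + s *\<^sub>R b)) has_derivative (\<lambda>s. (s *\<^sub>R b) \<bullet> G (x + r *\<^sub>R b))) (at r)" .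
    moreover have "(\<lambda>s. (s *\<^sub>R b) \<bullet> G (x + r *\<^sub>R b)) = (*) (G (x + r *\<^sub>R b) \<bullet> b)"
      by (simp add: fun_eq_iff inner_commute)
    ultimately show ?thesis by (simp add: has_field_derivative_def)
  qed
  have Fcont: "continuous_on UNIV F"
    using deriv by (auto simp: continuous_on_eq_continuous_at gderiv_def intro: has_derivative_continuous)
  have [measurable]: "F \<in> borel_measurable borel" by (rule borel_measurable_continuous_onI[OF Fcont])
  have Fint: "integrable lborel F"
  proof -
    have "integrable lborel (\<lambda>x. indicator (cball 0 R) x *\<^sub>R F x)"
      by (intro borel_integrable_compact continuous_on_subset[OF Fcont]) auto
    moreover have "(\<lambda>x. indicator (cball 0 R) x *\<^sub>R F x) = F"
      using supp by (fastforce simp: indicator_def fun_eq_iff)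
    ultimately show ?thesis by simp
  qed
  have shift: "integrable lborel (\<lambda>x. F (x + c))" "(LINT x|lborel. F (x + c)) = (LINT x|lborel. F x)" for c
  proof -
    have eq: "distr lborel borel (\<lambda>x. x + c) = (lborel :: 'a measure)"
    proof -
      have "(\<lambda>x. x + c) = (+) c" by (simp add: fun_eq_iff add.commute)
      then show ?thesis by (simp add: lborel_distr_plus)
    qed
    have "integrable (distr lborel borel (\<lambda>x. x + c)) F" unfolding eq by (rule Fint)
    then show "integrable lborel (\<lambda>x. F (x + c))" by (subst (asm) integrable_distr_eq) simp_all
    have "(LINT x|distr lborel borel (\<lambda>x. x + c). F x) = (LINT x|lborel. F (x + c))"
      by (rule integral_distr) simp_all
    then show "(LINT x|lborel. F (x + c)) = (LINT x|lborel. F x)" unfolding eq by simp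
  qed
  have D0: "(LINT x|lborel. D n x) = 0" for n
    unfolding D_def using shift Fint by simp
  have "(\<lambda>n. LINT x|lborel. D n x) \<longlonglongrightarrow> (LINT x|lborel. G x \<bullet> b)"
  proof (rule integral_dominated_convergence[where w = "\<lambda>x. indicator K x * M"])
    show "(\<lambda>x. G x \<bullet> b) \<in> borel_measurable lborel"
      using borel_measurable_continuous_onI[OF cont] by simp
    show "D n \<in> borel_measurable lborel" for n unfolding D_def by measurable
    have "integrable lborel (\<lambda>x. indicator K x *\<^sub>R M)"
      unfolding K_def by (intro borel_integrable_compact) auto
    then show "integrable lborel (\<lambda>x. indicator K x * M)" by simp
    have "(\<lambda>n. D n x) \<longlonglongrightarrow> G x \<bullet> b" for x
    proof -
      have "((\<lambda>r. (F (x + (0 + r) *\<^sub>R b) - F (x + 0 *\<^sub>R b)) / r) \<longlongrightarrow> G (x + 0 *\<^sub>R b) \<bullet> b) (at 0)"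
        using dF[of x 0] unfolding DERIV_def by simp
      then have "((\<lambda>r. (F (x + r *\<^sub>R b) - F x) / r) \<longlongrightarrow> G x \<bullet> b) (at 0)" by simp
      moreover have "filterlim h (at 0) sequentially"
        using h0 h(1) by (simp add: filterlim_at less_imp_neq[THEN not_sym] always_eventually)
      ultimately show ?thesis unfolding D_def by (rule filterlim_compose)
    qed
    then show "AE x in lborel. (\<lambda>n. D n x) \<longlonglongrightarrow> G x \<bullet> b" by simp
    have "\<bar>D n x\<bar> \<le> indicator K x * M" for n x
    proof (cases "x \<in> K")
      case True
      obtain r where r: "0 < r" "r < h n" "F (x + h n *\<^sub>R b) - F (x + 0 *\<^sub>R b) = (h n - 0) * (G (x + r *\<^sub>R b) \<bullet> b)"
        using MVT2[OF h(1)[of n], of "\<lambda>r. F (x + r *\<^sub>R b)" "\<lambda>r. G (x + r *\<^sub>R b) \<bullet> b"] dF by blast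
      have "norm (r *\<^sub>R b) \<le> 1 * norm b"
        unfolding norm_scaleR using r h(2)[of n] by (intro mult_right_mono) auto
      then have "norm (x + r *\<^sub>R b) \<le> R + 2 * norm b"
        using True norm_triangle_ineq[of x "r *\<^sub>R b"] by (simp add: K_def)
      then have "\<bar>G (x + r *\<^sub>R b) \<bullet> b\<bar> \<le> M" by (rule M(2))
      moreover have "D n x = G (x + r *\<^sub>R b) \<bullet> b"
        using r(3) h(1)[of n] by (simp add: D_def)
      ultimately show ?thesis using True by simp
    next
      case False
      have "norm (h n *\<^sub>R b) \<le> 1 * norm b"
        unfolding norm_scaleR using h[of n] by (intro mult_right_mono) auto
      moreover have "norm x \<le> norm (x + h n *\<^sub>R b) + norm (h n *\<^sub>R b)"
        using norm_triangle_ineq4[of "x + h n *\<^sub>R b" "h n *\<^sub>R b"] by simp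
      moreover have "norm x > R + norm b" using False by (simp add: K_def)
      ultimately have "norm (x + h n *\<^sub>R b) > R" "norm x > R" using norm_ge_zero[of b] by linarith+
      then show ?thesis using False by (simp add: D_def supp)
    qed
    then show "AE x in lborel. norm (D n x) \<le> indicator K x * M" for n by simp
  qed
  then show ?thesis unfolding D0 by (simp add: LIMSEQ_const_iff)
qed

lemma test_function_gradient_continuous:
  assumes "test_function S \<phi>" and g: "\<And>x. GDERIV \<phi> x :> g x"
  shows "continuous_on UNIV g"
proof -
  have "Ck (Suc 0) \<phi>" using assms(1) by (simp add: test_function_def)
  then obtain g' where g': "\<And>x. GDERIV \<phi> x :> g' x" "\<And>b. b \<in> Basis \<Longrightarrow> continuous_on UNIV (\<lambda>x. g' x \<bullet> b)"
    by auto
  have "g x = g' x" for x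
  proof -
    have "(\<lambda>h. h \<bullet> g x) = (\<lambda>h. h \<bullet> g' x)"
      using g[of x] g'(1)[of x] unfolding gderiv_def by (rule has_derivative_unique)
    then show ?thesis by (metis vector_eq_ldot)
  qed
  moreover have "continuous_on UNIV (\<lambda>x. \<Sum>b\<in>Basis. (g' x \<bullet> b) *\<^sub>R b)"
    by (intro continuous_intros g'(2))
  ultimately show ?thesis by (simp add: euclidean_representation)
qed

text \<open>For a coordinate vector b, the b-derivative of (\<phi> x)^2 (x \<bullet> b) is (\<phi>
  x)^2 + 2 \<phi> x (x \<bullet> b) (g x \<bullet> b), and its integral is 0. Since x \<bullet> b is
  at most R on the domain, Young's inequality absorbs half of the integral of \<phi>^2; the constant
  4 R^2 is twice the 2 R^2 left over.\<close>

lemma Poincare_test_function: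
  fixes \<phi> :: "'a::euclidean_space \<Rightarrow> real"
  assumes \<phi>: "test_function \<Omega> \<phi>" and g: "\<And>x. GDERIV \<phi> x :> g x"
    and R: "R \<ge> 0" "\<And>x. x \<in> \<Omega> \<Longrightarrow> norm x \<le> R"
  shows "(norm (abs_L2 \<phi>))\<^sup>2 \<le> 4 * R\<^sup>2 * (norm (abs_L2 g))\<^sup>2"
proof -
  obtain b :: 'a where b: "b \<in> Basis" using nonempty_Basis by blast
  have sq: "square_integrable \<phi>" "square_integrable g"
    by (rule test_function_square_integrable[OF \<phi> g])+
  have out: "\<phi> x = 0" if "x \<notin> \<Omega>" for x using \<phi> that unfolding test_function_def by blast
  have gcont: "continuous_on UNIV g" by (rule test_function_gradient_continuous[OF \<phi> g])
  have pcont: "continuous_on UNIV \<phi>" using \<phi> unfolding test_function_def by (metis Ck.simps(1))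
  define G where "G x = (\<phi> x * \<phi> x) *\<^sub>R b + (x \<bullet> b) *\<^sub>R (\<phi> x *\<^sub>R g x + \<phi> x *\<^sub>R g x)" for x
  have "GDERIV (\<lambda>x. \<phi> x * \<phi> x * (x \<bullet> b)) x :> G x" for x
  proof -
    have "GDERIV (\<lambda>x. x \<bullet> b) x :> b"
      unfolding gderiv_def by (auto intro!: derivative_eq_intros)
    from GDERIV_mult[OF GDERIV_mult[OF g g] this] show ?thesis unfolding G_def .
  qed
  moreover have "continuous_on UNIV G"
    unfolding G_def by (intro continuous_intros pcont gcont)
  moreover have "\<phi> x * \<phi> x * (x \<bullet> b) = 0" if "norm x > R" for x
    using out[of x] R(2)[of x] that by fastforce
  ultimately have 0: "(LINT x|lborel. G x \<bullet> b) = 0"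
    by (rule integral_directional_derivative_eq_0)
  have Gm: "(\<lambda>x. G x \<bullet> b) \<in> borel_measurable lborel"
    using borel_measurable_continuous_onI[OF \<open>continuous_on UNIV G\<close>] by simp
  have Gb: "G x \<bullet> b = (\<phi> x)\<^sup>2 + 2 * \<phi> x * ((x \<bullet> b) * (g x \<bullet> b))" for x
    using b by (simp add: G_def inner_add_left power2_eq_square)
  have xb: "\<bar>2 * \<phi> x * ((x \<bullet> b) * (g x \<bullet> b))\<bar> \<le> (\<phi> x)\<^sup>2 / 2 + 2 * R\<^sup>2 * (norm (g x))\<^sup>2" for x
  proof (cases "x \<in> \<Omega>")
    case True
    define c where "c = (x \<bullet> b) * (g x \<bullet> b)"
    have "\<bar>x \<bullet> b\<bar> \<le> R" using R(2)[OF True] Basis_le_norm[OF b, of x] by linarith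
    moreover have "\<bar>g x \<bullet> b\<bar> \<le> norm (g x)" by (rule Basis_le_norm[OF b])
    ultimately have "\<bar>c\<bar> \<le> R * norm (g x)"
      unfolding c_def abs_mult using R(1) by (intro mult_mono) auto
    then have "\<bar>c\<bar>\<^sup>2 \<le> (R * norm (g x))\<^sup>2" by (intro power_mono) auto
    then have c: "c\<^sup>2 \<le> R\<^sup>2 * (norm (g x))\<^sup>2" by (simp add: power_mult_distrib)
    have "0 \<le> (\<phi> x - 2 * c)\<^sup>2" "0 \<le> (\<phi> x + 2 * c)\<^sup>2" by simp_all
    then have "\<bar>2 * \<phi> x * c\<bar> \<le> (\<phi> x)\<^sup>2 / 2 + 2 * c\<^sup>2"
      by (simp add: power2_diff power2_sum abs_le_iff power_mult_distrib)
    then show ?thesis using c unfolding c_def by linarith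
  next
    case False
    then show ?thesis by (simp add: out)
  qed
  have i: "integrable lebesgue (\<lambda>x. (\<phi> x)\<^sup>2)" "integrable lebesgue (\<lambda>x. (norm (g x))\<^sup>2)"
    using sq by (auto simp: square_integrable_def)
  have [measurable]: "\<phi> \<in> borel_measurable lebesgue" "g \<in> borel_measurable lebesgue"
    using sq by (auto simp: square_integrable_def)
  have Gm2 [measurable]: "(\<lambda>x. G x \<bullet> b) \<in> borel_measurable lebesgue" by (rule measurable_completion[OF Gm])
  have "integrable lebesgue (\<lambda>x. G x \<bullet> b)"
  proof (rule Bochner_Integration.integrable_bound)
    show "integrable lebesgue (\<lambda>x. 2 * (\<phi> x)\<^sup>2 + 2 * R\<^sup>2 * (norm (g x))\<^sup>2)" using i by simp
    show "AE x in lebesgue. norm (G x \<bullet> b) \<le> norm (2 * (\<phi> x)\<^sup>2 + 2 * R\<^sup>2 * (norm (g x))\<^sup>2)"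
    proof (rule AE_I2)
      fix x
      have "\<bar>G x \<bullet> b\<bar> \<le> 2 * (\<phi> x)\<^sup>2 + 2 * R\<^sup>2 * (norm (g x))\<^sup>2"
        unfolding Gb using xb[of x] zero_le_power2[of "\<phi> x"] by linarith
      then show "norm (G x \<bullet> b) \<le> norm (2 * (\<phi> x)\<^sup>2 + 2 * R\<^sup>2 * (norm (g x))\<^sup>2)" by simp
    qed
  qed (rule Gm2)
  moreover have "(LINT x|lebesgue. G x \<bullet> b) = 0" using 0 integral_completion[OF Gm] by simp
  ultimately have "(LINT x|lebesgue. (\<phi> x)\<^sup>2) = (LINT x|lebesgue. (\<phi> x)\<^sup>2 - G x \<bullet> b)"
    using i by simp
  also have "\<dots> \<le> (LINT x|lebesgue. (\<phi> x)\<^sup>2 / 2 + 2 * R\<^sup>2 * (norm (g x))\<^sup>2)"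
  proof (rule integral_mono)
    show "integrable lebesgue (\<lambda>x. (\<phi> x)\<^sup>2 - G x \<bullet> b)"
      using i \<open>integrable lebesgue (\<lambda>x. G x \<bullet> b)\<close> by simp
    show "(\<phi> x)\<^sup>2 - G x \<bullet> b \<le> (\<phi> x)\<^sup>2 / 2 + 2 * R\<^sup>2 * (norm (g x))\<^sup>2" for x
      unfolding Gb using xb[of x] by linarith
  qed (use i in simp)
  also have "\<dots> = (LINT x|lebesgue. (\<phi> x)\<^sup>2) / 2 + 2 * R\<^sup>2 * (LINT x|lebesgue. (norm (g x))\<^sup>2)"
    using i by simp
  finally show ?thesis using power2_norm_abs_L2[OF sq(1)] power2_norm_abs_L2[OF sq(2)] by simp
qed

text \<open>The inequality describes a closed set of jets, so it passes from test functions to their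
  closure.\<close>

lemma Poincare_H10:
  fixes \<Omega> :: "'a::euclidean_space set"
  assumes "bounded \<Omega>"
  obtains C where "C \<ge> 0" "\<And>v. v \<in> H10 \<Omega> \<Longrightarrow> (norm (fst v))\<^sup>2 \<le> C * (norm (snd v))\<^sup>2"
proof -
  obtain R0 where "\<forall>x\<in>\<Omega>. norm x \<le> R0" using assms unfolding bounded_iff by blast
  then have R: "max R0 0 \<ge> 0" "\<And>x. x \<in> \<Omega> \<Longrightarrow> norm x \<le> max R0 0" by (auto simp: le_max_iff_disj)
  define C where "C = 4 * (max R0 0)\<^sup>2"
  have "closed {v :: 'a jet. (norm (fst v))\<^sup>2 \<le> C * (norm (snd v))\<^sup>2}"
    by (intro closed_Collect_le continuous_intros)
  moreover have "{(abs_L2 \<phi>, abs_L2 g) | \<phi> g. test_function \<Omega> \<phi> \<and> (\<forall>x. GDERIV \<phi> x :> g x)}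
      \<subseteq> {v :: 'a jet. (norm (fst v))\<^sup>2 \<le> C * (norm (snd v))\<^sup>2}"
    using Poincare_test_function[OF _ _ R] unfolding C_def by auto
  ultimately have "H10 \<Omega> \<subseteq> {v. (norm (fst v))\<^sup>2 \<le> C * (norm (snd v))\<^sup>2}"
    unfolding H10_def by (rule closure_minimal[rotated])
  then show ?thesis by (intro that[of C]) (auto simp: C_def)
qed

section \<open>An inverse inequality for polynomials\<close>

text \<open>The polynomial with coefficients a_j represents evaluation at 0 on polynomials of degree
  at most p in the inner product of \<open>{0..1}\<close>; finding it means solving a system with
  the Hilbert matrix. The a_j are the residues of N(y) / ((y + 1) ... (y + p + 1)), where N vanishes
  at 1, ..., p and is scaled so that the quotient is 1 at 0. The values of the quotient at 0, ..., p
  are the required right-hand sides.\<close>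

lemma endpoint_kernel_coeffs:
  obtains a :: "nat \<Rightarrow> real" where
    "\<And>m. m \<le> p \<Longrightarrow> (\<Sum>j\<le>p. a j / real (m + j + 1)) = (if m = 0 then 1 else 0)"
    "a 0 = (real p + 1)\<^sup>2"
proof -
  \<comment> \<open>With this factor N(0) = (p + 1)!, which is the value of the denominator at
    0.\<close>
  define c :: real where "c = (-1) ^ p * (real p + 1)"
  define N :: "real poly" where "N = smult c (\<Prod>i<p. [:- (real i + 1), 1:])"
  define L :: "nat \<Rightarrow> real poly" where "L j = (\<Prod>l\<in>{..p} - {j}. [:real l + 1, 1:])" for j
  define x where "x j = - (real j + 1)" for j :: nat
  define a where "a j = poly N (x j) / poly (L j) (x j)" for j
  have sgn: "(-1::real) ^ p * (-1) ^ p = 1" by (simp flip: power_mult_distrib)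
  have Nv: "poly N y = c * (\<Prod>i<p. y - (real i + 1))" for y
    by (auto simp: N_def poly_prod intro!: prod.cong)
  have Lv: "poly (L j) y = (\<Prod>l\<in>{..p} - {j}. y + (real l + 1))" for j y
    by (simp add: L_def poly_prod add.commute)
  have Lnz: "poly (L j) (x j) \<noteq> 0" for j
    by (auto simp: Lv x_def)
  have Lz: "poly (L j) (x k) = 0" if "k \<le> p" "k \<noteq> j" for j k
    using that by (auto simp: Lv x_def intro!: bexI[of _ k])
  \<comment> \<open>Lagrange interpolation at the p + 1 poles -1, ..., -(p + 1); this is the partial
    fraction decomposition with cleared denominators.\<close>
  have "N = (\<Sum>j\<le>p. smult (a j) (L j))"
  proof (rule poly_eqI_degree[of "x ` {..p}"])
    fix y assume "y \<in> x ` {..p}"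
    then obtain k where k: "k \<le> p" "y = x k" by auto
    have "(\<Sum>j\<le>p. a j * poly (L j) (x k)) = (\<Sum>j\<le>p. if j = k then poly N (x k) else 0)"
      by (intro sum.cong refl) (use k Lz Lnz in \<open>auto simp: a_def\<close>)
    then show "poly N y = poly (\<Sum>j\<le>p. smult (a j) (L j)) y"
      using k by (simp add: poly_sum)
  next
    have card: "card (x ` {..p}) = Suc p"
      by (subst card_image) (auto simp: inj_on_def x_def)
    have "degree (\<Prod>i<p. [:- (real i + 1), 1:]) \<le> (\<Sum>i<p. degree [:- (real i + 1), 1:])"
      using degree_prod_sum_le[of "{..<p}" "\<lambda>i. [:- (real i + 1), 1:]"] by (simp add: o_def)
    then show "degree N < card (x ` {..p})"
      unfolding card N_def by (simp add: less_Suc_eq_le del: mult_minus1)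
    have "degree (smult (a j) (L j)) \<le> p" if "j \<le> p" for j
    proof -
      have "degree (L j) \<le> (\<Sum>l\<in>{..p} - {j}. degree [:real l + 1, 1:])"
        unfolding L_def using degree_prod_sum_le[of "{..p} - {j}" "\<lambda>l. [:real l + 1, 1:]"] by (simp add: o_def)
      also have "\<dots> = p" using that by simp
      finally show ?thesis using degree_smult_le[of "a j" "L j"] by linarith
    qed
    then have "degree (\<Sum>j\<le>p. smult (a j) (L j)) \<le> p"
      by (intro degree_sum_le) auto
    then show "degree (\<Sum>j\<le>p. smult (a j) (L j)) < card (x ` {..p})" unfolding card by simp
  qed
  then have N: "poly N y = (\<Sum>j\<le>p. a j * poly (L j) y)" for y
    by (simp add: poly_sum)
  show ?thesis
  proof
    fix m assume "m \<le> p"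
    define Q where "Q = (\<Prod>l\<le>p. real m + (real l + 1))"
    have Q: "Q \<noteq> 0" by (auto simp: Q_def)
    have "(\<Sum>j\<le>p. a j / real (m + j + 1)) = poly N (real m) / Q"
      unfolding N sum_divide_distrib
    proof (rule sum.cong)
      fix j assume "j \<in> {..p}"
      then have "Q = (real m + (real j + 1)) * poly (L j) (real m)"
        unfolding Q_def Lv by (rule prod.remove[OF finite_atMost])
      moreover have "poly (L j) (real m) \<noteq> 0" using Q calculation by auto
      ultimately have "a j * poly (L j) (real m) / Q = a j / (real m + (real j + 1))"
        by (simp only: mult_divide_mult_cancel_right not_False_eq_True)
      then show "a j / real (m + j + 1) = a j * poly (L j) (real m) / Q"
        by (simp add: add.assoc)
    qed simp
    also have "\<dots> = (if m = 0 then 1 else 0)"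
    proof (cases "m = 0")
      case True
      have "(\<Prod>i<n. 0 - (real i + 1)) = (-1) ^ n * fact n" for n
        by (induction n) (simp_all add: algebra_simps)
      moreover have "(\<Prod>l\<le>n. real 0 + (real l + 1)) = fact (Suc n)" for n
        by (induction n) (simp_all add: algebra_simps)
      then have "Q = fact (Suc p)" unfolding Q_def True .
      ultimately have "poly N 0 / Q = (((-1) ^ p * (-1) ^ p) * fact (Suc p)) / fact (Suc p)"
        by (simp add: Nv c_def mult_ac)
      then show ?thesis using True sgn by simp
    next
      case False
      then have "(\<Prod>i<p. real m - (real i + 1)) = 0"
        using \<open>m \<le> p\<close> by (auto intro!: bexI[of _ "m - 1"])
      then show ?thesis using False by (simp add: Nv)
    qed
    finally show "(\<Sum>j\<le>p. a j / real (m + j + 1)) = (if m = 0 then 1 else 0)" .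
  next
    have 1: "(\<Prod>i<n. x 0 - (real i + 1)) = (-1) ^ n * fact (Suc n)" for n
      by (induction n) (simp_all add: x_def algebra_simps)
    have 3: "poly (L 0) (x 0) = fact p"
    proof -
      have "{..p} - {0} = Suc ` {..<p}" by (auto simp: image_Suc_lessThan)
      then have "poly (L 0) (x 0) = (\<Prod>l<p. real (Suc l))"
        unfolding Lv x_def by (simp add: prod.reindex)
      then show ?thesis by (simp add: fact_prod_Suc atLeast0LessThan)
    qed
    show "a 0 = (real p + 1)\<^sup>2"
    proof -
      have "a 0 = ((-1) ^ p * (-1) ^ p) * (real p + 1) * fact (Suc p) / fact p"
        unfolding a_def 3 Nv 1 c_def by (simp add: mult_ac)
      then show ?thesis using sgn by (simp add: power2_eq_square)
    qed
  qed
qed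

lemma has_integral_power_unit: "((\<lambda>x::real. x ^ n) has_integral 1 / real (n + 1)) {0..1}"
proof -
  have "((\<lambda>x::real. x ^ n) has_integral (1 ^ Suc n / real (n + 1) - 0 ^ Suc n / real (n + 1))) {0..1}"
  proof (rule fundamental_theorem_of_calculus)
    fix x :: real
    have "((\<lambda>x. x ^ Suc n / real (n + 1)) has_real_derivative x ^ n) (at x within {0..1})"
      by (rule DERIV_cong[OF DERIV_cdivide[OF DERIV_pow]]) (simp add: add.commute)
    then show "((\<lambda>x. x ^ Suc n / real (n + 1)) has_vector_derivative x ^ n) (at x within {0..1})"
      by (simp add: has_real_derivative_iff_has_vector_derivative)
  qed simp
  then show ?thesis by simp
qed

text \<open>Cauchy-Schwarz for q(0), written as the inner product of q with the representing
  polynomial R. The squared norm of R is R(0) = (p + 1)^2, so the constant cannot be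
  improved.\<close>

lemma poly_endpoint_bound:
  fixes q :: "real poly"
  assumes "degree q \<le> p"
  shows "(poly q 0)\<^sup>2 \<le> (real p + 1)\<^sup>2 * integral {0..1} (\<lambda>x. (poly q x)\<^sup>2)"
proof -
  obtain a where a: "\<And>m. m \<le> p \<Longrightarrow> (\<Sum>j\<le>p. a j / real (m + j + 1)) = (if m = 0 then 1 else 0)"
    "a 0 = (real p + 1)\<^sup>2" by (rule endpoint_kernel_coeffs[of p]) (rule that)
  define R where "R = (\<Sum>j\<le>p. monom (a j) j)"
  have R: "poly R x = (\<Sum>j\<le>p. a j * x ^ j)" for x
    by (simp add: R_def poly_sum poly_monom)
  have dR: "degree R \<le> p" unfolding R_def
    by (intro degree_sum_le) (auto intro: order_trans[OF degree_monom_le])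
  have repr: "((\<lambda>x. poly R x * poly f x) has_integral poly f 0) {0..1}" if "degree f \<le> p" for f
  proof -
    have f: "poly f x = (\<Sum>m\<le>p. coeff f m * x ^ m)" for x
      unfolding poly_altdef using that
      by (intro sum.mono_neutral_left) (auto simp: coeff_eq_0)
    have "((\<lambda>x. \<Sum>m\<le>p. \<Sum>j\<le>p. (coeff f m * a j) * x ^ (m + j)) has_integral
        (\<Sum>m\<le>p. \<Sum>j\<le>p. (coeff f m * a j) * (1 / real (m + j + 1)))) {0..1}"
      by (intro has_integral_sum has_integral_mult_right has_integral_power_unit finite_atMost)
    moreover have "(\<Sum>m\<le>p. \<Sum>j\<le>p. (coeff f m * a j) * (1 / real (m + j + 1))) = (\<Sum>m\<le>p. if m = 0 then coeff f 0 else 0)"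
    proof (rule sum.cong[OF refl])
      fix m assume "m \<in> {..p}"
      then have "coeff f m * (\<Sum>j\<le>p. a j / real (m + j + 1)) = (if m = 0 then coeff f 0 else 0)"
        using a(1)[of m] by simp
      then show "(\<Sum>j\<le>p. (coeff f m * a j) * (1 / real (m + j + 1))) = (if m = 0 then coeff f 0 else 0)"
        by (simp add: sum_distrib_left)
    qed
    moreover have "(\<lambda>x. \<Sum>m\<le>p. \<Sum>j\<le>p. (coeff f m * a j) * x ^ (m + j)) = (\<lambda>x. poly R x * poly f x)"
      unfolding R f sum_product by (subst sum.swap) (simp add: power_add mult_ac)
    ultimately show ?thesis by (simp add: poly_0_coeff_0)
  qed
  define P2 where "P2 = (real p + 1)\<^sup>2"
  have P2: "P2 > 0" "poly R 0 = P2"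
    using a(2) by (simp_all add: P2_def poly_0_coeff_0 R_def coeff_sum)
  \<comment> \<open>This c minimises the integral of (q - c R)^2, whose nonnegativity is the
    inequality.\<close>
  define c where "c = poly q 0 / P2"
  have q2: "((\<lambda>x. (poly q x)\<^sup>2) has_integral integral {0..1} (\<lambda>x. (poly q x)\<^sup>2)) {0..1}"
    by (intro integrable_integral integrable_continuous_real continuous_intros)
  have I: "((\<lambda>x. (poly q x)\<^sup>2 - 2 * c * (poly R x * poly q x) + c\<^sup>2 * (poly R x * poly R x)) has_integral
      (integral {0..1} (\<lambda>x. (poly q x)\<^sup>2) - 2 * c * poly q 0 + c\<^sup>2 * poly R 0)) {0..1}"
    by (intro has_integral_add has_integral_diff has_integral_mult_right q2 repr assms dR)
  have eq: "(\<lambda>x. (poly q x)\<^sup>2 - 2 * c * (poly R x * poly q x) + c\<^sup>2 * (poly R x * poly R x)) = (\<lambda>x. (poly q x - c * poly R x)\<^sup>2)"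
    by (simp add: fun_eq_iff power2_eq_square algebra_simps)
  have "0 \<le> integral {0..1} (\<lambda>x. (poly q x)\<^sup>2) - 2 * c * poly q 0 + c\<^sup>2 * poly R 0"
    by (rule has_integral_nonneg[OF I[unfolded eq]]) simp
  moreover have "2 * c * poly q 0 - c\<^sup>2 * poly R 0 = (poly q 0)\<^sup>2 / P2"
    using P2 by (simp add: c_def power2_eq_square)
  ultimately have "(poly q 0)\<^sup>2 / P2 \<le> integral {0..1} (\<lambda>x. (poly q x)\<^sup>2)" by linarith
  then show ?thesis using P2 unfolding P2_def[symmetric] by (simp add: pos_divide_le_eq mult.commute)
qed

text \<open>Every point of an interval is an endpoint of a subinterval of at least half its length.\<close>

lemma polynomial_inverse_inequality:
  fixes c :: "nat \<Rightarrow> 'b::real_inner"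
  assumes \<theta>_def: "\<theta> = (\<lambda>s. \<Sum>i\<le>p. s ^ i *\<^sub>R c i)"
    and "a < b" "x \<in> {a..b}"
  shows "(norm (\<theta> x))\<^sup>2 \<le> 2 * (real p + 1)\<^sup>2 / (b - a) * (LBINT s:{a..b}. (norm (\<theta> s))\<^sup>2)"
proof -
  define y where "y = (if x \<le> (a + b) / 2 then b else a)"
  define l where "l = y - x"
  have l: "\<bar>l\<bar> \<ge> (b - a) / 2" "l \<noteq> 0" and seg: "\<And>r. 0 \<le> r \<Longrightarrow> r \<le> 1 \<Longrightarrow> x + l * r \<in> {a..b}"
  proof -
    show "\<bar>l\<bar> \<ge> (b - a) / 2" using assms(3) by (auto simp: l_def y_def)
    then show "l \<noteq> 0" using assms(2) by auto
    fix r :: real assume r: "0 \<le> r" "r \<le> 1"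
    have "x + l * r = (1 - r) * x + r * y" by (simp add: l_def algebra_simps)
    moreover have "y \<in> {a..b}" using assms(2) by (auto simp: y_def)
    ultimately show "x + l * r \<in> {a..b}"
      using convexD[OF convex_real_interval(5), of x a b y "1 - r" r] r assms(3) by simp
  qed
  \<comment> \<open>Pairing with the value at x itself makes the polynomial scalar: q(0) is the
    square of the norm of w, and one such factor is cancelled at the end.\<close>
  define w where "w = \<theta> x"
  define q where "q = (\<Sum>i\<le>p. smult (c i \<bullet> w) ([:x, l:] ^ i))"
  have q: "poly q r = \<theta> (x + l * r) \<bullet> w" for r
    by (simp add: q_def \<theta>_def poly_sum inner_sum_left mult.commute)
  have "degree q \<le> p" unfolding q_def
  proof (intro degree_sum_le finite_atMost)
    fix i assume "i \<in> {..p}"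
    have "degree ([:x, l:] ^ i) \<le> degree [:x, l:] * i" by (rule degree_power_le)
    also have "\<dots> \<le> p" using \<open>i \<in> {..p}\<close> by simp
    finally show "degree (smult (c i \<bullet> w) ([:x, l:] ^ i)) \<le> p"
      using degree_smult_le le_trans by blast
  qed
  have cont: "continuous_on S \<theta>" for S unfolding \<theta>_def by (intro continuous_intros)
  define h where "h s = (norm (\<theta> s))\<^sup>2" for s
  have hcont: "continuous_on S h" for S unfolding h_def by (intro continuous_intros cont)
  have h0: "h s \<ge> 0" for s by (simp add: h_def)
  have hm [measurable]: "h \<in> borel_measurable borel" by (rule borel_measurable_continuous_onI[OF hcont])
  have hl: "continuous_on {0..1} (\<lambda>r. h (x + l * r))"
    by (rule continuous_on_compose2[OF hcont[of UNIV]]) (auto intro!: continuous_intros)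
  have "(poly q 0)\<^sup>2 \<le> (real p + 1)\<^sup>2 * integral {0..1} (\<lambda>r. (poly q r)\<^sup>2)"
    by (rule poly_endpoint_bound) fact
  also have "integral {0..1} (\<lambda>r. (poly q r)\<^sup>2) \<le> integral {0..1} (\<lambda>r. (norm w)\<^sup>2 * h (x + l * r))"
  proof (rule integral_le)
    fix r :: real
    show "(poly q r)\<^sup>2 \<le> (norm w)\<^sup>2 * h (x + l * r)"
      unfolding q h_def using Cauchy_Schwarz_ineq[of "\<theta> (x + l * r)" w]
      by (simp add: power2_norm_eq_inner mult.commute)
  qed (intro integrable_continuous_real continuous_intros hl)+
  also have "\<dots> = (norm w)\<^sup>2 * integral {0..1} (\<lambda>r. h (x + l * r))" by simp
  also have "integral {0..1} (\<lambda>r. h (x + l * r)) = (LBINT r:{0..1}. h (x + l * r))"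
    by (rule set_borel_integral_eq_integral(2)[symmetric]) (rule borel_integrable_atLeastAtMost'[OF hl])
  also have "\<dots> \<le> 2 / (b - a) * (LBINT s:{a..b}. h s)"
  proof -
    have int: "integrable lborel (\<lambda>s. indicator {a..b} s * h s)"
      using borel_integrable_atLeastAtMost'[OF hcont, of a b] by (simp add: set_integrable_def)
    have "(LBINT s:{a..b}. h s) = \<bar>l\<bar> * (LINT r|lborel. indicator {a..b} (x + l * r) * h (x + l * r))"
      unfolding set_lebesgue_integral_def real_scaleR_def
      using lborel_integral_real_affine[OF l(2), of "\<lambda>s. indicator {a..b} s * h s" x]
      by (simp only: real_scaleR_def)
    moreover have "(LBINT r:{0..1}. h (x + l * r)) \<le> (LINT r|lborel. indicator {a..b} (x + l * r) * h (x + l * r))"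
      unfolding set_lebesgue_integral_def real_scaleR_def
    proof (rule integral_mono')
      show "integrable lborel (\<lambda>r. indicator {a..b} (x + l * r) * h (x + l * r))"
        using lborel_integrable_real_affine[OF int l(2), of x] by simp
      show "0 \<le> indicator {a..b} (x + l * r) * h (x + l * r)" for r using h0 by simp
      show "indicator {0..1} r * h (x + l * r) \<le> indicator {a..b} (x + l * r) * h (x + l * r)" for r
        using seg[of r] h0[of "x + l * r"] by (cases "r \<in> {0..1}") simp_all
    qed
    moreover have "(b - a) / 2 * (LBINT r:{0..1}. h (x + l * r)) \<le> \<bar>l\<bar> * (LINT r|lborel. indicator {a..b} (x + l * r) * h (x + l * r))"
      using calculation(2) l(1) assms(2) h0
      by (intro mult_mono) (auto simp: set_lebesgue_integral_def)
    ultimately show ?thesis using assms(2) by (simp add: field_simps)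
  qed
  finally have "(poly q 0)\<^sup>2 \<le> (real p + 1)\<^sup>2 * ((norm w)\<^sup>2 * (2 / (b - a) * (LBINT s:{a..b}. h s)))"
    by (simp add: mult_left_mono)
  moreover have "poly q 0 = (norm w)\<^sup>2" using q[of 0] by (simp add: w_def power2_norm_eq_inner)
  ultimately have le: "(norm w)\<^sup>2 * (norm w)\<^sup>2 \<le> (norm w)\<^sup>2 * (2 * (real p + 1)\<^sup>2 / (b - a) * (LBINT s:{a..b}. h s))"
    by (simp add: power2_eq_square mult_ac)
  have "0 \<le> 2 * (real p + 1)\<^sup>2 / (b - a) * (LBINT s:{a..b}. h s)"
    using assms(2) h0 by (intro mult_nonneg_nonneg) (auto simp: set_lebesgue_integral_def)
  then have "(norm w)\<^sup>2 \<le> 2 * (real p + 1)\<^sup>2 / (b - a) * (LBINT s:{a..b}. h s)"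
  proof (cases "w = 0")
    case False
    then have "(norm w)\<^sup>2 > 0" by simp
    then show ?thesis by (rule mult_left_le_imp_le[OF le])
  qed simp
  then show ?thesis by (simp add: w_def h_def)
qed

section \<open>Piecewise continuous functions of time\<close>

lemma LBINT_FTC:
  fixes F f :: "real \<Rightarrow> real"
  assumes "finite S" "a \<le> b" "continuous_on {a..b} F"
    "\<And>x. x \<in> {a<..<b} - S \<Longrightarrow> (F has_real_derivative f x) (at x)"
    "set_integrable lborel {a..b} f"
  shows "(LBINT s:{a..b}. f s) = F b - F a"
proof -
  have "(f has_integral (F b - F a)) {a..b}"
    using assms by (intro fundamental_theorem_of_calculus_interior_strong[of S])
      (simp_all add: has_real_derivative_iff_has_vector_derivative)
  then show ?thesis using set_borel_integral_eq_integral(2)[OF assms(5)] by (simp add: integral_unique)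
qed

lemma LBINT_combine:
  fixes f :: "real \<Rightarrow> real"
  assumes "set_integrable lborel {a..c} f" "a \<le> b" "b \<le> c"
  shows "(LBINT s:{a..c}. f s) = (LBINT s:{a..b}. f s) + (LBINT s:{b..c}. f s)"
proof -
  have "set_integrable lborel {a..b} f" "set_integrable lborel {b..c} f"
    by (rule set_integrable_subset[OF assms(1)]; use assms in auto)+
  then show ?thesis
    using set_borel_integral_eq_integral[OF assms(1)] assms
    by (simp add: set_borel_integral_eq_integral Henstock_Kurzweil_Integration.integral_combine)
qed

lemma set_integral_norm_le:
  fixes f :: "real \<Rightarrow> 'b::{banach, second_countable_topology}"
  assumes "A \<in> sets lborel" "emeasure lborel A < \<infinity>" "\<And>s. s \<in> A \<Longrightarrow> norm (f s) \<le> B" "B \<ge> 0"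
  shows "norm (LBINT s:A. f s) \<le> B * measure lborel A"
proof -
  have i: "integrable lborel (\<lambda>s. indicator A s * B)"
    using assms by (intro integrable_mult_left integrable_real_indicator) auto
  have "norm (LBINT s:A. f s) \<le> (LINT s|lborel. indicator A s * B)"
  proof (cases "integrable lborel (\<lambda>s. indicator A s *\<^sub>R f s)")
    case True
    then show ?thesis unfolding set_lebesgue_integral_def
    proof (rule Bochner_Integration.integral_norm_bound_integral[OF _ i])
      show "norm (indicator A s *\<^sub>R f s) \<le> indicator A s * B" for s
        using assms(3)[of s] by (cases "s \<in> A") simp_all
    qed
  next
    case False
    then show ?thesis
      using assms(4) by (simp add: set_lebesgue_integral_def not_integrable_integral_eq)
  qed
  also have "\<dots> = B * measure lborel A" by simp
  finally show ?thesis .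
qed

text \<open>The class is closed under the pointwise operations used later and its members are
  integrable on every subinterval of \<open>{0..T}\<close>, so integrability side conditions reduce
  to \<open>bm_intros\<close>. The bound concerns \<open>{0..T}\<close> only, because polynomials
  are unbounded on the line.\<close>

definition bm :: "real \<Rightarrow> (real \<Rightarrow> 'b::{real_normed_vector, second_countable_topology}) \<Rightarrow> bool"
  where "bm T f \<longleftrightarrow> f \<in> borel_measurable borel \<and> (\<exists>B. \<forall>s\<in>{0..T}. norm (f s) \<le> B)"

lemma bm_continuous: "continuous_on UNIV f \<Longrightarrow> bm T f"
  unfolding bm_def
proof
  assume c: "continuous_on UNIV f"
  then show "f \<in> borel_measurable borel" by (rule borel_measurable_continuous_onI)
  have "bounded (f ` {0..T})"
    by (intro compact_imp_bounded compact_continuous_image continuous_on_subset[OF c]) auto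
  then show "\<exists>B. \<forall>s\<in>{0..T}. norm (f s) \<le> B" unfolding bounded_iff by auto
qed

lemma bm_add: "bm T f \<Longrightarrow> bm T g \<Longrightarrow> bm T (\<lambda>s. f s + g s)"
  unfolding bm_def
proof (elim conjE exE, intro conjI)
  fix B C assume "\<forall>s\<in>{0..T}. norm (f s) \<le> B" "\<forall>s\<in>{0..T}. norm (g s) \<le> C"
  then show "\<exists>B. \<forall>s\<in>{0..T}. norm (f s + g s) \<le> B"
    by (intro exI[of _ "B + C"] ballI norm_triangle_le add_mono) auto
qed measurable

lemma bm_scaleR: "bm T f \<Longrightarrow> bm T g \<Longrightarrow> bm T (\<lambda>s. (f s :: real) *\<^sub>R g s)"
  unfolding bm_def
proof (elim conjE exE, intro conjI)
  fix B C assume B: "\<forall>s\<in>{0..T}. norm (f s) \<le> B" and C: "\<forall>s\<in>{0..T}. norm (g s) \<le> C"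
  have "norm (f s *\<^sub>R g s) \<le> B * C" if "s \<in> {0..T}" for s
  proof -
    have "norm (f s) \<le> B" "norm (g s) \<le> C" using B C that by auto
    then have "norm (f s) * norm (g s) \<le> B * C"
      by (rule mult_mono') simp_all
    then show ?thesis by simp
  qed
  then show "\<exists>B. \<forall>s\<in>{0..T}. norm (f s *\<^sub>R g s) \<le> B" by blast
qed measurable

lemma bm_inner:
  fixes f g :: "real \<Rightarrow> 'b::{real_inner, second_countable_topology}"
  shows "bm T f \<Longrightarrow> bm T g \<Longrightarrow> bm T (\<lambda>s. f s \<bullet> g s)"
  unfolding bm_def
proof (elim conjE exE, intro conjI)
  fix B C assume B: "\<forall>s\<in>{0..T}. norm (f s) \<le> B" and C: "\<forall>s\<in>{0..T}. norm (g s) \<le> C"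
  have "norm (f s \<bullet> g s) \<le> B * C" if "s \<in> {0..T}" for s
  proof -
    have "norm (f s) \<le> B" "norm (g s) \<le> C" using B C that by auto
    then have "norm (f s) * norm (g s) \<le> B * C"
      by (rule mult_mono') simp_all
    then show ?thesis using Cauchy_Schwarz_ineq2[of "f s" "g s"] by simp
  qed
  then show "\<exists>B. \<forall>s\<in>{0..T}. norm (f s \<bullet> g s) \<le> B" by blast
qed measurable

lemma bm_const: "bm T (\<lambda>s. c)"
  by (intro bm_continuous continuous_intros)

lemma bm_diff: "bm T f \<Longrightarrow> bm T g \<Longrightarrow> bm T (\<lambda>s. f s - g s)"
  using bm_add[OF _ bm_scaleR[OF bm_const[of T "-1"]], of f g] by simp

lemma bm_mult: "bm T f \<Longrightarrow> bm T g \<Longrightarrow> bm T (\<lambda>s. (f s :: real) * g s)"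
  using bm_scaleR[of T f g] by simp

lemma bm_norm: "bm T f \<Longrightarrow> bm T (\<lambda>s. norm (f s))"
  unfolding bm_def by auto

lemma bm_power2: "bm T f \<Longrightarrow> bm T (\<lambda>s. (f s :: real)\<^sup>2)"
  using bm_mult[of T f f] by (simp add: power2_eq_square)

lemmas bm_intros = bm_add bm_diff bm_scaleR bm_mult bm_inner bm_const bm_norm bm_power2

lemma bm_set_integrable:
  fixes f :: "real \<Rightarrow> 'b::{banach, second_countable_topology}"
  assumes "bm T f" "0 \<le> a" "b \<le> T"
  shows "set_integrable lborel {a..b} f"
proof -
  obtain B where B: "\<And>s. s \<in> {0..T} \<Longrightarrow> norm (f s) \<le> B" and [measurable]: "f \<in> borel_measurable borel"
    using assms(1) unfolding bm_def by blast
  have "integrable lborel (\<lambda>s. indicator {a..b} s * B)"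
    by (intro integrable_mult_left integrable_real_indicator) (auto simp: emeasure_lborel_Icc_eq)
  then show ?thesis unfolding set_integrable_def
  proof (rule Bochner_Integration.integrable_bound)
    show "AE s in lborel. norm (indicator {a..b} s *\<^sub>R f s) \<le> norm (indicator {a..b} s * B)"
    proof (rule AE_I2)
      fix s show "norm (indicator {a..b} s *\<^sub>R f s) \<le> norm (indicator {a..b} s * B)"
      proof (cases "s \<in> {a..b}")
        case True
        then have "norm (f s) \<le> B" using B[of s] assms by auto
        then show ?thesis using True by simp
      qed simp
    qed
  qed measurable
qed

lemma set_integral_mono_bm:
  fixes f g :: "real \<Rightarrow> real"
  assumes "bm T f" "bm T g" "0 \<le> a" "b \<le> T" "\<And>s. s \<in> {a..b} \<Longrightarrow> s \<notin> S \<Longrightarrow> f s \<le> g s" "finite S"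
  shows "(LBINT s:{a..b}. f s) \<le> (LBINT s:{a..b}. g s)"
proof -
  have "AE s in lborel. s \<notin> S"
    using AE_lborel_singleton by (intro AE_not_in finite_imp_null_set_lborel assms)
  then have "AE s in lborel. indicator {a..b} s *\<^sub>R f s \<le> indicator {a..b} s *\<^sub>R g s"
    by eventually_elim (use assms(5) in \<open>simp add: indicator_def\<close>)
  then show ?thesis
    unfolding set_lebesgue_integral_def
    using bm_set_integrable[OF assms(1,3,4)] bm_set_integrable[OF assms(2,3,4)]
    unfolding set_integrable_def by (intro integral_mono_AE)
qed

text \<open>Vanishing off \<open>{0<..<T}\<close> lets every convolution run over
  \<open>{..t}\<close> with no lower limit and makes the primitives below vanish for t \<le> 0. The
  finite exceptional set accommodates jumps at mesh points.\<close>

definition pw :: "real \<Rightarrow> (real \<Rightarrow> 'b::{real_normed_vector, second_countable_topology}) \<Rightarrow> bool"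
  where "pw T v \<longleftrightarrow> (\<exists>S. finite S \<and> (\<forall>s. s \<notin> S \<longrightarrow> isCont v s)) \<and>
    (\<exists>B. \<forall>s. norm (v s) \<le> B) \<and> (\<forall>s. s \<notin> {0<..<T} \<longrightarrow> v s = 0)"

lemma pw_borel:
  assumes "pw T v" shows "v \<in> borel_measurable borel"
proof -
  obtain S where S: "finite S" "\<And>s. s \<notin> S \<Longrightarrow> isCont v s" using assms unfolding pw_def by blast
  then have "continuous_on (- S) v" by (auto intro!: continuous_at_imp_continuous_on)
  then show ?thesis by (rule borel_measurable_continuous_countable_exceptions[OF countable_finite[OF S(1)]])
qed

lemma pw_bm: "pw T v \<Longrightarrow> bm T' v"
  using pw_borel[of T v] unfolding bm_def pw_def by blast

lemma pw_continuous_mult: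
  assumes g: "continuous_on UNIV (g :: real \<Rightarrow> real)" and v: "pw T v"
  shows "pw T (\<lambda>s. g s *\<^sub>R v s)"
proof -
  obtain S B where S: "finite S" "\<And>s. s \<notin> S \<Longrightarrow> isCont v s" and B: "\<And>s. norm (v s) \<le> B"
    and 0: "\<And>s. s \<notin> {0<..<T} \<Longrightarrow> v s = 0"
    using v unfolding pw_def by blast
  obtain C where C: "\<And>s. s \<in> {0..T} \<Longrightarrow> norm (g s) \<le> C"
    using bm_continuous[OF g, of T] unfolding bm_def by blast
  have "norm (g s *\<^sub>R v s) \<le> max 0 (C * B)" for s
  proof (cases "s \<in> {0<..<T}")
    case True
    then have "norm (g s) \<le> C" using C[of s] by simp
    then have "norm (g s) * norm (v s) \<le> C * B"
      using B[of s] by (rule mult_mono') simp_all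
    then show ?thesis by simp
  qed (simp add: 0)
  moreover have "isCont (\<lambda>s. g s *\<^sub>R v s) s" if "s \<notin> S" for s
    using S(2)[OF that] g by (intro continuous_scaleR) (simp_all add: continuous_on_eq_continuous_at)
  ultimately show ?thesis unfolding pw_def using S(1) 0 by (metis scaleR_zero_right)
qed

lemma pw_integrable:
  fixes v :: "real \<Rightarrow> 'b::{banach, second_countable_topology}"
  assumes "pw T v" shows "integrable lborel v"
proof -
  have "set_integrable lborel {0..T} v" by (rule bm_set_integrable[OF pw_bm[OF assms]]) auto
  moreover have "indicator {0..T} s *\<^sub>R v s = v s" for s
    using assms by (cases "s \<in> {0..T}") (auto simp: pw_def)
  ultimately show ?thesis by (simp add: set_integrable_def)
qed

section \<open>Primitives of piecewise continuous functions\<close>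

definition cum :: "(real \<Rightarrow> 'b::{banach, second_countable_topology}) \<Rightarrow> real \<Rightarrow> 'b"
  where "cum v t = (LBINT s:{..t}. v s)"

lemma cum_diff:
  assumes "integrable lborel v" "a \<le> b"
  shows "cum v b - cum v a = (LBINT s:{a<..b}. v s)"
proof -
  have i: "set_integrable lborel A v" if "A \<in> sets borel" for A
    using assms(1) that unfolding set_integrable_def by (intro integrable_mult_indicator) simp_all
  have "{..b} = {..a} \<union> {a<..b}" using assms(2) by auto
  then have "cum v b = cum v a + (LBINT s:{a<..b}. v s)"
    unfolding cum_def by (simp only:) (intro set_integral_Un i; auto)
  then show ?thesis by simp
qed

lemma cum_nonpos: "pw T v \<Longrightarrow> t \<le> 0 \<Longrightarrow> cum v t = 0"
proof -
  assume "pw T v" "t \<le> 0"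
  then have "(\<lambda>s. indicator {..t} s *\<^sub>R v s) = (\<lambda>s. 0)" by (auto simp: pw_def indicator_def fun_eq_iff)
  then show "cum v t = 0" unfolding cum_def set_lebesgue_integral_def by simp
qed

text \<open>One estimate with two uses: \<open>c = 0\<close> gives Lipschitz continuity of the
  primitive, and \<open>c = v t\<close> with small \<open>e\<close> gives its derivative at a point
  of continuity.\<close>

lemma cum_lipschitz:
  assumes "integrable lborel v" "a \<le> b" "\<And>s. s \<in> {a<..b} \<Longrightarrow> norm (v s - c) \<le> e" "e \<ge> 0"
  shows "norm (cum v b - cum v a - (b - a) *\<^sub>R c) \<le> e * (b - a)"
proof -
  have i: "set_integrable lborel {a<..b} v"
    using assms(1) unfolding set_integrable_def by (intro integrable_mult_indicator) simp_all
  have ic: "set_integrable lborel {a<..b} (\<lambda>s. c)"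
    unfolding set_integrable_def using assms(2)
    by (intro integrable_scaleR_left integrable_real_indicator) auto
  have "(LBINT s:{a<..b}. c) = (b - a) *\<^sub>R c"
    using assms(2) by (simp add: set_lebesgue_integral_def)
  then have "cum v b - cum v a - (b - a) *\<^sub>R c = (LBINT s:{a<..b}. v s - c)"
    using set_integral_diff(2)[OF i ic] cum_diff[OF assms(1,2)] by simp
  also have "norm \<dots> \<le> e * measure lborel {a<..b}"
    by (rule set_integral_norm_le) (use assms in auto)
  finally show ?thesis using assms(2) by simp
qed

lemma continuous_cum:
  assumes "pw T v" shows "continuous_on UNIV (cum v)"
proof -
  obtain B where B: "\<And>s. norm (v s) \<le> B" using assms unfolding pw_def by blast
  have B0: "B \<ge> 0" using B[of 0] norm_ge_zero order_trans by blast
  have "norm (cum v b - cum v a) \<le> B * \<bar>b - a\<bar>" for a b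
    using cum_lipschitz[OF pw_integrable[OF assms], of a b 0 B]
      cum_lipschitz[OF pw_integrable[OF assms], of b a 0 B] B B0
    by (cases "a \<le> b") (simp_all add: norm_minus_commute)
  then have "B-lipschitz_on UNIV (cum v)"
    by (intro lipschitz_onI B0) (simp add: dist_norm)
  then show ?thesis by (rule lipschitz_on_continuous_on)
qed

lemma cum_has_vector_derivative:
  assumes "integrable lborel v" "isCont v t"
  shows "(cum v has_vector_derivative v t) (at t)"
  unfolding has_vector_derivative_def has_derivative_at_alt
proof (intro conjI allI impI)
  show "bounded_linear (\<lambda>x. x *\<^sub>R v t)" by (rule bounded_linear_scaleR_left)
  fix e :: real assume "e > 0"
  then obtain d where d: "d > 0" "\<And>s. dist s t < d \<Longrightarrow> dist (v s) (v t) < e"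
    using assms(2) unfolding continuous_at_eps_delta by blast
  show "\<exists>d>0. \<forall>y. norm (y - t) < d \<longrightarrow> norm (cum v y - cum v t - (y - t) *\<^sub>R v t) \<le> e * norm (y - t)"
  proof (intro exI[of _ d] conjI allI impI d(1))
    fix y assume y: "norm (y - t) < d"
    have near: "norm (v s - v t) \<le> e" if "s \<in> {min y t<..max y t}" for s
    proof -
      have "dist s t < d" using that y by (auto simp: dist_real_def)
      then show ?thesis using d(2)[of s] by (simp add: dist_norm)
    qed
    show "norm (cum v y - cum v t - (y - t) *\<^sub>R v t) \<le> e * norm (y - t)"
    proof (cases "t \<le> y")
      case True
      then show ?thesis
        using cum_lipschitz[OF assms(1) True, of "v t" e] near \<open>e > 0\<close> by (simp add: min_def max_def split: if_splits)
    next
      case False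
      then have "norm (cum v t - cum v y - (t - y) *\<^sub>R v t) \<le> e * (t - y)"
        using near \<open>e > 0\<close> by (intro cum_lipschitz[OF assms(1)]) (simp_all add: min_def max_def)
      moreover have "cum v y - cum v t - (y - t) *\<^sub>R v t = - (cum v t - cum v y - (t - y) *\<^sub>R v t)"
        by (simp add: scaleR_left_diff_distrib)
      ultimately show ?thesis using False by (simp only: norm_minus_cancel) simp
    qed
  qed
qed

section \<open>Exponential kernels\<close>

lemma LBINT_Ioc:
  fixes f :: "real \<Rightarrow> 'b::{banach, second_countable_topology}"
  shows "(LBINT s:{a<..b}. f s) = (LBINT s:{a..b}. f s)"
  unfolding set_lebesgue_integral_def
  by (rule integral_discrete_difference[of "{a}"]) (auto simp: indicator_def)

lemma has_real_derivative_inner: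
  assumes "(F has_vector_derivative F') (at x)" "(G has_vector_derivative G') (at x)"
  shows "((\<lambda>t. F t \<bullet> G t) has_real_derivative (F x \<bullet> G' + F' \<bullet> G x)) (at x)"
  unfolding has_real_derivative_iff_has_vector_derivative
  by (rule bounded_bilinear.has_vector_derivative[OF bounded_bilinear_inner assms])

lemma power2_norm_add_scaleR:
  fixes x y :: "'b::real_inner"
  shows "(norm (x + c *\<^sub>R y))\<^sup>2 = (norm x)\<^sup>2 + 2 * c * (x \<bullet> y) + c\<^sup>2 * (norm y)\<^sup>2"
  unfolding power2_norm_eq_inner inner_add_left inner_add_right inner_scaleR_left inner_scaleR_right
    inner_commute[of y x] by (simp add: power2_eq_square distrib_left)

lemma LBINT_exp:
  fixes l a b :: real
  assumes "l > 0" "a \<le> b"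
  shows "(LBINT s:{a..b}. exp (- l * (b - s))) = (1 - exp (- l * (b - a))) / l"
proof -
  have "(LBINT s:{a..b}. exp (- l * (b - s))) = exp (- l * (b - b)) / l - exp (- l * (b - a)) / l"
  proof (rule LBINT_FTC[of "{}"])
    show "((\<lambda>s. exp (- l * (b - s)) / l) has_real_derivative exp (- l * (b - s))) (at s)" for s
      by (rule derivative_eq_intros refl | use assms in simp)+
    show "set_integrable lborel {a..b} (\<lambda>s. exp (- l * (b - s)))"
      by (intro borel_integrable_atLeastAtMost' continuous_intros)
  qed (use assms in \<open>auto intro!: continuous_intros\<close>)
  then show ?thesis by (simp add: diff_divide_distrib)
qed

text \<open>The solution y of y' + l y = v that vanishes for t \<le> 0, that is 1/(D + l) applied to
  v. The factor exp(-l t) is pulled out of the integral so that continuity and derivative follow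
  from those of \<open>cum\<close>; \<open>conv_exp_eq\<close> is the convolution form.\<close>

definition conv_exp :: "real \<Rightarrow> (real \<Rightarrow> 'b::{banach, second_countable_topology}) \<Rightarrow> real \<Rightarrow> 'b"
  where "conv_exp l v t = exp (- l * t) *\<^sub>R cum (\<lambda>s. exp (l * s) *\<^sub>R v s) t"

text \<open>This is 1/(D + l)^2 applied to v. Its kernel r exp(-l r), with r = t - s, is expanded so
  that only primitives of functions independent of t occur.\<close>

definition conv_texp :: "real \<Rightarrow> (real \<Rightarrow> 'b::{banach, second_countable_topology}) \<Rightarrow> real \<Rightarrow> 'b"
  where "conv_texp l v t = exp (- l * t) *\<^sub>R
    (t *\<^sub>R cum (\<lambda>s. exp (l * s) *\<^sub>R v s) t - cum (\<lambda>s. (s * exp (l * s)) *\<^sub>R v s) t)"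

text \<open>The adjoint resolvent 1/(-D + l), run backwards from the value 0 at \<tau>.\<close>

definition backward_exp :: "real \<Rightarrow> real \<Rightarrow> (real \<Rightarrow> 'b::{banach, second_countable_topology}) \<Rightarrow> real \<Rightarrow> 'b"
  where "backward_exp l \<tau> v t = exp (l * t) *\<^sub>R
    (cum (\<lambda>s. exp (- l * s) *\<^sub>R v s) \<tau> - cum (\<lambda>s. exp (- l * s) *\<^sub>R v s) t)"

lemma pw_exp: "pw T v \<Longrightarrow> pw T (\<lambda>s. exp (c * s) *\<^sub>R v s)"
  by (intro pw_continuous_mult continuous_intros)

lemma pw_texp: "pw T v \<Longrightarrow> pw T (\<lambda>s. (s * exp (c * s)) *\<^sub>R v s)"
  by (intro pw_continuous_mult continuous_intros)

lemma conv_exp_eq: "conv_exp l v t = (LBINT s:{..t}. exp (- l * (t - s)) *\<^sub>R v s)"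
proof -
  have "conv_exp l v t = (LBINT s:{..t}. exp (- l * t) *\<^sub>R exp (l * s) *\<^sub>R v s)"
    unfolding conv_exp_def cum_def by (rule set_integral_scaleR_right[symmetric])
  also have "(\<lambda>s. exp (- l * t) *\<^sub>R exp (l * s) *\<^sub>R v s) = (\<lambda>s. exp (- l * (t - s)) *\<^sub>R v s)"
    by (simp add: fun_eq_iff algebra_simps flip: exp_add)
  finally show ?thesis .
qed

lemma set_integrable_pw:
  fixes v :: "real \<Rightarrow> 'b::{banach, second_countable_topology}"
  assumes "pw T v" "A \<in> sets borel" shows "set_integrable lborel A v"
  using pw_integrable[OF assms(1)] assms(2) unfolding set_integrable_def
  by (intro integrable_mult_indicator) simp_all

lemma conv_texp_eq:
  assumes "pw T v"
  shows "conv_texp l v t = (LBINT s:{..t}. ((t - s) * exp (- l * (t - s))) *\<^sub>R v s)"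
proof -
  have "conv_texp l v t = exp (- l * t) *\<^sub>R (LBINT s:{..t}. t *\<^sub>R exp (l * s) *\<^sub>R v s - (s * exp (l * s)) *\<^sub>R v s)"
    unfolding conv_texp_def cum_def
    using set_integral_diff(2)[OF set_integrable_pw[OF pw_continuous_mult[OF _ pw_exp[OF assms, of l], of "\<lambda>s. t"]]
        set_integrable_pw[OF pw_texp[OF assms, of l]], of "{..t}"]
    by (simp add: set_integral_scaleR_right continuous_on_const del: scaleR_scaleR)
  also have "\<dots> = (LBINT s:{..t}. exp (- l * t) *\<^sub>R (t *\<^sub>R exp (l * s) *\<^sub>R v s - (s * exp (l * s)) *\<^sub>R v s))"
    by (rule set_integral_scaleR_right[symmetric])
  also have "(\<lambda>s. exp (- l * t) *\<^sub>R (t *\<^sub>R exp (l * s) *\<^sub>R v s - (s * exp (l * s)) *\<^sub>R v s))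
      = (\<lambda>s. ((t - s) * exp (- l * (t - s))) *\<^sub>R v s)"
  proof
    fix s
    have "exp (- l * (t - s)) = exp (- l * t) * exp (l * s)"
      by (simp add: algebra_simps flip: exp_add)
    then show "exp (- l * t) *\<^sub>R (t *\<^sub>R exp (l * s) *\<^sub>R v s - (s * exp (l * s)) *\<^sub>R v s)
        = ((t - s) * exp (- l * (t - s))) *\<^sub>R v s"
      by (simp only: scaleR_right_diff_distrib scaleR_scaleR flip: scaleR_left_diff_distrib) (simp add: algebra_simps)
  qed
  finally show ?thesis .
qed

lemma continuous_conv_exp: "pw T v \<Longrightarrow> continuous_on UNIV (conv_exp l v)"
  unfolding conv_exp_def[abs_def] by (intro continuous_intros continuous_cum[OF pw_exp])

lemma continuous_conv_texp: "pw T v \<Longrightarrow> continuous_on UNIV (conv_texp l v)"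
  unfolding conv_texp_def[abs_def] by (intro continuous_intros continuous_cum[OF pw_exp] continuous_cum[OF pw_texp])

lemma continuous_backward_exp: "pw T v \<Longrightarrow> continuous_on UNIV (backward_exp l \<tau> v)"
  unfolding backward_exp_def[abs_def] by (intro continuous_intros continuous_cum[OF pw_exp])

lemma conv_exp_0: "pw T v \<Longrightarrow> t \<le> 0 \<Longrightarrow> conv_exp l v t = 0"
  by (simp add: conv_exp_def cum_nonpos[OF pw_exp])

lemma conv_texp_0: "pw T v \<Longrightarrow> t \<le> 0 \<Longrightarrow> conv_texp l v t = 0"
  by (simp add: conv_texp_def cum_nonpos[OF pw_exp] cum_nonpos[OF pw_texp])

lemma cum_weight_derivative:
  assumes "pw T (\<lambda>s. g s *\<^sub>R v s)" "isCont v t" "isCont g t"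
  shows "(cum (\<lambda>s. (g s :: real) *\<^sub>R v s) has_vector_derivative g t *\<^sub>R v t) (at t)"
  using assms by (intro cum_has_vector_derivative pw_integrable continuous_scaleR)

lemma exp_deriv: "((\<lambda>t. exp (c * t)) has_real_derivative c * exp (c * t)) (at t)" for c :: real
  by (auto intro!: derivative_eq_intros)

lemma conv_exp_derivative:
  assumes "pw T v" "isCont v t"
  shows "(conv_exp l v has_vector_derivative v t - l *\<^sub>R conv_exp l v t) (at t)"
proof -
  have "(cum (\<lambda>s. exp (l * s) *\<^sub>R v s) has_vector_derivative exp (l * t) *\<^sub>R v t) (at t)"
    by (rule cum_weight_derivative[OF pw_exp[OF assms(1)] assms(2)]) (intro continuous_intros)
  from has_vector_derivative_scaleR[OF exp_deriv[of "- l" t] this]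
  have "(conv_exp l v has_vector_derivative exp (- l * t) *\<^sub>R exp (l * t) *\<^sub>R v t
      + (- l * exp (- l * t)) *\<^sub>R cum (\<lambda>s. exp (l * s) *\<^sub>R v s) t) (at t)"
    unfolding conv_exp_def[abs_def] .
  moreover have "exp (- l * t) *\<^sub>R exp (l * t) *\<^sub>R v t = v t"
    by (simp flip: exp_add)
  ultimately show ?thesis by (simp add: conv_exp_def)
qed

lemma conv_texp_derivative:
  assumes "pw T v" "isCont v t"
  shows "(conv_texp l v has_vector_derivative conv_exp l v t - l *\<^sub>R conv_texp l v t) (at t)"
proof -
  let ?c = "cum (\<lambda>s. exp (l * s) *\<^sub>R v s)" and ?d = "cum (\<lambda>s. (s * exp (l * s)) *\<^sub>R v s)"
  have c: "(?c has_vector_derivative exp (l * t) *\<^sub>R v t) (at t)"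
    by (rule cum_weight_derivative[OF pw_exp[OF assms(1)] assms(2)]) (intro continuous_intros)
  have d: "(?d has_vector_derivative (t * exp (l * t)) *\<^sub>R v t) (at t)"
    by (rule cum_weight_derivative[OF pw_texp[OF assms(1)] assms(2)]) (intro continuous_intros)
  have "((\<lambda>t. t *\<^sub>R ?c t - ?d t) has_vector_derivative
      (t *\<^sub>R exp (l * t) *\<^sub>R v t + 1 *\<^sub>R ?c t - (t * exp (l * t)) *\<^sub>R v t)) (at t)"
    by (intro has_vector_derivative_diff has_vector_derivative_scaleR c d DERIV_ident)
  then have "((\<lambda>t. t *\<^sub>R ?c t - ?d t) has_vector_derivative ?c t) (at t)" by simp
  from has_vector_derivative_scaleR[OF exp_deriv[of "- l" t] this]
  show ?thesis unfolding conv_texp_def[abs_def] conv_exp_def by simp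
qed

lemma backward_exp_derivative:
  assumes "pw T v" "isCont v t"
  shows "(backward_exp l \<tau> v has_vector_derivative l *\<^sub>R backward_exp l \<tau> v t - v t) (at t)"
proof -
  let ?c = "cum (\<lambda>s. exp (- l * s) *\<^sub>R v s)"
  have c: "(?c has_vector_derivative exp (- l * t) *\<^sub>R v t) (at t)"
    by (rule cum_weight_derivative[OF pw_exp[OF assms(1)] assms(2)]) (intro continuous_intros)
  have "((\<lambda>t. ?c \<tau> - ?c t) has_vector_derivative 0 - exp (- l * t) *\<^sub>R v t) (at t)"
    by (intro has_vector_derivative_diff has_vector_derivative_const c)
  from has_vector_derivative_scaleR[OF exp_deriv[of l t] this]
  have "(backward_exp l \<tau> v has_vector_derivative exp (l * t) *\<^sub>R (0 - exp (- l * t) *\<^sub>R v t)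
      + (l * exp (l * t)) *\<^sub>R (?c \<tau> - ?c t)) (at t)"
    unfolding backward_exp_def[abs_def] .
  moreover have "exp (l * t) *\<^sub>R (0 - exp (- l * t) *\<^sub>R v t) = - v t"
    by (simp flip: exp_add)
  ultimately show ?thesis by (simp add: backward_exp_def)
qed

lemma pw_exceptional_set:
  assumes "pw T v" obtains S where "finite S" "\<And>s. s \<notin> S \<Longrightarrow> isCont v s"
  using assms unfolding pw_def by blast

lemma LBINT_bm_add:
  fixes f g :: "real \<Rightarrow> real"
  assumes "bm \<tau> f" "bm \<tau> g" "0 \<le> a" "b \<le> \<tau>"
  shows "(LBINT s:{a..b}. f s + g s) = (LBINT s:{a..b}. f s) + (LBINT s:{a..b}. g s)"
  by (rule set_integral_add(2)[OF bm_set_integrable[OF assms(1,3,4)] bm_set_integrable[OF assms(2,3,4)]])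

text \<open>Integration by parts against the solution \<open>z\<close> of \<open>-z' + l z = \<theta>\<close>, \<open>z(\<tau>) = 0\<close>: it moves one
  factor \<open>D/(D + l)\<close> from the first argument onto \<open>\<theta>\<close>.\<close>

lemma backward_pairing:
  fixes F \<theta> :: "real \<Rightarrow> 'b::{real_inner, banach, second_countable_topology}"
  assumes \<theta>: "pw \<tau> \<theta>" and \<tau>: "0 \<le> \<tau>" and F: "continuous_on UNIV F" "F 0 = 0"
    and F1: "finite S" "\<And>t. t \<notin> S \<Longrightarrow> (F has_vector_derivative F1 t) (at t)" "bm \<tau> F1"
  shows "(LBINT s:{0..\<tau>}. F1 s \<bullet> \<theta> s)
    = - (LBINT s:{0..\<tau>}. (F1 s + l *\<^sub>R F s) \<bullet> (l *\<^sub>R backward_exp l \<tau> \<theta> s - \<theta> s))"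
proof -
  define z where "z = backward_exp l \<tau> \<theta>"
  define z1 where "z1 s = l *\<^sub>R z s - \<theta> s" for s
  obtain S' where S': "finite S'" "\<And>s. s \<notin> S' \<Longrightarrow> isCont \<theta> s" by (rule pw_exceptional_set[OF \<theta>]) (rule that)
  have zc: "continuous_on UNIV z" unfolding z_def by (rule continuous_backward_exp[OF \<theta>])
  have bz: "bm \<tau> z" by (rule bm_continuous[OF zc])
  have b\<theta>: "bm \<tau> \<theta>" by (rule pw_bm[OF \<theta>])
  have bz1: "bm \<tau> z1" unfolding z1_def by (intro bm_intros bz b\<theta>)
  have bF: "bm \<tau> F" by (rule bm_continuous[OF F(1)])
  \<comment> \<open>Both boundary terms will vanish: at 0 because F 0 = 0, at \<tau> because z
    \<tau> = 0.\<close>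
  have "(LBINT s:{0..\<tau>}. F s \<bullet> z1 s + F1 s \<bullet> z s) = F \<tau> \<bullet> z \<tau> - F 0 \<bullet> z 0"
  proof (rule LBINT_FTC[of "S \<union> S'"])
    show "continuous_on {0..\<tau>} (\<lambda>s. F s \<bullet> z s)"
      by (intro continuous_intros continuous_on_subset[OF F(1)] continuous_on_subset[OF zc]) auto
    show "((\<lambda>s. F s \<bullet> z s) has_real_derivative F x \<bullet> z1 x + F1 x \<bullet> z x) (at x)"
      if "x \<in> {0<..<\<tau>} - (S \<union> S')" for x
      using that backward_exp_derivative[OF \<theta> S'(2), of x l \<tau>]
      by (intro has_real_derivative_inner F1) (auto simp: z_def z1_def)
    show "set_integrable lborel {0..\<tau>} (\<lambda>s. F s \<bullet> z1 s + F1 s \<bullet> z s)"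
      by (rule bm_set_integrable[of \<tau>]) (intro bm_intros bF bz1 bz F1 order_refl)+
  qed (use \<tau> F1 S' in auto)
  also have "\<dots> = 0" using F(2) by (simp add: z_def backward_exp_def)
  finally have "(LBINT s:{0..\<tau>}. l * (F s \<bullet> z1 s + F1 s \<bullet> z s)) = 0" by simp
  moreover have "l * (F s \<bullet> z1 s + F1 s \<bullet> z s) = F1 s \<bullet> \<theta> s + (F1 s + l *\<^sub>R F s) \<bullet> z1 s" for s
  proof -
    have "F1 s \<bullet> \<theta> s = l * (F1 s \<bullet> z s) - F1 s \<bullet> z1 s"
      by (simp add: z1_def inner_diff_right)
    then show ?thesis by (simp add: inner_add_left distrib_left)
  qed
  ultimately have "(LBINT s:{0..\<tau>}. F1 s \<bullet> \<theta> s + (F1 s + l *\<^sub>R F s) \<bullet> z1 s) = 0"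
    by (simp only:)
  moreover have "(LBINT s:{0..\<tau>}. F1 s \<bullet> \<theta> s + (F1 s + l *\<^sub>R F s) \<bullet> z1 s)
      = (LBINT s:{0..\<tau>}. F1 s \<bullet> \<theta> s) + (LBINT s:{0..\<tau>}. (F1 s + l *\<^sub>R F s) \<bullet> z1 s)"
    by (rule LBINT_bm_add[of \<tau>]) (intro bm_intros F1 b\<theta> bF bz1 order_refl)+
  ultimately have "(LBINT s:{0..\<tau>}. F1 s \<bullet> \<theta> s) + (LBINT s:{0..\<tau>}. (F1 s + l *\<^sub>R F s) \<bullet> z1 s) = 0"
    by linarith
  then show ?thesis unfolding z1_def z_def by linarith
qed

text \<open>Here z1 is the derivative of z = \<open>backward_exp l \<tau> \<theta>\<close>, and
  \<theta> = l z - z1. First claim: pairing D/(D + l) \<theta> with \<theta> equals minus the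
  pairing of \<theta> with z1, which is the square integral of z1 plus l/2 times the squared norm of
  z 0. Second claim: z vanishes at \<tau>, so its square integral is at most 4 \<tau>^2 times that
  of z1; for l \<tau> \<le> 1 this gives the constant 10 = 2 * 4 + 2.\<close>

lemma backward_energy:
  fixes \<theta> :: "real \<Rightarrow> 'b::{real_inner, banach, second_countable_topology}"
  assumes \<theta>: "pw \<tau> \<theta>" and \<tau>: "0 \<le> \<tau>" and l: "l > 0"
  defines "z1 \<equiv> \<lambda>s. l *\<^sub>R backward_exp l \<tau> \<theta> s - \<theta> s"
  shows "(LBINT s:{0..\<tau>}. (norm (z1 s))\<^sup>2) \<le> (LBINT s:{0..\<tau>}. (\<theta> s - l *\<^sub>R conv_exp l \<theta> s) \<bullet> \<theta> s)"
    and "l * \<tau> \<le> 1 \<Longrightarrow> (LBINT s:{0..\<tau>}. (norm (\<theta> s))\<^sup>2) \<le> 10 * (LBINT s:{0..\<tau>}. (norm (z1 s))\<^sup>2)"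
proof -
  define z where "z = backward_exp l \<tau> \<theta>"
  have z1: "z1 s = l *\<^sub>R z s - \<theta> s" for s by (simp add: z1_def z_def)
  obtain S where S: "finite S" "\<And>s. s \<notin> S \<Longrightarrow> isCont \<theta> s" by (rule pw_exceptional_set[OF \<theta>]) (rule that)
  have zc: "continuous_on UNIV z" unfolding z_def by (rule continuous_backward_exp[OF \<theta>])
  have zcI: "continuous_on {0..\<tau>} z" by (rule continuous_on_subset[OF zc]) simp
  have bz: "bm \<tau> z" by (rule bm_continuous[OF zc])
  have b\<theta>: "bm \<tau> \<theta>" by (rule pw_bm[OF \<theta>])
  have bz1: "bm \<tau> z1"
    unfolding z1_def by (intro bm_intros bm_continuous[OF continuous_backward_exp[OF \<theta>]] b\<theta>)
  have zd: "(z has_vector_derivative z1 x) (at x)" if "x \<notin> S" for x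
    using backward_exp_derivative[OF \<theta> S(2)[OF that], of l \<tau>] by (simp add: z_def z1_def)
  have z\<tau>: "z \<tau> = 0" by (simp add: z_def backward_exp_def)
  have y: "continuous_on UNIV (conv_exp l \<theta>)" by (rule continuous_conv_exp[OF \<theta>])
  have zz: "(LBINT s:{0..\<tau>}. z s \<bullet> z1 s + z1 s \<bullet> z s) = z \<tau> \<bullet> z \<tau> - z 0 \<bullet> z 0"
  proof (rule LBINT_FTC[of S])
    show "continuous_on {0..\<tau>} (\<lambda>s. z s \<bullet> z s)" by (intro continuous_intros zcI)
    show "((\<lambda>s. z s \<bullet> z s) has_real_derivative z x \<bullet> z1 x + z1 x \<bullet> z x) (at x)"
      if "x \<in> {0<..<\<tau>} - S" for x using that by (intro has_real_derivative_inner zd) auto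
    show "set_integrable lborel {0..\<tau>} (\<lambda>s. z s \<bullet> z1 s + z1 s \<bullet> z s)"
      by (rule bm_set_integrable[of \<tau>]) (intro bm_intros bz1 bz order_refl)+
  qed (use \<tau> S in auto)
  have "(LBINT s:{0..\<tau>}. (\<theta> s - l *\<^sub>R conv_exp l \<theta> s) \<bullet> \<theta> s)
      = - (LBINT s:{0..\<tau>}. (\<theta> s - l *\<^sub>R conv_exp l \<theta> s + l *\<^sub>R conv_exp l \<theta> s) \<bullet> z1 s)"
    unfolding z1_def
    by (rule backward_pairing[OF \<theta> \<tau> y conv_exp_0[OF \<theta>] S(1) conv_exp_derivative[OF \<theta> S(2)]])
       (auto intro!: bm_intros b\<theta> bm_continuous[OF y])
  also have "\<dots> = (LBINT s:{0..\<tau>}. - (\<theta> s \<bullet> z1 s))" by (simp add: set_lebesgue_integral_def)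
  finally have S1: "(LBINT s:{0..\<tau>}. (\<theta> s - l *\<^sub>R conv_exp l \<theta> s) \<bullet> \<theta> s) = (LBINT s:{0..\<tau>}. - (\<theta> s \<bullet> z1 s))" .
  have pt: "- (\<theta> s \<bullet> z1 s) = (norm (z1 s))\<^sup>2 + (- l / 2) * (z s \<bullet> z1 s + z1 s \<bullet> z s)" for s
  proof -
    have \<theta>s: "\<theta> s = l *\<^sub>R z s - z1 s" by (simp add: z1)
    have "\<theta> s \<bullet> z1 s = l * (z s \<bullet> z1 s) - z1 s \<bullet> z1 s"
      by (subst \<theta>s) (simp only: inner_diff_left inner_scaleR_left)
    moreover have "z1 s \<bullet> z s = z s \<bullet> z1 s" by (rule inner_commute)
    ultimately show "- (\<theta> s \<bullet> z1 s) = (norm (z1 s))\<^sup>2 + (- l / 2) * (z s \<bullet> z1 s + z1 s \<bullet> z s)"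
      by (simp only: power2_norm_eq_inner) simp
  qed
  note S1[unfolded pt]
  also have "(LBINT s:{0..\<tau>}. (norm (z1 s))\<^sup>2 + (- l / 2) * (z s \<bullet> z1 s + z1 s \<bullet> z s))
      = (LBINT s:{0..\<tau>}. (norm (z1 s))\<^sup>2) + (LBINT s:{0..\<tau>}. (- l / 2) * (z s \<bullet> z1 s + z1 s \<bullet> z s))"
    by (rule LBINT_bm_add[of \<tau>]) (intro bm_intros bz bz1 order_refl)+
  also have "\<dots> = (LBINT s:{0..\<tau>}. (norm (z1 s))\<^sup>2) + l / 2 * (z 0 \<bullet> z 0)"
    unfolding set_integral_mult_right zz by (simp add: z\<tau>)
  finally show "(LBINT s:{0..\<tau>}. (norm (z1 s))\<^sup>2) \<le> (LBINT s:{0..\<tau>}. (\<theta> s - l *\<^sub>R conv_exp l \<theta> s) \<bullet> \<theta> s)"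
    using l by simp
  assume lt: "l * \<tau> \<le> 1"
  \<comment> \<open>The weight s removes the uncontrolled boundary term at 0, and z \<tau> = 0
    removes the one at \<tau>.\<close>
  have "(LBINT s:{0..\<tau>}. s * (z s \<bullet> z1 s + z1 s \<bullet> z s) + 1 * (z s \<bullet> z s)) = \<tau> * (z \<tau> \<bullet> z \<tau>) - 0 * (z 0 \<bullet> z 0)"
  proof (rule LBINT_FTC[of S])
    show "continuous_on {0..\<tau>} (\<lambda>s. s * (z s \<bullet> z s))" by (intro continuous_intros zcI)
    show "((\<lambda>s. s * (z s \<bullet> z s)) has_real_derivative x * (z x \<bullet> z1 x + z1 x \<bullet> z x) + 1 * (z x \<bullet> z x)) (at x)"
      if "x \<in> {0<..<\<tau>} - S" for x
      using that by (intro DERIV_mult' DERIV_ident has_real_derivative_inner zd) auto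
    show "set_integrable lborel {0..\<tau>} (\<lambda>s. s * (z s \<bullet> z1 s + z1 s \<bullet> z s) + 1 * (z s \<bullet> z s))"
      by (rule bm_set_integrable[of \<tau>]) (intro bm_intros bz1 bz order_refl bm_continuous[OF continuous_on_id])+
  qed (use \<tau> S in auto)
  then have 0: "(LBINT s:{0..\<tau>}. s * (z s \<bullet> z1 s + z1 s \<bullet> z s) + 1 * (z s \<bullet> z s)) = 0" by (simp add: z\<tau>)
  \<comment> \<open>This is the nonnegativity of half the squared norm of z + 2 s z1, with s
    enlarged to \<tau> in the last term.\<close>
  have le: "1 / 2 * (norm (z s))\<^sup>2 \<le> 2 * \<tau>\<^sup>2 * (norm (z1 s))\<^sup>2 + (s * (z s \<bullet> z1 s + z1 s \<bullet> z s) + 1 * (z s \<bullet> z s))"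
    if "s \<in> {0..\<tau>}" for s
  proof -
    have "0 \<le> (norm (z s))\<^sup>2 + 2 * (2 * s) * (z s \<bullet> z1 s) + (2 * s)\<^sup>2 * (norm (z1 s))\<^sup>2"
      unfolding power2_norm_add_scaleR[symmetric] by (rule zero_le_power2)
    moreover have "(2 * s)\<^sup>2 * (norm (z1 s))\<^sup>2 \<le> (2 * \<tau>)\<^sup>2 * (norm (z1 s))\<^sup>2"
      using that by (intro mult_right_mono power_mono) auto
    moreover have "(2 * \<tau>)\<^sup>2 * (norm (z1 s))\<^sup>2 = 2 * (2 * \<tau>\<^sup>2 * (norm (z1 s))\<^sup>2)"
      by (simp add: power_mult_distrib)
    moreover have "2 * (2 * s) * (z s \<bullet> z1 s) = 2 * (s * (z s \<bullet> z1 s + z1 s \<bullet> z s))"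
      unfolding inner_commute[of "z1 s" "z s"] by simp
    ultimately show ?thesis unfolding power2_norm_eq_inner[of "z s"] by linarith
  qed
  define Z Z1 where "Z = (LBINT s:{0..\<tau>}. (norm (z s))\<^sup>2)" and "Z1 = (LBINT s:{0..\<tau>}. (norm (z1 s))\<^sup>2)"
  have bs: "bm \<tau> (\<lambda>s. s)" by (rule bm_continuous[OF continuous_on_id])
  have "(LBINT s:{0..\<tau>}. 1 / 2 * (norm (z s))\<^sup>2)
      \<le> (LBINT s:{0..\<tau>}. 2 * \<tau>\<^sup>2 * (norm (z1 s))\<^sup>2 + (s * (z s \<bullet> z1 s + z1 s \<bullet> z s) + 1 * (z s \<bullet> z s)))"
  proof (rule set_integral_mono_bm[of \<tau> _ _ _ _ "{}"])
    show "bm \<tau> (\<lambda>s. 1 / 2 * (norm (z s))\<^sup>2)"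
      by (rule bm_mult[OF bm_const bm_power2[OF bm_norm[OF bz]]])
    show "bm \<tau> (\<lambda>s. 2 * \<tau>\<^sup>2 * (norm (z1 s))\<^sup>2 + (s * (z s \<bullet> z1 s + z1 s \<bullet> z s) + 1 * (z s \<bullet> z s)))"
      by (intro bm_intros bs bz bz1)
    show "1 / 2 * (norm (z s))\<^sup>2 \<le> 2 * \<tau>\<^sup>2 * (norm (z1 s))\<^sup>2 + (s * (z s \<bullet> z1 s + z1 s \<bullet> z s) + 1 * (z s \<bullet> z s))"
      if "s \<in> {0..\<tau>}" for s by (rule le[OF that])
  qed simp_all
  also have "\<dots> = (LBINT s:{0..\<tau>}. 2 * \<tau>\<^sup>2 * (norm (z1 s))\<^sup>2)
      + (LBINT s:{0..\<tau>}. s * (z s \<bullet> z1 s + z1 s \<bullet> z s) + 1 * (z s \<bullet> z s))"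
    by (rule LBINT_bm_add[of \<tau>]) (intro bm_intros bz bz1 bs order_refl)+
  finally have "Z / 2 \<le> 2 * \<tau>\<^sup>2 * Z1" unfolding 0 by (simp add: Z_def Z1_def)
  then have "l\<^sup>2 * Z \<le> l\<^sup>2 * (4 * \<tau>\<^sup>2 * Z1)" by (intro mult_left_mono) auto
  also have "\<dots> = 4 * (l * \<tau>)\<^sup>2 * Z1" by (simp add: power_mult_distrib)
  also have "\<dots> \<le> 4 * 1 * Z1"
  proof -
    have "(l * \<tau>)\<^sup>2 \<le> 1" using lt l \<tau> by (intro power_le_one) auto
    moreover have "Z1 \<ge> 0" unfolding Z1_def set_lebesgue_integral_def by (intro integral_nonneg_AE) auto
    ultimately show ?thesis by (intro mult_right_mono) auto
  qed
  finally have Z: "l\<^sup>2 * Z \<le> 4 * Z1" by simp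
  have "(norm (\<theta> s))\<^sup>2 \<le> 2 * l\<^sup>2 * (norm (z s))\<^sup>2 + 2 * (norm (z1 s))\<^sup>2" for s
  proof -
    have "norm (\<theta> s) = norm (z1 s + (- l) *\<^sub>R z s)" by (simp add: z1)
    then have "(norm (\<theta> s))\<^sup>2 = (norm (z1 s))\<^sup>2 + 2 * (- l) * (z1 s \<bullet> z s) + (- l)\<^sup>2 * (norm (z s))\<^sup>2"
      by (simp only: power2_norm_add_scaleR)
    moreover have "0 \<le> (norm (z1 s))\<^sup>2 + 2 * l * (z1 s \<bullet> z s) + l\<^sup>2 * (norm (z s))\<^sup>2"
      unfolding power2_norm_add_scaleR[symmetric] by (rule zero_le_power2)
    ultimately show ?thesis by simp
  qed
  note pt\<theta> = this
  have "(LBINT s:{0..\<tau>}. (norm (\<theta> s))\<^sup>2) \<le> (LBINT s:{0..\<tau>}. 2 * l\<^sup>2 * (norm (z s))\<^sup>2 + 2 * (norm (z1 s))\<^sup>2)"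
  proof (rule set_integral_mono_bm[of \<tau> _ _ _ _ "{}"])
    show "bm \<tau> (\<lambda>s. (norm (\<theta> s))\<^sup>2)" by (rule bm_power2[OF bm_norm[OF b\<theta>]])
    show "bm \<tau> (\<lambda>s. 2 * l\<^sup>2 * (norm (z s))\<^sup>2 + 2 * (norm (z1 s))\<^sup>2)"
      by (intro bm_add bm_mult bm_power2 bm_norm bm_const bz bz1)
    show "(norm (\<theta> s))\<^sup>2 \<le> 2 * l\<^sup>2 * (norm (z s))\<^sup>2 + 2 * (norm (z1 s))\<^sup>2" for s by (rule pt\<theta>)
  qed simp_all
  also have "\<dots> = (LBINT s:{0..\<tau>}. 2 * l\<^sup>2 * (norm (z s))\<^sup>2) + (LBINT s:{0..\<tau>}. 2 * (norm (z1 s))\<^sup>2)"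
    by (rule LBINT_bm_add[of \<tau>]) (intro bm_intros bz bz1 order_refl)+
  also have "\<dots> = 2 * (l\<^sup>2 * Z) + 2 * Z1" by (simp add: Z_def Z1_def)
  finally show "(LBINT s:{0..\<tau>}. (norm (\<theta> s))\<^sup>2) \<le> 10 * (LBINT s:{0..\<tau>}. (norm (z1 s))\<^sup>2)"
    using Z unfolding Z1_def[symmetric] by linarith
qed


text \<open>\<open>q\<close> is D/(D + l)^2 applied to \<eta>, so the pairing on the right is that
  of D^2/(D + l)^2 \<eta> with \<theta>. Moving one factor onto \<theta> leaves D/(D + l) \<eta>
  against the derivative of the backward solution, and Young's inequality with the free parameter
  \<open>d\<close> separates the two.\<close>

lemma backward_lower_bound:
  fixes \<theta> \<eta> :: "real \<Rightarrow> 'b::{real_inner, banach, second_countable_topology}" and l :: real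
  assumes \<theta>: "pw \<tau> \<theta>" and \<eta>: "pw \<tau> \<eta>" and \<tau>: "0 \<le> \<tau>" and d: "d > 0"
  defines "q \<equiv> \<lambda>s. conv_exp l \<eta> s - l *\<^sub>R conv_texp l \<eta> s"
  shows "- (d / 2 * (LBINT s:{0..\<tau>}. (norm (l *\<^sub>R backward_exp l \<tau> \<theta> s - \<theta> s))\<^sup>2)
      + 1 / (2 * d) * (LBINT s:{0..\<tau>}. (norm (\<eta> s - l *\<^sub>R conv_exp l \<eta> s))\<^sup>2))
    \<le> (LBINT s:{0..\<tau>}. (\<eta> s - l *\<^sub>R conv_exp l \<eta> s - l *\<^sub>R q s) \<bullet> \<theta> s)"
proof -
  define z1 where "z1 s = l *\<^sub>R backward_exp l \<tau> \<theta> s - \<theta> s" for s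
  define y1 where "y1 s = \<eta> s - l *\<^sub>R conv_exp l \<eta> s" for s
  obtain S where S: "finite S" "\<And>s. s \<notin> S \<Longrightarrow> isCont \<eta> s" by (rule pw_exceptional_set[OF \<eta>]) (rule that)
  have yc: "continuous_on UNIV (conv_exp l \<eta>)" by (rule continuous_conv_exp[OF \<eta>])
  have qc: "continuous_on UNIV q" unfolding q_def by (intro continuous_intros yc continuous_conv_texp[OF \<eta>])
  have bz1: "bm \<tau> z1"
    unfolding z1_def[abs_def] by (intro bm_intros bm_continuous[OF continuous_backward_exp[OF \<theta>]] pw_bm[OF \<theta>])
  have by1: "bm \<tau> y1"
    unfolding y1_def[abs_def] by (intro bm_intros bm_continuous[OF yc] pw_bm[OF \<eta>])
  have "(LBINT s:{0..\<tau>}. (y1 s - l *\<^sub>R q s) \<bullet> \<theta> s) = - (LBINT s:{0..\<tau>}. (y1 s - l *\<^sub>R q s + l *\<^sub>R q s) \<bullet> z1 s)"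
    unfolding z1_def
  proof (rule backward_pairing[OF \<theta> \<tau> qc _ S(1)])
    show "q 0 = 0" by (simp add: q_def conv_exp_0[OF \<eta>] conv_texp_0[OF \<eta>])
    show "(q has_vector_derivative y1 t - l *\<^sub>R q t) (at t)" if "t \<notin> S" for t
    proof -
      have "(q has_vector_derivative (\<eta> t - l *\<^sub>R conv_exp l \<eta> t) - l *\<^sub>R (conv_exp l \<eta> t - l *\<^sub>R conv_texp l \<eta> t)) (at t)"
        unfolding q_def
        by (intro has_vector_derivative_diff conv_exp_derivative[OF \<eta> S(2)[OF that]]
            bounded_linear.has_vector_derivative[OF bounded_linear_scaleR_right] conv_texp_derivative[OF \<eta> S(2)[OF that]])
      then show ?thesis by (simp only: q_def y1_def)
    qed
    show "bm \<tau> (\<lambda>t. y1 t - l *\<^sub>R q t)" by (intro bm_intros by1 bm_continuous[OF qc])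
  qed
  also have "(LBINT s:{0..\<tau>}. (y1 s - l *\<^sub>R q s + l *\<^sub>R q s) \<bullet> z1 s) = (LBINT s:{0..\<tau>}. y1 s \<bullet> z1 s)" by simp
  finally have eq: "(LBINT s:{0..\<tau>}. (y1 s - l *\<^sub>R q s) \<bullet> \<theta> s) = - (LBINT s:{0..\<tau>}. y1 s \<bullet> z1 s)" .
  have "(LBINT s:{0..\<tau>}. y1 s \<bullet> z1 s) \<le> (LBINT s:{0..\<tau>}. d / 2 * (norm (z1 s))\<^sup>2 + 1 / (2 * d) * (norm (y1 s))\<^sup>2)"
  proof (rule set_integral_mono_bm[of \<tau> _ _ _ _ "{}"])
    show "bm \<tau> (\<lambda>s. y1 s \<bullet> z1 s)" by (rule bm_inner[OF by1 bz1])
    show "bm \<tau> (\<lambda>s. d / 2 * (norm (z1 s))\<^sup>2 + 1 / (2 * d) * (norm (y1 s))\<^sup>2)"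
      by (intro bm_add bm_mult bm_const bm_power2 bm_norm bz1 by1)
    fix s
    have "0 \<le> (norm (y1 s))\<^sup>2 + 2 * (- d) * (y1 s \<bullet> z1 s) + (- d)\<^sup>2 * (norm (z1 s))\<^sup>2"
      unfolding power2_norm_add_scaleR[symmetric] by (rule zero_le_power2)
    then have "2 * d * (y1 s \<bullet> z1 s) \<le> (norm (y1 s))\<^sup>2 + d\<^sup>2 * (norm (z1 s))\<^sup>2" by simp
    then have "2 * d * (y1 s \<bullet> z1 s) / (2 * d) \<le> ((norm (y1 s))\<^sup>2 + d\<^sup>2 * (norm (z1 s))\<^sup>2) / (2 * d)"
      using d by (intro divide_right_mono) auto
    then show "y1 s \<bullet> z1 s \<le> d / 2 * (norm (z1 s))\<^sup>2 + 1 / (2 * d) * (norm (y1 s))\<^sup>2"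
      using d by (simp add: add_divide_distrib power2_eq_square)
  qed simp_all
  also have "\<dots> = (LBINT s:{0..\<tau>}. d / 2 * (norm (z1 s))\<^sup>2) + (LBINT s:{0..\<tau>}. 1 / (2 * d) * (norm (y1 s))\<^sup>2)"
    by (rule LBINT_bm_add[of \<tau>]) (intro bm_mult bm_const bm_power2 bm_norm bz1 by1 order_refl)+
  also have "\<dots> = d / 2 * (LBINT s:{0..\<tau>}. (norm (z1 s))\<^sup>2) + 1 / (2 * d) * (LBINT s:{0..\<tau>}. (norm (y1 s))\<^sup>2)"
    by (simp only: set_integral_mult_right)
  finally show ?thesis using eq unfolding y1_def z1_def by linarith
qed

text \<open>With y = \<open>conv_exp l \<eta>\<close>, the right-hand side exceeds the left by l/2
  times the squared norm of y \<tau>. Having \<eta> itself in one slot makes the bound linear in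
  D/(D + l) \<eta>, so that afterwards only its integral, not that of its square, has to be
  estimated on each interval.\<close>

lemma forward_energy:
  fixes \<eta> :: "real \<Rightarrow> 'b::{real_inner, banach, second_countable_topology}"
  assumes \<eta>: "pw \<tau> \<eta>" and \<tau>: "0 \<le> \<tau>" and l: "l > 0"
  shows "(LBINT s:{0..\<tau>}. (norm (\<eta> s - l *\<^sub>R conv_exp l \<eta> s))\<^sup>2)
    \<le> (LBINT s:{0..\<tau>}. \<eta> s \<bullet> (\<eta> s - l *\<^sub>R conv_exp l \<eta> s))"
proof -
  define y where "y = conv_exp l \<eta>"
  define y1 where "y1 s = \<eta> s - l *\<^sub>R y s" for s
  obtain S where S: "finite S" "\<And>s. s \<notin> S \<Longrightarrow> isCont \<eta> s" by (rule pw_exceptional_set[OF \<eta>]) (rule that)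
  have yc: "continuous_on UNIV y" unfolding y_def by (rule continuous_conv_exp[OF \<eta>])
  have ycI: "continuous_on {0..\<tau>} y" by (rule continuous_on_subset[OF yc]) simp
  have by': "bm \<tau> y" by (rule bm_continuous[OF yc])
  have by1: "bm \<tau> y1"
    unfolding y1_def[abs_def] by (intro bm_intros by' pw_bm[OF \<eta>])
  have yd: "(y has_vector_derivative y1 t) (at t)" if "t \<notin> S" for t
    unfolding y_def y1_def by (rule conv_exp_derivative[OF \<eta> S(2)[OF that]])
  have "(LBINT s:{0..\<tau>}. y s \<bullet> y1 s + y1 s \<bullet> y s) = y \<tau> \<bullet> y \<tau> - y 0 \<bullet> y 0"
  proof (rule LBINT_FTC[of S])
    show "continuous_on {0..\<tau>} (\<lambda>s. y s \<bullet> y s)" by (intro continuous_intros ycI)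
    show "((\<lambda>s. y s \<bullet> y s) has_real_derivative y x \<bullet> y1 x + y1 x \<bullet> y x) (at x)"
      if "x \<in> {0<..<\<tau>} - S" for x using that by (intro has_real_derivative_inner yd) auto
    show "set_integrable lborel {0..\<tau>} (\<lambda>s. y s \<bullet> y1 s + y1 s \<bullet> y s)"
      by (rule bm_set_integrable[of \<tau>]) (intro bm_intros by1 by' order_refl)+
  qed (use \<tau> S in auto)
  then have yy: "(LBINT s:{0..\<tau>}. y s \<bullet> y1 s + y1 s \<bullet> y s) \<ge> 0"
    by (simp add: y_def conv_exp_0[OF \<eta>])
  have pt: "\<eta> s \<bullet> y1 s = (norm (y1 s))\<^sup>2 + l / 2 * (y s \<bullet> y1 s + y1 s \<bullet> y s)" for s
  proof -
    have \<eta>s: "\<eta> s = y1 s + l *\<^sub>R y s" by (simp add: y1_def)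
    have "\<eta> s \<bullet> y1 s = y1 s \<bullet> y1 s + l * (y s \<bullet> y1 s)"
      by (subst \<eta>s) (simp only: inner_add_left inner_scaleR_left)
    then show ?thesis by (simp only: power2_norm_eq_inner inner_commute[of "y1 s" "y s"]) simp
  qed
  have "(LBINT s:{0..\<tau>}. \<eta> s \<bullet> y1 s) = (LBINT s:{0..\<tau>}. (norm (y1 s))\<^sup>2 + l / 2 * (y s \<bullet> y1 s + y1 s \<bullet> y s))"
    by (simp only: pt)
  also have "\<dots> = (LBINT s:{0..\<tau>}. (norm (y1 s))\<^sup>2) + (LBINT s:{0..\<tau>}. l / 2 * (y s \<bullet> y1 s + y1 s \<bullet> y s))"
    by (rule LBINT_bm_add[of \<tau>]) (intro bm_intros by' by1 order_refl)+
  also have "(LBINT s:{0..\<tau>}. l / 2 * (y s \<bullet> y1 s + y1 s \<bullet> y s)) = l / 2 * (LBINT s:{0..\<tau>}. y s \<bullet> y1 s + y1 s \<bullet> y s)"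
    by (rule set_integral_mult_right)
  finally have "(LBINT s:{0..\<tau>}. \<eta> s \<bullet> y1 s) \<ge> (LBINT s:{0..\<tau>}. (norm (y1 s))\<^sup>2)"
    using mult_nonneg_nonneg[OF _ yy, of "l / 2"] l by linarith
  then show ?thesis unfolding y1_def y_def .
qed

text \<open>The semigroup property: the history before \<open>a\<close> enters only through one
  exponentially damped value.\<close>

lemma conv_exp_split:
  assumes "pw T v" "a \<le> t"
  shows "conv_exp l v t = exp (- l * (t - a)) *\<^sub>R conv_exp l v a
    + (LBINT s:{a<..t}. exp (- l * (t - s)) *\<^sub>R v s)"
proof -
  define c where "c = cum (\<lambda>s. exp (l * s) *\<^sub>R v s)"
  have "c t = c a + (LBINT s:{a<..t}. exp (l * s) *\<^sub>R v s)"
    unfolding c_def using cum_diff[OF pw_integrable[OF pw_exp[OF assms(1)]] assms(2), of l] by (simp add: algebra_simps)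
  then have "conv_exp l v t = exp (- l * t) *\<^sub>R c a + exp (- l * t) *\<^sub>R (LBINT s:{a<..t}. exp (l * s) *\<^sub>R v s)"
    unfolding conv_exp_def c_def[symmetric] by (simp add: scaleR_add_right)
  moreover have "exp (- l * t) *\<^sub>R c a = exp (- l * (t - a)) *\<^sub>R conv_exp l v a"
    unfolding conv_exp_def c_def[symmetric] by (simp add: algebra_simps flip: exp_add)
  moreover have "exp (- l * t) *\<^sub>R (LBINT s:{a<..t}. exp (l * s) *\<^sub>R v s) = (LBINT s:{a<..t}. exp (- l * (t - s)) *\<^sub>R v s)"
    unfolding set_integral_scaleR_right[symmetric]
    by (rule arg_cong[where f = "set_lebesgue_integral lborel {a<..t}"]) (simp add: fun_eq_iff algebra_simps flip: exp_add)
  ultimately show ?thesis by simp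
qed

lemma conv_exp_bound:
  assumes v: "pw T v" and l: "l > 0" and D: "\<And>s. s \<in> {0<..a} \<Longrightarrow> norm (v s) \<le> D" "D \<ge> 0" and a: "0 \<le> a"
  shows "norm (conv_exp l v a) \<le> D / l"
proof -
  have i: "integrable lborel (\<lambda>s. indicator {0..a} s * (exp (- l * (a - s)) * D))"
  proof -
    have "set_integrable lborel {0..a} (\<lambda>s. exp (- l * (a - s)) * D)"
      by (intro borel_integrable_atLeastAtMost' continuous_intros)
    then show ?thesis by (simp add: set_integrable_def)
  qed
  have "norm (conv_exp l v a) \<le> (LINT s|lborel. norm (indicator {..a} s *\<^sub>R exp (- l * (a - s)) *\<^sub>R v s))"
    unfolding conv_exp_eq set_lebesgue_integral_def by (rule integral_norm_bound)
  also have "\<dots> \<le> (LINT s|lborel. indicator {0..a} s * (exp (- l * (a - s)) * D))"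
  proof (rule integral_mono'[OF i])
    fix s
    show "norm (indicator {..a} s *\<^sub>R exp (- l * (a - s)) *\<^sub>R v s) \<le> indicator {0..a} s * (exp (- l * (a - s)) * D)"
    proof (cases "s \<in> {0<..a}")
      case True
      then show ?thesis using D(1)[OF True] by simp
    next
      case False
      then have "indicator {..a} s *\<^sub>R exp (- l * (a - s)) *\<^sub>R v s = 0"
        using v by (auto simp: pw_def indicator_def)
      then show ?thesis using D(2) by (simp only: norm_zero) simp
    qed
    show "0 \<le> indicator {0..a} s * (exp (- l * (a - s)) * D)" using D(2) by simp
  qed
  also have "\<dots> = (LBINT s:{0..a}. exp (- l * (a - s))) * D"
    unfolding set_lebesgue_integral_def
    by (simp only: real_scaleR_def mult.assoc[symmetric] integral_mult_left_zero)
  also have "\<dots> = (1 - exp (- l * (a - 0))) / l * D" by (simp only: LBINT_exp[OF l a])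
  also have "\<dots> \<le> 1 / l * D" using l D(2) by (intro mult_right_mono divide_right_mono) auto
  finally show ?thesis by simp
qed

lemma exp_const_Ioc:
  fixes c :: "'b::{banach, second_countable_topology}"
  assumes "l > 0"
  shows "set_integrable lborel {a<..t} (\<lambda>s. exp (- l * (t - s)) *\<^sub>R c)"
    and "a \<le> t \<Longrightarrow> (LBINT s:{a<..t}. exp (- l * (t - s)) *\<^sub>R c) = ((1 - exp (- l * (t - a))) / l) *\<^sub>R c"
proof -
  have "set_integrable lborel {a..t} (\<lambda>s. exp (- l * (t - s)))"
    by (intro borel_integrable_atLeastAtMost' continuous_intros)
  then have i: "set_integrable lborel {a<..t} (\<lambda>s. exp (- l * (t - s)))"
    by (rule set_integrable_subset) auto
  show "set_integrable lborel {a<..t} (\<lambda>s. exp (- l * (t - s)) *\<^sub>R c)"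
  proof -
    have "integrable lborel (\<lambda>s. (indicator {a<..t} s *\<^sub>R exp (- l * (t - s))) *\<^sub>R c)"
      by (rule integrable_scaleR_left) (rule i[unfolded set_integrable_def])
    then show ?thesis unfolding set_integrable_def by (simp only: scaleR_scaleR real_scaleR_def)
  qed
  assume at: "a \<le> t"
  have "(LBINT s:{a<..t}. exp (- l * (t - s)) *\<^sub>R c) = (LBINT s:{a<..t}. exp (- l * (t - s))) *\<^sub>R c"
    using integral_scaleR_left[of c lborel, OF i[unfolded set_integrable_def]]
    by (simp only: set_lebesgue_integral_def scaleR_scaleR real_scaleR_def)
  also have "(LBINT s:{a<..t}. exp (- l * (t - s))) = (1 - exp (- l * (t - a))) / l"
    unfolding LBINT_Ioc by (rule LBINT_exp[OF assms at])
  finally show "(LBINT s:{a<..t}. exp (- l * (t - s)) *\<^sub>R c) = ((1 - exp (- l * (t - a))) / l) *\<^sub>R c" .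
qed

text \<open>On (a, b) the function \<eta> - l y is the sum of the damped terms exp(-l (t - a))
  (\<eta> t - l y a) and an average of the increments \<eta> t - \<eta> s. These increments are
  majorised by those of the scalar function V, whose average is the derivative of W minus a damped
  nonnegative term. Thus every majorant has an explicit primitive and integrates to a multiple of D
  (1 - exp(-l (b - a))) / l. The bound D is required on all of \<open>{0<..<b}\<close> because y a
  collects the whole past.\<close>

lemma forward_local_bound:
  fixes \<eta> :: "real \<Rightarrow> 'b::{real_inner, banach, second_countable_topology}"
  assumes \<eta>: "pw \<tau> \<eta>" and l: "l > 0" and ab: "0 \<le> a" "a < b" "b \<le> \<tau>"
    and V: "continuous_on UNIV V" "\<And>s. s \<in> {a..b} \<Longrightarrow> 0 \<le> V s \<and> V s \<le> D"
    and D: "\<And>s. s \<in> {0<..<b} \<Longrightarrow> norm (\<eta> s) \<le> D"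
    and inc: "\<And>r s. a < s \<Longrightarrow> s \<le> r \<Longrightarrow> r < b \<Longrightarrow> norm (\<eta> r - \<eta> s) \<le> V r - V s"
  shows "(LBINT s:{a..b}. \<eta> s \<bullet> (\<eta> s - l *\<^sub>R conv_exp l \<eta> s)) \<le> 3 * D\<^sup>2 * ((1 - exp (- l * (b - a))) / l)"
proof -
  define y where "y = conv_exp l \<eta>"
  define e where "e t = exp (- l * (t - a))" for t
  \<comment> \<open>V is cut off to (a, b) so that W starts from 0 at a; W then solves W' + l W = V
    on that interval.\<close>
  define Vh where "Vh s = (if s \<in> {a<..<b} then V s else 0)" for s
  define W where "W = conv_exp l Vh"
  have D0: "D \<ge> 0" using V(2)[of a] ab by auto
  have cont: "continuous_on S (\<lambda>s. exp (- l * (t - s)))" for S t by (intro continuous_intros)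
  have Vh: "pw \<tau> Vh"
    unfolding pw_def
  proof (intro conjI exI allI impI)
    show "finite {a, b}" by simp
    fix s
    show "norm (Vh s) \<le> D" using V(2)[of s] D0 by (auto simp: Vh_def)
    show "Vh s = 0" if "s \<notin> {0<..<\<tau>}" using that ab by (auto simp: Vh_def)
    assume s: "s \<notin> {a, b}"
    show "isCont Vh s"
    proof (cases "s \<in> {a<..<b}")
      case True
      have "\<forall>\<^sub>F x in nhds s. Vh x = V x"
        using eventually_nhds_in_open[OF open_greaterThanLessThan True] by eventually_elim (simp add: Vh_def)
      then show ?thesis using V(1) by (simp add: isCont_cong continuous_on_eq_continuous_at)
    next
      case False
      then have "s \<in> - {a..b}" using s by auto
      then have "\<forall>\<^sub>F x in nhds s. x \<in> - {a..b}" by (intro eventually_nhds_in_open) auto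
      then have "\<forall>\<^sub>F x in nhds s. Vh x = 0" by eventually_elim (auto simp: Vh_def)
      then show ?thesis by (simp add: isCont_cong)
    qed
  qed
  have Wa: "W a = 0"
  proof -
    have "(\<lambda>s. indicator {..a} s *\<^sub>R exp (- l * (a - s)) *\<^sub>R Vh s) = (\<lambda>s. 0)" by (auto simp: Vh_def fun_eq_iff)
    then show ?thesis unfolding W_def conv_exp_eq set_lebesgue_integral_def by simp
  qed
  have iV: "set_integrable lborel {a<..t} (\<lambda>s. exp (- l * (t - s)) *\<^sub>R Vh s)" for t
    by (rule set_integrable_pw[OF pw_continuous_mult[OF cont Vh]]) simp
  have i\<eta>: "set_integrable lborel {a<..t} (\<lambda>s. exp (- l * (t - s)) *\<^sub>R \<eta> s)" for t
    by (rule set_integrable_pw[OF pw_continuous_mult[OF cont \<eta>]]) simp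
  note ic = exp_const_Ioc(1)[OF l] and vc = exp_const_Ioc(2)[OF l, of a _, folded e_def]
  have ya: "norm (y a) \<le> D / l"
    unfolding y_def by (rule conv_exp_bound[OF \<eta> l D D0 ab(1)]) (use ab in auto)
  have Wt: "W t = (LBINT s:{a<..t}. exp (- l * (t - s)) *\<^sub>R Vh s)" if "a \<le> t" for t
    using conv_exp_split[OF Vh that, of l] Wa by (simp add: W_def)
  have Wb: "W b \<le> D * ((1 - e b) / l)"
  proof -
    have "W b \<le> (LBINT s:{a<..b}. exp (- l * (b - s)) *\<^sub>R D)"
      unfolding Wt[OF less_imp_le[OF ab(2)]]
      by (rule set_integral_mono[OF iV ic]) (use V(2) D0 in \<open>auto simp: Vh_def\<close>)
    then show ?thesis using vc[of b D] ab by (simp add: mult.commute)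
  qed
  have main: "norm (\<eta> t - l *\<^sub>R y t) \<le> e t * (l * norm (y a) + D) + (Vh t - l * W t)" if t: "t \<in> {a<..<b}" for t
  proof -
    have at: "a \<le> t" using t by simp
    have et: "0 \<le> e t" by (simp add: e_def)
    define J where "J = (LBINT s:{a<..t}. exp (- l * (t - s)) *\<^sub>R (\<eta> t - \<eta> s))"
    have J: "J = ((1 - e t) / l) *\<^sub>R \<eta> t - (LBINT s:{a<..t}. exp (- l * (t - s)) *\<^sub>R \<eta> s)"
      unfolding J_def scaleR_right_diff_distrib vc[OF at, symmetric] by (rule set_integral_diff(2)[OF ic i\<eta>])
    have "l *\<^sub>R y t = (l * e t) *\<^sub>R y a + (1 - e t) *\<^sub>R \<eta> t - l *\<^sub>R J"
      unfolding J y_def using conv_exp_split[OF \<eta> at, of l] l by (simp add: e_def scaleR_add_right scaleR_right_diff_distrib)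
    then have "\<eta> t - l *\<^sub>R y t = e t *\<^sub>R \<eta> t + l *\<^sub>R J - (l * e t) *\<^sub>R y a"
      by (simp add: scaleR_left_diff_distrib)
    then have "norm (\<eta> t - l *\<^sub>R y t) \<le> norm (e t *\<^sub>R \<eta> t + l *\<^sub>R J) + norm ((l * e t) *\<^sub>R y a)"
      by (simp only: norm_triangle_ineq4)
    also have "\<dots> \<le> norm (e t *\<^sub>R \<eta> t) + norm (l *\<^sub>R J) + norm ((l * e t) *\<^sub>R y a)"
      by (intro add_right_mono norm_triangle_ineq)
    also have "\<dots> = e t * norm (\<eta> t) + l * norm J + l * e t * norm (y a)"
      using et l by (simp add: abs_mult)
    finally have le1: "norm (\<eta> t - l *\<^sub>R y t) \<le> e t * norm (\<eta> t) + l * norm J + l * e t * norm (y a)" .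
    have le2: "e t * norm (\<eta> t) \<le> e t * D" using D t ab et by (intro mult_left_mono) auto
    have le3: "l * norm J \<le> Vh t - l * W t"
    proof -
      have "norm J \<le> (LBINT s:{a<..t}. norm (exp (- l * (t - s)) *\<^sub>R (\<eta> t - \<eta> s)))"
        unfolding J_def by (rule set_integral_norm_bound) (use set_integral_diff(1)[OF ic i\<eta>] in \<open>simp only: scaleR_right_diff_distrib\<close>)
      also have "\<dots> \<le> (LBINT s:{a<..t}. exp (- l * (t - s)) *\<^sub>R Vh t - exp (- l * (t - s)) *\<^sub>R Vh s)"
      proof (rule set_integral_mono)
        show "set_integrable lborel {a<..t} (\<lambda>s. norm (exp (- l * (t - s)) *\<^sub>R (\<eta> t - \<eta> s)))"
          using set_integrable_norm[OF set_integral_diff(1)[OF ic[of a t "\<eta> t"] i\<eta>[of t]]] by (simp only: scaleR_right_diff_distrib)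
        show "set_integrable lborel {a<..t} (\<lambda>s. exp (- l * (t - s)) *\<^sub>R Vh t - exp (- l * (t - s)) *\<^sub>R Vh s)"
          by (rule set_integral_diff(1)[OF ic iV])
        fix s assume s: "s \<in> {a<..t}"
        have "norm (\<eta> t - \<eta> s) \<le> Vh t - Vh s" using inc[of s t] s t by (simp add: Vh_def)
        then show "norm (exp (- l * (t - s)) *\<^sub>R (\<eta> t - \<eta> s)) \<le> exp (- l * (t - s)) *\<^sub>R Vh t - exp (- l * (t - s)) *\<^sub>R Vh s"
          unfolding scaleR_right_diff_distrib[symmetric] by simp
      qed
      also have "\<dots> = ((1 - e t) / l) *\<^sub>R Vh t - W t"
        unfolding Wt[OF at] vc[OF at, symmetric] by (rule set_integral_diff(2)[OF ic iV])
      finally have "l * norm J \<le> l * (((1 - e t) / l) *\<^sub>R Vh t - W t)" using l by (intro mult_left_mono) auto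
      also have "\<dots> = (1 - e t) * Vh t - l * W t" using l by (simp add: right_diff_distrib)
      also have "\<dots> \<le> Vh t - l * W t"
        using et V(2)[of t] t mult_nonneg_nonneg[of "e t" "Vh t"] by (simp add: Vh_def left_diff_distrib)
      finally show "l * norm J \<le> Vh t - l * W t" .
    qed
    have "e t * (l * norm (y a) + D) = l * e t * norm (y a) + e t * D" by (simp add: distrib_left)
    then show ?thesis using le1 le2 le3 by linarith
  qed
  define G where "G t = D * (e t * (l * norm (y a) + D) + (Vh t - l * W t))" for t
  have Wc: "continuous_on UNIV W" unfolding W_def by (rule continuous_conv_exp[OF Vh])
  have bG: "bm \<tau> G"
    unfolding G_def[abs_def] e_def[abs_def]
    by (intro bm_intros pw_bm[OF Vh] bm_continuous[OF Wc]) (intro bm_continuous continuous_intros)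
  have byc: "bm \<tau> y" unfolding y_def by (rule bm_continuous[OF continuous_conv_exp[OF \<eta>]])
  have "(LBINT s:{a..b}. \<eta> s \<bullet> (\<eta> s - l *\<^sub>R y s)) \<le> (LBINT s:{a..b}. G s)"
  proof (rule set_integral_mono_bm[of \<tau> _ _ _ _ "{a, b}"])
    show "bm \<tau> (\<lambda>s. \<eta> s \<bullet> (\<eta> s - l *\<^sub>R y s))" by (intro bm_intros pw_bm[OF \<eta>] byc)
    fix s assume "s \<in> {a..b}" "s \<notin> {a, b}"
    then have s: "s \<in> {a<..<b}" by auto
    have "\<eta> s \<bullet> (\<eta> s - l *\<^sub>R y s) \<le> norm (\<eta> s) * norm (\<eta> s - l *\<^sub>R y s)" by (rule norm_cauchy_schwarz)
    also have "\<dots> \<le> D * norm (\<eta> s - l *\<^sub>R y s)" using D[of s] s ab by (intro mult_right_mono) auto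
    also have "\<dots> \<le> G s" unfolding G_def by (intro mult_left_mono main s D0)
    finally show "\<eta> s \<bullet> (\<eta> s - l *\<^sub>R y s) \<le> G s" .
  qed (use ab bG in auto)
  \<comment> \<open>V - l W is the derivative of W, and e t is that of - e t / l, so the majorant
    integrates exactly.\<close>
  also have "(LBINT s:{a..b}. G s) = D * (- (e b / l) * (l * norm (y a) + D) + W b) - D * (- (e a / l) * (l * norm (y a) + D) + W a)"
  proof (rule LBINT_FTC[of "{a, b}"])
    show "continuous_on {a..b} (\<lambda>t. D * (- (e t / l) * (l * norm (y a) + D) + W t))"
      unfolding e_def using l by (intro continuous_intros continuous_on_subset[OF Wc]) auto
    show "set_integrable lborel {a..b} G" by (rule bm_set_integrable[OF bG]) (use ab in auto)
    fix t assume t: "t \<in> {a<..<b} - {a, b}"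
    have "isCont Vh t"
    proof -
      have "\<forall>\<^sub>F x in nhds t. Vh x = V x"
        using eventually_nhds_in_open[of "{a<..<b}" t] t by (auto elim!: eventually_mono simp: Vh_def)
      then show ?thesis using V(1) by (simp add: isCont_cong continuous_on_eq_continuous_at)
    qed
    then have dW: "(W has_real_derivative Vh t - l * W t) (at t)"
      unfolding W_def using conv_exp_derivative[OF Vh, of t l] by (simp add: has_real_derivative_iff_has_vector_derivative)
    have de: "((\<lambda>t. - (e t / l)) has_real_derivative e t) (at t)"
      unfolding e_def by (rule derivative_eq_intros refl | use l in simp)+
    show "((\<lambda>t. D * (- (e t / l) * (l * norm (y a) + D) + W t)) has_real_derivative G t) (at t)"
      unfolding G_def by (intro DERIV_cmult DERIV_add dW DERIV_cmult_right de)
  qed (use ab in auto)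
  also have "\<dots> = D * ((1 - e b) / l * (l * norm (y a) + D) + W b)"
    using Wa by (simp add: e_def right_diff_distrib left_diff_distrib diff_divide_distrib distrib_left)
  \<comment> \<open>Two of the three equal contributions come from the damped terms, namely from the
    size of \<eta> and from l norm (y a) \<le> D; the third is W b.\<close>
  also have "\<dots> \<le> D * ((1 - e b) / l * (D + D) + D * ((1 - e b) / l))"
  proof (intro mult_left_mono add_mono Wb D0 order_refl)
    show "l * norm (y a) \<le> D" using ya l by (simp add: pos_le_divide_eq mult.commute)
    show "0 \<le> (1 - e b) / l" using l ab by (simp add: e_def)
  qed
  also have "\<dots> = 3 * D\<^sup>2 * ((1 - exp (- l * (b - a))) / l)"
    by (simp add: e_def power2_eq_square distrib_left)
  finally show ?thesis unfolding y_def .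
qed

section \<open>Meshes and fractional kernels\<close>

text \<open>Unlike \<open>time_mesh\<close> this prescribes no final time, so every initial segment
  of a mesh is again a mesh. The energy argument is run up to each mesh point separately.\<close>

definition mesh :: "(nat \<Rightarrow> real) \<Rightarrow> nat \<Rightarrow> bool"
  where "mesh t m \<longleftrightarrow> t 0 = 0 \<and> (\<forall>n\<in>{1..m}. t (n - 1) < t n)"

lemma mesh_step: "mesh t m \<Longrightarrow> n \<in> {1..m} \<Longrightarrow> t (n - 1) < t n"
  unfolding mesh_def by blast

lemma mesh_0: "mesh t m \<Longrightarrow> t 0 = 0"
  unfolding mesh_def by blast

lemma mesh_mono:
  assumes "mesh t m" "i \<le> j" "j \<le> m" shows "t i \<le> t j"
  using assms(2,3)
proof (induction j rule: dec_induct)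
  case (step j)
  have "t j < t (Suc j)" using mesh_step[OF assms(1), of "Suc j"] step by simp
  moreover have "t i \<le> t j" using step by simp
  ultimately show ?case by linarith
qed simp

lemma mesh_nonneg: "mesh t m \<Longrightarrow> n \<le> m \<Longrightarrow> 0 \<le> t n"
  using mesh_mono[of t m 0 n] unfolding mesh_def by (metis zero_le)

lemma LBINT_mesh:
  fixes f :: "real \<Rightarrow> real"
  assumes m: "mesh t m" and f: "bm (t m) f" and "j \<le> m"
  shows "(LBINT s:{0..t j}. f s) = (\<Sum>n\<in>{1..j}. LBINT s:{t (n - 1)..t n}. f s)"
  using assms(3)
proof (induction j)
  case 0
  have "(LBINT s:{0..0}. f s) = (LBINT s:{0<..0}. f s)" by (rule LBINT_Ioc[symmetric])
  also have "\<dots> = 0" by (simp add: set_lebesgue_integral_def)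
  finally show ?case by (simp add: mesh_0[OF m])
next
  case (Suc j)
  have "set_integrable lborel {0..t (Suc j)} f"
    by (rule bm_set_integrable[OF f order_refl mesh_mono[OF m Suc.prems order_refl]])
  then have "(LBINT s:{0..t (Suc j)}. f s) = (LBINT s:{0..t j}. f s) + (LBINT s:{t j..t (Suc j)}. f s)"
    by (rule LBINT_combine[OF _ mesh_nonneg[OF m] mesh_mono[OF m _ Suc.prems]]) (use Suc.prems in auto)
  moreover have "{1..Suc j} = insert (Suc j) {1..j}" by auto
  ultimately show ?case using Suc.IH Suc.prems by simp
qed

lemma LBINT_cong_open:
  fixes f g :: "real \<Rightarrow> 'b::{banach, second_countable_topology}"
  assumes "\<And>s. s \<in> {a<..<b} \<Longrightarrow> f s = g s"
  shows "(LBINT s:{a..b}. f s) = (LBINT s:{a..b}. g s)"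
  unfolding set_lebesgue_integral_def
  by (rule integral_discrete_difference[of "{a, b}"]) (use assms in \<open>auto simp: indicator_def\<close>)

text \<open>The integral of \<open>F' \<bullet> \<theta>\<close> over the mesh, with the derivative moved onto the polynomial pieces
  \<open>\<theta> n\<close>, so that it makes sense for merely continuous \<open>F\<close>.\<close>

definition mesh_pairing :: "(nat \<Rightarrow> real) \<Rightarrow> nat \<Rightarrow> (nat \<Rightarrow> real \<Rightarrow> 'b::{real_inner, banach, second_countable_topology}) \<Rightarrow>
    (nat \<Rightarrow> real \<Rightarrow> 'b) \<Rightarrow> (real \<Rightarrow> 'b) \<Rightarrow> real"
  where "mesh_pairing t m \<theta> \<theta>' F = (\<Sum>n\<in>{1..m}. F (t n) \<bullet> \<theta> n (t n) - F (t (n - 1)) \<bullet> \<theta> n (t (n - 1))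
    - (LBINT s:{t (n - 1)..t n}. F s \<bullet> \<theta>' n s))"

lemma mesh_pairing_eq:
  fixes F F1 v :: "real \<Rightarrow> 'b::{real_inner, banach, second_countable_topology}"
  assumes m: "mesh t m" and v: "bm (t m) v" "\<And>n s. n \<in> {1..m} \<Longrightarrow> s \<in> {t (n - 1)<..<t n} \<Longrightarrow> v s = \<theta> n s"
    and \<theta>: "\<And>n s. n \<in> {1..m} \<Longrightarrow> (\<theta> n has_vector_derivative \<theta>' n s) (at s)"
      "\<And>n. n \<in> {1..m} \<Longrightarrow> continuous_on UNIV (\<theta>' n)"
    and F: "continuous_on UNIV F" "finite S" "\<And>s. s \<notin> S \<Longrightarrow> (F has_vector_derivative F1 s) (at s)" "bm (t m) F1"
  shows "mesh_pairing t m \<theta> \<theta>' F = (LBINT s:{0..t m}. F1 s \<bullet> v s)"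
proof -
  have "F (t n) \<bullet> \<theta> n (t n) - F (t (n - 1)) \<bullet> \<theta> n (t (n - 1)) - (LBINT s:{t (n - 1)..t n}. F s \<bullet> \<theta>' n s)
      = (LBINT s:{t (n - 1)..t n}. F1 s \<bullet> v s)" if n: "n \<in> {1..m}" for n
  proof -
    have I: "0 \<le> t (n - 1)" "t (n - 1) \<le> t n" "t n \<le> t m"
      using mesh_mono[OF m, of "n - 1" n] mesh_mono[OF m, of n m] mesh_nonneg[OF m, of "n - 1"] n by auto
    have \<theta>c: "continuous_on UNIV (\<theta> n)"
      using \<theta>(1)[OF n] by (auto simp: continuous_on_eq_continuous_at intro: has_vector_derivative_continuous)
    have b: "bm (t m) (\<lambda>s. F s \<bullet> \<theta>' n s)" "bm (t m) (\<lambda>s. F1 s \<bullet> \<theta> n s)"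
      by (intro bm_inner F bm_continuous[OF F(1)] bm_continuous[OF \<theta>c] bm_continuous[OF \<theta>(2)[OF n]])+
    have "(LBINT s:{t (n - 1)..t n}. F s \<bullet> \<theta>' n s + F1 s \<bullet> \<theta> n s) = F (t n) \<bullet> \<theta> n (t n) - F (t (n - 1)) \<bullet> \<theta> n (t (n - 1))"
    proof (rule LBINT_FTC[OF F(2) I(2)])
      show "continuous_on {t (n - 1)..t n} (\<lambda>s. F s \<bullet> \<theta> n s)"
        by (intro continuous_intros continuous_on_subset[OF F(1)] continuous_on_subset[OF \<theta>c]) auto
      show "((\<lambda>s. F s \<bullet> \<theta> n s) has_real_derivative F x \<bullet> \<theta>' n x + F1 x \<bullet> \<theta> n x) (at x)"
        if "x \<in> {t (n - 1)<..<t n} - S" for x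
        using that by (intro has_real_derivative_inner F \<theta> n) auto
      show "set_integrable lborel {t (n - 1)..t n} (\<lambda>s. F s \<bullet> \<theta>' n s + F1 s \<bullet> \<theta> n s)"
        by (rule bm_set_integrable[OF bm_add[OF b] I(1,3)])
    qed
    moreover have "(LBINT s:{t (n - 1)..t n}. F1 s \<bullet> \<theta> n s) = (LBINT s:{t (n - 1)..t n}. F1 s \<bullet> v s)"
      by (rule LBINT_cong_open) (simp add: v(2)[OF n])
    ultimately show ?thesis using LBINT_bm_add[OF b I(1,3)] by linarith
  qed
  then have "mesh_pairing t m \<theta> \<theta>' F = (\<Sum>n\<in>{1..m}. LBINT s:{t (n - 1)..t n}. F1 s \<bullet> v s)"
    unfolding mesh_pairing_def by (intro sum.cong refl)
  also have "\<dots> = (LBINT s:{0..t m}. F1 s \<bullet> v s)"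
    by (rule LBINT_mesh[OF m bm_inner[OF F(4) v(1)] order_refl, symmetric])
  finally show ?thesis .
qed

section \<open>Integrals over l of exponential kernels and powers\<close>

lemma LBINT_of_has_integral:
  fixes f :: "real \<Rightarrow> real"
  assumes "(f has_integral I) S" "\<And>x. x \<in> S \<Longrightarrow> 0 \<le> f x" "f \<in> borel_measurable borel" "S \<in> sets borel"
  shows "set_integrable lborel S f" "(LBINT x:S. f x) = I"
proof -
  have [measurable]: "S \<in> sets borel" "f \<in> borel_measurable borel" by fact+
  have "((\<lambda>x. indicator S x * f x) has_integral I) UNIV"
  proof -
    have "(\<lambda>x. indicator S x * f x) = (\<lambda>x. if x \<in> S then f x else 0)" by (auto simp: fun_eq_iff)
    then show ?thesis using assms(1) has_integral_restrict_UNIV[of S f I] by simp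
  qed
  then have "(\<integral>\<^sup>+x. ennreal (indicator S x * f x) \<partial>lborel) = ennreal I"
    by (intro nn_integral_has_integral_lborel) (use assms(2) in \<open>auto simp: indicator_def\<close>)
  then have "has_bochner_integral lborel (\<lambda>x. indicator S x * f x) I"
    by (intro has_bochner_integral_nn_integral has_integral_nonneg[OF assms(1)] AE_I2)
       (use assms(2) in \<open>auto simp: indicator_def\<close>)
  then show "set_integrable lborel S f" "(LBINT x:S. f x) = I"
    by (auto simp: set_integrable_def set_lebesgue_integral_def has_bochner_integral_iff)
qed

lemma Gamma_scaled:
  fixes a r :: real
  assumes "a > 0" "r > 0"
  shows "set_integrable lborel {0<..} (\<lambda>l. l powr (a - 1) * exp (- l * r))"
    and "(LBINT l:{0<..}. l powr (a - 1) * exp (- l * r)) = Gamma a * r powr (- a)"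
proof -
  have 1: "has_bochner_integral lborel (\<lambda>t. indicator {0..} t * t powr (a - 1) / exp t) (Gamma a)"
    by (intro has_bochner_integral_nn_integral Gamma_conv_nn_integral_real[symmetric] AE_I2)
       (use assms Gamma_real_nonneg in \<open>auto intro: less_imp_le Gamma_real_pos\<close>)
  then have "has_bochner_integral lborel (\<lambda>l. indicator {0..} (0 + r * l) * (0 + r * l) powr (a - 1) / exp (0 + r * l)) (Gamma a /\<^sub>R \<bar>r\<bar>)"
    using lborel_has_bochner_integral_real_affine_iff[of r "\<lambda>t. indicator {0..} t * t powr (a - 1) / exp t" "Gamma a" 0] assms by simp
  then have "has_bochner_integral lborel (\<lambda>l. r powr (1 - a) * (indicator {0..} (0 + r * l) * (0 + r * l) powr (a - 1) / exp (0 + r * l))) (r powr (1 - a) * (Gamma a /\<^sub>R \<bar>r\<bar>))"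
    by (rule has_bochner_integral_mult_right)
  moreover have "r powr (1 - a) * (indicator {0..} (0 + r * l) * (0 + r * l) powr (a - 1) / exp (0 + r * l))
      = indicator {0<..} l *\<^sub>R (l powr (a - 1) * exp (- l * r))" for l
  proof (cases "l > 0")
    case True
    have "r powr (1 - a) * (r * l) powr (a - 1) = l powr (a - 1)"
      using True assms by (simp add: powr_mult flip: powr_add mult.assoc)
    then show ?thesis using True assms by (simp add: exp_minus divide_inverse mult.assoc[symmetric] mult.commute[of l])
  next
    case False
    then show ?thesis using assms by (cases "l = 0") (auto simp: indicator_def zero_le_mult_iff)
  qed
  moreover have "r powr (1 - a) * (Gamma a /\<^sub>R \<bar>r\<bar>) = Gamma a * r powr (- a)"
  proof -
    have "r powr (1 - a) = r powr (- a) * r" using assms powr_add[of r "- a" 1] by simp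
    then show ?thesis using assms by simp
  qed
  ultimately have "has_bochner_integral lborel (\<lambda>l. indicator {0<..} l *\<^sub>R (l powr (a - 1) * exp (- l * r))) (Gamma a * r powr (- a))"
    by (simp only:)
  then show "set_integrable lborel {0<..} (\<lambda>l. l powr (a - 1) * exp (- l * r))"
    "(LBINT l:{0<..}. l powr (a - 1) * exp (- l * r)) = Gamma a * r powr (- a)"
    by (auto simp: set_integrable_def set_lebesgue_integral_def has_bochner_integral_iff)
qed

text \<open>For \<open>e = 0\<close> and \<open>e = 1\<close> these are the convolution kernels of \<open>1/(D + l)\<close> and \<open>D/(D + l)\<^sup>2\<close>.\<close>

definition res_kernel :: "real \<Rightarrow> real \<Rightarrow> real \<Rightarrow> real"
  where "res_kernel e l r = (1 - e * (l * r)) * exp (- l * r)"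

text \<open>For x \<ge> 0 the absolute value of 1 - x is at most exp (x / 2), so half of the
  exponential pays for the linear factor. One exponential then dominates both kernels in the Fubini
  arguments.\<close>

lemma res_kernel_bound:
  assumes "e \<in> {0, 1}" "0 \<le> l" "0 \<le> r"
  shows "\<bar>res_kernel e l r\<bar> \<le> exp (- (l / 2) * r)"
proof -
  define x where "x = l * r"
  have x: "0 \<le> x" using assms by (simp add: x_def)
  have q: "1 + x / 2 + (x / 2)\<^sup>2 / 2 \<le> exp (x / 2)" using exp_lower_Taylor_quadratic[of "x / 2"] x by simp
  have sq: "0 \<le> (x - 2)\<^sup>2" by simp
  have "x - 1 \<le> 1 + x / 2 + (x / 2)\<^sup>2 / 2" using sq by (simp add: power2_eq_square algebra_simps)
  moreover have "1 \<le> exp (x / 2)" using x by simp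
  ultimately have "\<bar>1 - x\<bar> \<le> exp (x / 2)" "1 \<le> exp (x / 2)" using q x by (simp_all only: abs_le_iff) linarith+
  then have "\<bar>1 - e * x\<bar> \<le> exp (x / 2)" using assms(1) by auto
  then have "\<bar>1 - e * x\<bar> * exp (- x) \<le> exp (x / 2) * exp (- x)" by (intro mult_right_mono) auto
  also have "\<dots> = exp (- x / 2)" by (simp flip: exp_add)
  finally show ?thesis by (simp add: res_kernel_def x_def abs_mult)
qed

text \<open>Euler's integral for Gamma (1 - \<beta>), and for e = 1 also for Gamma (2 - \<beta>) =
  (1 - \<beta>) Gamma (1 - \<beta>). Passing from e = 0 to e = 1 therefore costs exactly the factor
  \<beta> = 1 - (1 - \<beta>).\<close>

lemma res_kernel_moment:
  fixes \<beta> r e :: real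
  assumes b: "0 < \<beta>" "\<beta> < 1" and r: "r > 0" and e: "e \<in> {0, 1}"
  shows "(LBINT l:{0<..}. l powr (- \<beta>) * res_kernel e l r) = Gamma (1 - \<beta>) * (1 - e * (1 - \<beta>)) * r powr (\<beta> - 1)"
proof -
  have pos: "1 - \<beta> > 0" "2 - \<beta> > 0" using b by auto
  note g1 = Gamma_scaled[OF pos(1) r] and g2 = Gamma_scaled[OF pos(2) r]
  have "(LBINT l:{0<..}. l powr (- \<beta>) * res_kernel e l r)
      = (LBINT l:{0<..}. l powr (1 - \<beta> - 1) * exp (- l * r) - (e * r) * (l powr (2 - \<beta> - 1) * exp (- l * r)))"
  proof (rule set_lebesgue_integral_cong)
    show "\<forall>l. l \<in> {0<..} \<longrightarrow> l powr (- \<beta>) * res_kernel e l r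
        = l powr (1 - \<beta> - 1) * exp (- l * r) - (e * r) * (l powr (2 - \<beta> - 1) * exp (- l * r))"
    proof (intro allI impI)
      fix l :: real assume "l \<in> {0<..}"
      then have "l powr (2 - \<beta> - 1) = l powr (- \<beta>) * l" using powr_add[of l "- \<beta>" 1] by simp
      then show "l powr (- \<beta>) * res_kernel e l r = l powr (1 - \<beta> - 1) * exp (- l * r) - (e * r) * (l powr (2 - \<beta> - 1) * exp (- l * r))"
        by (simp add: res_kernel_def left_diff_distrib right_diff_distrib)
    qed
  qed simp
  also have "\<dots> = Gamma (1 - \<beta>) * r powr (- (1 - \<beta>)) - (e * r) * (Gamma (2 - \<beta>) * r powr (- (2 - \<beta>)))"
  proof -
    have "set_integrable lborel {0<..} (\<lambda>l. (e * r) * (l powr (2 - \<beta> - 1) * exp (- l * r)))"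
      by (intro set_integrable_mult_right g2)
    from set_integral_diff(2)[OF g1(1) this] show ?thesis
      by (simp only: set_integral_mult_right g1(2) g2(2))
  qed
  also have "Gamma (2 - \<beta>) = (1 - \<beta>) * Gamma (1 - \<beta>)"
    using Gamma_plus1[of "1 - \<beta>"] b nonpos_Ints_nonpos[of "1 - \<beta>"] by fastforce
  also have "(e * r) * ((1 - \<beta>) * Gamma (1 - \<beta>) * r powr (- (2 - \<beta>))) = e * (1 - \<beta>) * Gamma (1 - \<beta>) * (r * r powr (\<beta> - 2))"
    by simp
  also have "r * r powr (\<beta> - 2) = r powr (\<beta> - 1)" using powr_add[of r 1 "\<beta> - 2"] r by simp
  finally show ?thesis by (simp add: algebra_simps)
qed

text \<open>Splitting at l = 1/k, the lower part contributes k powr \<beta> / (1 - \<beta>) and the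
  upper part k powr \<beta> / \<beta>. This power of k complements the power k powr (1 - \<beta>) in
  the bound for the square of \<eta>.\<close>

lemma powr_min_integrable:
  fixes \<beta> k :: real
  assumes b: "0 < \<beta>" "\<beta> < 1" and k: "k > 0"
  shows "set_integrable lborel {0<..} (\<lambda>l. l powr (- \<beta>) * min k (1 / l))"
    and "(LBINT l:{0<..}. l powr (- \<beta>) * min k (1 / l)) \<le> (1 / (1 - \<beta>) + 1 / \<beta>) * k powr \<beta>"
proof -
  have "((\<lambda>l. l powr (- \<beta>)) has_integral ((1 / k) powr (- \<beta> + 1) / (- \<beta> + 1))) {0..1 / k}"
    using b k by (intro has_integral_powr_from_0) auto
  note p1 = LBINT_of_has_integral[OF this]
  have "((\<lambda>l. l powr (- \<beta> - 1)) has_integral (- ((1 / k) powr (- \<beta> - 1 + 1)) / (- \<beta> - 1 + 1))) {1 / k..}"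
    using b k by (intro has_integral_powr_to_inf) auto
  note p2 = LBINT_of_has_integral[OF this]
  define g where "g l = indicator {0..1 / k} l * (k * l powr (- \<beta>)) + indicator {1 / k..} l * l powr (- \<beta> - 1)" for l
  have i1: "integrable lborel (\<lambda>l. indicator {0..1 / k} l * (k * l powr (- \<beta>)))"
    using p1(1) by (simp add: set_integrable_def mult.left_commute)
  have i2: "integrable lborel (\<lambda>l. indicator {1 / k..} l * l powr (- \<beta> - 1))"
    using p2(1) by (simp add: set_integrable_def)
  have g: "integrable lborel g" unfolding g_def by (intro Bochner_Integration.integrable_add i1 i2)
  have le: "indicator {0<..} l *\<^sub>R (l powr (- \<beta>) * min k (1 / l)) \<le> g l" for l
  proof (cases "l > 0")
    case True
    have "l powr (- \<beta>) * min k (1 / l) \<le> k * l powr (- \<beta>)"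
      using mult_left_mono[of "min k (1 / l)" k "l powr (- \<beta>)"] by (simp add: mult.commute)
    moreover have "l powr (- \<beta>) * min k (1 / l) \<le> l powr (- \<beta> - 1)"
    proof -
      have "l powr (- \<beta> - 1) = l powr (- \<beta>) * (1 / l)" using True by (simp add: powr_diff)
      moreover have "l powr (- \<beta>) * min k (1 / l) \<le> l powr (- \<beta>) * (1 / l)"
        by (intro mult_left_mono) auto
      ultimately show ?thesis by (simp only:)
    qed
    moreover have "0 \<le> k * l powr (- \<beta>)" "0 \<le> l powr (- \<beta> - 1)" using k by auto
    ultimately show ?thesis using True unfolding g_def by (cases "l \<le> 1 / k") (auto simp: indicator_def)
  next
    case False
    then show ?thesis using k by (simp add: g_def)
  qed
  have ge: "0 \<le> indicator {0<..} l *\<^sub>R (l powr (- \<beta>) * min k (1 / l))" for l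
    using k by (cases "l > 0") auto
  show i: "set_integrable lborel {0<..} (\<lambda>l. l powr (- \<beta>) * min k (1 / l))"
    unfolding set_integrable_def
    by (rule Bochner_Integration.integrable_bound[OF g]) (use le ge in \<open>auto intro!: AE_I2 order_trans[OF _ abs_ge_self]\<close>)
  have "(LBINT l:{0<..}. l powr (- \<beta>) * min k (1 / l)) \<le> (LINT l|lborel. g l)"
    using i unfolding set_lebesgue_integral_def set_integrable_def by (rule integral_mono[OF _ g le])
  also have "\<dots> = k * ((1 / k) powr (- \<beta> + 1) / (- \<beta> + 1)) + - ((1 / k) powr (- \<beta> - 1 + 1)) / (- \<beta> - 1 + 1)"
  proof -
    have "(LINT l|lborel. indicator {0..1 / k} l * (k * l powr (- \<beta>))) = k * ((1 / k) powr (- \<beta> + 1) / (- \<beta> + 1))"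
      using p1(2) by (simp add: set_lebesgue_integral_def mult.left_commute)
    moreover have "(LINT l|lborel. indicator {1 / k..} l * l powr (- \<beta> - 1)) = - ((1 / k) powr (- \<beta> - 1 + 1)) / (- \<beta> - 1 + 1)"
      using p2(2) by (simp add: set_lebesgue_integral_def)
    ultimately show ?thesis unfolding g_def by (simp only: Bochner_Integration.integral_add[OF i1 i2])
  qed
  also have "\<dots> = (1 / (1 - \<beta>) + 1 / \<beta>) * k powr \<beta>"
  proof -
    have "(1 / k) powr (- \<beta>) = k powr \<beta>" using k by (simp add: powr_divide powr_minus_divide)
    moreover have "(1 / k) powr (- \<beta> + 1) = k powr \<beta> / k" using k calculation powr_add[of "1 / k" "- \<beta>" 1] by simp
    ultimately show ?thesis using k b by (simp add: distrib_right)
  qed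
  finally show "(LBINT l:{0<..}. l powr (- \<beta>) * min k (1 / l)) \<le> (1 / (1 - \<beta>) + 1 / \<beta>) * k powr \<beta>" .
qed

section \<open>Lower bounds for the fractional pairing\<close>

definition res_conv :: "real \<Rightarrow> real \<Rightarrow> (real \<Rightarrow> 'b::{banach, second_countable_topology}) \<Rightarrow> real \<Rightarrow> 'b"
  where "res_conv e l v t = (LBINT s:{..t}. res_kernel e l (t - s) *\<^sub>R v s)"

lemma res_conv_0: "res_conv 0 l v = conv_exp l v"
  by (simp add: fun_eq_iff res_conv_def conv_exp_eq res_kernel_def)

lemma res_conv_1:
  assumes "pw T v"
  shows "res_conv 1 l v t = conv_exp l v t - l *\<^sub>R conv_texp l v t"
proof -
  have i: "set_integrable lborel {..t} (\<lambda>s. exp (- l * (t - s)) *\<^sub>R v s)"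
    by (rule set_integrable_pw[OF pw_continuous_mult[OF _ assms]]) (intro continuous_intros, simp)
  have j: "set_integrable lborel {..t} (\<lambda>s. l *\<^sub>R ((t - s) * exp (- l * (t - s))) *\<^sub>R v s)"
    by (rule set_integrable_pw[OF pw_continuous_mult[OF _ pw_continuous_mult[OF _ assms]]]) (intro continuous_intros, intro continuous_intros, simp)
  have "res_conv 1 l v t = (LBINT s:{..t}. exp (- l * (t - s)) *\<^sub>R v s - l *\<^sub>R ((t - s) * exp (- l * (t - s))) *\<^sub>R v s)"
  proof -
    have "res_kernel 1 l (t - s) = exp (- l * (t - s)) - l * ((t - s) * exp (- l * (t - s)))" for s
      by (simp add: res_kernel_def algebra_simps)
    then show ?thesis unfolding res_conv_def by (simp only: scaleR_left_diff_distrib scaleR_scaleR)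
  qed
  also have "\<dots> = conv_exp l v t - l *\<^sub>R conv_texp l v t"
    unfolding conv_exp_eq conv_texp_eq[OF assms] set_integral_scaleR_right[symmetric]
    by (rule set_integral_diff(2)[OF i j])
  finally show ?thesis .
qed

lemma one_minus_exp_le:
  fixes l k :: real
  assumes "l > 0" "0 \<le> k"
  shows "(1 - exp (- l * k)) / l \<le> min k (1 / l)"
proof -
  have "1 - exp (- l * k) \<le> l * k" using exp_ge_add_one_self[of "- l * k"] by simp
  then have "(1 - exp (- l * k)) / l \<le> k" using assms by (simp add: pos_divide_le_eq mult.commute)
  moreover have "(1 - exp (- l * k)) / l \<le> 1 / l" using assms by (intro divide_right_mono) auto
  ultimately show ?thesis by simp
qed

text \<open>The factor 2 comes from the halved exponent in \<open>res_kernel_bound\<close>. The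
  decay in 1/l gives integrability against l powr (- \<beta>) at infinity, the bound by \<tau> gives
  it at 0.\<close>

lemma res_conv_bound:
  assumes v: "pw \<tau> v" and B: "\<And>s. norm (v s) \<le> B" and l: "l > 0" and e: "e \<in> {0, 1}" and t: "0 \<le> t" "t \<le> \<tau>"
  shows "norm (res_conv e l v t) \<le> B * min \<tau> (2 / l)"
proof -
  have B0: "B \<ge> 0" using B[of 0] norm_ge_zero order_trans by blast
  have i: "integrable lborel (\<lambda>s. indicator {0..t} s * (exp (- (l / 2) * (t - s)) * B))"
  proof -
    have "set_integrable lborel {0..t} (\<lambda>s. exp (- (l / 2) * (t - s)) * B)"
      by (intro borel_integrable_atLeastAtMost' continuous_intros)
    then show ?thesis by (simp add: set_integrable_def)
  qed
  have "norm (res_conv e l v t) \<le> (LINT s|lborel. norm (indicator {..t} s *\<^sub>R res_kernel e l (t - s) *\<^sub>R v s))"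
    unfolding res_conv_def set_lebesgue_integral_def by (rule integral_norm_bound)
  also have "\<dots> \<le> (LINT s|lborel. indicator {0..t} s * (exp (- (l / 2) * (t - s)) * B))"
  proof (rule integral_mono'[OF i])
    fix s
    show "norm (indicator {..t} s *\<^sub>R res_kernel e l (t - s) *\<^sub>R v s) \<le> indicator {0..t} s * (exp (- (l / 2) * (t - s)) * B)"
    proof (cases "s \<in> {0..t}")
      case True
      then have "\<bar>res_kernel e l (t - s)\<bar> * norm (v s) \<le> exp (- (l / 2) * (t - s)) * B"
        using l by (intro mult_mono B res_kernel_bound[OF e]) auto
      then show ?thesis using True by simp
    next
      case False
      then have "indicator {..t} s *\<^sub>R res_kernel e l (t - s) *\<^sub>R v s = 0"
        using v by (auto simp: pw_def indicator_def)
      then show ?thesis using B0 by (simp only: norm_zero) simp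
    qed
    show "0 \<le> indicator {0..t} s * (exp (- (l / 2) * (t - s)) * B)" using B0 by simp
  qed
  also have "\<dots> = (LBINT s:{0..t}. exp (- (l / 2) * (t - s))) * B"
    unfolding set_lebesgue_integral_def
    by (simp only: real_scaleR_def mult.assoc[symmetric] integral_mult_left_zero)
  also have "\<dots> = (1 - exp (- (l / 2) * t)) / (l / 2) * B"
    using LBINT_exp[of "l / 2" 0 t] l t by simp
  also have "\<dots> \<le> min \<tau> (2 / l) * B"
    using one_minus_exp_le[of "l / 2" t] l t B0 by (intro mult_right_mono) auto
  finally show ?thesis by (simp add: mult.commute)
qed

lemma res_conv_measurable:
  fixes v :: "real \<Rightarrow> 'b::{banach, second_countable_topology}"
  assumes [measurable]: "v \<in> borel_measurable borel"
  shows "(\<lambda>(l, t). res_conv e l v t) \<in> borel_measurable (borel \<Otimes>\<^sub>M borel)"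
proof -
  have "(\<lambda>p. LINT s|lborel. (if s \<le> snd p then res_kernel e (fst p) (snd p - s) else 0) *\<^sub>R v s)
      \<in> borel_measurable (borel \<Otimes>\<^sub>M borel)"
    unfolding res_kernel_def
    by (rule lborel.borel_measurable_lebesgue_integral) measurable
  moreover have "(\<lambda>p. LINT s|lborel. (if s \<le> snd p then res_kernel e (fst p) (snd p - s) else 0) *\<^sub>R v s)
      = (\<lambda>(l, t). res_conv e l v t)"
    unfolding fun_eq_iff res_conv_def set_lebesgue_integral_def
    by (auto intro!: Bochner_Integration.integral_cong simp: indicator_def)
  ultimately show ?thesis by (simp only:)
qed

text \<open>The density of the superposition. The restriction to l > 0 is built in, so that
  integrals in l range over the whole line and Fubini applies on a product of two copies of
  \<open>lborel\<close>.\<close>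

definition res_weight :: "real \<Rightarrow> real \<Rightarrow> real"
  where "res_weight \<beta> l = indicator {0<..} l * l powr (- \<beta>)"

lemma res_weight_measurable [measurable]: "res_weight \<beta> \<in> borel_measurable borel"
  unfolding res_weight_def[abs_def] by measurable

lemma res_weight_nonneg: "0 \<le> res_weight \<beta> l"
  by (simp add: res_weight_def)

lemma res_weight_min_integrable:
  assumes "0 < \<beta>" "\<beta> < 1" "k > 0"
  shows "integrable lborel (\<lambda>l. res_weight \<beta> l * min k (1 / l))"
    "(LINT l|lborel. res_weight \<beta> l * min k (1 / l)) \<le> (1 / (1 - \<beta>) + 1 / \<beta>) * k powr \<beta>"
  using powr_min_integrable[OF assms]
  by (simp_all add: set_integrable_def set_lebesgue_integral_def res_weight_def mult.assoc)

lemma powr_shift_integrable: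
  fixes \<beta> t :: real
  assumes "0 < \<beta>" "0 \<le> t"
  shows "integrable lborel (\<lambda>s. indicator {0..t} s * (t - s) powr (\<beta> - 1))"
proof -
  have "((\<lambda>l. l powr (\<beta> - 1)) has_integral (t powr (\<beta> - 1 + 1) / (\<beta> - 1 + 1))) {0..t}"
    using assms by (intro has_integral_powr_from_0) auto
  then have "set_integrable lborel {0..t} (\<lambda>l. l powr (\<beta> - 1))"
    by (rule LBINT_of_has_integral(1)) auto
  then have i: "integrable lborel (\<lambda>l. indicator {0..t} l * l powr (\<beta> - 1))"
    by (simp add: set_integrable_def)
  have "integrable lborel (\<lambda>s. indicator {0..t} (t + (- 1) * s) * (t + (- 1) * s) powr (\<beta> - 1))"
    by (rule lborel_integrable_real_affine[OF i]) simp
  moreover have "indicator {0..t} (t + (- 1) * s) * (t + (- 1) * s) powr (\<beta> - 1) = indicator {0..t} s * (t - s) powr (\<beta> - 1)" for s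
    by (auto simp: indicator_def)
  ultimately show ?thesis by (simp only:)
qed

text \<open>The fractional integral of order \<beta> without its factor 1 / Gamma \<beta>. It may
  start at minus infinity because \<open>pw\<close> functions vanish on the negative axis.\<close>

definition frac_conv :: "real \<Rightarrow> (real \<Rightarrow> 'b::{banach, second_countable_topology}) \<Rightarrow> real \<Rightarrow> 'b"
  where "frac_conv \<beta> v t = (LBINT s:{..t}. (t - s) powr (\<beta> - 1) *\<^sub>R v s)"

text \<open>Fubini for the moment formula. The product is dominated by a multiple of l powr (-
  \<beta>) * exp (- l * (t - s) / 2), whose l-integral is a multiple of (t - s) powr (\<beta> - 1)
  and hence integrable in s.\<close>

lemma frac_conv_representation:
  fixes v :: "real \<Rightarrow> 'b::{banach, second_countable_topology}"
  assumes b: "0 < \<beta>" "\<beta> < 1" and e: "e \<in> {0, 1}" and v: "pw \<tau> v" and t: "0 \<le> t"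
  shows "integrable lborel (\<lambda>l. res_weight \<beta> l *\<^sub>R res_conv e l v t)"
    "(LINT l|lborel. res_weight \<beta> l *\<^sub>R res_conv e l v t) = (Gamma (1 - \<beta>) * (1 - e * (1 - \<beta>))) *\<^sub>R frac_conv \<beta> v t"
proof -
  define C where "C = Gamma (1 - \<beta>) * (1 - e * (1 - \<beta>))"
  define G where "G = Gamma (1 - \<beta>)"
  have G: "G > 0" unfolding G_def using b by (intro Gamma_real_pos) simp
  have pos: "1 - \<beta> > 0" using b by simp
  have [measurable]: "v \<in> borel_measurable borel" by (rule pw_borel[OF v])
  obtain B where B: "\<And>s. norm (v s) \<le> B" using v unfolding pw_def by blast
  have B0: "B \<ge> 0" using B[of 0] norm_ge_zero order_trans by blast
  define f where "f s l = (res_weight \<beta> l * (if s < t then res_kernel e l (t - s) else 0)) *\<^sub>R v s" for s l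
  have fm: "case_prod f \<in> borel_measurable (lborel \<Otimes>\<^sub>M lborel)"
    unfolding f_def res_kernel_def by measurable
  have dom: "integrable lborel (\<lambda>l. B * (res_weight \<beta> l * exp (- l * (r / 2))))"
      "(LINT l|lborel. B * (res_weight \<beta> l * exp (- l * (r / 2)))) = B * (G * (r / 2) powr (\<beta> - 1))" if r: "r > 0" for r
    using Gamma_scaled[OF pos, of "r / 2"] r
    by (simp_all add: set_integrable_def set_lebesgue_integral_def res_weight_def mult.assoc G_def)
  have nf: "norm (f s l) \<le> B * (res_weight \<beta> l * exp (- l * ((t - s) / 2)))" if "s < t" for s l
  proof (cases "l > 0")
    case True
    have "\<bar>res_kernel e l (t - s)\<bar> * norm (v s) \<le> exp (- (l / 2) * (t - s)) * B"
      using True that by (intro mult_mono B res_kernel_bound[OF e]) auto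
    from mult_left_mono[OF this res_weight_nonneg[of \<beta> l]] show ?thesis
      using that by (simp add: f_def abs_mult res_weight_nonneg mult_ac)
  next
    case False
    then show ?thesis by (simp add: f_def res_weight_def)
  qed
  have f0: "f s l = 0" if "s \<ge> t \<or> s \<notin> {0<..<\<tau>}" for s l
    using that v unfolding f_def pw_def by (metis mult_zero_right not_le scaleR_zero_left scaleR_zero_right)
  have fi: "integrable lborel (\<lambda>l. f s l)" for s
  proof (cases "s < t")
    case True
    show ?thesis
    proof (rule Bochner_Integration.integrable_bound[OF dom(1)[of "t - s"]])
      show "AE l in lborel. norm (f s l) \<le> norm (B * (res_weight \<beta> l * exp (- l * ((t - s) / 2))))"
        using nf[OF True] by (auto intro!: AE_I2 order_trans[OF _ abs_ge_self])
      show "f s \<in> borel_measurable lborel" unfolding f_def res_kernel_def by measurable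
    qed (use True in simp)
  next
    case False
    then have "f s = (\<lambda>l. 0)" using f0 by (auto simp: fun_eq_iff)
    then show ?thesis by simp
  qed
  have F: "integrable (lborel \<Otimes>\<^sub>M lborel) (case_prod f)"
  proof (rule lborel_pair.Fubini_integrable[OF fm])
    show "AE s in lborel. integrable lborel (\<lambda>l. case_prod f (s, l))" using fi by simp
    define c where "c = B * G * (1 / 2) powr (\<beta> - 1)"
    show "integrable lborel (\<lambda>s. LINT l|lborel. norm (case_prod f (s, l)))"
    proof (rule Bochner_Integration.integrable_bound)
      show "integrable lborel (\<lambda>s. c * (indicator {0..t} s * (t - s) powr (\<beta> - 1)))"
        by (intro integrable_mult_right powr_shift_integrable b t)
      show "(\<lambda>s. LINT l|lborel. norm (case_prod f (s, l))) \<in> borel_measurable lborel"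
        by (rule lborel.borel_measurable_lebesgue_integral) (use fm in \<open>auto intro!: borel_measurable_norm simp: case_prod_beta'\<close>)
      show "AE s in lborel. norm (LINT l|lborel. norm (case_prod f (s, l))) \<le> norm (c * (indicator {0..t} s * (t - s) powr (\<beta> - 1)))"
      proof (rule AE_I2)
        fix s
        have "(LINT l|lborel. norm (f s l)) \<le> c * (indicator {0..t} s * (t - s) powr (\<beta> - 1))"
        proof (cases "0 < s \<and> s < t")
          case True
          have "(LINT l|lborel. norm (f s l)) \<le> (LINT l|lborel. B * (res_weight \<beta> l * exp (- l * ((t - s) / 2))))"
            by (intro integral_mono integrable_norm fi dom nf) (use True in auto)
          also have "\<dots> = B * (G * ((t - s) / 2) powr (\<beta> - 1))" by (rule dom(2)) (use True in simp)
          also have "((t - s) / 2) powr (\<beta> - 1) = (1 / 2) powr (\<beta> - 1) * (t - s) powr (\<beta> - 1)"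
            using powr_mult[of "1 / 2" "t - s" "\<beta> - 1"] True by simp
          finally show ?thesis using True by (simp add: c_def)
        next
          case False
          then have "f s = (\<lambda>l. 0)" using f0[of s] by (auto simp: fun_eq_iff)
          then show ?thesis using B0 G by (simp add: c_def)
        qed
        moreover have "0 \<le> (LINT l|lborel. norm (f s l))" by (rule integral_nonneg_AE) simp
        ultimately show "norm (LINT l|lborel. norm (case_prod f (s, l))) \<le> norm (c * (indicator {0..t} s * (t - s) powr (\<beta> - 1)))"
          by simp
      qed
    qed
  qed
  have inner_s: "(LINT s|lborel. f s l) = res_weight \<beta> l *\<^sub>R res_conv e l v t" for l
  proof -
    have "(LINT s|lborel. f s l) = (LINT s|lborel. res_weight \<beta> l *\<^sub>R (indicator {..t} s *\<^sub>R res_kernel e l (t - s) *\<^sub>R v s))"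
      by (rule integral_discrete_difference[of "{t}"]) (auto simp: f_def indicator_def)
    then show ?thesis by (simp only: res_conv_def set_lebesgue_integral_def integral_scaleR_right)
  qed
  have inner_l: "(LINT l|lborel. f s l) = (if s < t then (C * (t - s) powr (\<beta> - 1)) *\<^sub>R v s else 0)" for s
  proof (cases "s < t")
    case True
    have "(LINT l|lborel. f s l) = (LINT l|lborel. (res_weight \<beta> l * res_kernel e l (t - s)) *\<^sub>R v s)"
      using True by (simp add: f_def)
    also have "\<dots> = (LINT l|lborel. res_weight \<beta> l * res_kernel e l (t - s)) *\<^sub>R v s"
    proof (rule integral_scaleR_left)
      show "integrable lborel (\<lambda>l. res_weight \<beta> l * res_kernel e l (t - s))"
      proof (rule Bochner_Integration.integrable_bound)
        show "integrable lborel (\<lambda>l. res_weight \<beta> l * exp (- l * ((t - s) / 2)))"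
          using Gamma_scaled(1)[OF pos, of "(t - s) / 2"] True
          by (simp add: set_integrable_def res_weight_def mult.assoc)
        show "AE l in lborel. norm (res_weight \<beta> l * res_kernel e l (t - s)) \<le> norm (res_weight \<beta> l * exp (- l * ((t - s) / 2)))"
        proof (rule AE_I2)
          fix l
          show "norm (res_weight \<beta> l * res_kernel e l (t - s)) \<le> norm (res_weight \<beta> l * exp (- l * ((t - s) / 2)))"
          proof (cases "l > 0")
            case l: True
            then show ?thesis using res_kernel_bound[OF e, of l "t - s"] True
              by (simp add: abs_mult res_weight_nonneg mult_left_mono)
          qed (simp add: res_weight_def)
        qed
        show "(\<lambda>l. res_weight \<beta> l * res_kernel e l (t - s)) \<in> borel_measurable lborel"
          unfolding res_kernel_def by measurable
      qed
    qed
    also have "(LINT l|lborel. res_weight \<beta> l * res_kernel e l (t - s)) = C * (t - s) powr (\<beta> - 1)"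
      using res_kernel_moment[OF b, of "t - s" e] e True
      by (simp add: set_lebesgue_integral_def res_weight_def mult.assoc C_def)
    finally show ?thesis using True by simp
  qed (simp add: f_def)
  show "integrable lborel (\<lambda>l. res_weight \<beta> l *\<^sub>R res_conv e l v t)"
    using lborel_pair.integrable_snd[OF F] unfolding inner_s .
  have "(LINT l|lborel. res_weight \<beta> l *\<^sub>R res_conv e l v t) = (LINT s|lborel. (if s < t then (C * (t - s) powr (\<beta> - 1)) *\<^sub>R v s else 0))"
    using lborel_pair.Fubini_integral[OF F] unfolding inner_s inner_l .
  also have "\<dots> = (LINT s|lborel. C *\<^sub>R (indicator {..t} s *\<^sub>R (t - s) powr (\<beta> - 1) *\<^sub>R v s))"
    by (rule integral_discrete_difference[of "{t}"]) (auto simp: indicator_def)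
  also have "\<dots> = C *\<^sub>R frac_conv \<beta> v t"
    by (simp only: frac_conv_def set_lebesgue_integral_def integral_scaleR_right)
  finally show "(LINT l|lborel. res_weight \<beta> l *\<^sub>R res_conv e l v t) = (Gamma (1 - \<beta>) * (1 - e * (1 - \<beta>))) *\<^sub>R frac_conv \<beta> v t"
    unfolding C_def .
qed

text \<open>The superposition in l is carried through the pairing term by term. This works for the
  undifferentiated form of the pairing because \<open>res_conv_bound\<close> gives decay in 1/l,
  which makes the double integrals absolutely convergent.\<close>

lemma mesh_pairing_representation:
  fixes v :: "real \<Rightarrow> 'b::{real_inner, banach, second_countable_topology}"
  assumes b: "0 < \<beta>" "\<beta> < 1" and e: "e \<in> {0, 1}" and m: "mesh t m" "t m > 0" and v: "pw (t m) v"
    and \<theta>: "\<And>n. n \<in> {1..m} \<Longrightarrow> continuous_on UNIV (\<theta>' n)"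
  shows "integrable lborel (\<lambda>l. res_weight \<beta> l * mesh_pairing t m \<theta> \<theta>' (res_conv e l v))"
    "(LINT l|lborel. res_weight \<beta> l * mesh_pairing t m \<theta> \<theta>' (res_conv e l v))
      = Gamma (1 - \<beta>) * (1 - e * (1 - \<beta>)) * mesh_pairing t m \<theta> \<theta>' (frac_conv \<beta> v)"
proof -
  define C where "C = Gamma (1 - \<beta>) * (1 - e * (1 - \<beta>))"
  define \<tau> where "\<tau> = t m"
  have v': "pw \<tau> v" using v by (simp add: \<tau>_def)
  have [measurable]: "v \<in> borel_measurable borel" by (rule pw_borel[OF v])
  obtain B where B: "\<And>s. norm (v s) \<le> B" using v unfolding pw_def by blast
  have B0: "B \<ge> 0" using B[of 0] norm_ge_zero order_trans by blast
  have point: "integrable lborel (\<lambda>l. res_weight \<beta> l * (res_conv e l v s \<bullet> c))"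
      "(LINT l|lborel. res_weight \<beta> l * (res_conv e l v s \<bullet> c)) = C * (frac_conv \<beta> v s \<bullet> c)" if "0 \<le> s" for s c
    using integrable_inner_left[of c lborel "\<lambda>l. res_weight \<beta> l *\<^sub>R res_conv e l v s"]
      integral_inner_left[of c lborel "\<lambda>l. res_weight \<beta> l *\<^sub>R res_conv e l v s"]
      frac_conv_representation[OF b e v that] by (simp_all add: C_def)
  have seg: "integrable lborel (\<lambda>l. res_weight \<beta> l * (LBINT s:{a..d}. res_conv e l v s \<bullet> x s))"
      "(LINT l|lborel. res_weight \<beta> l * (LBINT s:{a..d}. res_conv e l v s \<bullet> x s)) = C * (LBINT s:{a..d}. frac_conv \<beta> v s \<bullet> x s)"
    if ad: "0 \<le> a" "a \<le> d" "d \<le> \<tau>" and x: "continuous_on UNIV x" for a d x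
  proof -
    have [measurable]: "x \<in> borel_measurable borel" by (rule borel_measurable_continuous_onI[OF x])
    obtain X where X: "\<And>s. s \<in> {0..\<tau>} \<Longrightarrow> norm (x s) \<le> X" using bm_continuous[OF x, of \<tau>] unfolding bm_def by blast
    have "norm (x a) \<le> X" using X[of a] ad by simp
    then have X0: "X \<ge> 0" using norm_ge_zero[of "x a"] by linarith
    define g where "g l s = res_weight \<beta> l * (indicator {a..d} s * (res_conv e l v s \<bullet> x s))" for l s
    \<comment> \<open>The bound min \<tau> (2 / l) is written as 2 * min (\<tau> / 2) (1 / l) to fit
      \<open>res_weight_min_integrable\<close>.\<close>
    define M where "M l = 2 * B * X * (res_weight \<beta> l * min (\<tau> / 2) (1 / l))" for l
    have Mi: "integrable lborel M"
      unfolding M_def by (intro integrable_mult_right res_weight_min_integrable b) (use m in \<open>simp add: \<tau>_def\<close>)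
    have M0: "0 \<le> M l" for l
      unfolding M_def res_weight_def using B0 X0 m by (cases "l > 0") (auto simp: \<tau>_def)
    have gb: "\<bar>g l s\<bar> \<le> M l * indicator {a..d} s" for l s
    proof (cases "l > 0 \<and> s \<in> {a..d}")
      case True
      then have s: "0 \<le> s" "s \<le> \<tau>" using ad by auto
      have "\<bar>res_conv e l v s \<bullet> x s\<bar> \<le> norm (res_conv e l v s) * norm (x s)" by (rule Cauchy_Schwarz_ineq2)
      also have "\<dots> \<le> (B * min \<tau> (2 / l)) * X"
        by (intro mult_mono' res_conv_bound[OF v' B _ e s] X) (use True s in auto)
      also have "min \<tau> (2 / l) = 2 * min (\<tau> / 2) (1 / l)" by (simp add: min_def)
      finally have "res_weight \<beta> l * \<bar>res_conv e l v s \<bullet> x s\<bar> \<le> res_weight \<beta> l * (B * (2 * min (\<tau> / 2) (1 / l)) * X)"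
        by (rule mult_left_mono[OF _ res_weight_nonneg])
      then show ?thesis using True by (simp add: g_def M_def abs_mult res_weight_nonneg mult_ac)
    next
      case False
      then show ?thesis using M0[of l] by (auto simp: g_def res_weight_def)
    qed
    have gm: "case_prod g \<in> borel_measurable (lborel \<Otimes>\<^sub>M lborel)"
    proof -
      have [measurable]: "(\<lambda>p. res_conv e (fst p) v (snd p)) \<in> borel_measurable (borel \<Otimes>\<^sub>M borel)"
        using res_conv_measurable[of v e] by (simp add: case_prod_beta')
      show ?thesis unfolding g_def case_prod_beta' by measurable
    qed
    have rcm [measurable]: "(\<lambda>s. res_conv e l v s) \<in> borel_measurable borel" for l
      using measurable_compose[OF _ res_conv_measurable[of v e], of "\<lambda>s. (l, s)" borel] by simp
    have ind: "integrable lborel (\<lambda>s. M l * indicator {a..d} s)" for l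
      by (intro integrable_mult_right integrable_real_indicator) (auto simp: emeasure_lborel_Icc_eq)
    have gi: "integrable lborel (g l)" for l
    proof (rule Bochner_Integration.integrable_bound[OF ind[of l]])
      show "g l \<in> borel_measurable lborel" unfolding g_def by measurable
      show "AE s in lborel. norm (g l s) \<le> norm (M l * indicator {a..d} s)"
        using gb M0 by (auto intro!: AE_I2)
    qed
    have F: "integrable (lborel \<Otimes>\<^sub>M lborel) (case_prod g)"
    proof (rule lborel_pair.Fubini_integrable[OF gm])
      show "AE l in lborel. integrable lborel (\<lambda>s. case_prod g (l, s))" using gi by simp
      show "integrable lborel (\<lambda>l. LINT s|lborel. norm (case_prod g (l, s)))"
      proof (rule Bochner_Integration.integrable_bound[OF integrable_mult_left[OF Mi, of "d - a"]])
        show "(\<lambda>l. LINT s|lborel. norm (case_prod g (l, s))) \<in> borel_measurable lborel"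
          by (rule lborel.borel_measurable_lebesgue_integral) (use gm in \<open>auto intro!: borel_measurable_norm simp: case_prod_beta'\<close>)
        show "AE l in lborel. norm (LINT s|lborel. norm (case_prod g (l, s))) \<le> norm (M l * (d - a))"
        proof (rule AE_I2)
          fix l
          have "(LINT s|lborel. \<bar>g l s\<bar>) \<le> (LINT s|lborel. M l * indicator {a..d} s)"
            using gb by (intro integral_mono integrable_abs gi ind)
          also have "\<dots> = M l * (d - a)" using ad by simp
          finally show "norm (LINT s|lborel. norm (case_prod g (l, s))) \<le> norm (M l * (d - a))"
            using M0[of l] ad by (simp add: integral_nonneg_AE)
        qed
      qed
    qed
    have inner_s: "(LINT s|lborel. g l s) = res_weight \<beta> l * (LBINT s:{a..d}. res_conv e l v s \<bullet> x s)" for l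
      by (simp add: g_def set_lebesgue_integral_def)
    have inner_l: "(LINT l|lborel. g l s) = C * (indicator {a..d} s * (frac_conv \<beta> v s \<bullet> x s))" for s
    proof (cases "s \<in> {a..d}")
      case True
      then show ?thesis using point(2)[of s "x s"] ad by (simp add: g_def)
    qed (simp add: g_def)
    show "integrable lborel (\<lambda>l. res_weight \<beta> l * (LBINT s:{a..d}. res_conv e l v s \<bullet> x s))"
      using lborel_pair.integrable_fst[OF F] unfolding inner_s .
    show "(LINT l|lborel. res_weight \<beta> l * (LBINT s:{a..d}. res_conv e l v s \<bullet> x s)) = C * (LBINT s:{a..d}. frac_conv \<beta> v s \<bullet> x s)"
      using lborel_pair.Fubini_integral[OF F] unfolding inner_s inner_l by (simp add: set_lebesgue_integral_def)
  qed
  define T where "T n l = res_weight \<beta> l * (res_conv e l v (t n) \<bullet> \<theta> n (t n)) - res_weight \<beta> l * (res_conv e l v (t (n - 1)) \<bullet> \<theta> n (t (n - 1)))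
    - res_weight \<beta> l * (LBINT s:{t (n - 1)..t n}. res_conv e l v s \<bullet> \<theta>' n s)" for n l
  have I: "0 \<le> t (n - 1)" "t (n - 1) \<le> t n" "0 \<le> t n" "t n \<le> \<tau>" if "n \<in> {1..m}" for n
    using mesh_mono[OF m(1), of "n - 1" n] mesh_mono[OF m(1), of n m] mesh_nonneg[OF m(1), of "n - 1"] mesh_nonneg[OF m(1), of n] that
    by (auto simp: \<tau>_def)
  have Ti: "integrable lborel (T n)" if n: "n \<in> {1..m}" for n
    unfolding T_def
    by (intro Bochner_Integration.integrable_diff point(1)[OF I(3)[OF n]] point(1)[OF I(1)[OF n]] seg(1)[OF I(1,2,4)[OF n] \<theta>[OF n]])
  have Tv: "(LINT l|lborel. T n l) = C * (frac_conv \<beta> v (t n) \<bullet> \<theta> n (t n) - frac_conv \<beta> v (t (n - 1)) \<bullet> \<theta> n (t (n - 1))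
    - (LBINT s:{t (n - 1)..t n}. frac_conv \<beta> v s \<bullet> \<theta>' n s))" if n: "n \<in> {1..m}" for n
    unfolding T_def
    using point[OF I(3)[OF n], of "\<theta> n (t n)"] point[OF I(1)[OF n], of "\<theta> n (t (n - 1))"] seg[OF I(1,2,4)[OF n] \<theta>[OF n]]
    by (simp add: right_diff_distrib)
  have eq: "res_weight \<beta> l * mesh_pairing t m \<theta> \<theta>' (res_conv e l v) = (\<Sum>n\<in>{1..m}. T n l)" for l
    unfolding mesh_pairing_def T_def sum_distrib_left right_diff_distrib ..
  show "integrable lborel (\<lambda>l. res_weight \<beta> l * mesh_pairing t m \<theta> \<theta>' (res_conv e l v))"
    unfolding eq by (intro Bochner_Integration.integrable_sum Ti)
  have "(LINT l|lborel. (\<Sum>n\<in>{1..m}. T n l)) = (\<Sum>n\<in>{1..m}. LINT l|lborel. T n l)"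
    by (intro Bochner_Integration.integral_sum Ti)
  also have "\<dots> = C * mesh_pairing t m \<theta> \<theta>' (frac_conv \<beta> v)"
    unfolding mesh_pairing_def sum_distrib_left by (intro sum.cong refl Tv)
  finally show "(LINT l|lborel. res_weight \<beta> l * mesh_pairing t m \<theta> \<theta>' (res_conv e l v))
      = Gamma (1 - \<beta>) * (1 - e * (1 - \<beta>)) * mesh_pairing t m \<theta> \<theta>' (frac_conv \<beta> v)"
    unfolding eq C_def .
qed


lemma mesh_cover:
  assumes m: "mesh t m" and "n \<le> m" "0 < s" "s < t n"
  obtains j where "j \<in> {1..n}" "s \<in> {t (j - 1)<..<t j} \<or> s = t j"
proof -
  define j where "j = (LEAST j. s \<le> t j)"
  have j: "s \<le> t j" unfolding j_def by (rule LeastI[of _ n]) (use assms in simp)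
  have jn: "j \<le> n" unfolding j_def by (rule Least_le) (use assms in simp)
  have j0: "j \<noteq> 0" using j assms(3) mesh_0[OF m] by (cases j) auto
  then have "\<not> s \<le> t (j - 1)" unfolding j_def by (intro not_less_Least) (simp add: j_def[symmetric])
  then have "s \<in> {t (j - 1)<..<t j} \<or> s = t j" using j by auto
  then show ?thesis using that[of j] jn j0 by auto
qed

lemma sum_mesh_steps: "mesh t m \<Longrightarrow> (\<Sum>n\<in>{1..m}. t n - t (n - 1)) = t m"
proof -
  assume m: "mesh t m"
  have "(\<Sum>n\<in>{1..j}. t n - t (n - 1)) = t j - t 0" for j
  proof (induction j)
    case (Suc j)
    have "{1..Suc j} = insert (Suc j) {1..j}" by auto
    then show ?case using Suc by simp
  qed simp
  then show ?thesis using mesh_0[OF m] by simp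
qed

text \<open>Both claims integrate inequalities for a single l against l powr (- \<beta>): S l is the
  pairing of D/(D + l) \<theta> with \<theta>, and Q l that of D^2/(D + l)^2 \<eta> with \<theta>.
  The functions V n control the variation of \<eta> and the numbers D n its size; their monotonicity
  in n lets the current interval bound the whole past.\<close>

lemma mesh_pairing_energy:
  fixes \<theta> \<eta> :: "real \<Rightarrow> 'b::{real_inner, banach, second_countable_topology}"
  assumes b: "0 < \<beta>" "\<beta> < 1" and m: "mesh t m" "t m > 0"
    and \<theta>: "pw (t m) \<theta>" "\<And>n s. n \<in> {1..m} \<Longrightarrow> s \<in> {t (n - 1)<..<t n} \<Longrightarrow> \<theta> s = q n s"
    and q: "\<And>n s. n \<in> {1..m} \<Longrightarrow> (q n has_vector_derivative q' n s) (at s)"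
      "\<And>n. n \<in> {1..m} \<Longrightarrow> continuous_on UNIV (q' n)"
    and \<eta>: "pw (t m) \<eta>" "\<And>n. n \<le> m \<Longrightarrow> \<eta> (t n) = 0"
    and V: "\<And>n. n \<in> {1..m} \<Longrightarrow> continuous_on UNIV (V n)"
      "\<And>n s. n \<in> {1..m} \<Longrightarrow> s \<in> {t (n - 1)..t n} \<Longrightarrow> 0 \<le> V n s \<and> V n s \<le> D n"
    and D: "\<And>i j. 1 \<le> i \<Longrightarrow> i \<le> j \<Longrightarrow> j \<le> m \<Longrightarrow> D i \<le> D j"
      "\<And>n s. n \<in> {1..m} \<Longrightarrow> s \<in> {t (n - 1)<..<t n} \<Longrightarrow> norm (\<eta> s) \<le> D n"
      "\<And>n. n \<in> {1..m} \<Longrightarrow> (D n)\<^sup>2 \<le> M * (t n - t (n - 1)) powr (1 - \<beta>)"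
    and inc: "\<And>n r s. n \<in> {1..m} \<Longrightarrow> t (n - 1) < s \<Longrightarrow> s \<le> r \<Longrightarrow> r < t n \<Longrightarrow> norm (\<eta> r - \<eta> s) \<le> V n r - V n s"
  shows "1 / (10 * (1 - \<beta>) * Gamma (1 - \<beta>)) * t m powr (\<beta> - 1) * (LBINT s:{0..t m}. (norm (\<theta> s))\<^sup>2)
      \<le> mesh_pairing t m q q' (frac_conv \<beta> \<theta>)" (is ?coercive)
    and "- (mesh_pairing t m q q' (frac_conv \<beta> \<theta>) / 2
        + 3 / (2 * \<beta>\<^sup>2 * Gamma (1 - \<beta>)) * (1 / (1 - \<beta>) + 1 / \<beta>) * M * t m)
      \<le> mesh_pairing t m q q' (frac_conv \<beta> \<eta>)" (is ?bound)
proof -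
  define \<tau> where "\<tau> = t m"
  have \<tau>: "0 < \<tau>" "0 \<le> \<tau>" using m by (auto simp: \<tau>_def)
  note p\<theta> = \<theta>(1)[folded \<tau>_def] and p\<eta> = \<eta>(1)[folded \<tau>_def]
  define G where "G = Gamma (1 - \<beta>)"
  have G: "G > 0" unfolding G_def using b by (intro Gamma_real_pos) simp
  define S where "S l = mesh_pairing t m q q' (res_conv 0 l \<theta>)" for l
  define Q where "Q l = mesh_pairing t m q q' (res_conv 1 l \<eta>)" for l
  define N where "N = (LBINT s:{0..\<tau>}. (norm (\<theta> s))\<^sup>2)"
  define z1 where "z1 l s = l *\<^sub>R backward_exp l \<tau> \<theta> s - \<theta> s" for l s
  define y1 where "y1 l s = \<eta> s - l *\<^sub>R conv_exp l \<eta> s" for l s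
  define Z where "Z l = (LBINT s:{0..\<tau>}. (norm (z1 l s))\<^sup>2)" for l
  define Y where "Y l = (LBINT s:{0..\<tau>}. (norm (y1 l s))\<^sup>2)" for l
  have "N \<ge> 0" unfolding N_def set_lebesgue_integral_def by (intro integral_nonneg_AE) auto
  have Z0: "Z l \<ge> 0" for l unfolding Z_def set_lebesgue_integral_def by (intro integral_nonneg_AE) auto
  obtain S\<theta> where S\<theta>: "finite S\<theta>" "\<And>s. s \<notin> S\<theta> \<Longrightarrow> isCont \<theta> s" by (rule pw_exceptional_set[OF p\<theta>]) (rule that)
  obtain S\<eta> where S\<eta>: "finite S\<eta>" "\<And>s. s \<notin> S\<eta> \<Longrightarrow> isCont \<eta> s" by (rule pw_exceptional_set[OF p\<eta>]) (rule that)
  have S_eq: "S l = (LBINT s:{0..\<tau>}. (\<theta> s - l *\<^sub>R conv_exp l \<theta> s) \<bullet> \<theta> s)" for l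
  proof -
    have b\<theta>: "bm (t m) (\<lambda>s. \<theta> s - l *\<^sub>R conv_exp l \<theta> s)"
      by (intro bm_intros pw_bm[OF \<theta>(1)] bm_continuous[OF continuous_conv_exp[OF \<theta>(1)]])
    show ?thesis
      unfolding S_def res_conv_0 \<tau>_def
      by (rule mesh_pairing_eq[OF m(1) pw_bm[OF \<theta>(1)] \<theta>(2) q continuous_conv_exp[OF \<theta>(1)] S\<theta>(1)
          conv_exp_derivative[OF \<theta>(1) S\<theta>(2)]]) (assumption | rule b\<theta>)+
  qed
  have SZ: "Z l \<le> S l" and SN: "l * \<tau> \<le> 1 \<Longrightarrow> N \<le> 10 * Z l" if "l > 0" for l
    unfolding S_eq Z_def N_def z1_def using backward_energy[OF p\<theta> \<tau>(2) that] by blast+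
  have S_int: "integrable lborel (\<lambda>l. res_weight \<beta> l * S l)"
    and S_val: "(LINT l|lborel. res_weight \<beta> l * S l) = G * mesh_pairing t m q q' (frac_conv \<beta> \<theta>)"
    using mesh_pairing_representation[OF b _ m \<theta>(1) q(2), where e = 0 and \<theta> = q] unfolding S_def G_def by simp_all
  have Q_int: "integrable lborel (\<lambda>l. res_weight \<beta> l * Q l)"
    and Q_val: "(LINT l|lborel. res_weight \<beta> l * Q l) = G * \<beta> * mesh_pairing t m q q' (frac_conv \<beta> \<eta>)"
    using mesh_pairing_representation[OF b _ m \<eta>(1) q(2), where e = 1 and \<theta> = q] unfolding Q_def G_def by simp_all
  show ?coercive
  proof -
    \<comment> \<open>Only l \<le> 1/\<tau> is exploited: there S l \<ge> Z l \<ge> N / 10, and for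
      larger l it suffices that S l \<ge> 0. The weight over this range integrates to \<tau> powr
      (\<beta> - 1) / (1 - \<beta>).\<close>
    have hi: "((\<lambda>l. l powr (- \<beta>)) has_integral ((1 / \<tau>) powr (- \<beta> + 1) / (- \<beta> + 1))) {0..1 / \<tau>}"
      using b \<tau> by (intro has_integral_powr_from_0) auto
    have w1: "set_integrable lborel {0..1 / \<tau>} (\<lambda>l. l powr (- \<beta>))"
      "(LBINT l:{0..1 / \<tau>}. l powr (- \<beta>)) = (1 / \<tau>) powr (- \<beta> + 1) / (- \<beta> + 1)"
      by (rule LBINT_of_has_integral[OF hi]; simp)+
    have "N / 10 * (LBINT l:{0..1 / \<tau>}. l powr (- \<beta>)) = (LINT l|lborel. N / 10 * (indicator {0..1 / \<tau>} l * l powr (- \<beta>)))"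
      by (simp add: set_lebesgue_integral_def)
    also have "\<dots> \<le> (LINT l|lborel. res_weight \<beta> l * S l)"
    proof (rule integral_mono[OF _ S_int])
      show "integrable lborel (\<lambda>l. N / 10 * (indicator {0..1 / \<tau>} l * l powr (- \<beta>)))"
        using w1(1) by (intro integrable_mult_right) (simp add: set_integrable_def)
      fix l
      show "N / 10 * (indicator {0..1 / \<tau>} l * l powr (- \<beta>)) \<le> res_weight \<beta> l * S l"
      proof (cases "l > 0")
        case True
        show ?thesis
        proof (cases "l \<le> 1 / \<tau>")
          case le: True
          then have "l * \<tau> \<le> 1" using \<tau> by (simp add: pos_le_divide_eq)
          then have "N / 10 \<le> S l" using SZ[OF True] SN[OF True] by linarith
          from mult_right_mono[OF this powr_ge_zero[of l "- \<beta>"]] show ?thesis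
            using True le by (simp add: res_weight_def mult.commute)
        next
          case False
          have "0 \<le> S l" using SZ[OF True] Z0[of l] by linarith
          then show ?thesis using False by (simp add: res_weight_nonneg)
        qed
      next
        case False
        then show ?thesis by (cases "l = 0") (simp_all add: res_weight_def)
      qed
    qed
    finally have "N / 10 * ((1 / \<tau>) powr (- \<beta> + 1) / (- \<beta> + 1)) \<le> G * mesh_pairing t m q q' (frac_conv \<beta> \<theta>)"
      unfolding w1 S_val .
    moreover have "(1 / \<tau>) powr (- \<beta> + 1) = \<tau> powr (\<beta> - 1)"
      using \<tau> powr_minus_divide[of \<tau> "1 - \<beta>"] by (simp add: powr_divide)
    ultimately have "N / 10 * (\<tau> powr (\<beta> - 1) / (1 - \<beta>)) \<le> mesh_pairing t m q q' (frac_conv \<beta> \<theta>) * G"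
      by (simp add: mult.commute)
    then have "N / 10 * (\<tau> powr (\<beta> - 1) / (1 - \<beta>)) / G \<le> mesh_pairing t m q q' (frac_conv \<beta> \<theta>)"
      by (subst pos_divide_le_eq[OF G])
    moreover have "N / 10 * (\<tau> powr (\<beta> - 1) / (1 - \<beta>)) / G = 1 / (10 * (1 - \<beta>) * G) * \<tau> powr (\<beta> - 1) * N"
      by simp
    ultimately show ?thesis unfolding N_def G_def \<tau>_def by (simp only:)
  qed
  show ?bound
  proof -
    define k where "k n = t n - t (n - 1)" for n
    have k: "k n > 0" if "n \<in> {1..m}" for n using mesh_step[OF m(1) that] by (simp add: k_def)
    have M0: "M * k n powr (1 - \<beta>) \<ge> 0" if "n \<in> {1..m}" for n
      using D(3)[OF that] zero_le_power2[of "D n"] unfolding k_def by linarith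
    \<comment> \<open>The square of D n is already replaced by M k powr (1 - \<beta>). Integration
      in l then produces k powr (1 - \<beta>) * k powr \<beta> = k n, and these lengths add up to t
      m.\<close>
    define R where "R l = (\<Sum>n\<in>{1..m}. 3 * (M * k n powr (1 - \<beta>)) * min (k n) (1 / l))" for l
    have YR: "Y l \<le> R l" if l: "l > 0" for l
    proof -
      have by1: "bm (t m) (\<lambda>s. \<eta> s \<bullet> y1 l s)"
        unfolding y1_def by (intro bm_intros pw_bm[OF \<eta>(1)] bm_continuous[OF continuous_conv_exp[OF \<eta>(1)]])
      have "Y l \<le> (LBINT s:{0..t m}. \<eta> s \<bullet> y1 l s)"
        using forward_energy[OF p\<eta> \<tau>(2) l] unfolding Y_def y1_def \<tau>_def .
      also have "\<dots> = (\<Sum>n\<in>{1..m}. LBINT s:{t (n - 1)..t n}. \<eta> s \<bullet> y1 l s)"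
        by (rule LBINT_mesh[OF m(1) by1 order_refl])
      also have "\<dots> \<le> R l"
        unfolding R_def
      proof (rule sum_mono)
        fix n assume n: "n \<in> {1..m}"
        \<comment> \<open>The local bound needs control of the whole history: earlier intervals are
          covered by monotonicity of D, mesh points by the normalisation \<eta> = 0 there.\<close>
        have D0: "norm (\<eta> s) \<le> D n" if s: "s \<in> {0<..<t n}" for s
        proof -
          obtain j where j: "j \<in> {1..n}" "s \<in> {t (j - 1)<..<t j} \<or> s = t j"
            by (rule mesh_cover[OF m(1), of n s]) (use n s in auto)
          have Dn: "0 \<le> D n"
            using V(2)[OF n, of "t n"] mesh_step[OF m(1) n] by auto
          from j(2) show ?thesis
          proof
            assume "s \<in> {t (j - 1)<..<t j}"
            then have "norm (\<eta> s) \<le> D j" using D(2)[of j s] j n by auto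
            also have "D j \<le> D n" using D(1)[of j n] j n by auto
            finally show ?thesis .
          next
            assume "s = t j"
            then show ?thesis using \<eta>(2)[of j] j n Dn by auto
          qed
        qed
        have "(LBINT s:{t (n - 1)..t n}. \<eta> s \<bullet> y1 l s) \<le> 3 * (D n)\<^sup>2 * ((1 - exp (- l * (t n - t (n - 1)))) / l)"
          unfolding y1_def
          by (rule forward_local_bound[OF \<eta>(1) l _ mesh_step[OF m(1) n] _ V(1)[OF n] V(2)[OF n] D0 inc[OF n]])
             (use mesh_nonneg[OF m(1), of "n - 1"] mesh_mono[OF m(1), of n m] n in auto)
        also have "\<dots> \<le> 3 * (M * k n powr (1 - \<beta>)) * min (k n) (1 / l)"
        proof (intro mult_mono)
          show "(D n)\<^sup>2 \<le> M * k n powr (1 - \<beta>)" unfolding k_def by (rule D(3)[OF n])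
          show "(1 - exp (- l * (t n - t (n - 1)))) / l \<le> min (k n) (1 / l)"
            unfolding k_def by (rule one_minus_exp_le[OF l]) (use mesh_step[OF m(1) n] in simp)
          show "0 \<le> (1 - exp (- l * (t n - t (n - 1)))) / l" using l mesh_step[OF m(1) n] by simp
        qed (use M0[OF n] in auto)
        finally show "(LBINT s:{t (n - 1)..t n}. \<eta> s \<bullet> y1 l s) \<le> 3 * (M * k n powr (1 - \<beta>)) * min (k n) (1 / l)" .
      qed
      finally show ?thesis .
    qed
    \<comment> \<open>Young's parameter is \<beta>. The representation of the \<eta> pairing carries
      a factor \<beta> that the one of the \<theta> pairing lacks, so after division by it exactly
      one half of the \<theta> pairing is spent.\<close>
    have Q_ge: "- (\<beta> / 2 * S l + 1 / (2 * \<beta>) * R l) \<le> Q l" if l: "l > 0" for l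
    proof -
      let ?q = "\<lambda>s. conv_exp l \<eta> s - l *\<^sub>R conv_texp l \<eta> s"
      have qc: "continuous_on UNIV ?q"
        by (intro continuous_intros continuous_conv_exp[OF \<eta>(1)] continuous_conv_texp[OF \<eta>(1)])
      have "res_conv 1 l \<eta> = ?q" using res_conv_1[OF \<eta>(1)] by (simp add: fun_eq_iff)
      then have "Q l = mesh_pairing t m q q' ?q" by (simp add: Q_def)
      also have "\<dots> = (LBINT s:{0..t m}. (y1 l s - l *\<^sub>R ?q s) \<bullet> \<theta> s)"
      proof (rule mesh_pairing_eq[OF m(1) pw_bm[OF \<theta>(1)] \<theta>(2) q qc S\<eta>(1)])
        show "(?q has_vector_derivative y1 l s - l *\<^sub>R ?q s) (at s)" if "s \<notin> S\<eta>" for s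
          unfolding y1_def
          by (intro has_vector_derivative_diff conv_exp_derivative[OF \<eta>(1) S\<eta>(2)[OF that]]
              bounded_linear.has_vector_derivative[OF bounded_linear_scaleR_right] conv_texp_derivative[OF \<eta>(1) S\<eta>(2)[OF that]])
        show "bm (t m) (\<lambda>s. y1 l s - l *\<^sub>R ?q s)"
          unfolding y1_def by (intro bm_intros pw_bm[OF \<eta>(1)] bm_continuous[OF qc] bm_continuous[OF continuous_conv_exp[OF \<eta>(1)]])
      qed
      finally have "Q l \<ge> - (\<beta> / 2 * Z l + 1 / (2 * \<beta>) * Y l)"
        using backward_lower_bound[OF p\<theta> p\<eta> \<tau>(2) b(1), of l] unfolding Z_def Y_def z1_def y1_def \<tau>_def by linarith
      moreover have "\<beta> / 2 * Z l \<le> \<beta> / 2 * S l" using SZ[OF l] b by (intro mult_left_mono) auto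
      moreover have "1 / (2 * \<beta>) * Y l \<le> 1 / (2 * \<beta>) * R l" using YR[OF l] b by (intro mult_left_mono) auto
      ultimately show ?thesis by linarith
    qed
    have R_int: "integrable lborel (\<lambda>l. res_weight \<beta> l * R l)"
      and R_val: "(LINT l|lborel. res_weight \<beta> l * R l) \<le> 3 * M * ((1 / (1 - \<beta>) + 1 / \<beta>) * t m)"
    proof -
      have e: "res_weight \<beta> l * R l = (\<Sum>n\<in>{1..m}. 3 * (M * k n powr (1 - \<beta>)) * (res_weight \<beta> l * min (k n) (1 / l)))" for l
        unfolding R_def sum_distrib_left by (intro sum.cong refl) simp
      have i: "integrable lborel (\<lambda>l. 3 * (M * k n powr (1 - \<beta>)) * (res_weight \<beta> l * min (k n) (1 / l)))" if "n \<in> {1..m}" for n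
        by (intro integrable_mult_right res_weight_min_integrable b k that)
      show "integrable lborel (\<lambda>l. res_weight \<beta> l * R l)"
        unfolding e by (intro Bochner_Integration.integrable_sum i)
      have "(LINT l|lborel. res_weight \<beta> l * R l)
          = (\<Sum>n\<in>{1..m}. LINT l|lborel. 3 * (M * k n powr (1 - \<beta>)) * (res_weight \<beta> l * min (k n) (1 / l)))"
        unfolding e by (intro Bochner_Integration.integral_sum i)
      also have "\<dots> = (\<Sum>n\<in>{1..m}. 3 * (M * k n powr (1 - \<beta>)) * (LINT l|lborel. res_weight \<beta> l * min (k n) (1 / l)))"
        by (simp only: integral_mult_right_zero)
      also have "\<dots> \<le> (\<Sum>n\<in>{1..m}. 3 * M * (1 / (1 - \<beta>) + 1 / \<beta>) * k n)"
      proof (rule sum_mono)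
        fix n assume n: "n \<in> {1..m}"
        have "3 * (M * k n powr (1 - \<beta>)) * (LINT l|lborel. res_weight \<beta> l * min (k n) (1 / l))
            \<le> 3 * (M * k n powr (1 - \<beta>)) * ((1 / (1 - \<beta>) + 1 / \<beta>) * k n powr \<beta>)"
          using M0[OF n] by (intro mult_left_mono res_weight_min_integrable b k n) auto
        also have "\<dots> = 3 * M * (1 / (1 - \<beta>) + 1 / \<beta>) * (k n powr (1 - \<beta>) * k n powr \<beta>)" by simp
        also have "k n powr (1 - \<beta>) * k n powr \<beta> = k n" using k[OF n] by (simp flip: powr_add)
        finally show "3 * (M * k n powr (1 - \<beta>)) * (LINT l|lborel. res_weight \<beta> l * min (k n) (1 / l))
            \<le> 3 * M * (1 / (1 - \<beta>) + 1 / \<beta>) * k n" .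
      qed
      also have "\<dots> = 3 * M * ((1 / (1 - \<beta>) + 1 / \<beta>) * t m)"
        unfolding sum_distrib_left[symmetric] k_def sum_mesh_steps[OF m(1)] by (simp only: mult.assoc)
      finally show "(LINT l|lborel. res_weight \<beta> l * R l) \<le> 3 * M * ((1 / (1 - \<beta>) + 1 / \<beta>) * t m)" .
    qed
    define A where "A = mesh_pairing t m q q' (frac_conv \<beta> \<theta>)"
    define E where "E = mesh_pairing t m q q' (frac_conv \<beta> \<eta>)"
    define X where "X = (1 / (1 - \<beta>) + 1 / \<beta>) * t m"
    have le: "(LINT l|lborel. (- (\<beta> / 2)) * (res_weight \<beta> l * S l) + (- (1 / (2 * \<beta>))) * (res_weight \<beta> l * R l))
        \<le> (LINT l|lborel. res_weight \<beta> l * Q l)"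
    proof (rule integral_mono[OF _ Q_int])
      show "integrable lborel (\<lambda>l. (- (\<beta> / 2)) * (res_weight \<beta> l * S l) + (- (1 / (2 * \<beta>))) * (res_weight \<beta> l * R l))"
        by (intro Bochner_Integration.integrable_add integrable_mult_right S_int R_int)
      fix l
      show "(- (\<beta> / 2)) * (res_weight \<beta> l * S l) + (- (1 / (2 * \<beta>))) * (res_weight \<beta> l * R l) \<le> res_weight \<beta> l * Q l"
      proof (cases "l > 0")
        case True
        have "(- (\<beta> / 2)) * (res_weight \<beta> l * S l) + (- (1 / (2 * \<beta>))) * (res_weight \<beta> l * R l)
            = res_weight \<beta> l * (- (\<beta> / 2 * S l + 1 / (2 * \<beta>) * R l))" by (simp add: algebra_simps)
        also have "\<dots> \<le> res_weight \<beta> l * Q l" by (rule mult_left_mono[OF Q_ge[OF True] res_weight_nonneg])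
        finally show ?thesis .
      qed (simp add: res_weight_def)
    qed
    have eq: "(LINT l|lborel. (- (\<beta> / 2)) * (res_weight \<beta> l * S l) + (- (1 / (2 * \<beta>))) * (res_weight \<beta> l * R l))
        = (- (\<beta> / 2)) * (LINT l|lborel. res_weight \<beta> l * S l) + (- (1 / (2 * \<beta>))) * (LINT l|lborel. res_weight \<beta> l * R l)"
      by (simp only: Bochner_Integration.integral_add[OF integrable_mult_right[OF S_int] integrable_mult_right[OF R_int]] integral_mult_right_zero)
    have "(- (\<beta> / 2)) * (G * A) + (- (1 / (2 * \<beta>))) * (LINT l|lborel. res_weight \<beta> l * R l) \<le> G * \<beta> * E"
      using le unfolding eq S_val Q_val A_def E_def .
    moreover have "1 / (2 * \<beta>) * (LINT l|lborel. res_weight \<beta> l * R l) \<le> 1 / (2 * \<beta>) * (3 * M * X)"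
      unfolding X_def using R_val b by (intro mult_left_mono) auto
    ultimately have "- (\<beta> / 2 * (G * A) + 1 / (2 * \<beta>) * (3 * M * X)) \<le> (G * \<beta>) * E" by linarith
    then have "- (\<beta> / 2 * (G * A) + 1 / (2 * \<beta>) * (3 * M * X)) / (G * \<beta>) \<le> E"
      using G b by (subst pos_divide_le_eq) (simp_all add: mult.commute)
    moreover have "- (\<beta> / 2 * (G * A) + 1 / (2 * \<beta>) * (3 * M * X)) / (G * \<beta>) = - (A / 2 + 3 / (2 * \<beta>\<^sup>2 * G) * M * X)"
    proof -
      have "\<beta> / 2 * (G * A) / (G * \<beta>) = A / 2" using G b by simp
      moreover have "1 / (2 * \<beta>) * (3 * M * X) / (G * \<beta>) = 3 / (2 * \<beta>\<^sup>2 * G) * M * X"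
        by (simp add: power2_eq_square)
      ultimately show ?thesis by (simp only: minus_divide_left[symmetric] add_divide_distrib)
    qed
    ultimately have "- (A / 2 + 3 / (2 * \<beta>\<^sup>2 * G) * M * X) \<le> E" by (simp only:)
    moreover have "3 / (2 * \<beta>\<^sup>2 * G) * M * X = 3 / (2 * \<beta>\<^sup>2 * G) * (1 / (1 - \<beta>) + 1 / \<beta>) * M * t m"
      unfolding X_def by (simp only: ac_simps)
    ultimately show ?thesis unfolding A_def E_def G_def by (simp only:)
  qed
qed

section \<open>Fractional integrals of absolutely continuous functions\<close>

lemma triangle_product_integrable:
  fixes x g :: "real \<Rightarrow> real"
  assumes x: "integrable lborel x" and g: "integrable lborel g"
  shows "integrable (lborel \<Otimes>\<^sub>M lborel) (\<lambda>(s, r). if s \<le> r then x s * g r else 0)"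
proof -
  have [measurable]: "x \<in> borel_measurable borel" "g \<in> borel_measurable borel" using x g by auto
  have fm: "(\<lambda>(s, r). if s \<le> r then x s * g r else 0) \<in> borel_measurable (lborel \<Otimes>\<^sub>M lborel)" by measurable
  have le: "norm (if s \<le> r then x s * g r else 0) \<le> \<bar>x s\<bar> * \<bar>g r\<bar>" for s r by (simp add: abs_mult)
  have gi: "integrable lborel (\<lambda>r. \<bar>x s\<bar> * \<bar>g r\<bar>)" for s using g by simp
  have fi: "integrable lborel (\<lambda>r. if s \<le> r then x s * g r else 0)" for s
    by (rule Bochner_Integration.integrable_bound[OF gi[of s]]) (use le in \<open>auto intro!: AE_I2 simp: abs_mult\<close>)
  show ?thesis
  proof (rule lborel_pair.Fubini_integrable[OF fm])
    show "AE s in lborel. integrable lborel (\<lambda>r. case (s, r) of (s, r) \<Rightarrow> if s \<le> r then x s * g r else 0)"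
      using fi by simp
    show "integrable lborel (\<lambda>s. LINT r|lborel. norm (case (s, r) of (s, r) \<Rightarrow> if s \<le> r then x s * g r else 0))"
    proof (rule Bochner_Integration.integrable_bound)
      show "integrable lborel (\<lambda>s. \<bar>x s\<bar> * (LINT r|lborel. \<bar>g r\<bar>))" using x by simp
      show "(\<lambda>s. LINT r|lborel. norm (case (s, r) of (s, r) \<Rightarrow> if s \<le> r then x s * g r else 0)) \<in> borel_measurable lborel"
        by measurable
      show "AE s in lborel. norm (LINT r|lborel. norm (case (s, r) of (s, r) \<Rightarrow> if s \<le> r then x s * g r else 0))
          \<le> norm (\<bar>x s\<bar> * (LINT r|lborel. \<bar>g r\<bar>))"
      proof (rule AE_I2)
        fix s
        have "(LINT r|lborel. norm (if s \<le> r then x s * g r else 0)) \<le> (LINT r|lborel. \<bar>x s\<bar> * \<bar>g r\<bar>)"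
          by (intro integral_mono integrable_norm fi gi le)
        then have "(LINT r|lborel. norm (if s \<le> r then x s * g r else 0)) \<le> \<bar>x s\<bar> * (LINT r|lborel. \<bar>g r\<bar>)"
          by (simp only: integral_mult_right_zero)
        moreover have "0 \<le> (LINT r|lborel. norm (if s \<le> r then x s * g r else 0))"
          by (rule integral_nonneg_AE) simp
        ultimately show "norm (LINT r|lborel. norm (case (s, r) of (s, r) \<Rightarrow> if s \<le> r then x s * g r else 0))
            \<le> norm (\<bar>x s\<bar> * (LINT r|lborel. \<bar>g r\<bar>))"
          by simp
      qed
    qed
  qed
qed

text \<open>Fubini on the triangle s \<le> r. Both functions enter only as integrals of their
  densities, so no pointwise derivative is involved.\<close>

lemma integration_by_parts_AC:
  fixes x g X \<Phi> :: "real \<Rightarrow> real"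
  assumes ab: "a \<le> b" and x: "set_integrable lborel {a..b} x" and g: "set_integrable lborel {a..b} g"
    and X: "\<And>r. r \<in> {a..b} \<Longrightarrow> X r = X a + (LBINT s:{a..r}. x s)"
    and \<Phi>: "\<And>r. r \<in> {a..b} \<Longrightarrow> \<Phi> r = \<Phi> a + (LBINT s:{a..r}. g s)"
  shows "set_integrable lborel {a..b} (\<lambda>r. X r * g r)"
    "(LBINT r:{a..b}. X r * g r) = X b * \<Phi> b - X a * \<Phi> a - (LBINT s:{a..b}. x s * \<Phi> s)"
proof -
  define xx where "xx s = indicator {a..b} s * x s" for s
  define gg where "gg s = indicator {a..b} s * g s" for s
  have xi: "integrable lborel xx" and gi: "integrable lborel gg"
    using x g by (simp_all add: set_integrable_def xx_def[abs_def] gg_def[abs_def])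
  note F = triangle_product_integrable[OF xi gi]
  have xint: "(LINT s|lborel. xx s) = X b - X a" and gint: "(LINT s|lborel. gg s) = \<Phi> b - \<Phi> a"
    using X[of b] \<Phi>[of b] ab by (simp_all add: set_lebesgue_integral_def xx_def gg_def)
  have inner_s: "(LINT s|lborel. (if s \<le> r then xx s * gg r else 0)) = X r * gg r - X a * gg r" for r
  proof (cases "r \<in> {a..b}")
    case True
    have "(LINT s|lborel. (if s \<le> r then xx s * gg r else 0)) = (LINT s|lborel. (indicator {a..r} s * x s) * gg r)"
      by (rule Bochner_Integration.integral_cong) (use True in \<open>auto simp: xx_def indicator_def\<close>)
    also have "\<dots> = (LBINT s:{a..r}. x s) * gg r"
      unfolding set_lebesgue_integral_def real_scaleR_def by (rule integral_mult_left_zero)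
    also have "(LBINT s:{a..r}. x s) = X r - X a" using X[OF True] by simp
    finally show ?thesis by (simp add: left_diff_distrib)
  next
    case False
    then have "gg r = 0" by (simp add: gg_def)
    then show ?thesis by (simp cong: if_cong)
  qed
  have inner_r: "(LINT r|lborel. (if s \<le> r then xx s * gg r else 0)) = xx s * \<Phi> b - xx s * \<Phi> s" for s
  proof (cases "s \<in> {a..b}")
    case True
    have "(LINT r|lborel. (if s \<le> r then xx s * gg r else 0)) = (LINT r|lborel. xx s * (indicator {s..b} r * g r))"
      by (rule Bochner_Integration.integral_cong) (use True in \<open>auto simp: gg_def indicator_def\<close>)
    also have "\<dots> = xx s * (LBINT r:{s..b}. g r)"
      unfolding set_lebesgue_integral_def real_scaleR_def by (rule integral_mult_right_zero)
    also have "(LBINT r:{s..b}. g r) = \<Phi> b - \<Phi> s"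
      using LBINT_combine[OF g, of s] True \<Phi>[of b] \<Phi>[OF True] ab by simp
    finally show ?thesis by (simp add: right_diff_distrib)
  next
    case False
    then have "xx s = 0" by (simp add: xx_def)
    then show ?thesis by (simp cong: if_cong)
  qed
  have i1: "integrable lborel (\<lambda>r. X r * gg r - X a * gg r)"
    using lborel_pair.integrable_snd[OF F] unfolding inner_s .
  have "integrable lborel (\<lambda>r. (X r * gg r - X a * gg r) + X a * gg r)"
    by (rule Bochner_Integration.integrable_add[OF i1 integrable_mult_right[OF gi]])
  then have i1': "integrable lborel (\<lambda>r. X r * gg r)" by simp
  then show "set_integrable lborel {a..b} (\<lambda>r. X r * g r)"
    by (simp add: set_integrable_def gg_def mult.left_commute)
  have i2: "integrable lborel (\<lambda>s. xx s * \<Phi> b - xx s * \<Phi> s)"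
    using lborel_pair.integrable_fst[OF F] unfolding inner_r .
  have "integrable lborel (\<lambda>s. xx s * \<Phi> b - (xx s * \<Phi> b - xx s * \<Phi> s))"
    by (rule Bochner_Integration.integrable_diff[OF integrable_mult_left[OF xi] i2])
  then have i2': "integrable lborel (\<lambda>s. xx s * \<Phi> s)" by simp
  have "(LINT r|lborel. X r * gg r - X a * gg r) = (LINT s|lborel. xx s * \<Phi> b - xx s * \<Phi> s)"
    using lborel_pair.Fubini_integral[OF F] unfolding inner_s inner_r .
  then have "(LINT r|lborel. X r * gg r) - X a * (\<Phi> b - \<Phi> a) = (X b - X a) * \<Phi> b - (LINT s|lborel. xx s * \<Phi> s)"
    using i1' i2' xi gi by (simp add: xint gint)
  moreover have "(LINT r|lborel. X r * gg r) = (LBINT r:{a..b}. X r * g r)"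
    by (simp add: set_lebesgue_integral_def gg_def mult.left_commute)
  moreover have "(LINT s|lborel. xx s * \<Phi> s) = (LBINT s:{a..b}. x s * \<Phi> s)"
    by (simp add: set_lebesgue_integral_def xx_def mult.assoc)
  ultimately show "(LBINT r:{a..b}. X r * g r) = X b * \<Phi> b - X a * \<Phi> a - (LBINT s:{a..b}. x s * \<Phi> s)"
    by (simp add: algebra_simps)
qed

lemma powr_interval:
  fixes \<beta> :: real
  assumes b: "0 < \<beta>" and st: "s \<le> t"
  shows "set_integrable lborel {s..t} (\<lambda>r. (r - s) powr (\<beta> - 1))" "(LBINT r:{s..t}. (r - s) powr (\<beta> - 1)) = (t - s) powr \<beta> / \<beta>"
proof -
  have "((\<lambda>l. l powr (\<beta> - 1)) has_integral ((t - s) powr (\<beta> - 1 + 1) / (\<beta> - 1 + 1))) {0..t - s}"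
    using assms by (intro has_integral_powr_from_0) auto
  then have "((\<lambda>l. l powr (\<beta> - 1)) has_integral ((t - s) powr \<beta> / \<beta>)) {0..t - s}" by simp
  from LBINT_of_has_integral[OF this]
  have i: "integrable lborel (\<lambda>l. indicator {0..t - s} l * l powr (\<beta> - 1))"
    and v: "(LINT l|lborel. indicator {0..t - s} l * l powr (\<beta> - 1)) = (t - s) powr \<beta> / \<beta>"
    by (simp_all add: set_integrable_def set_lebesgue_integral_def)
  have e: "indicator {0..t - s} (- s + 1 * r) * (- s + 1 * r) powr (\<beta> - 1) = indicator {s..t} r *\<^sub>R (r - s) powr (\<beta> - 1)" for r
    by (auto simp: indicator_def)
  show "set_integrable lborel {s..t} (\<lambda>r. (r - s) powr (\<beta> - 1))"
    using lborel_integrable_real_affine[OF i, of 1 "- s"] unfolding e set_integrable_def by simp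
  show "(LBINT r:{s..t}. (r - s) powr (\<beta> - 1)) = (t - s) powr \<beta> / \<beta>"
    using lborel_integral_real_affine[of 1 "\<lambda>l. indicator {0..t - s} l * l powr (\<beta> - 1)" "- s"] v
    unfolding e set_lebesgue_integral_def by simp
qed

lemma powr_interval_reflected:
  fixes \<beta> :: real
  assumes b: "0 < \<beta>" and r: "0 \<le> r" "r \<le> t"
  shows "set_integrable lborel {0..r} (\<lambda>s. (t - s) powr (\<beta> - 1))"
    "(LBINT s:{0..r}. (t - s) powr (\<beta> - 1)) = t powr \<beta> / \<beta> - (t - r) powr \<beta> / \<beta>"
proof -
  have i0: "set_integrable lborel {0..t} (\<lambda>s. (t - s) powr (\<beta> - 1))"
  proof -
    have i: "integrable lborel (\<lambda>l. indicator {0..t} l * l powr (\<beta> - 1))"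
      using powr_interval(1)[OF b, of 0 t] r by (simp add: set_integrable_def)
    have e: "indicator {0..t} (t + (- 1) * s) * (t + (- 1) * s) powr (\<beta> - 1) = indicator {0..t} s *\<^sub>R (t - s) powr (\<beta> - 1)" for s
      by (auto simp: indicator_def)
    show ?thesis using lborel_integrable_real_affine[OF i, of "- 1" t] unfolding e set_integrable_def by simp
  qed
  show i: "set_integrable lborel {0..r} (\<lambda>s. (t - s) powr (\<beta> - 1))"
    by (rule set_integrable_subset[OF i0]) (use r in auto)
  have "(LBINT s:{0..r}. (t - s) powr (\<beta> - 1)) = - ((t - r) powr \<beta> / \<beta>) - (- ((t - 0) powr \<beta> / \<beta>))"
  proof (rule LBINT_FTC[of "{}"])
    show "continuous_on {0..r} (\<lambda>s. - ((t - s) powr \<beta> / \<beta>))"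
      by (intro continuous_intros continuous_on_powr') (use r b in auto)
    show "((\<lambda>s. - ((t - s) powr \<beta> / \<beta>)) has_real_derivative (t - x) powr (\<beta> - 1)) (at x)" if "x \<in> {0<..<r} - {}" for x
    proof -
      have "((\<lambda>s. (t - s) powr \<beta>) has_real_derivative (\<beta> * (t - x) powr (\<beta> - 1)) * (- 1)) (at x)"
        by (rule DERIV_chain2[OF has_real_derivative_powr]) (use that r in \<open>auto intro!: derivative_eq_intros\<close>)
      from DERIV_minus[OF DERIV_cdivide[OF this, of \<beta>]] show ?thesis using b by simp
    qed
  qed (use r i in auto)
  then show "(LBINT s:{0..r}. (t - s) powr (\<beta> - 1)) = t powr \<beta> / \<beta> - (t - r) powr \<beta> / \<beta>" by simp
qed

text \<open>Fractional integral of an absolutely continuous function \<open>\<phi>\<close>. The backward difference quotients of the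
  kernel \<open>t powr \<beta> / \<beta>\<close> are dominated by its derivative, which makes those of the fractional
  integral converge almost everywhere; no differentiation theorem for \<open>L\<^sub>1\<close> functions is needed.\<close>

lemma frac_integral_AC:
  fixes \<phi> g :: "real \<Rightarrow> real"
  assumes b: "0 < \<beta>" "\<beta> < 1" and T: "0 < T"
    and g: "set_integrable lborel {0..T} g"
    and \<phi>: "\<And>r. r \<in> {0..T} \<Longrightarrow> \<phi> r = \<phi> 0 + (LBINT s:{0..r}. g s)"
  defines "h \<equiv> \<lambda>t. (LBINT s:{0..t}. (t - s) powr (\<beta> - 1) * \<phi> s)"
  obtains G where "set_integrable lborel {0..T} G"
    "\<And>t. t \<in> {0..T} \<Longrightarrow> h t = (LBINT s:{0..t}. G s)"
    "AE t in lborel. t \<in> {0<..<T} \<longrightarrow> (\<forall>D. (h has_real_derivative D) (at t) \<longrightarrow> D = G t)"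
proof -
  \<comment> \<open>W is the primitive of w; both are extended by 0 to nonpositive arguments, so
    that the convolutions with \<open>gg\<close> range over the whole line.\<close>
  define W where "W t = (if t > 0 then t powr \<beta> / \<beta> else 0)" for t
  define w where "w t = (if t > 0 then t powr (\<beta> - 1) else 0)" for t
  define gg where "gg s = indicator {0..T} s * g s" for s
  have gi: "integrable lborel gg" using g by (simp add: set_integrable_def gg_def[abs_def])
  then have [measurable]: "gg \<in> borel_measurable borel" by auto
  have [measurable]: "w \<in> borel_measurable borel" "W \<in> borel_measurable borel" unfolding w_def W_def by measurable
  have h_eq: "h t = \<phi> 0 * W t + (LINT s|lborel. W (t - s) * gg s)" and hi: "integrable lborel (\<lambda>s. W (t - s) * gg s)"
    if t: "t \<in> {0..T}" for t
  proof -
    have g': "set_integrable lborel {0..t} g" by (rule set_integrable_subset[OF g]) (use t in auto)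
    have X: "- ((t - r) powr \<beta> / \<beta>) = - ((t - 0) powr \<beta> / \<beta>) + (LBINT s:{0..r}. (t - s) powr (\<beta> - 1))" if "r \<in> {0..t}" for r
      using powr_interval_reflected(2)[OF b(1), of r t] that by simp
    have \<phi>': "\<phi> r = \<phi> 0 + (LBINT s:{0..r}. g s)" if "r \<in> {0..t}" for r using \<phi>[of r] that t by auto
    note P = integration_by_parts_AC[OF _ powr_interval_reflected(1)[OF b(1)] g', of t "\<lambda>r. - ((t - r) powr \<beta> / \<beta>)" \<phi>, OF _ _ _ X \<phi>']
    have e: "W (t - s) * gg s = - (indicator {0..t} s *\<^sub>R (- ((t - s) powr \<beta> / \<beta>) * g s))" for s
      using t b by (cases "s = t") (auto simp: W_def gg_def indicator_def)
    have "set_integrable lborel {0..t} (\<lambda>r. - ((t - r) powr \<beta> / \<beta>) * g r)"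
      by (rule P(1)) (use t in auto)
    then show "integrable lborel (\<lambda>s. W (t - s) * gg s)" unfolding e set_integrable_def by (rule Bochner_Integration.integrable_minus)
    have "(LBINT r:{0..t}. - ((t - r) powr \<beta> / \<beta>) * g r)
        = - ((t - t) powr \<beta> / \<beta>) * \<phi> t - - ((t - 0) powr \<beta> / \<beta>) * \<phi> 0 - (LBINT s:{0..t}. (t - s) powr (\<beta> - 1) * \<phi> s)"
      by (rule P(2)) (use t in auto)
    moreover have "(LINT s|lborel. W (t - s) * gg s) = - (LBINT r:{0..t}. - ((t - r) powr \<beta> / \<beta>) * g r)"
      unfolding e set_lebesgue_integral_def by simp
    moreover have "W t = t powr \<beta> / \<beta>" using t b by (cases "t = 0") (auto simp: W_def)
    ultimately show "h t = \<phi> 0 * W t + (LINT s|lborel. W (t - s) * gg s)"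
      unfolding h_def using b by simp
  qed
  define f where "f s r = (if r \<le> T then w (r - s) * gg s else 0)" for s r
  have w_int: "integrable lborel (\<lambda>r. if r \<le> t then w (r - s) else 0)" and w_val: "(LINT r|lborel. (if r \<le> t then w (r - s) else 0)) = W (t - s)" for s t
  proof -
    have e: "(if r \<le> t then w (r - s) else 0) = indicator {s..t} r *\<^sub>R (r - s) powr (\<beta> - 1)" for r
      by (auto simp: w_def indicator_def)
    show "integrable lborel (\<lambda>r. if r \<le> t then w (r - s) else 0)"
      unfolding e using powr_interval(1)[OF b(1), of s t] by (cases "s \<le> t") (simp_all add: set_integrable_def)
    show "(LINT r|lborel. (if r \<le> t then w (r - s) else 0)) = W (t - s)"
      unfolding e using powr_interval(2)[OF b(1), of s t] b
      by (cases "s < t"; cases "s = t") (simp_all add: set_lebesgue_integral_def W_def)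
  qed
  have w0: "0 \<le> w r" for r by (simp add: w_def)
  have W0: "0 \<le> W r" for r using b by (simp add: W_def)
  have WT: "\<bar>gg s\<bar> * W (T - s) \<le> \<bar>gg s\<bar> * W T" for s
  proof (cases "s \<in> {0..T}")
    case True
    then have "W (T - s) \<le> W T" using b T by (auto simp: W_def intro!: divide_right_mono powr_mono2)
    then show ?thesis by (intro mult_left_mono) auto
  qed (simp add: gg_def)
  have fm: "case_prod f \<in> borel_measurable (lborel \<Otimes>\<^sub>M lborel)" unfolding f_def by measurable
  have f_alt: "f s r = (if r \<le> T then w (r - s) else 0) * gg s" for s r by (simp add: f_def)
  have nf: "norm (f s r) = (if r \<le> T then w (r - s) else 0) * \<bar>gg s\<bar>" for s r by (simp add: f_def abs_mult w0)
  have F: "integrable (lborel \<Otimes>\<^sub>M lborel) (case_prod f)"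
  proof (rule lborel_pair.Fubini_integrable[OF fm])
    show "AE s in lborel. integrable lborel (\<lambda>r. case_prod f (s, r))"
      unfolding prod.case f_alt by (intro AE_I2 integrable_mult_left w_int)
    show "integrable lborel (\<lambda>s. LINT r|lborel. norm (case_prod f (s, r)))"
    proof (rule Bochner_Integration.integrable_bound)
      show "integrable lborel (\<lambda>s. \<bar>gg s\<bar> * W T)" using gi by simp
      show "(\<lambda>s. LINT r|lborel. norm (case_prod f (s, r))) \<in> borel_measurable lborel"
        unfolding f_def by measurable
      show "AE s in lborel. norm (LINT r|lborel. norm (case_prod f (s, r))) \<le> norm (\<bar>gg s\<bar> * W T)"
        unfolding prod.case nf integral_mult_left_zero w_val
        using WT W0 by (intro AE_I2) (simp add: abs_mult mult.commute)
    qed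
  qed
  \<comment> \<open>The expected derivative of h: w convolved with the density of \<phi>, plus the
    contribution \<phi> 0 * w of the initial value.\<close>
  define G where "G r = \<phi> 0 * w r + (LINT s|lborel. f s r)" for r
  have G1: "integrable lborel (\<lambda>r. LINT s|lborel. f s r)" by (rule lborel_pair.integrable_snd[OF F])
  have wI: "set_integrable lborel {0..t} w" and wV: "(LBINT r:{0..t}. w r) = W t" if "0 \<le> t" for t
  proof -
    have e: "indicator {0..t} r *\<^sub>R w r = (if r \<le> t then w (r - 0) else 0)" for r
      by (auto simp: w_def indicator_def)
    show "set_integrable lborel {0..t} w" unfolding set_integrable_def e by (rule w_int)
    show "(LBINT r:{0..t}. w r) = W t" unfolding set_lebesgue_integral_def e w_val by simp
  qed
  have G1s: "set_integrable lborel A (\<lambda>r. LINT s|lborel. f s r)" if "A \<in> sets borel" for A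
    unfolding set_integrable_def by (rule integrable_mult_indicator) (use that G1 in auto)
  have GI: "set_integrable lborel {0..T} G"
    unfolding G_def[abs_def] by (intro set_integral_add(1) set_integrable_mult_right wI G1s) (use T in auto)
  moreover have "h t = (LBINT s:{0..t}. G s)" if t: "t \<in> {0..T}" for t
  proof -
    have t0: "0 \<le> t" using t by simp
    define f' where "f' s r = (if r \<le> t then w (r - s) else 0) * gg s" for s r
    have e: "f' s r = indicator {..t} r *\<^sub>R f s r" for s r using t by (auto simp: f'_def f_def indicator_def)
    have e2: "case_prod f' = (\<lambda>p. indicator (UNIV \<times> {..t}) p *\<^sub>R case_prod f p)"
      by (auto simp: fun_eq_iff e indicator_def)
    have "integrable (lborel \<Otimes>\<^sub>M lborel) (\<lambda>p. indicator (UNIV \<times> {..t}) p *\<^sub>R case_prod f p)"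
      by (rule integrable_mult_indicator[OF _ F]) auto
    then have F': "integrable (lborel \<Otimes>\<^sub>M lborel) (case_prod f')" unfolding e2 .
    have "(LINT r|lborel. LINT s|lborel. f' s r) = (LINT s|lborel. LINT r|lborel. f' s r)"
      by (rule lborel_pair.Fubini_integral[OF F'])
    also have "\<dots> = (LINT s|lborel. W (t - s) * gg s)"
      unfolding f'_def integral_mult_left_zero w_val ..
    finally have "(LINT r|lborel. LINT s|lborel. f' s r) = (LINT s|lborel. W (t - s) * gg s)" .
    moreover have "(LINT r|lborel. LINT s|lborel. f' s r) = (LBINT r:{0..t}. LINT s|lborel. f s r)"
      unfolding set_lebesgue_integral_def
    proof (rule Bochner_Integration.integral_cong[OF refl])
      fix r
      have "(LINT s|lborel. f' s r) = indicator {..t} r *\<^sub>R (LINT s|lborel. f s r)" unfolding e by simp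
      also have "\<dots> = indicator {0..t} r *\<^sub>R (LINT s|lborel. f s r)"
      proof (cases "r < 0")
        case True
        then have "(\<lambda>s. f s r) = (\<lambda>s. 0)" by (auto simp: fun_eq_iff f_def w_def gg_def indicator_def)
        then show ?thesis by simp
      qed (auto simp: indicator_def)
      finally show "(LINT s|lborel. f' s r) = indicator {0..t} r *\<^sub>R (LINT s|lborel. f s r)" .
    qed
    moreover have "(LBINT s:{0..t}. G s) = \<phi> 0 * W t + (LBINT r:{0..t}. LINT s|lborel. f s r)"
      unfolding G_def using set_integral_add(2)[OF set_integrable_mult_right[OF wI[OF t0], of "\<phi> 0"] G1s[of "{0..t}"]]
      by (simp add: wV[OF t0])
    ultimately show ?thesis using h_eq[OF t] by simp
  qed
  \<comment> \<open>The exceptional t are those for which w (t - s) * gg s is not integrable in s.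
    For all other t a multiple of its norm dominates the difference quotients under the integral, so
    any derivative of h has to be G t.\<close>
  moreover have "AE t in lborel. t \<in> {0<..<T} \<longrightarrow> (\<forall>D. (h has_real_derivative D) (at t) \<longrightarrow> D = G t)"
    using lborel_pair.AE_integrable_snd[OF F]
  proof eventually_elim
    case (elim t)
    show ?case
    proof (intro impI allI)
      fix D assume t: "t \<in> {0<..<T}" and D: "(h has_real_derivative D) (at t)"
      \<comment> \<open>Backward steps keep t - e n in \<open>{0..T}\<close>. Moreover K n r
        vanishes for r \<le> 0 just as w r does, whereas a forward quotient of W would be positive
        for r slightly below 0.\<close>
      define e where "e n = t / (real n + 2)" for n :: nat
      have e: "0 < e n" "e n < t" for n
      proof -
        show "0 < e n" using t by (simp add: e_def)
        have "t / (real n + 2) < t / 1" using t by (intro divide_strict_left_mono) auto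
        then show "e n < t" by (simp add: e_def)
      qed
      have e0: "e \<longlonglongrightarrow> 0" unfolding e_def by real_asymp
      define K where "K n r = (W r - W (r - e n)) / e n" for n r
      have Kw: "(\<lambda>n. K n r) \<longlonglongrightarrow> w r" if "r \<noteq> 0" for r
      proof (cases "r > 0")
        case True
        have "(W has_real_derivative w r) (at r)"
        proof (rule has_field_derivative_transform_within_open[of "\<lambda>r. r powr \<beta> / \<beta>" _ _ "{0<..}"])
          have "((\<lambda>r. r powr \<beta>) has_real_derivative \<beta> * r powr (\<beta> - 1)) (at r)"
            using True by (rule has_real_derivative_powr)
          from DERIV_cdivide[OF this, of \<beta>] show "((\<lambda>r. r powr \<beta> / \<beta>) has_real_derivative w r) (at r)"
            using True b by (simp add: w_def)
        qed (use True in \<open>auto simp: W_def\<close>)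
        then have "((\<lambda>x. (W (r + x) - W r) / x) \<longlongrightarrow> w r) (at 0)" by (simp add: DERIV_def)
        moreover have "filterlim (\<lambda>n. - e n) (at 0) sequentially"
          unfolding filterlim_at using tendsto_minus[OF e0] e by (auto simp: less_imp_neq[THEN not_sym])
        ultimately have "(\<lambda>n. (W (r + - e n) - W r) / - e n) \<longlonglongrightarrow> w r" by (rule filterlim_compose)
        moreover have "(W (r + - e n) - W r) / - e n = K n r" for n
          by (simp add: K_def minus_divide_left[symmetric] flip: minus_divide_right) (simp add: diff_divide_distrib)
        ultimately show ?thesis by (simp only:)
      next
        case False
        then have "K n r = 0" for n using e(1)[of n] by (simp add: K_def W_def)
        then show ?thesis using False by (simp add: w_def)
      qed
      \<comment> \<open>The first constant serves r \<le> 2 e n, where K n r \<le> W r / e n \<le> 2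
        W r / r. The second serves larger r, where the mean value theorem evaluates w at a point not
        below r / 2.\<close>
      define c where "c = max (2 / \<beta>) (2 powr (1 - \<beta>))"
      have Kb: "\<bar>K n r\<bar> \<le> c * w r" for n r
      proof (cases "r > 0")
        case True
        have K0: "0 \<le> K n r"
          unfolding K_def W_def using b e(1)[of n] True
          by (auto intro!: divide_nonneg_pos divide_right_mono powr_mono2)
        show ?thesis
        proof (cases "r \<le> 2 * e n")
          case le: True
          have "K n r \<le> W r / e n" unfolding K_def using W0[of "r - e n"] e(1)[of n] by (intro divide_right_mono) auto
          also have "\<dots> \<le> W r / (r / 2)" using le True W0[of r] e(1)[of n] by (intro divide_left_mono) auto
          also have "\<dots> = 2 / \<beta> * w r" using True powr_diff[of r \<beta> 1] by (simp add: W_def w_def)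
          also have "\<dots> \<le> c * w r" by (intro mult_right_mono w0) (simp add: c_def)
          finally show ?thesis using K0 by simp
        next
          case False
          have "\<exists>z>r - e n. z < r \<and> W r - W (r - e n) = (r - (r - e n)) * w z"
          proof (rule MVT2)
            fix x assume "r - e n \<le> x" "x \<le> r"
            then have x: "x > 0" using False e(1)[of n] by linarith
            show "(W has_real_derivative w x) (at x)"
            proof (rule has_field_derivative_transform_within_open[of "\<lambda>r. r powr \<beta> / \<beta>" _ _ "{0<..}"])
              have "((\<lambda>r. r powr \<beta>) has_real_derivative \<beta> * x powr (\<beta> - 1)) (at x)"
                using x by (rule has_real_derivative_powr)
              from DERIV_cdivide[OF this, of \<beta>] show "((\<lambda>r. r powr \<beta> / \<beta>) has_real_derivative w x) (at x)"
                using x b by (simp add: w_def)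
            qed (use x in \<open>auto simp: W_def\<close>)
          qed (use e(1)[of n] in simp)
          then obtain z where z: "r - e n < z" "z < r" "W r - W (r - e n) = e n * w z" by auto
          have zr: "r / 2 \<le> z" using z(1) False by linarith
          have "K n r = w z" using z(3) e(1)[of n] by (simp add: K_def)
          also have "\<dots> \<le> (r / 2) powr (\<beta> - 1)" using zr True b by (auto simp: w_def intro!: powr_mono2')
          also have "\<dots> = 2 powr (1 - \<beta>) * w r"
          proof -
            have "(r / 2) powr (\<beta> - 1) = r powr (\<beta> - 1) / 2 powr (\<beta> - 1)" using True by (simp add: powr_divide)
            moreover have "2 powr (1 - \<beta>) = 1 / (2 powr (\<beta> - 1) :: real)" by (simp flip: powr_minus_divide)
            ultimately show ?thesis using True by (simp add: w_def)
          qed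
          also have "\<dots> \<le> c * w r" by (intro mult_right_mono w0) (simp add: c_def)
          finally show ?thesis using K0 by simp
        qed
      next
        case False
        then show ?thesis using e(1)[of n] by (simp add: K_def W_def w_def)
      qed
      have KG: "(h t - h (t - e n)) / e n = \<phi> 0 * K n t + (LINT s|lborel. K n (t - s) * gg s)" for n
      proof -
        have t1: "t \<in> {0..T}" "t - e n \<in> {0..T}" using t e[of n] by auto
        have "(LINT s|lborel. K n (t - s) * gg s) = (LINT s|lborel. (W (t - s) * gg s - W (t - e n - s) * gg s) / e n)"
          by (intro Bochner_Integration.integral_cong refl) (simp add: K_def left_diff_distrib algebra_simps)
        also have "\<dots> = ((LINT s|lborel. W (t - s) * gg s) - (LINT s|lborel. W (t - e n - s) * gg s)) / e n"
          using hi[OF t1(1)] hi[OF t1(2)] by simp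
        finally show ?thesis unfolding h_eq[OF t1(1)] h_eq[OF t1(2)]
          by (simp add: K_def add_divide_distrib diff_divide_distrib right_diff_distrib)
      qed
      have wi: "integrable lborel (\<lambda>s. w (t - s) * gg s)"
        using elim t by (simp add: f_def)
      have "(\<lambda>n. LINT s|lborel. K n (t - s) * gg s) \<longlonglongrightarrow> (LINT s|lborel. w (t - s) * gg s)"
      proof (rule integral_dominated_convergence[where w = "\<lambda>s. c * norm (w (t - s) * gg s)"])
        show "integrable lborel (\<lambda>s. c * norm (w (t - s) * gg s))" using wi by (intro integrable_mult_right integrable_norm)
        have "AE s in lborel. s \<noteq> t" by (rule AE_lborel_singleton)
        then show "AE s in lborel. (\<lambda>n. K n (t - s) * gg s) \<longlonglongrightarrow> w (t - s) * gg s"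
          by eventually_elim (intro tendsto_mult Kw tendsto_const, simp)
        show "AE s in lborel. norm (K n (t - s) * gg s) \<le> c * norm (w (t - s) * gg s)" for n
        proof (rule AE_I2)
          fix s
          show "norm (K n (t - s) * gg s) \<le> c * norm (w (t - s) * gg s)"
            using mult_right_mono[OF Kb[of n "t - s"] abs_ge_zero[of "gg s"]] by (simp add: abs_mult w0 mult.assoc)
        qed
        show "(\<lambda>s. K n (t - s) * gg s) \<in> borel_measurable lborel" for n unfolding K_def by measurable
      qed measurable
      then have "(\<lambda>n. (h t - h (t - e n)) / e n) \<longlonglongrightarrow> \<phi> 0 * w t + (LINT s|lborel. w (t - s) * gg s)"
        unfolding KG by (intro tendsto_intros Kw) (use t in auto)
      moreover have "\<phi> 0 * w t + (LINT s|lborel. w (t - s) * gg s) = G t" using t by (simp add: G_def f_def)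
      moreover have "(\<lambda>n. (h t - h (t - e n)) / e n) \<longlonglongrightarrow> D"
      proof -
        have "filterlim (\<lambda>n. - e n) (at 0) sequentially"
          unfolding filterlim_at using tendsto_minus[OF e0] e by (auto simp: less_imp_neq[THEN not_sym])
        moreover have "((\<lambda>x. (h (t + x) - h t) / x) \<longlongrightarrow> D) (at 0)" using D by (simp add: DERIV_def)
        ultimately have "(\<lambda>n. (h (t + - e n) - h t) / - e n) \<longlonglongrightarrow> D" by (rule filterlim_compose[rotated])
        moreover have "(h (t + - e n) - h t) / - e n = (h t - h (t - e n)) / e n" for n
          by (simp add: diff_divide_distrib)
        ultimately show ?thesis by (simp only:)
      qed
      ultimately show "D = G t" using LIMSEQ_unique by metis
    qed
  qed
  ultimately show ?thesis by (rule that)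
qed

section \<open>Weak absolute continuity\<close>

lemma set_integral_finite_sum:
  fixes f :: "'i \<Rightarrow> 'a \<Rightarrow> 'b::{banach, second_countable_topology}"
  assumes "\<And>i. i \<in> I \<Longrightarrow> set_integrable M A (f i)"
  shows "set_integrable M A (\<lambda>s. \<Sum>i\<in>I. f i s)"
    "set_lebesgue_integral M A (\<lambda>s. \<Sum>i\<in>I. f i s) = (\<Sum>i\<in>I. set_lebesgue_integral M A (f i))"
  using assms unfolding set_integrable_def set_lebesgue_integral_def scaleR_sum_right
  by (simp_all add: Bochner_Integration.integrable_sum Bochner_Integration.integral_sum)

text \<open>Completeness of the Lebesgue measure. It matters for the source term and for the
  derivatives, about which the equation speaks only almost everywhere.\<close>

lemma lebesgue_measurable_cong_AE:
  assumes g: "g \<in> borel_measurable lebesgue" and eq: "AE x in lebesgue. f x = g x"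
  shows "f \<in> borel_measurable lebesgue"
proof (rule measurableI)
  fix A :: "'b set" assume "A \<in> sets borel"
  then have "g -` A \<inter> space lebesgue \<in> sets lebesgue" by (rule measurable_sets[OF g])
  then have 1: "g -` A \<in> sets lebesgue" by simp
  have "AE x in lebesgue. x \<in> g -` A \<longleftrightarrow> x \<in> f -` A" using eq by eventually_elim simp
  then have "f -` A \<in> sets lebesgue"
    by (rule completion.in_sets_AE[OF _ 1]) simp
  then show "f -` A \<inter> space lebesgue \<in> sets lebesgue" by simp
qed simp

lemma lebesgue_integral_cong_AE:
  fixes f g :: "'a::euclidean_space \<Rightarrow> 'b::{banach, second_countable_topology}"
  assumes g: "integrable lebesgue g" and eq: "AE x in lebesgue. f x = g x"
  shows "integrable lebesgue f" "integral\<^sup>L lebesgue f = integral\<^sup>L lebesgue g"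
proof -
  have gm: "g \<in> borel_measurable lebesgue" using g by (rule borel_measurable_integrable)
  have fm: "f \<in> borel_measurable lebesgue" by (rule lebesgue_measurable_cong_AE[OF gm eq])
  show "integrable lebesgue f" using integrable_cong_AE[OF fm gm eq] g by simp
  show "integral\<^sup>L lebesgue f = integral\<^sup>L lebesgue g" by (rule integral_cong_AE[OF fm gm eq])
qed

lemma lborel_integral_cong_AE:
  fixes f g :: "'a::euclidean_space \<Rightarrow> 'b::{banach, second_countable_topology}"
  assumes g: "integrable lborel g" and eq: "AE x in lborel. f x = g x"
  shows "integrable lebesgue f" "integral\<^sup>L lebesgue f = integral\<^sup>L lborel g"
proof -
  have gm: "g \<in> borel_measurable lborel" using g by (rule borel_measurable_integrable)
  have gi: "integrable lebesgue g" using integrable_completion[OF gm] g by simp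
  have eq': "AE x in lebesgue. f x = g x" using eq by (simp add: AE_completion_iff)
  show "integrable lebesgue f" by (rule lebesgue_integral_cong_AE[OF gi eq'])
  show "integral\<^sup>L lebesgue f = integral\<^sup>L lborel g"
    using lebesgue_integral_cong_AE(2)[OF gi eq'] integral_completion[OF gm] by simp
qed

text \<open>Absolute continuity tested against one vector at a time; density and exceptional null
  set may depend on c. This is what a componentwise argument for fractional integrals delivers, and
  it suffices for integration by parts against polynomials, which have finitely many coefficient
  vectors.\<close>

definition weakly_AC :: "real \<Rightarrow> (real \<Rightarrow> 'b::real_inner) \<Rightarrow> (real \<Rightarrow> 'b) \<Rightarrow> bool"
  where "weakly_AC T H D \<longleftrightarrow> (\<forall>c. \<exists>g. set_integrable lborel {0..T} g \<and>
    (\<forall>r\<in>{0..T}. H r \<bullet> c = H 0 \<bullet> c + (LBINT s:{0..r}. g s)) \<and>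
    (AE s in lborel. s \<in> {0<..<T} \<longrightarrow> D s \<bullet> c = g s))"

lemma weakly_ACE:
  assumes "weakly_AC T H D"
  obtains g where "set_integrable lborel {0..T} g"
    "\<And>r. r \<in> {0..T} \<Longrightarrow> H r \<bullet> c = H 0 \<bullet> c + (LBINT s:{0..r}. g s)"
    "AE s in lborel. s \<in> {0<..<T} \<longrightarrow> D s \<bullet> c = g s"
proof -
  obtain g where g: "set_integrable lborel {0..T} g \<and>
    (\<forall>r\<in>{0..T}. H r \<bullet> c = H 0 \<bullet> c + (LBINT s:{0..r}. g s)) \<and>
    (AE s in lborel. s \<in> {0<..<T} \<longrightarrow> D s \<bullet> c = g s)"
    using assms unfolding weakly_AC_def by blast
  show thesis
    by (rule that[of g, OF g[THEN conjunct1] bspec[OF g[THEN conjunct2, THEN conjunct1]] g[THEN conjunct2, THEN conjunct2]])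
qed

lemma weakly_AC_cong:
  assumes "weakly_AC T H D" and H: "\<And>r. r \<in> {0..T} \<Longrightarrow> H' r = H r"
    and D: "AE s in lborel. s \<in> {0<..<T} \<longrightarrow> D' s = D s" and T: "0 \<le> T"
  shows "weakly_AC T H' D'"
  unfolding weakly_AC_def
proof
  fix c
  obtain g where g: "set_integrable lborel {0..T} g"
    "\<And>r. r \<in> {0..T} \<Longrightarrow> H r \<bullet> c = H 0 \<bullet> c + (LBINT s:{0..r}. g s)"
    "AE s in lborel. s \<in> {0<..<T} \<longrightarrow> D s \<bullet> c = g s"
    by (rule weakly_ACE[OF assms(1), of c]) (rule that)
  have "AE s in lborel. s \<in> {0<..<T} \<longrightarrow> D' s \<bullet> c = g s"
    using g(3) D by eventually_elim simp
  note 3 = this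
  have 2: "H' r \<bullet> c = H' 0 \<bullet> c + (LBINT s:{0..r}. g s)" if "r \<in> {0..T}" for r
    using g(2)[OF that] H[OF that] H[of 0] T by simp
  show "\<exists>g. set_integrable lborel {0..T} g \<and>
    (\<forall>r\<in>{0..T}. H' r \<bullet> c = H' 0 \<bullet> c + (LBINT s:{0..r}. g s)) \<and>
    (AE s in lborel. s \<in> {0<..<T} \<longrightarrow> D' s \<bullet> c = g s)" by (rule exI[of _ g]) (intro conjI ballI g(1) 2 3)
qed

lemma weakly_AC_zero: "weakly_AC T (\<lambda>t. 0) (\<lambda>t. 0)"
  unfolding weakly_AC_def by (intro allI exI[of _ "\<lambda>s. 0"]) (simp add: set_integrable_def)

lemma weakly_AC_add:
  assumes "weakly_AC T H D" "weakly_AC T H' D'"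
  shows "weakly_AC T (\<lambda>t. H t + H' t) (\<lambda>t. D t + D' t)"
  unfolding weakly_AC_def
proof
  fix c
  obtain g where g: "set_integrable lborel {0..T} g"
    "\<And>r. r \<in> {0..T} \<Longrightarrow> H r \<bullet> c = H 0 \<bullet> c + (LBINT s:{0..r}. g s)"
    "AE s in lborel. s \<in> {0<..<T} \<longrightarrow> D s \<bullet> c = g s"
    by (rule weakly_ACE[OF assms(1), of c]) (rule that)
  obtain g' where g': "set_integrable lborel {0..T} g'"
    "\<And>r. r \<in> {0..T} \<Longrightarrow> H' r \<bullet> c = H' 0 \<bullet> c + (LBINT s:{0..r}. g' s)"
    "AE s in lborel. s \<in> {0<..<T} \<longrightarrow> D' s \<bullet> c = g' s"
    by (rule weakly_ACE[OF assms(2), of c]) (rule that)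
  have 1: "set_integrable lborel {0..T} (\<lambda>s. g s + g' s)" by (intro set_integral_add g g')
  have 2: "(H r + H' r) \<bullet> c = (H 0 + H' 0) \<bullet> c + (LBINT s:{0..r}. g s + g' s)" if "r \<in> {0..T}" for r
  proof -
    have s: "set_integrable lborel {0..r} g" "set_integrable lborel {0..r} g'"
      using that by (auto intro!: set_integrable_subset[OF g(1)] set_integrable_subset[OF g'(1)])
    show ?thesis unfolding set_integral_add(2)[OF s] inner_add_left using g(2)[OF that] g'(2)[OF that] by simp
  qed
  have 3: "AE s in lborel. s \<in> {0<..<T} \<longrightarrow> (D s + D' s) \<bullet> c = g s + g' s"
    using g(3) g'(3) by eventually_elim (simp add: inner_add_left)
  show "\<exists>g. set_integrable lborel {0..T} g \<and>
    (\<forall>r\<in>{0..T}. (H r + H' r) \<bullet> c = (H 0 + H' 0) \<bullet> c + (LBINT s:{0..r}. g s)) \<and>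
    (AE s in lborel. s \<in> {0<..<T} \<longrightarrow> (D s + D' s) \<bullet> c = g s)" by (rule exI[of _ "\<lambda>s. g s + g' s"]) (intro conjI ballI 1 2 3)
qed

lemma weakly_AC_sum:
  assumes "finite I" "\<And>i. i \<in> I \<Longrightarrow> weakly_AC T (H i) (D i)"
  shows "weakly_AC T (\<lambda>t. \<Sum>i\<in>I. H i t) (\<lambda>t. \<Sum>i\<in>I. D i t)"
  using assms by (induction I rule: finite_induct) (auto simp: weakly_AC_zero intro!: weakly_AC_add)

lemma weakly_AC_scaleR:
  assumes "set_integrable lborel {0..T} g" "\<And>r. r \<in> {0..T} \<Longrightarrow> \<psi> r = \<psi> 0 + (LBINT s:{0..r}. g s)"
  shows "weakly_AC T (\<lambda>t. \<psi> t *\<^sub>R d) (\<lambda>t. g t *\<^sub>R d)"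
  unfolding weakly_AC_def
proof
  fix c
  have 1: "set_integrable lborel {0..T} (\<lambda>s. g s * (d \<bullet> c))" using assms(1) by simp
  have 2: "(\<psi> r *\<^sub>R d) \<bullet> c = (\<psi> 0 *\<^sub>R d) \<bullet> c + (LBINT s:{0..r}. g s * (d \<bullet> c))" if "r \<in> {0..T}" for r
    using assms(2)[OF that] by (simp add: distrib_right)
  show "\<exists>g'. set_integrable lborel {0..T} g' \<and>
    (\<forall>r\<in>{0..T}. (\<psi> r *\<^sub>R d) \<bullet> c = (\<psi> 0 *\<^sub>R d) \<bullet> c + (LBINT s:{0..r}. g' s)) \<and>
    (AE s in lborel. s \<in> {0<..<T} \<longrightarrow> (g s *\<^sub>R d) \<bullet> c = g' s)"
    by (rule exI[of _ "\<lambda>s. g s * (d \<bullet> c)"]) (rule conjI[OF 1 conjI[OF ballI[OF 2] AE_I2]], assumption, simp)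
qed

text \<open>Each monomial of X brings in one coefficient vector c i and hence a scalar density g i.
  The finitely many null sets are united and \<open>integration_by_parts_AC\<close> is applied for
  each i; the outcome expresses the integral of D \<bullet> X without D.\<close>

lemma weakly_AC_parts:
  fixes H D :: "real \<Rightarrow> 'b::real_inner"
  assumes H: "weakly_AC T H D" and ab: "0 \<le> a" "a \<le> b" "b \<le> T"
    and X: "\<And>s. X s = (\<Sum>i\<le>p. s ^ i *\<^sub>R c i)"
    and X': "\<And>s. X' s = (\<Sum>i\<le>p. (real i * s ^ (i - 1)) *\<^sub>R c i)"
  shows "set_integrable lebesgue {a<..<b} (\<lambda>s. D s \<bullet> X s)"
    "(LINT s:{a<..<b}|lebesgue. D s \<bullet> X s) = H b \<bullet> X b - H a \<bullet> X a - (LBINT s:{a..b}. H s \<bullet> X' s)"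
    "set_integrable lborel {a..b} (\<lambda>s. H s \<bullet> X' s)"
proof -
  have "\<exists>g. set_integrable lborel {0..T} g \<and>
    (\<forall>r\<in>{0..T}. H r \<bullet> c i = H 0 \<bullet> c i + (LBINT s:{0..r}. g s)) \<and>
    (AE s in lborel. s \<in> {0<..<T} \<longrightarrow> D s \<bullet> c i = g s)" for i
    using H unfolding weakly_AC_def by blast
  then have "\<exists>g. \<forall>i. set_integrable lborel {0..T} (g i) \<and>
    (\<forall>r\<in>{0..T}. H r \<bullet> c i = H 0 \<bullet> c i + (LBINT s:{0..r}. g i s)) \<and>
    (AE s in lborel. s \<in> {0<..<T} \<longrightarrow> D s \<bullet> c i = g i s)"
    by (intro choice allI)
  then obtain g where gg: "\<And>i. set_integrable lborel {0..T} (g i) \<and>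
    (\<forall>r\<in>{0..T}. H r \<bullet> c i = H 0 \<bullet> c i + (LBINT s:{0..r}. g i s)) \<and>
    (AE s in lborel. s \<in> {0<..<T} \<longrightarrow> D s \<bullet> c i = g i s)" by blast
  note g = gg[THEN conjunct1] bspec[OF gg[THEN conjunct2, THEN conjunct1]]
    and gD = gg[THEN conjunct2, THEN conjunct2]
  have gab: "set_integrable lborel {a..b} (g i)" for i
    by (rule set_integrable_subset[OF g(1)]) (use ab in auto)
  have Hr: "H r \<bullet> c i = H a \<bullet> c i + (LBINT s:{a..r}. g i s)" if r: "r \<in> {a..b}" for r i
  proof -
    have "(LBINT s:{0..r}. g i s) = (LBINT s:{0..a}. g i s) + (LBINT s:{a..r}. g i s)"
      by (rule LBINT_combine[OF set_integrable_subset[OF g(1)]]) (use r ab in auto)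
    moreover have "H r \<bullet> c i = H 0 \<bullet> c i + (LBINT s:{0..r}. g i s)" "H a \<bullet> c i = H 0 \<bullet> c i + (LBINT s:{0..a}. g i s)"
      by (rule g(2), use r ab in simp)+
    ultimately show ?thesis by linarith
  qed
  define x where "x i s = real i * s ^ (i - 1)" for i and s :: real
  have xc: "continuous_on {a'..b'} (x i)" for i a' b' unfolding x_def by (intro continuous_intros)
  have xi: "set_integrable lborel {a'..b'} (x i)" for i a' b' by (rule borel_integrable_atLeastAtMost') (rule xc)
  have xX: "r ^ i = a ^ i + (LBINT s:{a..r}. x i s)" if "r \<in> {a..b}" for r i
  proof -
    have "(LBINT s:{a..r}. x i s) = r ^ i - a ^ i"
    proof (rule LBINT_FTC[of "{}" _ _ "\<lambda>s. s ^ i"])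
      show "((\<lambda>s. s ^ i) has_real_derivative x i y) (at y)" for y :: real
        unfolding x_def by (auto intro!: derivative_eq_intros)
    qed (use that xi in \<open>auto intro!: continuous_intros\<close>)
    then show ?thesis by simp
  qed
  have ibp: "set_integrable lborel {a..b} (\<lambda>r. r ^ i * g i r)"
    "(LBINT r:{a..b}. r ^ i * g i r) = b ^ i * (H b \<bullet> c i) - a ^ i * (H a \<bullet> c i) - (LBINT s:{a..b}. x i s * (H s \<bullet> c i))" for i
    using integration_by_parts_AC[OF ab(2) xi[of a b i] gab[of i], of "\<lambda>r. r ^ i" "\<lambda>r. H r \<bullet> c i"] xX Hr by blast+
  have Hc: "continuous_on {a..b} (\<lambda>s. H s \<bullet> c i)" for i
  proof -
    have "continuous_on {a..b} (\<lambda>r. integral {a..r} (g i))"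
      by (rule indefinite_integral_continuous_1) (use set_borel_integral_eq_integral(1)[OF gab] in simp)
    then have "continuous_on {a..b} (\<lambda>r. H a \<bullet> c i + integral {a..r} (g i))" by (intro continuous_intros)
    moreover have "(LBINT s:{a..r}. g i s) = integral {a..r} (g i)" if "r \<in> {a..b}" for r
      by (rule set_borel_integral_eq_integral(2)[OF set_integrable_subset[OF gab]]) (use that in auto)
    then have "H r \<bullet> c i = H a \<bullet> c i + integral {a..r} (g i)" if "r \<in> {a..b}" for r
      using Hr[OF that, of i] that by metis
    ultimately show ?thesis using continuous_on_cong[OF refl, of "{a..b}" "\<lambda>s. H s \<bullet> c i" "\<lambda>r. H a \<bullet> c i + integral {a..r} (g i)"] by blast
  qed
  have xH: "set_integrable lborel {a..b} (\<lambda>s. x i s * (H s \<bullet> c i))" for i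
    by (rule borel_integrable_atLeastAtMost') (intro continuous_intros xc Hc)
  have HX': "H s \<bullet> X' s = (\<Sum>i\<le>p. x i s * (H s \<bullet> c i))" for s
    by (simp add: X' x_def inner_sum_right)
  show "set_integrable lborel {a..b} (\<lambda>s. H s \<bullet> X' s)"
    unfolding HX' by (rule set_integral_finite_sum(1)) (use xH in auto)
  have LX': "(LBINT s:{a..b}. H s \<bullet> X' s) = (\<Sum>i\<le>p. LBINT s:{a..b}. x i s * (H s \<bullet> c i))"
    unfolding HX' by (rule set_integral_finite_sum(2)) (use xH in auto)
  define R where "R s = (\<Sum>i\<le>p. s ^ i * g i s)" for s
  have Ri: "set_integrable lborel {a..b} R"
    unfolding R_def by (rule set_integral_finite_sum(1)) (use ibp in auto)
  have "(LBINT s:{a..b}. R s) = (\<Sum>i\<le>p. LBINT s:{a..b}. s ^ i * g i s)"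
    unfolding R_def by (rule set_integral_finite_sum(2)) (use ibp in auto)
  also have "\<dots> = H b \<bullet> X b - H a \<bullet> X a - (LBINT s:{a..b}. H s \<bullet> X' s)"
    unfolding ibp(2) LX' X by (simp add: sum_subtractf inner_sum_right)
  finally have RI: "(LBINT s:{a..b}. R s) = H b \<bullet> X b - H a \<bullet> X a - (LBINT s:{a..b}. H s \<bullet> X' s)" .
  have "AE s in lborel. \<forall>i\<in>{..p}. s \<in> {0<..<T} \<longrightarrow> D s \<bullet> c i = g i s"
    by (rule AE_finite_allI) (use gD in auto)
  moreover have "AE s in lborel. s \<noteq> a" "AE s in lborel. s \<noteq> b" by (rule AE_lborel_singleton)+
  ultimately have eq: "AE s in lborel. indicat_real {a<..<b} s *\<^sub>R (D s \<bullet> X s) = indicat_real {a..b} s *\<^sub>R R s"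
  proof eventually_elim
    case (elim s)
    show ?case
    proof (cases "s \<in> {a<..<b}")
      case True
      then have "D s \<bullet> c i = g i s" if "i \<le> p" for i using elim(1) ab that by auto
      then have "D s \<bullet> X s = R s" by (simp add: X R_def inner_sum_right)
      then show ?thesis using True by simp
    next
      case False then show ?thesis using elim by (auto simp: indicator_def)
    qed
  qed
  note L = lborel_integral_cong_AE[OF Ri[unfolded set_integrable_def] eq]
  show "set_integrable lebesgue {a<..<b} (\<lambda>s. D s \<bullet> X s)"
    using L(1) by (simp add: set_integrable_def)
  show "(LINT s:{a<..<b}|lebesgue. D s \<bullet> X s) = H b \<bullet> X b - H a \<bullet> X a - (LBINT s:{a..b}. H s \<bullet> X' s)"
    using L(2) RI by (simp add: set_lebesgue_integral_def)
qed

text \<open>The increments of u \<bullet> d are integrals of the weak derivative between points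
  inside the interval; continuity of u up to 0 and T extends the formula to the closed
  interval.\<close>

lemma weakly_AC_weak_derivative:
  fixes u u' :: "real \<Rightarrow> 'b::{real_inner, banach, second_countable_topology}"
  assumes w: "has_weak_derivative {0<..<T} u u'" and c: "continuous_on {0..T} u" and T: "0 < T"
  shows "weakly_AC T u u'"
  unfolding weakly_AC_def
proof
  fix d
  have int: "integrable lebesgue (\<lambda>s. indicat_real {0<..<T} s *\<^sub>R u' s)"
    using w by (simp add: has_weak_derivative_def set_integrable_def)
  define k where "k s = (indicat_real {0<..<T} s *\<^sub>R u' s) \<bullet> d" for s
  have ki: "integrable lebesgue k" unfolding k_def by (intro integrable_inner_left int)
  \<comment> \<open>A Borel version of the Lebesgue measurable component, since the densities in
    \<open>weakly_AC\<close> live on \<open>lborel\<close>.\<close>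
  obtain g where g: "g \<in> borel_measurable lborel" and kg: "AE s in lborel. k s = g s"
    using completion_ex_borel_measurable_real[OF borel_measurable_integrable[OF ki]] by blast
  have kg': "AE s in lebesgue. g s = k s" using kg by (simp add: AE_completion_iff eq_commute)
  have "integrable lebesgue g" by (rule lebesgue_integral_cong_AE[OF ki kg'])
  then have gi: "integrable lborel g" using integrable_completion[OF g] by simp
  have gs: "set_integrable lborel A g" if "A \<in> sets borel" for A
    unfolding set_integrable_def by (rule integrable_mult_indicator[OF _ gi]) (use that in simp)
  have inc: "u r \<bullet> d - u x \<bullet> d = (LBINT s:{x..r}. g s)" if xr: "0 < x" "x < r" "r < T" for x r
  proof -
    have "u r - u x = (LINT s:{x..r}|lebesgue. u' s)"
      by (rule weak_derivative_imp_integral[OF w continuous_on_subset[OF c]]) (use xr in auto)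
    also have "\<dots> = (LINT s|lebesgue. indicat_real {x..r} s *\<^sub>R (indicat_real {0<..<T} s *\<^sub>R u' s))"
      unfolding set_lebesgue_integral_def by (rule Bochner_Integration.integral_cong) (use xr in \<open>auto simp: indicator_def\<close>)
    finally have 1: "u r - u x = (LINT s|lebesgue. indicat_real {x..r} s *\<^sub>R (indicat_real {0<..<T} s *\<^sub>R u' s))" .
    have "integrable lebesgue (\<lambda>s. indicat_real {x..r} s *\<^sub>R (indicat_real {0<..<T} s *\<^sub>R u' s))"
      by (rule integrable_mult_indicator[OF _ int]) simp
    then have "(u r - u x) \<bullet> d = (LINT s|lebesgue. (indicat_real {x..r} s *\<^sub>R (indicat_real {0<..<T} s *\<^sub>R u' s)) \<bullet> d)"
      unfolding 1 by (intro integral_inner_left[symmetric])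
    also have "\<dots> = (LINT s|lebesgue. indicat_real {x..r} s *\<^sub>R k s)" by (simp add: k_def mult.assoc)
    also have "\<dots> = (LBINT s:{x..r}. g s)"
      unfolding set_lebesgue_integral_def
      by (rule lborel_integral_cong_AE(2)[OF gs[unfolded set_integrable_def]]) (use kg in \<open>auto elim!: eventually_mono\<close>)
    finally show ?thesis by (simp add: inner_diff_left)
  qed
  define J where "J r = (LBINT s:{0..r}. g s)" for r
  have "continuous_on {0..T} (\<lambda>r. integral {0..r} g)"
    by (rule indefinite_integral_continuous_1) (use set_borel_integral_eq_integral(1)[OF gs] in simp)
  moreover have "J r = integral {0..r} g" for r
    unfolding J_def by (rule set_borel_integral_eq_integral(2)[OF gs]) simp
  ultimately have Jc: "continuous_on {0..T} J" by simp
  define F where "F r = u r \<bullet> d - J r" for r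
  have Fc: "continuous_on (closure {0<..<T}) F" unfolding F_def using T c Jc by (auto intro!: continuous_intros)
  have FF: "F r = F x" if "0 < x" "x < r" "r < T" for x r
  proof -
    have "J r = J x + (LBINT s:{x..r}. g s)" unfolding J_def by (rule LBINT_combine[OF gs]) (use that in auto)
    then show ?thesis using inc[OF that] by (simp add: F_def)
  qed
  have "F r = F (T / 2)" if "r \<in> {0<..<T}" for r
    proof (cases r "T / 2" rule: linorder_cases)
    case less then show ?thesis using FF[of r "T / 2"] that T by simp
  next
    case greater then show ?thesis using FF[of "T / 2" r] that T by simp
  next
    case equal then show ?thesis by (simp only:)
  qed
  then have "F r = F (T / 2)" if "r \<in> closure {0<..<T}" for r
    using continuous_constant_on_closure[OF Fc, of "F (T / 2)" r] that by blast
  then have F0: "F r = F 0" if "r \<in> {0..T}" for r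
  proof -
    have "r \<in> closure {0<..<T}" "0 \<in> closure {0<..<T}" using that T by (auto simp: closure_greaterThanLessThan)
    then show ?thesis using \<open>\<And>r. r \<in> closure {0<..<T} \<Longrightarrow> F r = F (T / 2)\<close>[of r] \<open>\<And>r. r \<in> closure {0<..<T} \<Longrightarrow> F r = F (T / 2)\<close>[of 0] by linarith
  qed
  have "J 0 = 0" using Jc J_def set_borel_integral_eq_integral(2)[OF gs, of "{0..0}"] by simp
  then have 2: "u r \<bullet> d = u 0 \<bullet> d + (LBINT s:{0..r}. g s)" if "r \<in> {0..T}" for r
    using F0[OF that] by (simp add: F_def J_def)
  have 3: "AE s in lborel. s \<in> {0<..<T} \<longrightarrow> u' s \<bullet> d = g s"
    using kg by eventually_elim (auto simp: k_def indicator_def)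
  show "\<exists>g. set_integrable lborel {0..T} g \<and>
    (\<forall>r\<in>{0..T}. u r \<bullet> d = u 0 \<bullet> d + (LBINT s:{0..r}. g s)) \<and>
    (AE s in lborel. s \<in> {0<..<T} \<longrightarrow> u' s \<bullet> d = g s)" by (rule exI[of _ g]) (intro conjI ballI gs 2 3, simp)
qed

section \<open>Fractional integrals of piecewise polynomials\<close>

text \<open>The fractional integral in the scheme acts on raw functions w with arbitrary values at
  finitely many points, on the Lebesgue measure. Here it is replaced by the convolution of the
  normalised zero extension v on the Borel side.\<close>

lemma frac_integral_pw:
  fixes v w :: "real \<Rightarrow> 'b::{banach, second_countable_topology}"
  assumes b: "0 < \<beta>" "\<beta> < 1" and v: "pw \<tau> v" and S: "finite S" and t: "0 \<le> t"
    and w: "\<And>s. s \<in> {0..t} \<Longrightarrow> s \<notin> S \<Longrightarrow> w s = v s"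
  shows "integrable lborel (\<lambda>s. indicat_real {0..t} s *\<^sub>R ((t - s) powr (\<beta> - 1) *\<^sub>R v s))"
    "frac_conv \<beta> v t = (LINT s|lborel. indicat_real {0..t} s *\<^sub>R ((t - s) powr (\<beta> - 1) *\<^sub>R v s))"
    "frac_integral \<beta> w t = (1 / Gamma \<beta>) *\<^sub>R frac_conv \<beta> v t"
proof -
  let ?f = "\<lambda>s. indicat_real {0..t} s *\<^sub>R ((t - s) powr (\<beta> - 1) *\<^sub>R v s)"
  obtain B where B: "\<And>s. norm (v s) \<le> B" using v by (auto simp: pw_def)
  have B0: "0 \<le> B" using B[of 0] norm_ge_zero[of "v 0"] by linarith
  have [measurable]: "v \<in> borel_measurable borel" by (rule pw_borel[OF v])
  have "integrable lborel (\<lambda>s. B * (indicat_real {0..t} s * (t - s) powr (\<beta> - 1)))"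
    by (intro integrable_mult_right powr_shift_integrable b t)
  then show i: "integrable lborel ?f"
  proof (rule Bochner_Integration.integrable_bound)
    show "?f \<in> borel_measurable lborel" by measurable
    show "AE s in lborel. norm (?f s) \<le> norm (B * (indicat_real {0..t} s * (t - s) powr (\<beta> - 1)))"
    proof (rule AE_I2)
      fix s :: real
      have "(t - s) powr (\<beta> - 1) * norm (v s) \<le> (t - s) powr (\<beta> - 1) * B"
        by (intro mult_left_mono B) simp
      then show "norm (?f s) \<le> norm (B * (indicat_real {0..t} s * (t - s) powr (\<beta> - 1)))"
        using B0 by (auto simp: indicator_def abs_mult mult.commute)
    qed
  qed
  have v0: "v s = 0" if "s < 0" for s using v that by (auto simp: pw_def)
  show c: "frac_conv \<beta> v t = integral\<^sup>L lborel ?f"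
    unfolding frac_conv_def set_lebesgue_integral_def
    by (rule Bochner_Integration.integral_cong) (auto simp: indicator_def v0)
  have "frac_integral \<beta> w t = (LINT s|lebesgue. (1 / Gamma \<beta>) *\<^sub>R ?f s)"
    unfolding frac_integral_def set_lebesgue_integral_def
    by (rule integral_discrete_difference[of S])
       (use S w in \<open>auto simp: countable_finite indicator_def omega_def\<close>)
  also have "\<dots> = (LINT s|lborel. (1 / Gamma \<beta>) *\<^sub>R ?f s)"
    by (rule integral_completion) (use i in \<open>auto intro!: borel_measurable_scaleR borel_measurable_integrable[OF i]\<close>)
  also have "\<dots> = (1 / Gamma \<beta>) *\<^sub>R integral\<^sup>L lborel ?f" by (rule integral_scaleR_right)
  finally show "frac_integral \<beta> w t = (1 / Gamma \<beta>) *\<^sub>R frac_conv \<beta> v t" by (simp add: c)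
qed

text \<open>\<open>frac_integral_AC\<close> is applied to each component u \<bullet> c. Where the
  fractional integral is differentiable, the component of its derivative must be the density found
  there, so \<open>vector_derivative\<close> has the intended meaning almost everywhere.\<close>

lemma frac_integral_weakly_AC:
  fixes u :: "real \<Rightarrow> 'b::{real_inner, banach, second_countable_topology}"
  assumes b: "0 < \<beta>" "\<beta> < 1" and T: "0 < T" and u: "weakly_AC T u u'"
    and v: "pw T v" "\<And>s. s \<in> {0<..<T} \<Longrightarrow> v s = u s"
    and diff: "AE t in lborel. t \<in> {0<..<T} \<longrightarrow> frac_integral \<beta> u differentiable (at t)"
  shows "weakly_AC T (frac_integral \<beta> u) (\<lambda>t. vector_derivative (frac_integral \<beta> u) (at t))"
  unfolding weakly_AC_def
proof
  fix c
  obtain g where g: "set_integrable lborel {0..T} g"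
    "\<And>r. r \<in> {0..T} \<Longrightarrow> u r \<bullet> c = u 0 \<bullet> c + (LBINT s:{0..r}. g s)"
    by (rule weakly_ACE[OF u, of c]) (rule that)
  define h where "h t = (LBINT s:{0..t}. (t - s) powr (\<beta> - 1) * (u s \<bullet> c))" for t
  obtain G where G: "set_integrable lborel {0..T} G" "\<And>t. t \<in> {0..T} \<Longrightarrow> h t = (LBINT s:{0..t}. G s)"
    and hG: "AE t in lborel. t \<in> {0<..<T} \<longrightarrow> (\<forall>D. (h has_real_derivative D) (at t) \<longrightarrow> D = G t)"
    by (rule frac_integral_AC[OF b T g, folded h_def]) (assumption, rule that)
  have \<Gamma>: "Gamma \<beta> > 0" using b by (simp add: Gamma_real_pos)
  have Ih: "frac_integral \<beta> u t \<bullet> c = h t / Gamma \<beta>" if t: "t \<in> {0..T}" for t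
  proof -
    have t0: "0 \<le> t" using t by simp
    have uv: "u s = v s" if "s \<in> {0..t}" "s \<notin> {0, T}" for s using v(2)[of s] that t by auto
    have f: "finite {0, T}" by simp
    have 1: "integrable lborel (\<lambda>s. indicat_real {0..t} s *\<^sub>R ((t - s) powr (\<beta> - 1) *\<^sub>R v s))"
      by (rule frac_integral_pw(1)[OF b v(1) f t0 uv])
    have 2: "frac_conv \<beta> v t = (LINT s|lborel. indicat_real {0..t} s *\<^sub>R ((t - s) powr (\<beta> - 1) *\<^sub>R v s))"
      by (rule frac_integral_pw(2)[OF b v(1) f t0 uv])
    have 3: "frac_integral \<beta> u t = (1 / Gamma \<beta>) *\<^sub>R frac_conv \<beta> v t"
      by (rule frac_integral_pw(3)[OF b v(1) f t0 uv])
    have "frac_conv \<beta> v t \<bullet> c = (LINT s|lborel. (indicat_real {0..t} s *\<^sub>R ((t - s) powr (\<beta> - 1) *\<^sub>R v s)) \<bullet> c)"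
      unfolding 2 by (rule integral_inner_left[symmetric]) (rule 1)
    also have "\<dots> = h t"
      unfolding h_def set_lebesgue_integral_def
      by (rule integral_discrete_difference[of "{0, T}"]) (use t v(2) in \<open>auto simp: indicator_def\<close>)
    finally show ?thesis unfolding 3 by simp
  qed
  have 1: "set_integrable lborel {0..T} (\<lambda>s. G s / Gamma \<beta>)" using G(1) by simp
  have 2: "frac_integral \<beta> u r \<bullet> c = frac_integral \<beta> u 0 \<bullet> c + (LBINT s:{0..r}. G s / Gamma \<beta>)" if r: "r \<in> {0..T}" for r
  proof -
    have "h 0 = 0"
      using G(2)[of 0] T set_borel_integral_eq_integral(2)[OF set_integrable_subset[OF G(1)], of "{0..0}"] by simp
    moreover have "frac_integral \<beta> u 0 \<bullet> c = h 0 / Gamma \<beta>" by (rule Ih) (use T in simp)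
    moreover have "(LBINT s:{0..r}. G s / Gamma \<beta>) = h r / Gamma \<beta>" unfolding G(2)[OF r] by (rule set_integral_divide_zero)
    ultimately show ?thesis using Ih[OF r] by (simp only: div_0 add_0_left)
  qed
  have 3: "AE s in lborel. s \<in> {0<..<T} \<longrightarrow> vector_derivative (frac_integral \<beta> u) (at s) \<bullet> c = G s / Gamma \<beta>"
    using diff hG
  proof eventually_elim
    case (elim s)
    show ?case
    proof
      assume s: "s \<in> {0<..<T}"
      define D where "D = vector_derivative (frac_integral \<beta> u) (at s)"
      have "(frac_integral \<beta> u has_vector_derivative D) (at s)"
        using elim(1) s unfolding D_def by (simp add: vector_derivative_works)
      then have "((\<lambda>t. frac_integral \<beta> u t \<bullet> c) has_vector_derivative D \<bullet> c) (at s)"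
        by (rule bounded_linear.has_vector_derivative[OF bounded_linear_inner_left])
      then have "((\<lambda>t. frac_integral \<beta> u t \<bullet> c) has_real_derivative D \<bullet> c) (at s)"
        by (simp add: has_real_derivative_iff_has_vector_derivative)
      then have "((\<lambda>t. Gamma \<beta> * (frac_integral \<beta> u t \<bullet> c)) has_real_derivative Gamma \<beta> * (D \<bullet> c)) (at s)"
        by (rule DERIV_cmult)
      then have "(h has_real_derivative Gamma \<beta> * (D \<bullet> c)) (at s)"
        by (rule has_field_derivative_transform_within_open[where S = "{0<..<T}"]) (use s Ih \<Gamma> in auto)
      then have "Gamma \<beta> * (D \<bullet> c) = G s" using elim(2) s by blast
      then show "vector_derivative (frac_integral \<beta> u) (at s) \<bullet> c = G s / Gamma \<beta>"
        unfolding D_def using \<Gamma> by (simp add: field_simps)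
    qed
  qed
  show "\<exists>g. set_integrable lborel {0..T} g \<and>
    (\<forall>r\<in>{0..T}. frac_integral \<beta> u r \<bullet> c = frac_integral \<beta> u 0 \<bullet> c + (LBINT s:{0..r}. g s)) \<and>
    (AE s in lborel. s \<in> {0<..<T} \<longrightarrow> vector_derivative (frac_integral \<beta> u) (at s) \<bullet> c = g s)"
    by (rule exI[of _ "\<lambda>s. G s / Gamma \<beta>"]) (intro conjI ballI 1 2 3)
qed

text \<open>The value B(\<beta>, i + 1) of the Beta function, the factor that a power of degree i
  acquires under convolution with the fractional kernel.\<close>

definition beta_const :: "real \<Rightarrow> nat \<Rightarrow> real"
  where "beta_const \<beta> i = (LINT x|lborel. indicat_real {0<..1} x * ((1 - x) powr (\<beta> - 1) * x ^ i))"

lemma truncated_power_integral: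
  fixes \<beta> a t :: real
  assumes "0 < \<beta>" "0 \<le> a" "0 \<le> t"
  shows "integrable lborel (\<lambda>s. indicat_real {a<..t} s * ((t - s) powr (\<beta> - 1) * (s - a) ^ i))"
    "(LINT s|lborel. indicat_real {a<..t} s * ((t - s) powr (\<beta> - 1) * (s - a) ^ i))
      = beta_const \<beta> i * max 0 (t - a) powr (\<beta> + i)"
proof -
  let ?f = "\<lambda>s. indicat_real {a<..t} s * ((t - s) powr (\<beta> - 1) * (s - a) ^ i)"
  have "integrable lborel (\<lambda>s. t ^ i * (indicat_real {0..t} s * (t - s) powr (\<beta> - 1)))"
    by (intro integrable_mult_right powr_shift_integrable assms)
  then show "integrable lborel ?f"
  proof (rule Bochner_Integration.integrable_bound)
    show "?f \<in> borel_measurable lborel" by measurable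
    show "AE s in lborel. norm (?f s) \<le> norm (t ^ i * (indicat_real {0..t} s * (t - s) powr (\<beta> - 1)))"
    proof (rule AE_I2)
      fix s :: real
      show "norm (?f s) \<le> norm (t ^ i * (indicat_real {0..t} s * (t - s) powr (\<beta> - 1)))"
      proof (cases "s \<in> {a<..t}")
        case True
        have "(s - a) ^ i \<le> t ^ i" by (intro power_mono) (use True assms in auto)
        then have "(t - s) powr (\<beta> - 1) * (s - a) ^ i \<le> (t - s) powr (\<beta> - 1) * t ^ i" by (intro mult_left_mono) auto
        then show ?thesis using True assms by (simp add: abs_mult power_abs mult.commute)
      qed (use assms in simp)
    qed
  qed
  show "integral\<^sup>L lborel ?f = beta_const \<beta> i * max 0 (t - a) powr (\<beta> + i)"
  proof (cases "a < t")
    case False then show ?thesis by simp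
  next
    case True
    define k where "k = t - a"
    have k: "k > 0" using True by (simp add: k_def)
    have "integral\<^sup>L lborel ?f = \<bar>k\<bar> *\<^sub>R (LINT x|lborel. ?f (a + k * x))"
      by (rule lborel_integral_real_affine) (use k in simp)
    also have "(LINT x|lborel. ?f (a + k * x))
        = (LINT x|lborel. (k powr (\<beta> - 1) * k ^ i) * (indicat_real {0<..1} x * ((1 - x) powr (\<beta> - 1) * x ^ i)))"
    proof (rule Bochner_Integration.integral_cong)
      fix x :: real
      have 1: "t - (a + k * x) = k * (1 - x)" by (simp add: k_def algebra_simps)
      have 2: "a + k * x \<in> {a<..t} \<longleftrightarrow> x \<in> {0<..1}"
      proof -
        have "a + k * x \<in> {a<..t} \<longleftrightarrow> 0 < k * x \<and> k * x \<le> k"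
          unfolding greaterThanAtMost_iff using k_def by linarith
        then show ?thesis
          using mult_less_cancel_left_pos[OF k, of 0 x] mult_le_cancel_left_pos[OF k, of x 1] by simp
      qed
      show "?f (a + k * x) = (k powr (\<beta> - 1) * k ^ i) * (indicat_real {0<..1} x * ((1 - x) powr (\<beta> - 1) * x ^ i))"
      proof (cases "x \<in> {0<..1}")
        case True
        then have "(k * (1 - x)) powr (\<beta> - 1) = k powr (\<beta> - 1) * (1 - x) powr (\<beta> - 1)" by (simp add: powr_mult)
        then show ?thesis using True 2 unfolding 1 by (simp add: power_mult_distrib)
      qed (use 2 in simp)
    qed simp
    also have "\<bar>k\<bar> *\<^sub>R \<dots> = beta_const \<beta> i * (k * (k powr (\<beta> - 1) * k ^ i))"
      using k by (simp add: beta_const_def)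
    also have "k * (k powr (\<beta> - 1) * k ^ i) = k powr (\<beta> + i)"
    proof -
      have "k powr (\<beta> + i) = k powr 1 * k powr (\<beta> - 1) * k powr (real i)"
        unfolding powr_add[symmetric] by simp
      then show ?thesis using k by (simp add: powr_realpow)
    qed
    finally show ?thesis using k by (simp add: k_def)
  qed
qed

lemma truncated_polynomial_integral:
  fixes d :: "nat \<Rightarrow> 'b::{banach, second_countable_topology}" and \<beta> a t :: real
  assumes "0 < \<beta>" "0 \<le> a" "0 \<le> t" and Q: "\<And>s. Q s = (\<Sum>i\<le>p. (s - a) ^ i *\<^sub>R d i)"
  shows "integrable lborel (\<lambda>s. indicat_real {0..t} s *\<^sub>R ((t - s) powr (\<beta> - 1) *\<^sub>R (if a < s then Q s else 0)))"
    "(LINT s|lborel. indicat_real {0..t} s *\<^sub>R ((t - s) powr (\<beta> - 1) *\<^sub>R (if a < s then Q s else 0)))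
      = (\<Sum>i\<le>p. (max 0 (t - a) powr (\<beta> + i)) *\<^sub>R (beta_const \<beta> i *\<^sub>R d i))"
proof -
  note tp = truncated_power_integral[OF assms(1-3)]
  have eq: "(\<lambda>s. indicat_real {0..t} s *\<^sub>R ((t - s) powr (\<beta> - 1) *\<^sub>R (if a < s then Q s else 0)))
    = (\<lambda>s. \<Sum>i\<le>p. (indicat_real {a<..t} s * ((t - s) powr (\<beta> - 1) * (s - a) ^ i)) *\<^sub>R d i)" (is "?L = ?R")
  proof
    fix s
    show "?L s = ?R s" using assms(2)
      by (cases "a < s \<and> s \<le> t") (auto simp: Q scaleR_sum_right)
  qed
  show "integrable lborel ?L" unfolding eq by (intro Bochner_Integration.integrable_sum integrable_scaleR_left tp)
  show "integral\<^sup>L lborel ?L = (\<Sum>i\<le>p. (max 0 (t - a) powr (\<beta> + i)) *\<^sub>R (beta_const \<beta> i *\<^sub>R d i))"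
  proof -
    have 1: "(LINT s|lborel. (indicat_real {a<..t} s * ((t - s) powr (\<beta> - 1) * (s - a) ^ i)) *\<^sub>R d i)
        = (max 0 (t - a) powr (\<beta> + i)) *\<^sub>R (beta_const \<beta> i *\<^sub>R d i)" for i
    proof -
      have "(LINT s|lborel. (indicat_real {a<..t} s * ((t - s) powr (\<beta> - 1) * (s - a) ^ i)) *\<^sub>R d i)
          = (LINT s|lborel. indicat_real {a<..t} s * ((t - s) powr (\<beta> - 1) * (s - a) ^ i)) *\<^sub>R d i"
        by (rule integral_scaleR_left) (rule tp(1))
      then show ?thesis unfolding tp(2) by (simp add: mult.commute)
    qed
    show ?thesis unfolding eq 1[symmetric] by (rule Bochner_Integration.integral_sum) (intro integrable_scaleR_left tp)
  qed
qed

lemma truncated_power_AC: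
  fixes \<gamma> a :: real
  assumes "0 < \<gamma>" "0 \<le> a"
  defines "g \<equiv> \<lambda>s. \<gamma> * max 0 (s - a) powr (\<gamma> - 1)"
  shows "set_integrable lborel {0..r} g" "0 \<le> r \<Longrightarrow> max 0 (r - a) powr \<gamma> = max 0 (0 - a) powr \<gamma> + (LBINT s:{0..r}. g s)"
proof -
  have eq: "(\<lambda>s. indicat_real {0..r} s *\<^sub>R g s) = (\<lambda>s. indicat_real {a..r} s *\<^sub>R (\<gamma> * (s - a) powr (\<gamma> - 1)))"
    using assms(2) by (auto simp: fun_eq_iff g_def indicator_def max_def)
  have i: "set_integrable lborel {a..r} (\<lambda>s. \<gamma> * (s - a) powr (\<gamma> - 1))"
  proof (cases "a \<le> r")
    case True then show ?thesis using powr_interval(1)[OF assms(1) True] by simp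
  qed (simp add: set_integrable_def)
  show "set_integrable lborel {0..r} g" using i unfolding set_integrable_def eq .
  have "(LBINT s:{0..r}. g s) = (LBINT s:{a..r}. \<gamma> * (s - a) powr (\<gamma> - 1))" unfolding set_lebesgue_integral_def eq ..
  also have "\<dots> = max 0 (r - a) powr \<gamma>"
  proof (cases "a \<le> r")
    case True then show ?thesis using powr_interval(2)[OF assms(1) True] assms(1) by simp
  qed (simp add: set_lebesgue_integral_def)
  finally show "max 0 (r - a) powr \<gamma> = max 0 (0 - a) powr \<gamma> + (LBINT s:{0..r}. g s)" using assms(2) by simp
qed

lemma truncated_power_derivative:
  fixes \<gamma> a t :: real
  assumes "t \<noteq> a"
  shows "((\<lambda>t. max 0 (t - a) powr \<gamma>) has_real_derivative \<gamma> * max 0 (t - a) powr (\<gamma> - 1)) (at t)"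
proof (cases "t < a")
  case True
  have "((\<lambda>t. 0) has_real_derivative \<gamma> * max 0 (t - a) powr (\<gamma> - 1)) (at t)" using True by simp
  then show ?thesis
    by (rule has_field_derivative_transform_within_open[where S = "{..<a}"]) (use True in auto)
next
  case False
  with assms have t: "a < t" by simp
  have "((\<lambda>t. (t - a) powr \<gamma>) has_real_derivative \<gamma> * max 0 (t - a) powr (\<gamma> - 1)) (at t)"
    using t by (auto intro!: derivative_eq_intros)
  then show ?thesis
    by (rule has_field_derivative_transform_within_open[where S = "{a<..}"]) (use t in auto)
qed

text \<open>Horner's scheme: the induction peels off one factor s, written as (s - a) + a.\<close>

lemma polynomial_recentre:
  fixes c :: "nat \<Rightarrow> 'b::real_vector" and a :: real
  shows "\<exists>d. \<forall>s. (\<Sum>i\<le>p. s ^ i *\<^sub>R c i) = (\<Sum>i\<le>p. (s - a) ^ i *\<^sub>R d i)"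
proof (induction p arbitrary: c)
  case 0
  show ?case by (intro exI[of _ c]) simp
next
  case (Suc p)
  obtain d where d: "\<And>s. (\<Sum>i\<le>p. s ^ i *\<^sub>R c (Suc i)) = (\<Sum>i\<le>p. (s - a) ^ i *\<^sub>R d i)"
    using Suc.IH[of "\<lambda>i. c (Suc i)"] by blast
  define e where "e i = (if i = 0 then c 0 else d (i - 1)) + (if i \<le> p then a *\<^sub>R d i else 0)" for i
  have "(\<Sum>i\<le>Suc p. s ^ i *\<^sub>R c i) = (\<Sum>i\<le>Suc p. (s - a) ^ i *\<^sub>R e i)" for s
  proof -
    have "(\<Sum>i\<le>Suc p. s ^ i *\<^sub>R c i) = c 0 + s *\<^sub>R (\<Sum>i\<le>p. s ^ i *\<^sub>R c (Suc i))"
      by (simp only: sum.atMost_Suc_shift) (simp add: scaleR_sum_right)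
    also have "\<dots> = c 0 + (s - a) *\<^sub>R (\<Sum>i\<le>p. (s - a) ^ i *\<^sub>R d i) + a *\<^sub>R (\<Sum>i\<le>p. (s - a) ^ i *\<^sub>R d i)"
      unfolding d by (simp add: algebra_simps)
    also have "c 0 + (s - a) *\<^sub>R (\<Sum>i\<le>p. (s - a) ^ i *\<^sub>R d i) = (\<Sum>i\<le>Suc p. (s - a) ^ i *\<^sub>R (if i = 0 then c 0 else d (i - 1)))"
      by (simp only: sum.atMost_Suc_shift) (simp add: scaleR_sum_right)
    also have "a *\<^sub>R (\<Sum>i\<le>p. (s - a) ^ i *\<^sub>R d i) = (\<Sum>i\<le>Suc p. (s - a) ^ i *\<^sub>R (if i \<le> p then a *\<^sub>R d i else 0))"
      by (simp add: scaleR_sum_right mult.commute)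
    finally show ?thesis unfolding e_def scaleR_add_right sum.distrib .
  qed
  then show ?case by blast
qed

text \<open>A piecewise polynomial is a combination of polynomials truncated at mesh points, and the
  fractional integral of a power of degree i truncated at a is a multiple of the truncated power of
  order \<beta> + i. Such powers are absolutely continuous and differentiable except at a, so the
  derivative is explicit off the mesh.\<close>

lemma frac_integral_piecewise_polynomial:
  fixes U :: "real \<Rightarrow> 'b::{real_inner, banach, second_countable_topology}"
  assumes b: "0 < \<beta>" "\<beta> < 1" and m: "mesh t N"
    and U: "\<And>n s. n \<in> {1..N} \<Longrightarrow> s \<in> {t (n - 1)<..<t n} \<Longrightarrow> U s = (\<Sum>i\<le>p n. s ^ i *\<^sub>R c n i)"
  shows "weakly_AC (t N) (frac_integral \<beta> U) (\<lambda>s. vector_derivative (frac_integral \<beta> U) (at s))"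
proof -
  define q where "q n s = (\<Sum>i\<le>p n. s ^ i *\<^sub>R c n i)" for n s
  have "\<exists>d. \<forall>s. q n s = (\<Sum>i\<le>p n. (s - a) ^ i *\<^sub>R d i)" for n a
    unfolding q_def by (rule polynomial_recentre)
  note ex = this
  define d where "d n a = (SOME d. \<forall>s. q n s = (\<Sum>i\<le>p n. (s - a) ^ i *\<^sub>R d i))" for n a
  have d: "q n s = (\<Sum>i\<le>p n. (s - a) ^ i *\<^sub>R d n a i)" for n a s
    unfolding d_def using someI_ex[OF ex[of n a]] by blast
  define tr where "tr a n s = (if a < s then q n s else 0)" for a :: real and n s
  have t0: "0 \<le> t n" if "n \<le> N" for n using mesh_nonneg[OF m that] .
  define I where "I a n r = (LINT s|lborel. indicat_real {0..r} s *\<^sub>R ((r - s) powr (\<beta> - 1) *\<^sub>R tr a n s))" for a n r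
  have I: "integrable lborel (\<lambda>s. indicat_real {0..r} s *\<^sub>R ((r - s) powr (\<beta> - 1) *\<^sub>R tr a n s))"
    "I a n r = (\<Sum>i\<le>p n. (max 0 (r - a) powr (\<beta> + i)) *\<^sub>R (beta_const \<beta> i *\<^sub>R d n a i))" if "0 \<le> a" "0 \<le> r" for a n r
    unfolding I_def tr_def using truncated_polynomial_integral[OF b(1) that d] by blast+
  \<comment> \<open>Piece n is switched on at its left end and subtracted again beyond its right
    end: on interval j the pieces with n < j cancel and those with n > j have not started.\<close>
  have dec: "U s = (\<Sum>n\<in>{1..N}. tr (t (n - 1)) n s - tr (t n) n s)"
    if s: "0 < s" "s < t N" "s \<notin> t ` {..N}" for s
  proof -
    obtain j where j: "j \<in> {1..N}" "s \<in> {t (j - 1)<..<t j} \<or> s = t j"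
      by (rule mesh_cover[OF m _ s(1,2)]) (auto intro: that)
    have js: "s \<in> {t (j - 1)<..<t j}" using j s(3) by auto
    have "tr (t (n - 1)) n s - tr (t n) n s = (if n = j then q n s else 0)" if n: "n \<in> {1..N}" for n
    proof (cases n j rule: linorder_cases)
      case less
      then have "t (n - 1) \<le> t (j - 1)" "t n \<le> t (j - 1)" using j(1) by (auto intro!: mesh_mono[OF m])
      then show ?thesis using less js by (simp add: tr_def)
    next
      case equal then show ?thesis using js by (auto simp: tr_def)
    next
      case greater
      then have "t j \<le> t (n - 1)" "t j \<le> t n" using n by (auto intro!: mesh_mono[OF m])
      then show ?thesis using greater js by (auto simp: tr_def)
    qed
    then have "(\<Sum>n\<in>{1..N}. tr (t (n - 1)) n s - tr (t n) n s) = (\<Sum>n\<in>{1..N}. if n = j then q n s else 0)"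
      by (intro sum.cong) auto
    also have "\<dots> = q j s" using j(1) by simp
    finally show ?thesis using U[OF j(1) js] by (simp add: q_def)
  qed
  have F: "frac_integral \<beta> U r = (1 / Gamma \<beta>) *\<^sub>R (\<Sum>n\<in>{1..N}. I (t (n - 1)) n r - I (t n) n r)" if r: "r \<in> {0..t N}" for r
  proof -
    let ?h = "\<lambda>a n s. indicat_real {0..r} s *\<^sub>R ((r - s) powr (\<beta> - 1) *\<^sub>R tr a n s)"
    let ?f = "\<lambda>s. (1 / Gamma \<beta>) *\<^sub>R (\<Sum>n\<in>{1..N}. ?h (t (n - 1)) n s - ?h (t n) n s)"
    have hi: "integrable lborel (?h (t (n - 1)) n)" "integrable lborel (?h (t n) n)" if "n \<in> {1..N}" for n
      by (rule I(1); use that r t0[of n] t0[of "n - 1"] in auto)+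
    have fi: "integrable lborel ?f" by (intro integrable_scaleR_right Bochner_Integration.integrable_sum Bochner_Integration.integrable_diff hi)
    have "frac_integral \<beta> U r = integral\<^sup>L lebesgue ?f"
      unfolding frac_integral_def set_lebesgue_integral_def
    proof (rule integral_discrete_difference[of "insert 0 (t ` {..N})"])
      fix s assume s: "s \<notin> insert 0 (t ` {..N})"
      show "indicat_real {0..r} s *\<^sub>R omega \<beta> (r - s) *\<^sub>R U s = ?f s"
      proof (cases "s \<in> {0..r}")
        case True
        then have "0 < s" "s < t N" using s r by (auto simp: order_less_le)
        then have "U s = (\<Sum>n\<in>{1..N}. tr (t (n - 1)) n s - tr (t n) n s)" using s by (intro dec) auto
        then show ?thesis using True by (simp add: omega_def scaleR_sum_right scaleR_diff_right)
      qed simp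
    qed (auto simp: countable_finite)
    also have "\<dots> = integral\<^sup>L lborel ?f" by (rule integral_completion) (rule borel_measurable_integrable[OF fi])
    also have "\<dots> = (1 / Gamma \<beta>) *\<^sub>R (\<Sum>n\<in>{1..N}. I (t (n - 1)) n r - I (t n) n r)"
    proof -
      have "(LINT s|lborel. (\<Sum>n\<in>{1..N}. ?h (t (n - 1)) n s - ?h (t n) n s))
          = (\<Sum>n\<in>{1..N}. LINT s|lborel. ?h (t (n - 1)) n s - ?h (t n) n s)"
        by (rule Bochner_Integration.integral_sum) (intro Bochner_Integration.integrable_diff hi)
      also have "\<dots> = (\<Sum>n\<in>{1..N}. I (t (n - 1)) n r - I (t n) n r)"
        unfolding I_def by (intro sum.cong refl Bochner_Integration.integral_diff hi)
      finally show ?thesis unfolding integral_scaleR_right by (rule arg_cong[where f = "scaleR (1 / Gamma \<beta>)"])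
    qed
    finally show ?thesis .
  qed
  define E where "E = (\<lambda>n a i. (beta_const \<beta> i / Gamma \<beta>) *\<^sub>R d n a i)"
  define \<psi> where "\<psi> = (\<lambda>a i r. max 0 (r - a) powr (\<beta> + real i))"
  define \<psi>' where "\<psi>' = (\<lambda>a i r. (\<beta> + real i) * max 0 (r - a) powr (\<beta> + real i - 1))"
  define H where "H r = (\<Sum>n\<in>{1..N}. \<Sum>i\<le>p n. \<psi> (t (n - 1)) i r *\<^sub>R E n (t (n - 1)) i) + (\<Sum>n\<in>{1..N}. \<Sum>i\<le>p n. \<psi> (t n) i r *\<^sub>R (- E n (t n) i))" for r
  define D where "D r = (\<Sum>n\<in>{1..N}. \<Sum>i\<le>p n. \<psi>' (t (n - 1)) i r *\<^sub>R E n (t (n - 1)) i) + (\<Sum>n\<in>{1..N}. \<Sum>i\<le>p n. \<psi>' (t n) i r *\<^sub>R (- E n (t n) i))" for r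
  have HF: "frac_integral \<beta> U r = H r" if r: "r \<in> {0..t N}" for r
  proof -
    have "I (t (n - 1)) n r = (\<Sum>i\<le>p n. \<psi> (t (n - 1)) i r *\<^sub>R (beta_const \<beta> i *\<^sub>R d n (t (n - 1)) i))"
      "I (t n) n r = (\<Sum>i\<le>p n. \<psi> (t n) i r *\<^sub>R (beta_const \<beta> i *\<^sub>R d n (t n) i))" if "n \<in> {1..N}" for n
      unfolding \<psi>_def by (rule I(2); use that r t0[of n] t0[of "n - 1"] in auto)+
    note 2 = this
    have 3: "(\<Sum>i\<le>p n. \<psi> a i r *\<^sub>R E n a i) = (1 / Gamma \<beta>) *\<^sub>R (\<Sum>i\<le>p n. \<psi> a i r *\<^sub>R (beta_const \<beta> i *\<^sub>R d n a i))" for a n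
      unfolding E_def scaleR_sum_right scaleR_scaleR by (intro sum.cong refl arg_cong2[where f = scaleR]) simp
    have 1: "(\<Sum>i\<le>p n. \<psi> (t (n - 1)) i r *\<^sub>R E n (t (n - 1)) i) = (1 / Gamma \<beta>) *\<^sub>R I (t (n - 1)) n r"
      "(\<Sum>i\<le>p n. \<psi> (t n) i r *\<^sub>R E n (t n) i) = (1 / Gamma \<beta>) *\<^sub>R I (t n) n r" if "n \<in> {1..N}" for n
      unfolding 3 2[OF that] by (rule refl)+
    have "H r = (\<Sum>n\<in>{1..N}. (1 / Gamma \<beta>) *\<^sub>R I (t (n - 1)) n r) - (\<Sum>n\<in>{1..N}. (1 / Gamma \<beta>) *\<^sub>R I (t n) n r)"
      unfolding H_def scaleR_minus_right sum_negf add_uminus_conv_diff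
      by (intro arg_cong2[where f = minus] sum.cong refl 1)
    then show ?thesis unfolding F[OF r] sum_subtractf scaleR_diff_right scaleR_sum_right by (rule sym)
  qed
  have A: "weakly_AC (t N) (\<lambda>r. \<psi> a i r *\<^sub>R e) (\<lambda>r. \<psi>' a i r *\<^sub>R e)" if "0 \<le> a" for a i and e :: 'b
    unfolding \<psi>_def \<psi>'_def
  proof (rule weakly_AC_scaleR)
    have bi: "0 < \<beta> + real i" using b by simp
    show "set_integrable lborel {0..t N} (\<lambda>r. (\<beta> + real i) * max 0 (r - a) powr (\<beta> + real i - 1))"
      by (rule truncated_power_AC(1)[OF bi that])
    show "max 0 (r - a) powr (\<beta> + real i) = max 0 (0 - a) powr (\<beta> + real i)
        + (LBINT s:{0..r}. (\<beta> + real i) * max 0 (s - a) powr (\<beta> + real i - 1))" if "r \<in> {0..t N}" for r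
      by (rule truncated_power_AC(2)[OF bi \<open>0 \<le> a\<close>]) (use that in simp)
  qed
  have 1: "weakly_AC (t N) H D"
    unfolding H_def D_def
    by (intro weakly_AC_add weakly_AC_sum finite_atLeastAtMost finite_atMost A t0) auto
  have 2: "AE s in lborel. s \<in> {0<..<t N} \<longrightarrow> vector_derivative (frac_integral \<beta> U) (at s) = D s"
  proof -
    have "t ` {..N} \<in> null_sets lborel" by (rule finite_imp_null_set_lborel) simp
    then have "AE s in lborel. s \<notin> t ` {..N}" by (rule AE_not_in)
    then show ?thesis
    proof eventually_elim
      case (elim s)
      show ?case
      proof
        assume s: "s \<in> {0<..<t N}"
        have ne: "s \<noteq> t n" if "n \<le> N" for n using elim that by auto
        have der: "((\<lambda>r. \<psi> (t n) i r *\<^sub>R e) has_vector_derivative \<psi>' (t n) i s *\<^sub>R e) (at s)" if "n \<le> N" for n i and e :: 'b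
          using truncated_power_derivative[OF ne[OF that], of "\<beta> + real i"] unfolding \<psi>_def \<psi>'_def
          by (intro bounded_linear.has_vector_derivative[OF bounded_linear_scaleR_left])
             (simp add: has_real_derivative_iff_has_vector_derivative)
        have "(H has_vector_derivative D s) (at s)"
          unfolding H_def D_def
          by (intro has_vector_derivative_add has_vector_derivative_sum der) auto
        then have "(frac_integral \<beta> U has_vector_derivative D s) (at s)"
          by (rule has_vector_derivative_transform_within_open[where S = "{0<..<t N}"]) (use s HF in auto)
        then show "vector_derivative (frac_integral \<beta> U) (at s) = D s" by (rule vector_derivative_at)
      qed
    qed
  qed
  show ?thesis by (rule weakly_AC_cong[OF 1 _ 2]) (use HF t0 in auto)
qed

section \<open>The error identity\<close>

lemma weakly_AC_fst: "weakly_AC T H D \<Longrightarrow> weakly_AC T (\<lambda>s. fst (H s)) (\<lambda>s. fst (D s))"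
  unfolding weakly_AC_def by (intro allI) (drule_tac x = "(c, 0)" in spec, simp add: inner_prod_def)

lemma weakly_AC_snd: "weakly_AC T H D \<Longrightarrow> weakly_AC T (\<lambda>s. snd (H s)) (\<lambda>s. snd (D s))"
  unfolding weakly_AC_def by (intro allI) (drule_tac x = "(0, c)" in spec, simp add: inner_prod_def)

lemma polynomial_derivative:
  fixes c :: "nat \<Rightarrow> 'b::real_normed_vector"
  shows "((\<lambda>s. \<Sum>i\<le>p. s ^ i *\<^sub>R c i) has_vector_derivative (\<Sum>i\<le>p. (real i * s ^ (i - 1)) *\<^sub>R c i)) (at s)"
proof (intro has_vector_derivative_sum bounded_linear.has_vector_derivative[OF bounded_linear_scaleR_left])
  fix i
  have "((\<lambda>s. s ^ i) has_real_derivative real i * s ^ (i - 1)) (at s)"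
    by (auto intro!: derivative_eq_intros)
  then show "((\<lambda>s. s ^ i) has_vector_derivative real i * s ^ (i - 1)) (at s)"
    by (simp add: has_real_derivative_iff_has_vector_derivative)
qed

lemma weakly_AC_polynomial:
  fixes c :: "nat \<Rightarrow> 'b::real_inner"
  shows "weakly_AC T (\<lambda>s. \<Sum>i\<le>p. s ^ i *\<^sub>R c i) (\<lambda>s. \<Sum>i\<le>p. (real i * s ^ (i - 1)) *\<^sub>R c i)"
proof (intro weakly_AC_sum finite_atMost weakly_AC_scaleR)
  fix i
  have int: "set_integrable lborel {0..r} (\<lambda>s. real i * s ^ (i - 1))" for r
    by (intro borel_integrable_atLeastAtMost' continuous_intros)
  then show "set_integrable lborel {0..T} (\<lambda>s. real i * s ^ (i - 1))" .
  fix r assume r: "r \<in> {0..T}"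
  have "(LBINT s:{0..r}. real i * s ^ (i - 1)) = r ^ i - 0 ^ i"
  proof (rule LBINT_FTC[of "{}" _ _ "\<lambda>s. s ^ i"])
    show "((\<lambda>s. s ^ i) has_real_derivative real i * y ^ (i - 1)) (at y)" for y :: real
      by (auto intro!: derivative_eq_intros)
  qed (use r int in \<open>auto intro!: continuous_intros\<close>)
  then show "r ^ i = 0 ^ i + (LBINT s:{0..r}. real i * s ^ (i - 1))" by simp
qed

lemma left_lim_eq:
  fixes v q :: "real \<Rightarrow> 'b::t2_space"
  assumes "a < b" "\<And>s. s \<in> {a<..<b} \<Longrightarrow> v s = q s" "isCont q b"
  shows "left_lim v b = q b"
  unfolding left_lim_def
proof (rule tendsto_Lim)
  have "(q \<longlongrightarrow> q b) (at_left b)" using assms(3) by (simp add: isCont_def filterlim_at_split)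
  moreover have "eventually (\<lambda>s. q s = v s) (at_left b)"
    by (rule eventually_at_leftI[of a]) (use assms in auto)
  ultimately show "(v \<longlongrightarrow> q b) (at_left b)" by (rule Lim_transform_eventually)
qed simp

lemma right_lim_eq:
  fixes v q :: "real \<Rightarrow> 'b::t2_space"
  assumes "a < b" "\<And>s. s \<in> {a<..<b} \<Longrightarrow> v s = q s" "isCont q a"
  shows "right_lim v a = q a"
  unfolding right_lim_def
proof (rule tendsto_Lim)
  have "(q \<longlongrightarrow> q a) (at_right a)" using assms(3) by (simp add: isCont_def filterlim_at_split)
  moreover have "eventually (\<lambda>s. q s = v s) (at_right a)"
    by (rule eventually_at_rightI[of _ b]) (use assms in auto)
  ultimately show "(v \<longlongrightarrow> q a) (at_right a)" by (rule Lim_transform_eventually)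
qed simp

lemma lebesgue_open_interval_integral:
  fixes f :: "real \<Rightarrow> real"
  assumes "set_integrable lborel {a..b} g" "\<And>s. s \<in> {a<..<b} \<Longrightarrow> f s = g s"
  shows "(LINT s:{a<..<b}|lebesgue. f s) = (LBINT s:{a..b}. g s)"
  unfolding set_lebesgue_integral_def
proof (rule lborel_integral_cong_AE(2)[OF assms(1)[unfolded set_integrable_def]])
  have "AE s in lborel. s \<noteq> a" "AE s in lborel. s \<noteq> b" by (rule AE_lborel_singleton)+
  then show "AE s in lborel. indicat_real {a<..<b} s *\<^sub>R f s = indicat_real {a..b} s *\<^sub>R g s"
    by eventually_elim (use assms(2) in \<open>auto simp: indicator_def\<close>)
qed

text \<open>One mesh with its solution, scheme solution and projection, and one choice
  \<open>cU\<close>, \<open>cP\<close> of polynomial coefficients on each interval. Constants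
  defined inside depend only on the parameters that they mention; uniformity in all other data is
  read off from that.\<close>

locale dg_error =
  fixes \<Omega> :: "'a::euclidean_space set" and \<alpha> T K :: real and N :: nat and t :: "nat \<Rightarrow> real" and p :: "nat \<Rightarrow> nat"
    and f :: "real \<Rightarrow> ('a, real) L2" and u0 :: "('a, real) L2" and u U P \<eta>' :: "real \<Rightarrow> 'a jet"
    and cU cP :: "nat \<Rightarrow> nat \<Rightarrow> 'a jet"
  assumes \<alpha>: "-1 < \<alpha>" "\<alpha> < 0" and K: "K > 0" and T: "T > 0"
    and time_mesh: "time_mesh T N t" and p: "\<And>n. n \<in> {1..N} \<Longrightarrow> p n \<ge> 1"
    and steps: "\<And>i j. 1 \<le> i \<Longrightarrow> i \<le> j \<Longrightarrow> j \<le> N \<Longrightarrow> step t i \<le> step t j"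
    and sol: "frac_diffusion_solution \<Omega> K \<alpha> T f u0 u"
    and dg: "dg_solution \<Omega> K \<alpha> N t p f u0 U"
    and proj: "dg_projection \<Omega> N t p u P"
    and eta_weak: "\<And>n. n \<in> {1..N} \<Longrightarrow> has_weak_derivative (subinterval t n) (\<lambda>s. P s - u s) \<eta>'"
    and cU: "\<And>n i. n \<in> {1..N} \<Longrightarrow> i \<le> p n \<Longrightarrow> cU n i \<in> H10 \<Omega>"
      "\<And>n s. n \<in> {1..N} \<Longrightarrow> s \<in> subinterval t n \<Longrightarrow> U s = (\<Sum>i\<le>p n. s ^ i *\<^sub>R cU n i)"
    and cP: "\<And>n i. n \<in> {1..N} \<Longrightarrow> i \<le> p n \<Longrightarrow> cP n i \<in> H10 \<Omega>"
      "\<And>n s. n \<in> {1..N} \<Longrightarrow> s \<in> subinterval t n \<Longrightarrow> P s = (\<Sum>i\<le>p n. s ^ i *\<^sub>R cP n i)"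
begin

abbreviation "\<beta> \<equiv> \<alpha> + 1"

text \<open>Polynomials on the whole line extending the n-th pieces, so that one-sided limits at
  mesh points become plain values.\<close>

definition "qU n s = (\<Sum>i\<le>p n. s ^ i *\<^sub>R cU n i)"
definition "qP n s = (\<Sum>i\<le>p n. s ^ i *\<^sub>R cP n i)"
definition "c\<theta> n i = cU n i - cP n i"
definition "\<theta> n s = (\<Sum>i\<le>p n. s ^ i *\<^sub>R c\<theta> n i)"
definition "\<theta>' n s = (\<Sum>i\<le>p n. (real i * s ^ (i - 1)) *\<^sub>R c\<theta> n i)"

lemma \<beta>: "0 < \<beta>" "\<beta> < 1" using \<alpha> by auto
lemma mesh: "mesh t N" and tN: "t N = T" and N: "1 \<le> N"
  using time_mesh by (auto simp: time_mesh_def mesh_def)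
lemma mesh_sub: "m \<le> N \<Longrightarrow> mesh t m" using mesh by (auto simp: mesh_def)
lemma t_step: "n \<in> {1..N} \<Longrightarrow> t (n - 1) < t n" by (rule mesh_step[OF mesh])
lemma t_nonneg: "n \<le> N \<Longrightarrow> 0 \<le> t n" by (rule mesh_nonneg[OF mesh])
lemma t_le_T: "n \<le> N \<Longrightarrow> t n \<le> T" using mesh_mono[OF mesh, of n N] tN by simp
lemma t_interval: "n \<in> {1..N} \<Longrightarrow> 0 \<le> t (n - 1)" "n \<in> {1..N} \<Longrightarrow> t n \<le> T" "n \<in> {1..N} \<Longrightarrow> 0 < t n"
proof -
  assume n: "n \<in> {1..N}"
  show "0 \<le> t (n - 1)" "t n \<le> T" using n by (auto intro: t_nonneg t_le_T)
  then show "0 < t n" using t_step[OF n] by simp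
qed

lemma \<theta>_eq: "\<theta> n s = qU n s - qP n s"
  by (simp add: \<theta>_def qU_def qP_def c\<theta>_def scaleR_diff_right sum_subtractf)
lemma continuous_qU: "continuous_on A (qU n)" unfolding qU_def by (intro continuous_intros)
lemma continuous_qP: "continuous_on A (qP n)" unfolding qP_def by (intro continuous_intros)
lemma continuous_\<theta>: "continuous_on A (\<theta> n)" unfolding \<theta>_def by (intro continuous_intros)
lemma continuous_\<theta>': "continuous_on A (\<theta>' n)" unfolding \<theta>'_def by (intro continuous_intros)
lemma isCont_q: "isCont (qU n) s" "isCont (qP n) s"
  using continuous_qU[of UNIV n] continuous_qP[of UNIV n] by (auto simp: continuous_on_eq_continuous_at)
lemma U_eq: "n \<in> {1..N} \<Longrightarrow> s \<in> {t (n - 1)<..<t n} \<Longrightarrow> U s = qU n s"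
  using cU(2) by (simp add: qU_def subinterval_def)
lemma P_eq: "n \<in> {1..N} \<Longrightarrow> s \<in> {t (n - 1)<..<t n} \<Longrightarrow> P s = qP n s"
  using cP(2) by (simp add: qP_def subinterval_def)
lemma c\<theta>: "n \<in> {1..N} \<Longrightarrow> i \<le> p n \<Longrightarrow> c\<theta> n i \<in> H10 \<Omega>"
  unfolding c\<theta>_def by (intro subspace_diff[OF subspace_H10] cU cP)

lemma left_lim_U: "n \<in> {1..N} \<Longrightarrow> left_lim U (t n) = qU n (t n)"
  by (rule left_lim_eq[OF t_step]) (auto intro: U_eq isCont_q)
lemma right_lim_U: "n \<in> {1..N} \<Longrightarrow> right_lim U (t (n - 1)) = qU n (t (n - 1))"
  by (rule right_lim_eq[OF t_step]) (auto intro: U_eq isCont_q)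
lemma qP_end: "n \<in> {1..N} \<Longrightarrow> qP n (t n) = u (t n)"
proof -
  assume n: "n \<in> {1..N}"
  have "left_lim P (t n) = qP n (t n)"
    by (rule left_lim_eq[OF t_step[OF n]]) (use n in \<open>auto intro: P_eq isCont_q\<close>)
  then show ?thesis using proj n by (simp add: dg_projection_def)
qed

lemma u_continuous: "continuous_on {0..T} u" and u_0: "fst (u 0) = u0"
  using sol by (auto simp: frac_diffusion_solution_def)

lemma u_bounded_piecewise: "m \<le> N \<Longrightarrow> \<exists>B. \<forall>s\<in>{0..t m}. norm (u s) \<le> B"
proof -
  assume "m \<le> N"
  then have "compact (u ` {0..t m})"
    by (intro compact_continuous_image continuous_on_subset[OF u_continuous]) (auto dest: t_le_T)
  then have "bounded (u ` {0..t m})" by (rule compact_imp_bounded)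
  then show ?thesis by (auto simp: bounded_iff)
qed

text \<open>Trial functions have arbitrary values at mesh points, so these are normalised to 0. Only
  the history up to t m enters the energy identity for m, hence everything from t m on is cut
  off.\<close>

definition "cutoff m v s = (if 0 < s \<and> s < t m \<and> s \<notin> t ` {..m} then v s else (0::'a jet))"

lemma pw_cut:
  assumes m: "m \<in> {1..N}" and v: "\<And>n s. n \<in> {1..m} \<Longrightarrow> s \<in> {t (n - 1)<..<t n} \<Longrightarrow> v s = w n s"
    and w: "\<And>n. n \<in> {1..m} \<Longrightarrow> continuous_on {t (n - 1)..t n} (w n)"
  shows "pw (t m) (cutoff m v)"
proof -
  have mm: "mesh t m" using m by (intro mesh_sub) simp
  have loc: "\<exists>n\<in>{1..m}. s \<in> {t (n - 1)<..<t n}" if s: "0 < s" "s < t m" "s \<notin> t ` {..m}" for s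
  proof -
    obtain j where "j \<in> {1..m}" "s \<in> {t (j - 1)<..<t j} \<or> s = t j"
      by (rule mesh_cover[OF mm order_refl s(1,2)]) (rule that)
    then show ?thesis using s(3) by auto
  qed
  have nn: "n \<in> {1..N}" if "n \<in> {1..m}" for n using that m by simp
  have "\<exists>B. \<forall>s\<in>{t (n - 1)..t n}. norm (w n s) \<le> B" if "n \<in> {1..m}" for n
  proof -
    have "bounded (w n ` {t (n - 1)..t n})"
      by (intro compact_imp_bounded compact_continuous_image w[OF that] compact_Icc)
    then show ?thesis by (auto simp: bounded_iff)
  qed
  then have "\<forall>n\<in>{1..m}. \<exists>B. \<forall>s\<in>{t (n - 1)..t n}. norm (w n s) \<le> B" by blast
  from bchoice[OF this] obtain B where B: "\<And>n s. n \<in> {1..m} \<Longrightarrow> s \<in> {t (n - 1)..t n} \<Longrightarrow> norm (w n s) \<le> B n" by blast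
  have "norm (cutoff m v s) \<le> (\<Sum>n\<in>{1..m}. \<bar>B n\<bar>)" for s
  proof (cases "0 < s \<and> s < t m \<and> s \<notin> t ` {..m}")
    case True
    then obtain n where n: "n \<in> {1..m}" "s \<in> {t (n - 1)<..<t n}" using loc by blast
    have "norm (w n s) \<le> B n" by (rule B) (use n in auto)
    also have "\<dots> \<le> \<bar>B n\<bar>" by simp
    also have "\<dots> \<le> (\<Sum>n\<in>{1..m}. \<bar>B n\<bar>)" by (rule member_le_sum) (use n in auto)
    finally show ?thesis using True v[OF n] by (simp add: cutoff_def)
  next
    case False then show ?thesis by (auto simp: cutoff_def intro!: sum_nonneg)
  qed
  then have bd: "\<exists>B. \<forall>s. norm (cutoff m v s) \<le> B" by blast
  have "isCont (cutoff m v) s" if s: "s \<notin> insert 0 (t ` {..m})" for s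
  proof (cases "0 < s \<and> s < t m")
    case True
    then obtain n where n: "n \<in> {1..m}" "s \<in> {t (n - 1)<..<t n}" using loc s by blast
    have eq: "cutoff m v r = w n r" if r: "r \<in> {t (n - 1)<..<t n}" for r
    proof -
      have ne: "r \<noteq> t i" if "i \<le> m" for i
      proof (cases "i < n")
        case True
        then have "t i \<le> t (n - 1)" using n by (intro mesh_mono[OF mm]) auto
        then show ?thesis using r by auto
      next
        case False
        then have "t n \<le> t i" using that by (intro mesh_mono[OF mm]) auto
        then show ?thesis using r by auto
      qed
      have "0 \<le> t (n - 1)" "t n \<le> t m" using n t_interval[OF nn] mesh_mono[OF mm, of n m] by auto
      then show ?thesis using r ne v[OF n(1) r] by (auto simp: cutoff_def)
    qed
    have "continuous_on {t (n - 1)<..<t n} (w n)" by (rule continuous_on_subset[OF w[OF n(1)]]) auto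
    then have "continuous_on {t (n - 1)<..<t n} (cutoff m v)" by (rule continuous_on_eq) (simp add: eq)
    then show ?thesis using n(2) by (simp add: continuous_on_eq_continuous_at)
  next
    case False
    have S: "s < 0 \<or> t m < s" using False s by force
    have "open ({..<0} \<union> {t m<..})" by (intro open_Un) auto
    moreover have "cutoff m v r = 0" if "r \<in> {..<0} \<union> {t m<..}" for r using that by (auto simp: cutoff_def)
    ultimately have "continuous_on ({..<0} \<union> {t m<..}) (cutoff m v)"
      by (subst continuous_on_cong[OF refl, of _ _ "\<lambda>_. 0"]) auto
    then show ?thesis using S \<open>open ({..<0} \<union> {t m<..})\<close> by (auto simp: continuous_on_eq_continuous_at)
  qed
  then have "\<exists>S. finite S \<and> (\<forall>s. s \<notin> S \<longrightarrow> isCont (cutoff m v) s)" by (intro exI[of _ "insert 0 (t ` {..m})"]) auto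
  then show ?thesis using bd unfolding pw_def by (auto simp: cutoff_def)
qed

lemma pw_cut_U: "m \<in> {1..N} \<Longrightarrow> pw (t m) (cutoff m U)"
  by (rule pw_cut[where w = qU]) (auto intro: U_eq continuous_qU)
lemma pw_cut_u: "m \<in> {1..N} \<Longrightarrow> pw (t m) (cutoff m u)"
proof (rule pw_cut[where w = "\<lambda>n. u"])
  fix n assume "m \<in> {1..N}" "n \<in> {1..m}"
  then have n: "n \<in> {1..N}" by simp
  show "continuous_on {t (n - 1)..t n} u"
    using t_interval[OF n] by (intro continuous_on_subset[OF u_continuous]) auto
qed simp_all
lemma pw_cut_UP: "m \<in> {1..N} \<Longrightarrow> pw (t m) (cutoff m (\<lambda>s. U s - P s))"
proof (rule pw_cut[where w = \<theta>])
  fix n s assume "m \<in> {1..N}" "n \<in> {1..m}" and s: "s \<in> {t (n - 1)<..<t n}"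
  then have n: "n \<in> {1..N}" by simp
  show "U s - P s = \<theta> n s" unfolding \<theta>_eq U_eq[OF n s] P_eq[OF n s] ..
qed (assumption | rule continuous_\<theta>)+
lemma pw_cut_Pu: "m \<in> {1..N} \<Longrightarrow> pw (t m) (cutoff m (\<lambda>s. P s - u s))"
proof (rule pw_cut[where w = "\<lambda>n s. qP n s - u s"])
  fix n assume "m \<in> {1..N}" "n \<in> {1..m}"
  then have n: "n \<in> {1..N}" by simp
  show "continuous_on {t (n - 1)..t n} (\<lambda>s. qP n s - u s)"
    using t_interval[OF n] by (intro continuous_intros continuous_qP continuous_on_subset[OF u_continuous]) auto
qed (auto simp: P_eq)

lemma frac_integral_cut:
  assumes m: "m \<in> {1..N}" and v: "pw (t m) (cutoff m v)" and r: "0 \<le> r" "r \<le> t m"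
  shows "frac_integral \<beta> v r = (1 / Gamma \<beta>) *\<^sub>R frac_conv \<beta> (cutoff m v) r"
proof (rule frac_integral_pw(3)[OF \<beta> v, of "insert 0 (t ` {..m})" r])
  fix s assume "s \<in> {0..r}" "s \<notin> insert 0 (t ` {..m})"
  then show "v s = cutoff m v s" using r by (auto simp: cutoff_def order_less_le)
qed (use r in auto)

lemma weakly_AC_u: obtains u' where "weakly_AC T u u'"
    "AE s in lebesgue. s \<in> {0<..<T} \<longrightarrow> (\<forall>v\<in>H10 \<Omega>. fst (u' s) \<bullet> fst v
      + dirichlet_form K (riemann_liouville \<alpha> u s) v = f s \<bullet> fst v)"
    "AE s in lebesgue. s \<in> {0<..<T} \<longrightarrow> frac_integral \<beta> u differentiable (at s)"
proof -
  obtain u' where u': "has_weak_derivative {0<..<T} u u'"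
      "AE t in lebesgue. t \<in> {0<..<T} \<longrightarrow>
        f t \<in> L2_on \<Omega> \<and>
        frac_integral (\<alpha> + 1) u differentiable (at t) \<and>
        (\<forall>v\<in>H10 \<Omega>. fst (u' t) \<bullet> fst v + dirichlet_form K (riemann_liouville \<alpha> u t) v
          = f t \<bullet> fst v)"
    using sol unfolding frac_diffusion_solution_def by blast
  show thesis
  proof (rule that[OF weakly_AC_weak_derivative[OF u'(1) u_continuous T]])
    show "AE s in lebesgue. s \<in> {0<..<T} \<longrightarrow> (\<forall>v\<in>H10 \<Omega>. fst (u' s) \<bullet> fst v
      + dirichlet_form K (riemann_liouville \<alpha> u s) v = f s \<bullet> fst v)"
      using u'(2) by eventually_elim blast
    show "AE s in lebesgue. s \<in> {0<..<T} \<longrightarrow> frac_integral \<beta> u differentiable (at s)"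
      using u'(2) by eventually_elim blast
  qed
qed

lemma weakly_AC_Iu: "weakly_AC T (frac_integral \<beta> u) (riemann_liouville \<alpha> u)"
proof -
  obtain u' where u': "weakly_AC T u u'"
    "AE s in lebesgue. s \<in> {0<..<T} \<longrightarrow> frac_integral \<beta> u differentiable (at s)"
    by (rule weakly_AC_u) (rule that)
  define v where "v s = (if s \<in> {0<..<T} then u s else 0)" for s
  have "pw T v"
    unfolding pw_def
  proof (intro conjI)
    obtain B where B: "\<forall>s\<in>{0..T}. norm (u s) \<le> B" using u_bounded_piecewise[of N] tN by auto
    show "\<exists>B. \<forall>s. norm (v s) \<le> B" proof (intro exI allI)
      fix s show "norm (v s) \<le> \<bar>B\<bar>"
        using bspec[OF B, of s] by (cases "s \<in> {0<..<T}") (auto simp: v_def)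
    qed
    have "isCont v s" if s: "s \<notin> {0, T}" for s
    proof (cases "s \<in> {0<..<T}")
      case True
      have "continuous_on {0<..<T} u" by (rule continuous_on_subset[OF u_continuous]) auto
      then have "continuous_on {0<..<T} v" by (rule continuous_on_eq) (simp add: v_def)
      then show ?thesis using True by (simp add: continuous_on_eq_continuous_at)
    next
      case False
      have o: "open ({..<0} \<union> {T<..})" by (intro open_Un) auto
      have "continuous_on ({..<0} \<union> {T<..}) v"
        by (subst continuous_on_cong[OF refl, of _ _ "\<lambda>_. 0"]) (auto simp: v_def)
      moreover have "s \<in> {..<0} \<union> {T<..}" using False s by force
      ultimately show ?thesis using o by (simp add: continuous_on_eq_continuous_at)
    qed
    then show "\<exists>S. finite S \<and> (\<forall>s. s \<notin> S \<longrightarrow> isCont v s)" by (intro exI[of _ "{0, T}"]) auto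
  qed (simp add: v_def)
  then have "weakly_AC T (frac_integral \<beta> u) (\<lambda>t. vector_derivative (frac_integral \<beta> u) (at t))"
    by (rule frac_integral_weakly_AC[OF \<beta> T u'(1)]) (use u'(2) in \<open>auto simp: v_def AE_completion_iff\<close>)
  then show ?thesis by (simp add: riemann_liouville_def[abs_def])
qed

lemma weakly_AC_IU: "weakly_AC T (frac_integral \<beta> U) (riemann_liouville \<alpha> U)"
  using frac_integral_piecewise_polynomial[OF \<beta> mesh, where U = U and p = p and c = cU] U_eq
  by (simp add: qU_def tN riemann_liouville_def[abs_def])

lemma weakly_AC_IUP: "weakly_AC T (frac_integral \<beta> (\<lambda>s. U s - P s)) (riemann_liouville \<alpha> (\<lambda>s. U s - P s))"
  using frac_integral_piecewise_polynomial[OF \<beta> mesh, where U = "\<lambda>s. U s - P s" and p = p and c = c\<theta>] U_eq P_eq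
  by (simp add: \<theta>_def[symmetric] \<theta>_eq tN riemann_liouville_def[abs_def])

text \<open>For absolutely continuous H this is the integral of H' \<bullet> X over the n-th
  interval (\<open>weakly_AC_parts\<close>), and it is one summand of
  \<open>mesh_pairing\<close>.\<close>

definition "boundary_pairing n H X X' = H (t n) \<bullet> X (t n) - H (t (n - 1)) \<bullet> X (t (n - 1))
    - (LBINT s:{t (n - 1)..t n}. H s \<bullet> X' s)" for H X X' :: "real \<Rightarrow> 'b::real_inner"

text \<open>The limit of \<theta> at t (n - 1) from the left. For n = 1 it is 0 because scheme and
  solution share the starting value.\<close>

definition "jump_start n = (if n = 1 then 0 else fst (\<theta> (n - 1) (t (n - 1))))"

text \<open>The equation, tested at almost every time s with X s, is integrated over the interval
  and subtracted from the scheme, which eliminates f. All derivatives, including the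
  Riemann-Liouville ones, are then moved onto X.\<close>

lemma galerkin_identity:
  assumes n: "n \<in> {1..N}" and c: "\<And>i. i \<le> p n \<Longrightarrow> c i \<in> H10 \<Omega>"
    and X: "\<And>s. X s = (\<Sum>i\<le>p n. s ^ i *\<^sub>R c i)" and X': "\<And>s. X' s = (\<Sum>i\<le>p n. (real i * s ^ (i - 1)) *\<^sub>R c i)"
  shows "(fst (qU n (t (n - 1))) - fst (u (t (n - 1))) - jump_start n) \<bullet> fst (X (t (n - 1)))
      + boundary_pairing n (\<lambda>s. fst (qU n s)) (\<lambda>s. fst (X s)) (\<lambda>s. fst (X' s))
      - boundary_pairing n (\<lambda>s. fst (u s)) (\<lambda>s. fst (X s)) (\<lambda>s. fst (X' s))
      + K * (boundary_pairing n (\<lambda>s. snd (frac_integral \<beta> U s)) (\<lambda>s. snd (X s)) (\<lambda>s. snd (X' s))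
        - boundary_pairing n (\<lambda>s. snd (frac_integral \<beta> u s)) (\<lambda>s. snd (X s)) (\<lambda>s. snd (X' s))) = 0"
proof -
  define a b where "a = t (n - 1)" and "b = t n"
  have ab: "0 \<le> a" "a \<le> b" "b \<le> T" using t_interval[OF n] t_step[OF n] by (auto simp: a_def b_def)
  have fX: "fst (X s) = (\<Sum>i\<le>p n. s ^ i *\<^sub>R fst (c i))" "fst (X' s) = (\<Sum>i\<le>p n. (real i * s ^ (i - 1)) *\<^sub>R fst (c i))"
    and sX: "snd (X s) = (\<Sum>i\<le>p n. s ^ i *\<^sub>R snd (c i))" "snd (X' s) = (\<Sum>i\<le>p n. (real i * s ^ (i - 1)) *\<^sub>R snd (c i))" for s
    by (simp_all add: X X' fst_sum snd_sum)
  obtain u' where u': "weakly_AC T u u'"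
    "AE s in lebesgue. s \<in> {0<..<T} \<longrightarrow> (\<forall>v\<in>H10 \<Omega>. fst (u' s) \<bullet> fst v
      + dirichlet_form K (riemann_liouville \<alpha> u s) v = f s \<bullet> fst v)"
    by (rule weakly_AC_u) (rule that)
  define qU' where "qU' s = (\<Sum>i\<le>p n. (real i * s ^ (i - 1)) *\<^sub>R cU n i)" for s
  have wq: "weakly_AC T (qU n) qU'" unfolding qU_def[abs_def] qU'_def[abs_def] by (rule weakly_AC_polynomial)
  note Pu = weakly_AC_parts[OF weakly_AC_fst[OF u'(1)] ab fX]
  note Pq = weakly_AC_parts[OF weakly_AC_fst[OF wq] ab fX]
  note PIu = weakly_AC_parts[OF weakly_AC_snd[OF weakly_AC_Iu] ab sX]
  note PIU = weakly_AC_parts[OF weakly_AC_snd[OF weakly_AC_IU] ab sX]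
  have XH: "X s \<in> H10 \<Omega>" for s unfolding X by (intro subspace_sum[OF subspace_H10] subspace_scale[OF subspace_H10] c) simp
  have sub: "subinterval t n = {a<..<b}" by (simp add: subinterval_def a_def b_def)
  have Xp: "X \<in> poly_space (H10 \<Omega>) (p n)" unfolding poly_space_def using c X by (auto intro!: exI[of _ c])
  note DG0 = bspec[OF bspec[OF conjunct2[OF dg[unfolded dg_solution_def]] n] Xp]
  have DG: "(fst (right_lim U a) - (if n = 1 then u0 else fst (left_lim U a))) \<bullet> fst (X a)
        + (LINT s:{a<..<b}|lebesgue. fst (vector_derivative U (at s)) \<bullet> fst (X s)
            + dirichlet_form K (riemann_liouville \<alpha> U s) (X s))
      = (LINT s:{a<..<b}|lebesgue. f s \<bullet> fst (X s))"
    using DG0 unfolding sub a_def[symmetric] .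
  have vd: "vector_derivative U (at s) = qU' s" if s: "s \<in> {a<..<b}" for s
  proof (rule vector_derivative_at)
    have "(qU n has_vector_derivative qU' s) (at s)"
      unfolding qU_def[abs_def] qU'_def by (rule polynomial_derivative)
    then show "(U has_vector_derivative qU' s) (at s)"
      by (rule has_vector_derivative_transform_within_open[where S = "{a<..<b}"])
         (use s U_eq[OF n] in \<open>auto simp: a_def b_def\<close>)
  qed
  have "(LINT s:{a<..<b}|lebesgue. fst (vector_derivative U (at s)) \<bullet> fst (X s) + dirichlet_form K (riemann_liouville \<alpha> U s) (X s))
      = (LINT s:{a<..<b}|lebesgue. fst (qU' s) \<bullet> fst (X s) + K * (snd (riemann_liouville \<alpha> U s) \<bullet> snd (X s)))"
    unfolding set_lebesgue_integral_def
    by (rule Bochner_Integration.integral_cong) (auto simp: indicator_def dirichlet_form_def vd)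
  also have "\<dots> = (LINT s:{a<..<b}|lebesgue. fst (qU' s) \<bullet> fst (X s)) + K * (LINT s:{a<..<b}|lebesgue. snd (riemann_liouville \<alpha> U s) \<bullet> snd (X s))"
    unfolding set_integral_mult_right[symmetric] by (rule set_integral_add(2)) (use Pq(1) PIU(1) in auto)
  finally have L: "(LINT s:{a<..<b}|lebesgue. fst (vector_derivative U (at s)) \<bullet> fst (X s) + dirichlet_form K (riemann_liouville \<alpha> U s) (X s))
    = (LINT s:{a<..<b}|lebesgue. fst (qU' s) \<bullet> fst (X s)) + K * (LINT s:{a<..<b}|lebesgue. snd (riemann_liouville \<alpha> U s) \<bullet> snd (X s))" .
  have int: "set_integrable lebesgue {a<..<b} (\<lambda>s. fst (u' s) \<bullet> fst (X s) + K * (snd (riemann_liouville \<alpha> u s) \<bullet> snd (X s)))"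
    by (rule set_integral_add(1)) (use Pu(1) PIu(1) in auto)
  have "(LINT s:{a<..<b}|lebesgue. f s \<bullet> fst (X s))
      = (LINT s:{a<..<b}|lebesgue. fst (u' s) \<bullet> fst (X s) + K * (snd (riemann_liouville \<alpha> u s) \<bullet> snd (X s)))"
    unfolding set_lebesgue_integral_def
  proof (rule lebesgue_integral_cong_AE(2)[OF int[unfolded set_integrable_def]])
    show "AE s in lebesgue. indicat_real {a<..<b} s *\<^sub>R (f s \<bullet> fst (X s)) =
      indicat_real {a<..<b} s *\<^sub>R (fst (u' s) \<bullet> fst (X s) + K * (snd (riemann_liouville \<alpha> u s) \<bullet> snd (X s)))"
      using u'(2)
    proof eventually_elim
      case (elim s)
      show ?case
      proof (cases "s \<in> {a<..<b}")
        case True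
        then have "s \<in> {0<..<T}" using ab by auto
        then have "fst (u' s) \<bullet> fst (X s) + dirichlet_form K (riemann_liouville \<alpha> u s) (X s) = f s \<bullet> fst (X s)"
          using elim XH by blast
        then show ?thesis by (simp add: dirichlet_form_def)
      qed simp
    qed
  qed
  also have "\<dots> = (LINT s:{a<..<b}|lebesgue. fst (u' s) \<bullet> fst (X s)) + K * (LINT s:{a<..<b}|lebesgue. snd (riemann_liouville \<alpha> u s) \<bullet> snd (X s))"
    unfolding set_integral_mult_right[symmetric] by (rule set_integral_add(2)) (use Pu(1) PIu(1) in auto)
  finally have R: "(LINT s:{a<..<b}|lebesgue. f s \<bullet> fst (X s))
    = (LINT s:{a<..<b}|lebesgue. fst (u' s) \<bullet> fst (X s)) + K * (LINT s:{a<..<b}|lebesgue. snd (riemann_liouville \<alpha> u s) \<bullet> snd (X s))" .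
  \<comment> \<open>For n \<ge> 2 the left limit of U is the sum of u and \<theta> (n - 1) at t (n -
    1), because the projection interpolates u there.\<close>
  have J: "fst (right_lim U a) - (if n = 1 then u0 else fst (left_lim U a)) = fst (qU n a) - fst (u a) - jump_start n"
  proof (cases "n = 1")
    case True
    then have "a = 0" using mesh_0[OF mesh] by (simp add: a_def)
    then show ?thesis using True right_lim_U[OF n] u_0 by (simp add: jump_start_def a_def)
  next
    case False
    then have n1: "n - 1 \<in> {1..N}" using n by auto
    show ?thesis
      using False right_lim_U[OF n] left_lim_U[OF n1] qP_end[OF n1] by (simp add: jump_start_def a_def \<theta>_eq)
  qed
  show ?thesis
    using DG unfolding L R J Pu(2) Pq(2) PIu(2) PIU(2) boundary_pairing_def a_def[symmetric] b_def[symmetric]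
    by (simp add: algebra_simps)
qed

end

section \<open>The energy estimate\<close>

lemma norm_snd_le_norm: "norm (snd x) \<le> norm x"
  by (cases x) (simp add: norm_snd_le)

lemma pw_snd: assumes "pw T v" shows "pw T (\<lambda>s. snd (v s))"
proof -
  obtain S B where S: "finite S" "\<And>s. s \<notin> S \<Longrightarrow> isCont v s" and B: "\<And>s. norm (v s) \<le> B"
    and z: "\<And>s. s \<notin> {0<..<T} \<Longrightarrow> v s = 0"
    using assms unfolding pw_def by blast
  have "norm (snd (v s)) \<le> B" for s using norm_snd_le_norm[of "v s"] B[of s] by linarith
  then show ?thesis unfolding pw_def
    using S z by (intro conjI exI[of _ S] exI[of _ B] allI impI isCont_snd) auto
qed

lemma frac_conv_snd:
  fixes v :: "real \<Rightarrow> 'b::{banach, second_countable_topology} \<times> 'c::{banach, second_countable_topology}"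
  assumes b: "0 < \<beta>" "\<beta> < 1" and v: "pw \<tau> v" and t: "0 \<le> t"
  shows "frac_conv \<beta> (\<lambda>s. snd (v s)) t = snd (frac_conv \<beta> v t)"
proof -
  have "frac_conv \<beta> (\<lambda>s. snd (v s)) t = (LINT s|lborel. snd (indicat_real {0..t} s *\<^sub>R ((t - s) powr (\<beta> - 1) *\<^sub>R v s)))"
    using frac_integral_pw(2)[OF b pw_snd[OF v] finite.emptyI t refl] by simp
  also have "\<dots> = snd (frac_conv \<beta> v t)"
    unfolding frac_integral_pw(2)[OF b v finite.emptyI t refl]
    by (rule integral_bounded_linear[OF bounded_linear_snd frac_integral_pw(1)[OF b v finite.emptyI t refl]])
  finally show ?thesis .
qed

lemma frac_conv_add:
  fixes v w :: "real \<Rightarrow> 'b::{banach, second_countable_topology}"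
  assumes b: "0 < \<beta>" "\<beta> < 1" and v: "pw \<tau> v" and w: "pw \<tau> w" and t: "0 \<le> t" and z: "pw \<tau> z" "\<And>s. z s = v s + w s"
  shows "frac_conv \<beta> z t = frac_conv \<beta> v t + frac_conv \<beta> w t"
  unfolding frac_integral_pw(2)[OF b v finite.emptyI t refl] frac_integral_pw(2)[OF b w finite.emptyI t refl]
    frac_integral_pw(2)[OF b z(1) finite.emptyI t refl] z(2) scaleR_add_right
  by (rule Bochner_Integration.integral_add)
     (rule frac_integral_pw(1)[OF b v finite.emptyI t refl] frac_integral_pw(1)[OF b w finite.emptyI t refl])+

context dg_error begin

text \<open>\<open>E n\<close> bounds the variation of P - u on the n-th interval; \<open>M\<close>
  is the right-hand side of the final estimate up to its constant.\<close>

definition "E n = (LINT s:subinterval t n|lebesgue. norm (\<eta>' s))"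
definition "M = (MAX n\<in>{1..N}. step t n powr \<alpha> * (E n)\<^sup>2)"
definition "\<eta> n s = qP n s - u s"

lemma step_pos: "n \<in> {1..N} \<Longrightarrow> 0 < step t n" using t_step by (simp add: step_def)
lemma E_le_M: "n \<in> {1..N} \<Longrightarrow> step t n powr \<alpha> * (E n)\<^sup>2 \<le> M"
  unfolding M_def by (rule Max_ge) auto
lemma M_nonneg: "0 \<le> M"
proof -
  have "0 \<le> step t 1 powr \<alpha> * (E 1)\<^sup>2" by simp
  also have "\<dots> \<le> M" by (rule E_le_M) (use N in simp)
  finally show ?thesis .
qed
lemma E_sq: assumes n: "n \<in> {1..N}" shows "(E n)\<^sup>2 \<le> M * step t n powr (- \<alpha>)"
proof -
  have "step t n powr \<alpha> * step t n powr (- \<alpha>) = 1"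
    using step_pos[OF n] unfolding powr_add[symmetric] by simp
  then have "(E n)\<^sup>2 = (step t n powr \<alpha> * (E n)\<^sup>2) * step t n powr (- \<alpha>)"
    by (metis mult.commute mult.assoc mult_1)
  also have "\<dots> \<le> M * step t n powr (- \<alpha>)" by (intro mult_right_mono E_le_M n) simp
  finally show ?thesis .
qed
lemma E_sq_T: assumes n: "n \<in> {1..N}" shows "(E n)\<^sup>2 \<le> T powr (- \<alpha>) * M"
proof -
  have "step t n \<le> T" using t_interval[OF n] by (simp add: step_def)
  then have "step t n powr (- \<alpha>) \<le> T powr (- \<alpha>)" using step_pos[OF n] \<alpha> by (intro powr_mono2) auto
  then have "M * step t n powr (- \<alpha>) \<le> M * T powr (- \<alpha>)" by (rule mult_left_mono) (rule M_nonneg)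
  then show ?thesis using E_sq[OF n] by (simp add: mult.commute)
qed

definition "h n s = indicat_real (subinterval t n) s * norm (\<eta>' s)"
text \<open>The variation function of P - u on the n-th interval. Clamping the argument makes it
  continuous on the whole line, the form in which \<open>mesh_pairing_energy\<close> takes
  it.\<close>

definition "V n s = integral {t (n - 1)..max (t (n - 1)) (min s (t n))} (h n)"

lemma h_integrable: assumes n: "n \<in> {1..N}" shows "set_integrable lebesgue {c..d} (h n)"
proof -
  have "set_integrable lebesgue (subinterval t n) \<eta>'" using eta_weak[OF n] by (simp add: has_weak_derivative_def)
  then have "set_integrable lebesgue (subinterval t n) (\<lambda>s. norm (\<eta>' s))" by (rule set_integrable_norm)
  then have "integrable lebesgue (h n)" by (simp add: set_integrable_def h_def[abs_def])
  then show ?thesis unfolding set_integrable_def by (intro integrable_mult_indicator) auto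
qed

lemma V_continuous: assumes n: "n \<in> {1..N}" shows "continuous_on UNIV (V n)"
proof -
  have "continuous_on {t (n - 1)..t n} (\<lambda>x. integral {t (n - 1)..x} (h n))"
    by (rule indefinite_integral_continuous_1[OF set_lebesgue_integral_eq_integral(1)[OF h_integrable[OF n]]])
  then show ?thesis unfolding V_def[abs_def]
    by (rule continuous_on_compose2) (use t_step[OF n] in \<open>auto intro!: continuous_intros\<close>)
qed

lemma V_diff: assumes n: "n \<in> {1..N}" and sr: "t (n - 1) \<le> s" "s \<le> r" "r \<le> t n"
  shows "V n r - V n s = integral {s..r} (h n)"
proof -
  have "integral {t (n - 1)..s} (h n) + integral {s..r} (h n) = integral {t (n - 1)..r} (h n)"
    by (rule Henstock_Kurzweil_Integration.integral_combine[OF sr(1,2)]) (rule set_lebesgue_integral_eq_integral(1)[OF h_integrable[OF n]])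
  then show ?thesis using sr by (simp add: V_def)
qed

lemma h_integral_nonneg: "n \<in> {1..N} \<Longrightarrow> 0 \<le> integral {s..r} (h n)"
  by (rule integral_nonneg[OF set_lebesgue_integral_eq_integral(1)[OF h_integrable]]) (auto simp: h_def)

lemma V_end: assumes n: "n \<in> {1..N}" shows "V n (t n) = E n"
proof -
  have "V n (t n) = integral {t (n - 1)..t n} (h n)" using t_step[OF n] by (simp add: V_def)
  also have "\<dots> = (LINT s:{t (n - 1)..t n}|lebesgue. h n s)"
    by (rule set_lebesgue_integral_eq_integral(2)[OF h_integrable[OF n], symmetric])
  also have "\<dots> = E n" unfolding E_def set_lebesgue_integral_def
    by (rule Bochner_Integration.integral_cong) (auto simp: h_def subinterval_def indicator_def)
  finally show ?thesis .
qed

lemma V_bounds: assumes n: "n \<in> {1..N}" and s: "s \<in> {t (n - 1)..t n}"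
  shows "0 \<le> V n s" "V n s \<le> E n"
proof -
  show "0 \<le> V n s" unfolding V_def by (rule h_integral_nonneg[OF n])
  show "V n s \<le> E n" using V_diff[OF n, of s "t n"] h_integral_nonneg[OF n, of s "t n"] V_end[OF n] s by simp
qed

lemma \<eta>_continuous: assumes n: "n \<in> {1..N}" shows "continuous_on {t (n - 1)..t n} (\<eta> n)"
  unfolding \<eta>_def[abs_def] using t_interval[OF n]
  by (intro continuous_intros continuous_qP continuous_on_subset[OF u_continuous]) auto

lemma Pu_eq: "n \<in> {1..N} \<Longrightarrow> s \<in> {t (n - 1)<..<t n} \<Longrightarrow> P s - u s = \<eta> n s"
  by (simp only: \<eta>_def P_eq)

lemma \<eta>_increment: assumes n: "n \<in> {1..N}" and sr: "t (n - 1) < s" "s \<le> r" "r < t n"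
  shows "norm (\<eta> n r - \<eta> n s) \<le> V n r - V n s"
proof (cases "s = r")
  case False
  with sr have sr': "s < r" by simp
  have w: "has_weak_derivative {t (n - 1)<..<t n} (\<lambda>s. P s - u s) \<eta>'" using eta_weak[OF n] by (simp only: subinterval_def)
  have i: "set_integrable lebesgue {s..r} \<eta>'"
    by (rule set_integrable_subset[of _ "{t (n - 1)<..<t n}"]) (use w sr in \<open>auto simp: has_weak_derivative_def\<close>)
  have "continuous_on {t (n - 1)<..<t n} (\<eta> n)" by (rule continuous_on_subset[OF \<eta>_continuous[OF n]]) auto
  then have c: "continuous_on {t (n - 1)<..<t n} (\<lambda>s. P s - u s)"
    by (rule continuous_on_eq) (rule Pu_eq[OF n, symmetric])
  have m: "s \<in> {t (n - 1)<..<t n}" "r \<in> {t (n - 1)<..<t n}" using sr by auto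
  have "\<eta> n r - \<eta> n s = (LINT x:{s..r}|lebesgue. \<eta>' x)"
    using weak_derivative_imp_integral[OF w c sr(1) sr' sr(3)] unfolding Pu_eq[OF n m(1)] Pu_eq[OF n m(2)] .
  then have "norm (\<eta> n r - \<eta> n s) \<le> (LINT x:{s..r}|lebesgue. norm (\<eta>' x))"
    using set_integral_norm_bound[OF i] by simp
  also have "\<dots> = (LINT x:{s..r}|lebesgue. h n x)" unfolding set_lebesgue_integral_def
    by (rule Bochner_Integration.integral_cong) (use sr in \<open>auto simp: h_def subinterval_def indicator_def\<close>)
  also have "\<dots> = integral {s..r} (h n)" by (rule set_lebesgue_integral_eq_integral(2)[OF h_integrable[OF n]])
  also have "\<dots> = V n r - V n s" by (rule V_diff[OF n, symmetric]) (use sr in auto)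
  finally show ?thesis .
qed simp

text \<open>\<eta> n vanishes at the right end of its interval, so its size is bounded by its
  variation. A limit is taken because \<open>\<eta>_increment\<close> compares interior points
  only.\<close>

lemma \<eta>_bound_inner: assumes n: "n \<in> {1..N}" and s: "s \<in> {t (n - 1)<..<t n}" shows "norm (\<eta> n s) \<le> E n"
proof -
  have "\<eta> n (t n) = 0" using qP_end[OF n] by (simp add: \<eta>_def)
  moreover have "(\<eta> n \<longlongrightarrow> \<eta> n (t n)) (at_left (t n))"
    using bspec[OF \<eta>_continuous[OF n, unfolded continuous_on_def], of "t n"] t_step[OF n]
    unfolding at_within_Icc_at_left[OF t_step[OF n]] by simp
  ultimately have "(\<eta> n \<longlongrightarrow> 0) (at_left (t n))" by simp
  then have "((\<lambda>r. E n + norm (\<eta> n r)) \<longlongrightarrow> E n + norm (0::'a jet)) (at_left (t n))" by (intro tendsto_intros)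
  moreover have "eventually (\<lambda>r. norm (\<eta> n s) \<le> E n + norm (\<eta> n r)) (at_left (t n))"
  proof (rule eventually_at_leftI[of s])
    fix r assume r: "r \<in> {s<..<t n}"
    have "norm (\<eta> n r - \<eta> n s) \<le> V n r - V n s" by (rule \<eta>_increment[OF n]) (use r s in auto)
    also have "\<dots> \<le> E n" using V_bounds(2)[OF n, of r] V_bounds(1)[OF n, of s] r s by simp
    finally show "norm (\<eta> n s) \<le> E n + norm (\<eta> n r)"
      using norm_triangle_ineq2[of "\<eta> n s" "\<eta> n r"] by (simp add: norm_minus_commute)
  qed (use s in simp)
  ultimately have "norm (\<eta> n s) \<le> E n + norm (0::'a jet)" by (rule tendsto_lowerbound) simp
  then show ?thesis by simp
qed

lemma \<eta>_bound_start: assumes n: "n \<in> {1..N}" shows "norm (\<eta> n (t (n - 1))) \<le> E n"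
proof -
  have "(\<eta> n \<longlongrightarrow> \<eta> n (t (n - 1))) (at_right (t (n - 1)))"
    using bspec[OF \<eta>_continuous[OF n, unfolded continuous_on_def], of "t (n - 1)"] t_step[OF n]
    unfolding at_within_Icc_at_right[OF t_step[OF n]] by simp
  then have "((\<lambda>r. norm (\<eta> n r)) \<longlongrightarrow> norm (\<eta> n (t (n - 1)))) (at_right (t (n - 1)))" by (rule tendsto_norm)
  moreover have "eventually (\<lambda>r. norm (\<eta> n r) \<le> E n) (at_right (t (n - 1)))"
    by (rule eventually_at_rightI[of _ "t n"], erule \<eta>_bound_inner[OF n], rule t_step[OF n])
  ultimately show ?thesis by (rule tendsto_upperbound) simp
qed

text \<open>Since p n \<ge> 1, the derivative \<theta>' n is a polynomial of degree at most p n - 1,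
  which is what the moment conditions of the projection are stated for.\<close>

lemma projection_orthogonal: assumes n: "n \<in> {1..N}"
  shows "(LBINT s:{t (n - 1)..t n}. fst (\<eta> n s) \<bullet> fst (\<theta>' n s)) = 0"
proof -
  obtain k where k: "p n = Suc k" using p[OF n] by (cases "p n") auto
  have "\<theta>' n s = (\<Sum>i\<le>k. s ^ i *\<^sub>R (real (Suc i) *\<^sub>R c\<theta> n (Suc i)))" for s
    unfolding \<theta>'_def k by (simp only: sum.atMost_Suc_shift) (simp add: mult.commute)
  then have "\<theta>' n \<in> poly_space (H10 \<Omega>) (p n - 1)"
    unfolding poly_space_def using c\<theta>[OF n] k
    by (auto intro!: exI[of _ "\<lambda>i. real (Suc i) *\<^sub>R c\<theta> n (Suc i)"] subspace_scale[OF subspace_H10])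
  then have 0: "(LINT s:subinterval t n|lebesgue. fst (u s - P s) \<bullet> fst (\<theta>' n s)) = 0"
    using proj n unfolding dg_projection_def by blast
  have "(LINT s:{t (n - 1)<..<t n}|lebesgue. fst (u s - P s) \<bullet> fst (\<theta>' n s)) = (LBINT s:{t (n - 1)..t n}. - (fst (\<eta> n s) \<bullet> fst (\<theta>' n s)))"
  proof (rule lebesgue_open_interval_integral)
    show "set_integrable lborel {t (n - 1)..t n} (\<lambda>s. - (fst (\<eta> n s) \<bullet> fst (\<theta>' n s)))"
      by (intro borel_integrable_atLeastAtMost' continuous_intros \<eta>_continuous[OF n] continuous_\<theta>')
    show "fst (u s - P s) \<bullet> fst (\<theta>' n s) = - (fst (\<eta> n s) \<bullet> fst (\<theta>' n s))" if "s \<in> {t (n - 1)<..<t n}" for s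
    proof -
      have "u s - P s = - (P s - u s)" by simp
      then show ?thesis unfolding Pu_eq[OF n that] by simp
    qed
  qed
  then show ?thesis using 0 by (simp add: subinterval_def set_integral_uminus set_lebesgue_integral_def)
qed

lemma \<theta>_derivative: "(\<theta> n has_vector_derivative \<theta>' n s) (at s)"
  unfolding \<theta>_def[abs_def] \<theta>'_def by (rule polynomial_derivative)

lemma \<theta>_energy_integral: assumes n: "n \<in> {1..N}"
  shows "(LBINT s:{t (n - 1)..t n}. fst (\<theta> n s) \<bullet> fst (\<theta>' n s))
    = (norm (fst (\<theta> n (t n))))\<^sup>2 / 2 - (norm (fst (\<theta> n (t (n - 1)))))\<^sup>2 / 2"
  unfolding power2_norm_eq_inner
proof (rule LBINT_FTC[of "{}" _ _ "\<lambda>s. (fst (\<theta> n s) \<bullet> fst (\<theta> n s)) / 2"])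
  fix s
  have 1: "((\<lambda>s. fst (\<theta> n s)) has_vector_derivative fst (\<theta>' n s)) (at s)"
    by (rule bounded_linear.has_vector_derivative[OF bounded_linear_fst \<theta>_derivative])
  have "((\<lambda>s. fst (\<theta> n s) \<bullet> fst (\<theta> n s)) has_vector_derivative (fst (\<theta> n s) \<bullet> fst (\<theta>' n s) + fst (\<theta>' n s) \<bullet> fst (\<theta> n s))) (at s)"
    by (rule bounded_bilinear.has_vector_derivative[OF bounded_bilinear_inner 1 1])
  then have "((\<lambda>s. fst (\<theta> n s) \<bullet> fst (\<theta> n s)) has_real_derivative 2 * (fst (\<theta> n s) \<bullet> fst (\<theta>' n s))) (at s)"
    by (simp add: has_real_derivative_iff_has_vector_derivative inner_commute)
  then show "((\<lambda>s. (fst (\<theta> n s) \<bullet> fst (\<theta> n s)) / 2) has_real_derivative fst (\<theta> n s) \<bullet> fst (\<theta>' n s)) (at s)"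
    by (drule_tac DERIV_cdivide[where c = 2]) simp
qed (use t_step[OF n] in \<open>auto intro!: continuous_intros borel_integrable_atLeastAtMost' continuous_\<theta> continuous_\<theta>'\<close>)

definition "\<Theta> H n = boundary_pairing n (\<lambda>s. snd (H s)) (\<lambda>s. snd (\<theta> n s)) (\<lambda>s. snd (\<theta>' n s))" for H :: "real \<Rightarrow> 'a jet"

text \<open>\<open>galerkin_identity\<close> with X = \<theta>, where U - u = \<theta> + \<eta>. The
  \<eta> part is orthogonal to \<theta>' and vanishes at t n; at the left end the boundary term
  cancels against the jump term. What is left of the time derivative completes a square with the
  left value.\<close>

lemma energy_step: assumes n: "n \<in> {1..N}"
  shows "((norm (fst (\<theta> n (t n))))\<^sup>2 + (norm (fst (\<theta> n (t (n - 1))) - jump_start n))\<^sup>2 - (norm (jump_start n))\<^sup>2) / 2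
    + K * (\<Theta> (frac_integral \<beta> U) n - \<Theta> (frac_integral \<beta> u) n) = 0"
proof -
  define a b where "a = t (n - 1)" and "b = t n"
  define L where "L = jump_start n"
  have ui: "continuous_on {a..b} u" unfolding a_def b_def
    using t_interval[OF n] by (intro continuous_on_subset[OF u_continuous]) auto
  have int: "set_integrable lborel {a..b} (\<lambda>s. fst (qU n s) \<bullet> fst (\<theta>' n s))" "set_integrable lborel {a..b} (\<lambda>s. fst (u s) \<bullet> fst (\<theta>' n s))"
    "set_integrable lborel {a..b} (\<lambda>s. fst (\<theta> n s) \<bullet> fst (\<theta>' n s))" "set_integrable lborel {a..b} (\<lambda>s. fst (\<eta> n s) \<bullet> fst (\<theta>' n s))"
    by (intro borel_integrable_atLeastAtMost' continuous_intros ui continuous_\<theta>' continuous_qU continuous_\<theta> \<eta>_continuous[OF n, folded a_def b_def])+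
  have "(LBINT s:{a..b}. fst (qU n s) \<bullet> fst (\<theta>' n s)) - (LBINT s:{a..b}. fst (u s) \<bullet> fst (\<theta>' n s))
      = (LBINT s:{a..b}. fst (\<theta> n s) \<bullet> fst (\<theta>' n s) + fst (\<eta> n s) \<bullet> fst (\<theta>' n s))"
    unfolding set_integral_diff(2)[OF int(1,2), symmetric]
    by (intro arg_cong[where f = "set_lebesgue_integral lborel {a..b}"] ext) (simp add: \<theta>_eq \<eta>_def algebra_simps)
  also have "\<dots> = (LBINT s:{a..b}. fst (\<theta> n s) \<bullet> fst (\<theta>' n s))"
    unfolding set_integral_add(2)[OF int(3,4)] using projection_orthogonal[OF n] by (simp add: a_def b_def)
  finally have I: "(LBINT s:{a..b}. fst (qU n s) \<bullet> fst (\<theta>' n s)) - (LBINT s:{a..b}. fst (u s) \<bullet> fst (\<theta>' n s))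
      = (norm (fst (\<theta> n b)))\<^sup>2 / 2 - (norm (fst (\<theta> n a)))\<^sup>2 / 2"
    using \<theta>_energy_integral[OF n] by (simp add: a_def b_def)
  have b: "fst (qU n b) \<bullet> x - fst (u b) \<bullet> x = fst (\<theta> n b) \<bullet> x" for x
    using qP_end[OF n] by (simp add: \<theta>_eq b_def inner_diff_left)
  have "(fst (qU n a) - fst (u a) - L) \<bullet> fst (\<theta> n a)
      + boundary_pairing n (\<lambda>s. fst (qU n s)) (\<lambda>s. fst (\<theta> n s)) (\<lambda>s. fst (\<theta>' n s))
      - boundary_pairing n (\<lambda>s. fst (u s)) (\<lambda>s. fst (\<theta> n s)) (\<lambda>s. fst (\<theta>' n s))
      + K * (\<Theta> (frac_integral \<beta> U) n - \<Theta> (frac_integral \<beta> u) n) = 0"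
    unfolding \<Theta>_def a_def L_def
    by (rule galerkin_identity[OF n c\<theta>[OF n]]) (auto simp: \<theta>_def \<theta>'_def)
  then have "fst (\<theta> n b) \<bullet> fst (\<theta> n b) - L \<bullet> fst (\<theta> n a) - ((norm (fst (\<theta> n b)))\<^sup>2 / 2 - (norm (fst (\<theta> n a)))\<^sup>2 / 2)
      + K * (\<Theta> (frac_integral \<beta> U) n - \<Theta> (frac_integral \<beta> u) n) = 0"
    unfolding boundary_pairing_def a_def[symmetric] b_def[symmetric] I[symmetric] b[symmetric] inner_diff_left by linarith
  moreover have "(norm (fst (\<theta> n a) - L))\<^sup>2 = (norm (fst (\<theta> n a)))\<^sup>2 - 2 * (L \<bullet> fst (\<theta> n a)) + (norm L)\<^sup>2"
    unfolding power2_norm_eq_inner by (simp add: inner_diff_left inner_diff_right inner_commute)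
  moreover have "fst (\<theta> n b) \<bullet> fst (\<theta> n b) = (norm (fst (\<theta> n b)))\<^sup>2" by (rule power2_norm_eq_inner[symmetric])
  ultimately show ?thesis unfolding a_def[symmetric] b_def[symmetric] L_def[symmetric] by (simp add: field_simps)
qed

text \<open>The left value entering step k + 1 is \<theta> k (t k), so the norms at mesh points
  telescope and the squared jumps remain.\<close>

lemma energy_sum: assumes m: "m \<in> {1..N}"
  shows "((norm (fst (\<theta> m (t m))))\<^sup>2 + (\<Sum>n\<in>{1..m}. (norm (fst (\<theta> n (t (n - 1))) - jump_start n))\<^sup>2)) / 2
    + K * (\<Sum>n\<in>{1..m}. \<Theta> (frac_integral \<beta> U) n - \<Theta> (frac_integral \<beta> u) n) = 0"
proof -
  have "1 \<le> m" "m \<le> N" using m by auto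
  then show ?thesis
  proof (induction m rule: dec_induct)
    case base
    then show ?case using energy_step[of 1] by (simp add: jump_start_def)
  next
    case (step k)
    have "Suc k \<in> {1..N}" using step by simp
    note e = energy_step[OF this]
    have "norm (jump_start (Suc k)) = norm (fst (\<theta> k (t k)))" using step by (simp add: jump_start_def)
    then have e': "((norm (fst (\<theta> (Suc k) (t (Suc k)))))\<^sup>2 + (norm (fst (\<theta> (Suc k) (t (Suc k - 1))) - jump_start (Suc k)))\<^sup>2
        - (norm (fst (\<theta> k (t k))))\<^sup>2) / 2
      + K * (\<Theta> (frac_integral \<beta> U) (Suc k) - \<Theta> (frac_integral \<beta> u) (Suc k)) = 0" using e by simp
    have IH: "((norm (fst (\<theta> k (t k))))\<^sup>2 + (\<Sum>n\<in>{1..k}. (norm (fst (\<theta> n (t (n - 1))) - jump_start n))\<^sup>2)) / 2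
      + K * (\<Sum>n\<in>{1..k}. \<Theta> (frac_integral \<beta> U) n - \<Theta> (frac_integral \<beta> u) n) = 0" using step by simp
    have sum: "(\<Sum>n\<in>{1..Suc k}. g n) = (\<Sum>n\<in>{1..k}. g n) + g (Suc k)" for g :: "nat \<Rightarrow> real" by simp
    have alg: "(y' + (S + j)) / 2 + K * (B + a) = 0" if "(y' + j - y) / 2 + K * a = 0" "(y + S) / 2 + K * B = 0" for y' j y a S B :: real
      using that by (simp add: field_simps)
    show ?case unfolding sum by (rule alg[OF e' IH])
  qed
qed

lemma boundary_pairing_cong:
  assumes n: "n \<in> {1..N}" and H: "\<And>s. s \<in> {t (n - 1)..t n} \<Longrightarrow> H s = H' s"
  shows "boundary_pairing n H X X' = boundary_pairing n H' X X'"
proof -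
  have "(LBINT s:{t (n - 1)..t n}. H s \<bullet> X' s) = (LBINT s:{t (n - 1)..t n}. H' s \<bullet> X' s)"
    by (rule set_lebesgue_integral_cong) (auto simp: H)
  moreover have "H (t n) = H' (t n)" "H (t (n - 1)) = H' (t (n - 1))" using t_step[OF n] by (auto intro!: H)
  ultimately show ?thesis by (simp add: boundary_pairing_def)
qed

lemma boundary_pairing_scaleR: "boundary_pairing n (\<lambda>s. c *\<^sub>R H s) X X' = c * boundary_pairing n H X X'"
  unfolding boundary_pairing_def by (simp add: right_diff_distrib)

lemma \<Theta>_diff: assumes n: "n \<in> {1..N}" and H: "weakly_AC T H D" "weakly_AC T H' D'"
  shows "\<Theta> (\<lambda>s. H s - H' s) n = \<Theta> H n - \<Theta> H' n"
proof -
  have ab: "0 \<le> t (n - 1)" "t (n - 1) \<le> t n" "t n \<le> T" using t_interval[OF n] t_step[OF n] by auto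
  have s: "snd (\<theta> n s) = (\<Sum>i\<le>p n. s ^ i *\<^sub>R snd (c\<theta> n i))" "snd (\<theta>' n s) = (\<Sum>i\<le>p n. (real i * s ^ (i - 1)) *\<^sub>R snd (c\<theta> n i))" for s
    by (simp_all add: \<theta>_def \<theta>'_def snd_sum)
  note i = weakly_AC_parts(3)[OF weakly_AC_snd[OF H(1)] ab s] weakly_AC_parts(3)[OF weakly_AC_snd[OF H(2)] ab s]
  show ?thesis unfolding \<Theta>_def boundary_pairing_def snd_diff inner_diff_left set_integral_diff(2)[OF i] by simp
qed

lemma weakly_AC_diff: assumes "weakly_AC T H D" "weakly_AC T H' D'"
  shows "weakly_AC T (\<lambda>s. H s - H' s :: 'a jet) (\<lambda>s. D s - D' s)"
proof -
  have "weakly_AC T (\<lambda>s. - H' s) (\<lambda>s. - D' s)"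
    unfolding weakly_AC_def
  proof
    fix c
    obtain g where g: "set_integrable lborel {0..T} g"
      "\<And>r. r \<in> {0..T} \<Longrightarrow> H' r \<bullet> (- c) = H' 0 \<bullet> (- c) + (LBINT s:{0..r}. g s)"
      "AE s in lborel. s \<in> {0<..<T} \<longrightarrow> D' s \<bullet> (- c) = g s"
      by (rule weakly_ACE[OF assms(2), of "- c"]) (rule that)
    show "\<exists>g. set_integrable lborel {0..T} g \<and> (\<forall>r\<in>{0..T}. - H' r \<bullet> c = - H' 0 \<bullet> c + (LBINT s:{0..r}. g s)) \<and>
      (AE s in lborel. s \<in> {0<..<T} \<longrightarrow> - D' s \<bullet> c = g s)"
      using g unfolding inner_minus_right inner_minus_left by blast
  qed
  from weakly_AC_add[OF assms(1) this] show ?thesis by simp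
qed

lemma pw_cut_P: "m \<in> {1..N} \<Longrightarrow> pw (t m) (cutoff m P)"
  by (rule pw_cut[where w = qP]) (auto intro: P_eq continuous_qP)

lemma cutoff_eq: assumes m: "m \<in> {1..N}" and n: "n \<in> {1..m}" "s \<in> {t (n - 1)<..<t n}"
  shows "cutoff m v s = v s"
proof -
  have mm: "mesh t m" using m by (intro mesh_sub) simp
  have ne: "s \<noteq> t i" if "i \<le> m" for i
  proof (cases "i < n")
    case True
    then have "t i \<le> t (n - 1)" using n by (intro mesh_mono[OF mm]) auto
    then show ?thesis using n by auto
  next
    case False
    then have "t n \<le> t i" using that by (intro mesh_mono[OF mm]) auto
    then show ?thesis using n by auto
  qed
  have "0 \<le> t (n - 1)" by (rule t_interval) (use n m in auto)
  moreover have "t n \<le> t m" using n by (intro mesh_mono[OF mm]) auto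
  ultimately show ?thesis using n ne by (auto simp: cutoff_def)
qed

lemma frac_integral_split: assumes m: "m \<in> {1..N}" and r: "0 \<le> r" "r \<le> t m"
  shows "frac_integral \<beta> (\<lambda>s. P s - u s) r
    = frac_integral \<beta> U r - frac_integral \<beta> u r - frac_integral \<beta> (\<lambda>s. U s - P s) r"
proof -
  have "frac_conv \<beta> (cutoff m U) r = frac_conv \<beta> (cutoff m (\<lambda>s. U s - P s)) r + frac_conv \<beta> (cutoff m P) r"
    by (rule frac_conv_add[OF \<beta> pw_cut_UP[OF m] pw_cut_P[OF m] r(1) pw_cut_U[OF m]]) (simp add: cutoff_def)
  moreover have "frac_conv \<beta> (cutoff m P) r = frac_conv \<beta> (cutoff m (\<lambda>s. P s - u s)) r + frac_conv \<beta> (cutoff m u) r"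
    by (rule frac_conv_add[OF \<beta> pw_cut_Pu[OF m] pw_cut_u[OF m] r(1) pw_cut_P[OF m]]) (simp add: cutoff_def)
  ultimately show ?thesis
    unfolding frac_integral_cut[OF m pw_cut_U[OF m] r] frac_integral_cut[OF m pw_cut_u[OF m] r]
      frac_integral_cut[OF m pw_cut_UP[OF m] r] frac_integral_cut[OF m pw_cut_Pu[OF m] r]
    by (simp add: scaleR_add_right)
qed

text \<open>\<open>E n\<close> need not increase with n, but the estimate requires a bound for
  \<eta> that also covers the past. Since the steps do not decrease and - \<alpha> > 0,
  \<open>D n\<close> is nondecreasing, and it dominates \<open>E n\<close> by the choice of
  \<open>M\<close>.\<close>

definition "D n = sqrt (M * step t n powr (- \<alpha>))"

lemma E_le_D: "n \<in> {1..N} \<Longrightarrow> E n \<le> D n"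
  unfolding D_def by (rule real_le_rsqrt) (rule E_sq)

text \<open>\<open>c2\<close> is the constant of the lower bound for the \<eta> pairing in
  \<open>mesh_pairing_energy\<close>, and \<open>c1\<close> below is its coercivity
  constant.\<close>

definition "c2 = 3 / (2 * \<beta>\<^sup>2 * Gamma (1 - \<beta>)) * (1 / (1 - \<beta>) + 1 / \<beta>)"
definition "c1 = 1 / (10 * (1 - \<beta>) * Gamma (1 - \<beta>))"
definition "\<theta>c m s = snd (cutoff m (\<lambda>s. U s - P s) s)"
definition "\<Lambda> m = mesh_pairing t m (\<lambda>n s. snd (\<theta> n s)) (\<lambda>n s. snd (\<theta>' n s)) (frac_conv \<beta> (\<theta>c m))"

lemma \<theta>c_eq: assumes m: "m \<in> {1..N}" and n: "n \<in> {1..m}" "s \<in> {t (n - 1)<..<t n}"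
  shows "\<theta>c m s = snd (\<theta> n s)"
proof -
  have nN: "n \<in> {1..N}" using m n by simp
  show ?thesis unfolding \<theta>c_def cutoff_eq[OF m n] U_eq[OF nN n(2)] P_eq[OF nN n(2)] \<theta>_eq ..
qed

lemma pw_\<theta>c: "m \<in> {1..N} \<Longrightarrow> pw (t m) (\<theta>c m)"
  unfolding \<theta>c_def[abs_def] by (rule pw_snd) (rule pw_cut_UP)

text \<open>The memory term of U - u is the sum of those of \<theta> and \<eta>. The second costs
  half of \<Lambda> m and a multiple of M t m, so half of the coercive quantity survives in the
  energy identity.\<close>

lemma energy:
  assumes m: "m \<in> {1..N}"
  shows "c1 * t m powr (\<beta> - 1) * (LBINT s:{0..t m}. (norm (\<theta>c m s))\<^sup>2) \<le> \<Lambda> m"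
    "((norm (fst (\<theta> m (t m))))\<^sup>2 + (\<Sum>n\<in>{1..m}. (norm (fst (\<theta> n (t (n - 1))) - jump_start n))\<^sup>2)) / 2
      + K / Gamma \<beta> * (\<Lambda> m / 2 - c2 * M * t m) \<le> 0"
proof -
  have mm: "mesh t m" using m by (intro mesh_sub) simp
  have tm: "t m > 0" using t_interval[OF m] by simp
  have nN: "n \<in> {1..N}" if "n \<in> {1..m}" for n using that m by simp
  define \<eta>c where "\<eta>c s = snd (cutoff m (\<lambda>s. P s - u s) s)" for s
  have \<eta>c: "\<eta>c s = snd (\<eta> n s)" if "n \<in> {1..m}" "s \<in> {t (n - 1)<..<t n}" for n s
    unfolding \<eta>c_def cutoff_eq[OF m that] Pu_eq[OF nN[OF that(1)] that(2)] ..
  have p\<eta>: "pw (t m) \<eta>c" unfolding \<eta>c_def[abs_def] by (rule pw_snd) (rule pw_cut_Pu[OF m])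
  have d: "((\<lambda>s. snd (\<theta> n s)) has_vector_derivative snd (\<theta>' n s)) (at s)" for n s
    by (rule bounded_linear.has_vector_derivative[OF bounded_linear_snd \<theta>_derivative])
  have c: "continuous_on UNIV (\<lambda>s. snd (\<theta>' n s))" for n by (intro continuous_on_snd continuous_\<theta>')
  have z: "\<eta>c (t n) = 0" if "n \<le> m" for n using that by (simp add: \<eta>c_def cutoff_def)
  have Vb: "0 \<le> V n s \<and> V n s \<le> D n" if "n \<in> {1..m}" "s \<in> {t (n - 1)..t n}" for n s
    using V_bounds[OF nN[OF that(1)] that(2)] E_le_D[OF nN[OF that(1)]] by simp
  have Dm: "D i \<le> D j" if "1 \<le> i" "i \<le> j" "j \<le> m" for i j
  proof -
    have "step t i powr (- \<alpha>) \<le> step t j powr (- \<alpha>)"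
      using steps[of i j] step_pos[of i] that m \<alpha> by (intro powr_mono2) auto
    then show ?thesis unfolding D_def by (intro real_sqrt_le_mono mult_left_mono M_nonneg)
  qed
  have \<eta>D: "norm (\<eta>c s) \<le> D n" if "n \<in> {1..m}" "s \<in> {t (n - 1)<..<t n}" for n s
  proof -
    have "norm (\<eta>c s) \<le> norm (\<eta> n s)" unfolding \<eta>c[OF that] by (rule norm_snd_le_norm)
    also have "\<dots> \<le> D n" using \<eta>_bound_inner[OF nN[OF that(1)] that(2)] E_le_D[OF nN[OF that(1)]] by simp
    finally show ?thesis .
  qed
  have DM: "(D n)\<^sup>2 \<le> M * (t n - t (n - 1)) powr (1 - \<beta>)" if "n \<in> {1..m}" for n
    using M_nonneg by (simp add: D_def step_def)
  have inc: "norm (\<eta>c r - \<eta>c s) \<le> V n r - V n s" if "n \<in> {1..m}" "t (n - 1) < s" "s \<le> r" "r < t n" for n r s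
  proof -
    have r: "r \<in> {t (n - 1)<..<t n}" and s: "s \<in> {t (n - 1)<..<t n}" using that by auto
    have "norm (\<eta>c r - \<eta>c s) \<le> norm (\<eta> n r - \<eta> n s)"
      unfolding \<eta>c[OF that(1) r] \<eta>c[OF that(1) s] snd_diff[symmetric] by (rule norm_snd_le_norm)
    also have "\<dots> \<le> V n r - V n s" by (rule \<eta>_increment[OF nN[OF that(1)] that(2-4)])
    finally show ?thesis .
  qed
  note core = mesh_pairing_energy[OF \<beta> mm tm pw_\<theta>c[OF m] \<theta>c_eq[OF m] d c p\<eta> z V_continuous[OF nN] Vb Dm \<eta>D DM inc]
  show "c1 * t m powr (\<beta> - 1) * (LBINT s:{0..t m}. (norm (\<theta>c m s))\<^sup>2) \<le> \<Lambda> m"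
    unfolding c1_def \<Lambda>_def by (rule core(1))
  have lower: "- (\<Lambda> m / 2 + c2 * M * t m) \<le> mesh_pairing t m (\<lambda>n s. snd (\<theta> n s)) (\<lambda>n s. snd (\<theta>' n s)) (frac_conv \<beta> \<eta>c)"
    unfolding c2_def \<Lambda>_def by (rule core(2))
  have \<Gamma>: "Gamma \<beta> > 0" using \<beta> by (simp add: Gamma_real_pos)
  have range: "0 \<le> s" "s \<le> t m" if "n \<in> {1..m}" "s \<in> {t (n - 1)..t n}" for n s
  proof -
    have "0 \<le> t (n - 1)" by (rule t_interval[OF nN[OF that(1)]])
    moreover have "t n \<le> t m" by (rule mesh_mono[OF mm]) (use that in auto)
    ultimately show "0 \<le> s" "s \<le> t m" using that by auto
  qed
  have A: "boundary_pairing n (frac_conv \<beta> (\<theta>c m)) (\<lambda>s. snd (\<theta> n s)) (\<lambda>s. snd (\<theta>' n s))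
      = Gamma \<beta> * \<Theta> (frac_integral \<beta> (\<lambda>s. U s - P s)) n" if n: "n \<in> {1..m}" for n
    unfolding \<Theta>_def boundary_pairing_scaleR[symmetric]
  proof (rule boundary_pairing_cong[OF nN[OF n]])
    fix s assume "s \<in> {t (n - 1)..t n}"
    note s = range[OF n this]
    show "frac_conv \<beta> (\<theta>c m) s = Gamma \<beta> *\<^sub>R snd (frac_integral \<beta> (\<lambda>s. U s - P s) s)"
      unfolding frac_integral_cut[OF m pw_cut_UP[OF m] s] \<theta>c_def[abs_def] frac_conv_snd[OF \<beta> pw_cut_UP[OF m] s(1)]
      using \<Gamma> by simp
  qed
  have B: "boundary_pairing n (frac_conv \<beta> \<eta>c) (\<lambda>s. snd (\<theta> n s)) (\<lambda>s. snd (\<theta>' n s))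
      = Gamma \<beta> * (\<Theta> (frac_integral \<beta> U) n - \<Theta> (frac_integral \<beta> u) n - \<Theta> (frac_integral \<beta> (\<lambda>s. U s - P s)) n)" if n: "n \<in> {1..m}" for n
  proof -
    have "boundary_pairing n (frac_conv \<beta> \<eta>c) (\<lambda>s. snd (\<theta> n s)) (\<lambda>s. snd (\<theta>' n s))
      = Gamma \<beta> * \<Theta> (\<lambda>s. frac_integral \<beta> U s - frac_integral \<beta> u s - frac_integral \<beta> (\<lambda>s. U s - P s) s) n"
      unfolding \<Theta>_def boundary_pairing_scaleR[symmetric]
    proof (rule boundary_pairing_cong[OF nN[OF n]])
      fix s assume "s \<in> {t (n - 1)..t n}"
      note s = range[OF n this]
      show "frac_conv \<beta> \<eta>c s = Gamma \<beta> *\<^sub>R snd (frac_integral \<beta> U s - frac_integral \<beta> u s - frac_integral \<beta> (\<lambda>s. U s - P s) s)"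
        unfolding frac_integral_split[OF m s, symmetric] frac_integral_cut[OF m pw_cut_Pu[OF m] s]
          \<eta>c_def[abs_def] frac_conv_snd[OF \<beta> pw_cut_Pu[OF m] s(1)]
        using \<Gamma> by simp
    qed
    then show ?thesis
      unfolding \<Theta>_diff[OF nN[OF n] weakly_AC_diff[OF weakly_AC_IU weakly_AC_Iu] weakly_AC_IUP]
        \<Theta>_diff[OF nN[OF n] weakly_AC_IU weakly_AC_Iu] .
  qed
  have mp: "mesh_pairing t m (\<lambda>n s. snd (\<theta> n s)) (\<lambda>n s. snd (\<theta>' n s)) F
    = (\<Sum>n\<in>{1..m}. boundary_pairing n F (\<lambda>s. snd (\<theta> n s)) (\<lambda>s. snd (\<theta>' n s)))" for F
    unfolding mesh_pairing_def boundary_pairing_def ..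
  define S where "S = (\<Sum>n\<in>{1..m}. \<Theta> (frac_integral \<beta> U) n - \<Theta> (frac_integral \<beta> u) n)"
  \<comment> \<open>In A and B the fractional integral of U - P enters with opposite signs, so it
    drops out; up to the factor Gamma \<beta> what remains is the memory sum of
    \<open>energy_sum\<close>.\<close>
  have "\<Lambda> m + mesh_pairing t m (\<lambda>n s. snd (\<theta> n s)) (\<lambda>n s. snd (\<theta>' n s)) (frac_conv \<beta> \<eta>c)
      = (\<Sum>n\<in>{1..m}. Gamma \<beta> * (\<Theta> (frac_integral \<beta> U) n - \<Theta> (frac_integral \<beta> u) n))"
    unfolding \<Lambda>_def mp sum.distrib[symmetric] by (rule sum.cong[OF refl]) (unfold A B, simp add: right_diff_distrib)
  also have "\<dots> = Gamma \<beta> * S" by (simp add: S_def sum_distrib_left)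
  finally have "\<Lambda> m / 2 - c2 * M * t m \<le> Gamma \<beta> * S" using lower by linarith
  then have "(\<Lambda> m / 2 - c2 * M * t m) / Gamma \<beta> \<le> S" using \<Gamma> by (simp add: pos_divide_le_eq mult.commute)
  then have "K * ((\<Lambda> m / 2 - c2 * M * t m) / Gamma \<beta>) \<le> K * S" using K by (intro mult_left_mono) auto
  then show "((norm (fst (\<theta> m (t m))))\<^sup>2 + (\<Sum>n\<in>{1..m}. (norm (fst (\<theta> n (t (n - 1))) - jump_start n))\<^sup>2)) / 2
      + K / Gamma \<beta> * (\<Lambda> m / 2 - c2 * M * t m) \<le> 0"
    using energy_sum[OF m] unfolding S_def[symmetric] by simp
qed

end

section \<open>The error bound\<close>

context dg_error begin

text \<open>\<open>C1\<close> results from dropping \<Lambda> m \<ge> 0 in \<open>energy\<close> and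
  using t m \<le> T. \<open>C2\<close> results from dropping the norms instead and dividing by the
  coercivity factor c1 * t m powr (\<beta> - 1).\<close>

definition "C1 = 2 * (K / Gamma \<beta>) * c2 * T"
definition "C2 = 2 * c2 / c1 * T powr (1 - \<beta>)"

lemma c1_pos: "c1 > 0" and c2_pos: "c2 > 0" and K\<Gamma>_pos: "K / Gamma \<beta> > 0"
proof -
  have 1: "0 < 1 - \<beta>" and G: "0 < Gamma (1 - \<beta>)" "0 < Gamma \<beta>" using \<beta> by (auto intro!: Gamma_real_pos)
  show "c1 > 0" unfolding c1_def by (intro divide_pos_pos mult_pos_pos 1 G) auto
  show "c2 > 0" unfolding c2_def by (intro divide_pos_pos mult_pos_pos add_pos_pos zero_less_power 1 G \<beta>) auto
  show "K / Gamma \<beta> > 0" by (rule divide_pos_pos[OF K G(2)])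
qed

lemma C1_nonneg: "C1 \<ge> 0" and C2_nonneg: "C2 \<ge> 0"
proof -
  have "0 < C1" unfolding C1_def by (intro mult_pos_pos[OF mult_pos_pos[OF mult_pos_pos]] K\<Gamma>_pos c2_pos T) simp
  then show "C1 \<ge> 0" by simp
  show "C2 \<ge> 0" using c1_pos c2_pos unfolding C2_def by simp
qed

text \<open>The energy inequality is read twice, once for the nodal values and jumps and once for
  \<Lambda> m. The last bound keeps the factor t m, which later cancels against the inverse of t n
  in the weight of the theorem.\<close>

lemma energy_bounds:
  assumes m: "m \<in> {1..N}"
  shows "(norm (fst (\<theta> m (t m))))\<^sup>2 \<le> C1 * M"
    "(norm (fst (\<theta> m (t (m - 1))) - jump_start m))\<^sup>2 \<le> C1 * M"
    "(LBINT s:{t (m - 1)..t m}. (norm (snd (\<theta> m s)))\<^sup>2) \<le> C2 * M * t m"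
proof -
  have mm: "mesh t m" using m by (intro mesh_sub) simp
  have tm: "0 < t m" "t m \<le> T" using t_interval[OF m] by auto
  define Y where "Y = (norm (fst (\<theta> m (t m))))\<^sup>2"
  define J where "J = (\<Sum>n\<in>{1..m}. (norm (fst (\<theta> n (t (n - 1))) - jump_start n))\<^sup>2)"
  define k where "k = K / Gamma \<beta>"
  have Y0: "0 \<le> Y" and J0: "0 \<le> J" by (auto simp: Y_def J_def intro: sum_nonneg)
  have k: "k > 0" using K\<Gamma>_pos by (simp add: k_def)
  have I0: "0 \<le> (LBINT s:{0..t m}. (norm (\<theta>c m s))\<^sup>2)"
    unfolding set_lebesgue_integral_def by (rule Bochner_Integration.integral_nonneg) simp
  have "0 \<le> c1 * t m powr (\<beta> - 1) * (LBINT s:{0..t m}. (norm (\<theta>c m s))\<^sup>2)"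
    using c1_pos I0 by simp
  then have \<Lambda>0: "0 \<le> \<Lambda> m" using energy(1)[OF m] by linarith
  define w where "w = k * (\<Lambda> m / 2 - c2 * M * t m)"
  have en: "(Y + J) / 2 + w \<le> 0"
    using energy(2)[OF m] by (simp only: Y_def J_def k_def w_def)
  have half: "y + 2 * x \<le> 0" if "y / 2 + x \<le> 0" for x y :: real using that by simp
  note en = half[OF en]
  have cM: "c2 * M * t m \<le> c2 * M * T" using c2_pos M_nonneg tm by (intro mult_left_mono) auto
  have "- (c2 * M * T) \<le> \<Lambda> m / 2 - c2 * M * t m" using \<Lambda>0 cM by linarith
  then have "k * (- (c2 * M * T)) \<le> w" unfolding w_def using k by (intro mult_left_mono) auto
  moreover have "C1 * M = - 2 * (k * (- (c2 * M * T)))" by (simp add: C1_def k_def)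
  ultimately have YJ: "Y + J \<le> C1 * M" using en by linarith
  show "(norm (fst (\<theta> m (t m))))\<^sup>2 \<le> C1 * M" using YJ J0 by (simp add: Y_def)
  have "(norm (fst (\<theta> m (t (m - 1))) - jump_start m))\<^sup>2 \<le> J"
    unfolding J_def by (rule member_le_sum) (use m in auto)
  then show "(norm (fst (\<theta> m (t (m - 1))) - jump_start m))\<^sup>2 \<le> C1 * M" using YJ Y0 by linarith
  have "w \<le> 0" using en Y0 J0 by linarith
  then have "\<Lambda> m / 2 - c2 * M * t m \<le> 0" using k unfolding w_def mult_le_0_iff by linarith
  then have \<Lambda>: "\<Lambda> m \<le> 2 * (c2 * M * t m)" by linarith
  define I where "I = (LBINT s:{0..t m}. (norm (\<theta>c m s))\<^sup>2)"
  have "c1 * t m powr (\<beta> - 1) * I \<le> 2 * (c2 * M * t m)" using energy(1)[OF m] \<Lambda> by (simp add: I_def)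
  then have "(c1 * t m powr (\<beta> - 1) * I) * (t m powr (1 - \<beta>) / c1) \<le> 2 * (c2 * M * t m) * (t m powr (1 - \<beta>) / c1)"
    using c1_pos by (intro mult_right_mono) auto
  moreover have "(c1 * t m powr (\<beta> - 1) * I) * (t m powr (1 - \<beta>) / c1) = I"
  proof -
    have "t m powr (\<beta> - 1) * t m powr (1 - \<beta>) = 1" using tm unfolding powr_add[symmetric] by simp
    moreover have "(c1 * x * I) * (y / c1) = (x * y) * I" for x y :: real using c1_pos by simp
    ultimately show ?thesis by simp
  qed
  ultimately have "I \<le> 2 * (c2 * M * t m) * (t m powr (1 - \<beta>) / c1)" by simp
  also have "\<dots> \<le> 2 * (c2 * M * t m) * (T powr (1 - \<beta>) / c1)"
    using tm c1_pos c2_pos M_nonneg \<alpha> by (intro mult_left_mono divide_right_mono powr_mono2) auto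
  also have "\<dots> = C2 * M * t m" by (simp add: C2_def)
  finally have I: "I \<le> C2 * M * t m" .
  have bm: "bm (t m) (\<lambda>s. (norm (\<theta>c m s))\<^sup>2)" by (intro bm_power2 bm_norm pw_bm[OF pw_\<theta>c[OF m]])
  have "(LBINT s:{t (m - 1)..t m}. (norm (snd (\<theta> m s)))\<^sup>2) = (LBINT s:{t (m - 1)..t m}. (norm (\<theta>c m s))\<^sup>2)"
    by (rule LBINT_cong_open) (subst \<theta>c_eq[OF m, of m], use m in auto)
  also have "\<dots> \<le> (\<Sum>n\<in>{1..m}. LBINT s:{t (n - 1)..t n}. (norm (\<theta>c m s))\<^sup>2)"
  proof (rule member_le_sum[where f = "\<lambda>n. LBINT s:{t (n - 1)..t n}. (norm (\<theta>c m s))\<^sup>2"])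
    fix n show "0 \<le> (LBINT s:{t (n - 1)..t n}. (norm (\<theta>c m s))\<^sup>2)"
      unfolding set_lebesgue_integral_def by (rule Bochner_Integration.integral_nonneg) simp
  qed (use m in auto)
  also have "\<dots> = I" unfolding I_def by (rule LBINT_mesh[OF mm bm order_refl, symmetric])
  finally show "(LBINT s:{t (m - 1)..t m}. (norm (snd (\<theta> m s)))\<^sup>2) \<le> C2 * M * t m" using I by linarith
qed

text \<open>The value after the jump is the jump plus the left value, each with square at most C1 M;
  the triangle inequality for squares gives 4 = 2 + 2.\<close>

lemma \<theta>_start_bound: assumes n: "n \<in> {1..N}"
  shows "(norm (fst (\<theta> n (t (n - 1)))))\<^sup>2 \<le> 4 * C1 * M"
proof -
  have L: "(norm (jump_start n))\<^sup>2 \<le> C1 * M"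
  proof (cases "n = 1")
    case True then show ?thesis using C1_nonneg M_nonneg by (simp add: jump_start_def)
  next
    case False
    then have "n - 1 \<in> {1..N}" using n by auto
    from energy_bounds(1)[OF this] show ?thesis using False by (simp add: jump_start_def)
  qed
  define x where "x = norm (fst (\<theta> n (t (n - 1))) - jump_start n)"
  define y where "y = norm (jump_start n)"
  have "norm (fst (\<theta> n (t (n - 1)))) \<le> x + y"
    using norm_triangle_ineq[of "fst (\<theta> n (t (n - 1))) - jump_start n" "jump_start n"] by (simp add: x_def y_def)
  then have "(norm (fst (\<theta> n (t (n - 1)))))\<^sup>2 \<le> (x + y)\<^sup>2" by (intro power_mono) auto
  also have "\<dots> \<le> 2 * x\<^sup>2 + 2 * y\<^sup>2" using sum_squares_bound[of x y] by (simp add: power2_sum)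
  finally show ?thesis using energy_bounds(2)[OF n] L unfolding x_def y_def by linarith
qed

text \<open>The exponent is 0 for affine pieces and 1 for higher degrees, for which the inverse
  inequality costs a division by the step.\<close>

definition "e n = min 1 (p n - 1)"
definition "\<mu> = (MIN n\<in>{1..N}. inverse (t n) * step t n ^ e n)"
definition "\<pi> = (MAX n\<in>{1..N}. (real (p n))\<^sup>2)"
text \<open>A bound for \<mu> in terms of T alone, read off at n = N, where t N = T and the last
  step is at most T.\<close>

definition "m0 = max 1 T / T"

lemma \<mu>_le: "n \<in> {1..N} \<Longrightarrow> \<mu> \<le> inverse (t n) * step t n ^ e n"
  unfolding \<mu>_def by (rule Min_le) auto

lemma \<pi>_ge: "n \<in> {1..N} \<Longrightarrow> (real (p n))\<^sup>2 \<le> \<pi>"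
  unfolding \<pi>_def by (rule Max_ge) auto

lemma \<pi>_ge_1: "1 \<le> \<pi>"
proof -
  have "1 \<le> real (p 1)" using p[of 1] N by simp
  then have "1 \<le> (real (p 1))\<^sup>2" by simp
  also have "\<dots> \<le> \<pi>" by (rule \<pi>_ge) (use N in simp)
  finally show ?thesis .
qed

lemma \<mu>_pos: "0 < \<mu>"
proof -
  have "\<mu> \<in> (\<lambda>n. inverse (t n) * step t n ^ e n) ` {1..N}"
    unfolding \<mu>_def by (rule Min_in) (use N in auto)
  then obtain n where n: "n \<in> {1..N}" "\<mu> = inverse (t n) * step t n ^ e n" by blast
  show ?thesis unfolding n(2) using t_interval(3)[OF n(1)] step_pos[OF n(1)] by simp
qed

lemma \<mu>_le_m0: "\<mu> \<le> m0"
proof -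
  have NN: "N \<in> {1..N}" using N by simp
  have s: "0 < step t N" "step t N \<le> T" using step_pos[OF NN] t_interval[OF NN] tN by (auto simp: step_def)
  have "step t N ^ e N \<le> max 1 T"
  proof (cases "e N = 0")
    case False
    then have "e N = 1" by (simp add: e_def)
    then show ?thesis using s by simp
  qed simp
  then have "inverse T * step t N ^ e N \<le> inverse T * max 1 T" using T by (intro mult_left_mono) auto
  moreover have "\<mu> \<le> inverse T * step t N ^ e N" using \<mu>_le[OF NN] unfolding tN .
  moreover have "m0 = inverse T * max 1 T" by (simp add: m0_def divide_inverse mult.commute)
  ultimately show ?thesis by linarith
qed

lemma m0_nonneg: "0 \<le> m0" using T by (simp add: m0_def)

lemma \<mu>\<pi>: "\<mu> / \<pi> \<le> m0" "0 \<le> \<mu> / \<pi>"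
proof -
  have "\<mu> / \<pi> \<le> \<mu> / 1" using \<mu>_pos \<pi>_ge_1 by (intro divide_left_mono) auto
  then show "\<mu> / \<pi> \<le> m0" using \<mu>_le_m0 by simp
  show "0 \<le> \<mu> / \<pi>" using \<mu>_pos \<pi>_ge_1 by simp
qed

text \<open>For p n = 1 the weight offers no power of the step to pay for an inverse inequality, but
  an affine function is bounded by its end values. For p n \<ge> 2 the inverse inequality and the
  Poincare inequality reduce the pointwise value to the integral of the gradient bounded in
  \<open>energy_bounds\<close>.\<close>

lemma \<theta>_weighted_bound:
  assumes n: "n \<in> {1..N}" and s: "s \<in> {t (n - 1)<..<t n}"
    and Cp: "Cp \<ge> 0" "\<And>v. v \<in> H10 \<Omega> \<Longrightarrow> (norm (fst v))\<^sup>2 \<le> Cp * (norm (snd v))\<^sup>2"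
  shows "\<mu> / \<pi> * (norm (fst (\<theta> n s)))\<^sup>2 \<le> (m0 * (4 * C1) + 8 * Cp * C2) * M"
proof (cases "p n = 1")
  case True
  define a b where "a = t (n - 1)" and "b = t n"
  have ab: "a < s" "s < b" using s by (auto simp: a_def b_def)
  \<comment> \<open>The barycentric coordinate of s: \<theta> at s is a convex combination of its
    two end values, both already bounded.\<close>
  define l where "l = (s - a) / (b - a)"
  have l: "0 \<le> l" "l \<le> 1" using ab by (auto simp: l_def divide_le_eq)
  have "l * (b - a) = s - a" using ab by (simp add: l_def)
  then have ls: "s = (1 - l) * a + l * b" by (simp add: algebra_simps)
  define c where "c = fst (c\<theta> n 0)"
  define d where "d = fst (c\<theta> n 1)"
  have lin: "fst (\<theta> n r) = c + r *\<^sub>R d" for r by (simp add: \<theta>_def True c_def d_def fst_sum)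
  have "fst (\<theta> n s) = (1 - l) *\<^sub>R fst (\<theta> n a) + l *\<^sub>R fst (\<theta> n b)"
    unfolding lin by (subst ls) (simp add: algebra_simps)
  then have "norm (fst (\<theta> n s)) \<le> norm ((1 - l) *\<^sub>R fst (\<theta> n a)) + norm (l *\<^sub>R fst (\<theta> n b))"
    by (simp only: norm_triangle_ineq)
  also have "\<dots> = (1 - l) * norm (fst (\<theta> n a)) + l * norm (fst (\<theta> n b))" using l by simp
  also have "\<dots> \<le> (1 - l) * sqrt (4 * C1 * M) + l * sqrt (4 * C1 * M)"
  proof (intro add_mono mult_left_mono)
    show "norm (fst (\<theta> n a)) \<le> sqrt (4 * C1 * M)" by (rule real_le_rsqrt) (use \<theta>_start_bound[OF n] in \<open>simp add: a_def\<close>)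
    have "0 \<le> C1 * M" using C1_nonneg M_nonneg by simp
    then have "(norm (fst (\<theta> n b)))\<^sup>2 \<le> 4 * C1 * M" using energy_bounds(1)[OF n] unfolding b_def by linarith
    then show "norm (fst (\<theta> n b)) \<le> sqrt (4 * C1 * M)" by (rule real_le_rsqrt)
  qed (use l in auto)
  also have "\<dots> = sqrt (4 * C1 * M)" by (simp add: algebra_simps)
  finally have "(norm (fst (\<theta> n s)))\<^sup>2 \<le> (sqrt (4 * C1 * M))\<^sup>2" by (intro power_mono) auto
  also have "\<dots> = 4 * C1 * M" using C1_nonneg M_nonneg by simp
  finally have "\<mu> / \<pi> * (norm (fst (\<theta> n s)))\<^sup>2 \<le> m0 * (4 * C1 * M)"
    using \<mu>\<pi> m0_nonneg by (intro mult_mono) auto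
  moreover have "0 \<le> 8 * Cp * C2 * M" using Cp(1) C2_nonneg M_nonneg by simp
  ultimately show ?thesis by (simp add: distrib_right)
next
  case False
  then have p2: "p n \<ge> 2" using p[OF n] by simp
  define k where "k = t n - t (n - 1)"
  have k: "0 < k" using t_step[OF n] by (simp add: k_def)
  have tn: "0 < t n" by (rule t_interval[OF n])
  have "e n = 1" using p2 by (simp add: e_def)
  then have \<mu>: "\<mu> \<le> k / t n" using \<mu>_le[OF n] by (simp add: k_def step_def divide_inverse mult.commute)
  define I where "I = (LBINT s:{t (n - 1)..t n}. (norm (fst (\<theta> n s)))\<^sup>2)"
  have f: "(\<lambda>s. fst (\<theta> n s)) = (\<lambda>s. \<Sum>i\<le>p n. s ^ i *\<^sub>R fst (c\<theta> n i))" by (simp add: \<theta>_def fst_sum)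
  have inv: "(norm (fst (\<theta> n s)))\<^sup>2 \<le> 2 * (real (p n) + 1)\<^sup>2 / k * I"
    unfolding I_def k_def by (rule polynomial_inverse_inequality[OF f t_step[OF n]]) (use s in auto)
  have H: "\<theta> n r \<in> H10 \<Omega>" for r
    unfolding \<theta>_def by (intro subspace_sum[OF subspace_H10] subspace_scale[OF subspace_H10] c\<theta>[OF n]) simp
  have "I \<le> (LBINT s:{t (n - 1)..t n}. Cp * (norm (snd (\<theta> n s)))\<^sup>2)"
    unfolding I_def
    by (rule set_integral_mono)
       (auto intro!: borel_integrable_atLeastAtMost' continuous_intros continuous_\<theta> Cp(2) H)
  also have "\<dots> = Cp * (LBINT s:{t (n - 1)..t n}. (norm (snd (\<theta> n s)))\<^sup>2)" by simp
  also have "\<dots> \<le> Cp * (C2 * M * t n)" by (rule mult_left_mono[OF energy_bounds(3)[OF n] Cp(1)])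
  finally have I: "I \<le> Cp * (C2 * M * t n)" .
  define q where "q = (real (p n))\<^sup>2"
  have q: "q > 0" "q \<le> \<pi>" using p2 \<pi>_ge[OF n] by (auto simp: q_def)
  have "(real (p n) + 1)\<^sup>2 \<le> (2 * real (p n))\<^sup>2" using p2 by (intro power_mono) auto
  then have "2 * (real (p n) + 1)\<^sup>2 / k \<le> 8 * q / k" using k by (intro divide_right_mono) (auto simp: q_def power_mult_distrib)
  moreover have "0 \<le> I"
    unfolding I_def set_lebesgue_integral_def by (rule Bochner_Integration.integral_nonneg) simp
  moreover have "0 \<le> Cp * (C2 * M * t n)" using Cp(1) C2_nonneg M_nonneg tn by simp
  ultimately have "2 * (real (p n) + 1)\<^sup>2 / k * I \<le> 8 * q / k * (Cp * (C2 * M * t n))"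
    using I k q by (intro mult_mono) auto
  with inv have \<theta>: "(norm (fst (\<theta> n s)))\<^sup>2 \<le> 8 * q / k * (Cp * (C2 * M * t n))" by linarith
  \<comment> \<open>The factors k / t n and 1 / q cancel q / k of the inverse inequality and t n of
    the energy bound, which leaves a constant free of mesh and degree.\<close>
  have "\<mu> / \<pi> \<le> (k / t n) / q" using \<mu> \<mu>_pos q by (intro frac_le) auto
  then have "\<mu> / \<pi> * (norm (fst (\<theta> n s)))\<^sup>2 \<le> (k / t n) / q * (8 * q / k * (Cp * (C2 * M * t n)))"
    using \<theta> k tn q by (intro mult_mono) auto
  also have "\<dots> = 8 * Cp * C2 * M" using k tn q by (simp add: field_simps)
  finally have "\<mu> / \<pi> * (norm (fst (\<theta> n s)))\<^sup>2 \<le> 8 * Cp * C2 * M" .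
  moreover have "0 \<le> m0 * (4 * C1) * M" using m0_nonneg C1_nonneg M_nonneg by simp
  ultimately show ?thesis by (simp add: distrib_right)
qed

lemma power2_norm_fst_add: "(norm (fst (x + y)))\<^sup>2 \<le> 2 * (norm (fst x))\<^sup>2 + 2 * (norm (fst (y::'a jet)))\<^sup>2"
proof -
  have "(norm (fst (x + y)))\<^sup>2 \<le> (norm (fst x) + norm (fst y))\<^sup>2"
    unfolding fst_add by (intro power_mono norm_triangle_ineq) simp
  also have "\<dots> \<le> 2 * (norm (fst x))\<^sup>2 + 2 * (norm (fst y))\<^sup>2"
    using sum_squares_bound[of "norm (fst x)" "norm (fst y)"] by (simp add: power2_sum)
  finally show ?thesis .
qed

lemma power2_norm_fst_le: "norm x \<le> E n \<Longrightarrow> (norm (fst (x::'a jet)))\<^sup>2 \<le> (E n)\<^sup>2"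
  using norm_fst_le[of "fst x" "snd x"] by (intro power_mono) auto

text \<open>At t n from the left only \<theta> contributes, because the projection interpolates
  there; from the right of t (n - 1) there is also \<eta>, bounded by \<open>E n\<close>.\<close>

lemma nodal_bound:
  assumes n: "n \<in> {1..N}"
  shows "max ((norm (fst (right_lim U (t (n - 1)) - u (t (n - 1)))))\<^sup>2) ((norm (fst (left_lim U (t n) - u (t n))))\<^sup>2)
    \<le> (8 * C1 + 2 * T powr (- \<alpha>)) * M"
proof -
  have "right_lim U (t (n - 1)) - u (t (n - 1)) = \<theta> n (t (n - 1)) + \<eta> n (t (n - 1))"
    unfolding right_lim_U[OF n] by (simp add: \<theta>_eq \<eta>_def)
  then have "(norm (fst (right_lim U (t (n - 1)) - u (t (n - 1)))))\<^sup>2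
      \<le> 2 * (norm (fst (\<theta> n (t (n - 1)))))\<^sup>2 + 2 * (norm (fst (\<eta> n (t (n - 1)))))\<^sup>2"
    by (simp only: power2_norm_fst_add)
  also have "\<dots> \<le> 2 * (4 * C1 * M) + 2 * (T powr (- \<alpha>) * M)"
    using \<theta>_start_bound[OF n] power2_norm_fst_le[OF \<eta>_bound_start[OF n]] E_sq_T[OF n] by linarith
  finally have 1: "(norm (fst (right_lim U (t (n - 1)) - u (t (n - 1)))))\<^sup>2 \<le> (8 * C1 + 2 * T powr (- \<alpha>)) * M"
    by (simp add: algebra_simps)
  have "left_lim U (t n) - u (t n) = \<theta> n (t n)"
    unfolding left_lim_U[OF n] \<theta>_eq qP_end[OF n] ..
  moreover have "C1 * M \<le> (8 * C1 + 2 * T powr (- \<alpha>)) * M"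
    using C1_nonneg M_nonneg by (intro mult_right_mono) auto
  ultimately have 2: "(norm (fst (left_lim U (t n) - u (t n))))\<^sup>2 \<le> (8 * C1 + 2 * T powr (- \<alpha>)) * M"
    using energy_bounds(1)[OF n] by simp
  show ?thesis using 1 2 by simp
qed

lemma Linf_bound:
  assumes Cp: "Cp \<ge> 0" "\<And>v. v \<in> H10 \<Omega> \<Longrightarrow> (norm (fst v))\<^sup>2 \<le> Cp * (norm (snd v))\<^sup>2"
  shows "\<mu> * ((Linf_L2 N t (\<lambda>s. u s - U s))\<^sup>2 / \<pi>)
    \<le> (2 * (m0 * (4 * C1) + 8 * Cp * C2) + 2 * m0 * T powr (- \<alpha>)) * M"
proof -
  define C3 where "C3 = 2 * (m0 * (4 * C1) + 8 * Cp * C2) + 2 * m0 * T powr (- \<alpha>)"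
  have C3: "C3 * M \<ge> 0"
    unfolding C3_def using Cp(1) m0_nonneg C1_nonneg C2_nonneg M_nonneg
    by (intro mult_nonneg_nonneg add_nonneg_nonneg) auto
  \<comment> \<open>Chosen so that \<mu> / \<pi> times the square of R is C3 * M.\<close>
  define R where "R = sqrt (C3 * M * (\<pi> / \<mu>))"
  have pt: "norm (fst (u s - U s)) \<le> R" if n: "n \<in> {1..N}" and s: "s \<in> subinterval t n" for n s
  proof -
    have s': "s \<in> {t (n - 1)<..<t n}" using s by (simp only: subinterval_def)
    have "U s - u s = \<theta> n s + \<eta> n s" unfolding U_eq[OF n s'] \<theta>_eq \<eta>_def by simp
    then have "(norm (fst (U s - u s)))\<^sup>2 \<le> 2 * (norm (fst (\<theta> n s)))\<^sup>2 + 2 * (norm (fst (\<eta> n s)))\<^sup>2"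
      by (simp only: power2_norm_fst_add)
    also have "\<dots> \<le> 2 * (norm (fst (\<theta> n s)))\<^sup>2 + 2 * (T powr (- \<alpha>) * M)"
      using power2_norm_fst_le[OF \<eta>_bound_inner[OF n s']] E_sq_T[OF n] by linarith
    finally have "\<mu> / \<pi> * (norm (fst (U s - u s)))\<^sup>2 \<le> \<mu> / \<pi> * (2 * (norm (fst (\<theta> n s)))\<^sup>2 + 2 * (T powr (- \<alpha>) * M))"
      by (rule mult_left_mono) (rule \<mu>\<pi>)
    also have "\<dots> = 2 * (\<mu> / \<pi> * (norm (fst (\<theta> n s)))\<^sup>2) + \<mu> / \<pi> * (2 * (T powr (- \<alpha>) * M))"
      by (simp add: algebra_simps)
    also have "\<dots> \<le> 2 * ((m0 * (4 * C1) + 8 * Cp * C2) * M) + m0 * (2 * (T powr (- \<alpha>) * M))"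
      using \<mu>\<pi>(1) M_nonneg by (intro add_mono mult_left_mono \<theta>_weighted_bound[OF n s' Cp] mult_right_mono) auto
    also have "\<dots> = C3 * M" by (simp add: C3_def algebra_simps)
    finally have le: "\<mu> / \<pi> * (norm (fst (U s - u s)))\<^sup>2 \<le> C3 * M" .
    have "(norm (fst (U s - u s)))\<^sup>2 = \<mu> / \<pi> * (norm (fst (U s - u s)))\<^sup>2 * (\<pi> / \<mu>)"
      using \<mu>_pos \<pi>_ge_1 by simp
    also have "\<dots> \<le> C3 * M * (\<pi> / \<mu>)" using le \<mu>_pos \<pi>_ge_1 by (intro mult_right_mono) auto
    finally have "norm (fst (U s - u s)) \<le> R" unfolding R_def by (rule real_le_rsqrt)
    then show ?thesis by (simp add: norm_minus_commute)
  qed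
  have ne: "subinterval t n \<noteq> {}" if "n \<in> {1..N}" for n
    using t_step[OF that] by (simp add: subinterval_def)
  have "Linf_L2 N t (\<lambda>s. u s - U s) \<in> (\<lambda>n. SUP s\<in>subinterval t n. norm (fst (u s - U s))) ` {1..N}"
    unfolding Linf_L2_def by (rule Max_in) (use N in auto)
  then obtain n where n: "n \<in> {1..N}" and L: "Linf_L2 N t (\<lambda>s. u s - U s) = (SUP s\<in>subinterval t n. norm (fst (u s - U s)))" by blast
  have LR: "Linf_L2 N t (\<lambda>s. u s - U s) \<le> R" unfolding L by (rule cSUP_least[OF ne[OF n]]) (rule pt[OF n])
  obtain s where s: "s \<in> subinterval t n" using ne[OF n] by blast
  have "norm (fst (u s - U s)) \<le> Linf_L2 N t (\<lambda>s. u s - U s)"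
    unfolding L by (rule cSUP_upper[OF s]) (use pt[OF n] in \<open>auto intro!: bdd_aboveI[of _ R]\<close>)
  then have L0: "0 \<le> Linf_L2 N t (\<lambda>s. u s - U s)" using norm_ge_zero[of "fst (u s - U s)"] by linarith
  have "(Linf_L2 N t (\<lambda>s. u s - U s))\<^sup>2 \<le> R\<^sup>2" by (rule power_mono[OF LR L0])
  also have "\<dots> = C3 * M * (\<pi> / \<mu>)" unfolding R_def using C3 \<mu>_pos \<pi>_ge_1 by simp
  finally have "\<mu> / \<pi> * (Linf_L2 N t (\<lambda>s. u s - U s))\<^sup>2 \<le> \<mu> / \<pi> * (C3 * M * (\<pi> / \<mu>))"
    by (rule mult_left_mono) (rule \<mu>\<pi>)
  also have "\<dots> = C3 * M" using \<mu>_pos \<pi>_ge_1 by simp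
  finally show ?thesis by (simp add: C3_def)
qed

lemma error_bound:
  assumes Cp: "Cp \<ge> 0" "\<And>v. v \<in> H10 \<Omega> \<Longrightarrow> (norm (fst v))\<^sup>2 \<le> Cp * (norm (snd v))\<^sup>2"
  shows "(MAX n\<in>{1..N}. max ((norm (fst (right_lim U (t (n - 1)) - u (t (n - 1)))))\<^sup>2)
                       ((norm (fst (left_lim U (t n) - u (t n))))\<^sup>2))
      + (MIN n\<in>{1..N}. inverse (t n) * step t n ^ min 1 (p n - 1))
        * ((Linf_L2 N t (\<lambda>s. u s - U s))\<^sup>2 / (MAX n\<in>{1..N}. (real (p n))\<^sup>2))
    \<le> (8 * C1 + 2 * T powr (- \<alpha>) + (2 * (m0 * (4 * C1) + 8 * Cp * C2) + 2 * m0 * T powr (- \<alpha>)))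
      * (MAX n\<in>{1..N}. step t n powr \<alpha> * (LINT s:subinterval t n|lebesgue. norm (\<eta>' s))\<^sup>2)"
proof -
  have 1: "(MAX n\<in>{1..N}. max ((norm (fst (right_lim U (t (n - 1)) - u (t (n - 1)))))\<^sup>2)
                       ((norm (fst (left_lim U (t n) - u (t n))))\<^sup>2)) \<le> (8 * C1 + 2 * T powr (- \<alpha>)) * M"
    by (rule Max.boundedI) (use N nodal_bound in auto)
  show ?thesis
    unfolding distrib_right using 1 Linf_bound[OF Cp] unfolding \<mu>_def \<pi>_def e_def M_def E_def distrib_right
    by linarith
qed

end

section \<open>One constant for all meshes, degrees and solutions\<close>

theorem theorem4:
  fixes \<Omega> :: "'a::euclidean_space set" and \<alpha> T K :: real
  assumes "bounded \<Omega>" "polyhedral_domain \<Omega>" "K > 0" "-1 < \<alpha>" "\<alpha> < 0" "T > 0"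
  shows "\<exists>C>0. \<forall>(N :: nat) (t :: nat \<Rightarrow> real) (p :: nat \<Rightarrow> nat)
      (f :: real \<Rightarrow> ('a, real) L2) (u0 :: ('a, real) L2)
      (u :: real \<Rightarrow> 'a jet) (U :: real \<Rightarrow> 'a jet) (P :: real \<Rightarrow> 'a jet) (\<eta>' :: real \<Rightarrow> 'a jet).
    time_mesh T N t \<longrightarrow>
    (\<forall>n\<in>{1..N}. p n \<ge> 1) \<longrightarrow>
    (\<forall>i\<in>{1..N}. \<forall>j\<in>{1..N}. i \<le> j \<longrightarrow> step t i \<le> step t j) \<longrightarrow>
    u \<in> W11 {0<..<T} (H10 \<Omega>) \<longrightarrow>
    frac_diffusion_solution \<Omega> K \<alpha> T f u0 u \<longrightarrow>
    dg_solution \<Omega> K \<alpha> N t p f u0 U \<longrightarrow>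
    dg_projection \<Omega> N t p u P \<longrightarrow>
    (\<forall>n\<in>{1..N}. has_weak_derivative (subinterval t n) (\<lambda>s. P s - u s) \<eta>') \<longrightarrow>
    (MAX n\<in>{1..N}. max ((norm (fst (right_lim U (t (n - 1)) - u (t (n - 1)))))\<^sup>2)
                       ((norm (fst (left_lim U (t n) - u (t n))))\<^sup>2))
      + (MIN n\<in>{1..N}. inverse (t n) * step t n ^ min 1 (p n - 1))
        * ((Linf_L2 N t (\<lambda>s. u s - U s))\<^sup>2 / (MAX n\<in>{1..N}. (real (p n))\<^sup>2))
    \<le> C * (MAX n\<in>{1..N}. step t n powr \<alpha>
            * (LINT s:subinterval t n|lebesgue. norm (\<eta>' s))\<^sup>2)"
proof -
  obtain Cp where Cp: "Cp \<ge> 0" "\<And>v. v \<in> H10 \<Omega> \<Longrightarrow> (norm (fst v))\<^sup>2 \<le> Cp * (norm (snd v))\<^sup>2"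
    by (rule Poincare_H10[OF assms(1)]) (rule that)
  \<comment> \<open>Outside the locale these constants take at most \<alpha>, T and K as arguments,
    so \<open>C\<close> is fixed before mesh, degrees and solution are introduced; \<open>Cp\<close>
    comes from the domain alone.\<close>
  define A1 A2 A3 where "A1 = dg_error.C1 \<alpha> T K" and "A2 = dg_error.C2 \<alpha> T" and "A3 = dg_error.m0 T"
  define C where "C = 8 * A1 + 2 * T powr (- \<alpha>) + (2 * (A3 * (4 * A1) + 8 * Cp * A2) + 2 * A3 * T powr (- \<alpha>))"
  show ?thesis
  \<comment> \<open>The maximum with 1 makes the constant positive, and M \<ge> 0 allows the
    enlargement.\<close>
  proof (rule exI[of _ "max 1 C"], intro conjI allI impI)
    fix N :: nat and t :: "nat \<Rightarrow> real" and p :: "nat \<Rightarrow> nat"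
      and f :: "real \<Rightarrow> ('a, real) L2" and u0 :: "('a, real) L2"
      and u U P \<eta>' :: "real \<Rightarrow> 'a jet"
    assume mesh: "time_mesh T N t" and p: "\<forall>n\<in>{1..N}. p n \<ge> 1"
      and steps: "\<forall>i\<in>{1..N}. \<forall>j\<in>{1..N}. i \<le> j \<longrightarrow> step t i \<le> step t j"
      and sol: "frac_diffusion_solution \<Omega> K \<alpha> T f u0 u"
      and dg: "dg_solution \<Omega> K \<alpha> N t p f u0 U" and proj: "dg_projection \<Omega> N t p u P"
      and weak: "\<forall>n\<in>{1..N}. has_weak_derivative (subinterval t n) (\<lambda>s. P s - u s) \<eta>'"
    have coeffs: "\<exists>c. \<forall>n\<in>{1..N}. (\<forall>i\<le>p n. c n i \<in> H10 \<Omega>) \<and> (\<forall>s\<in>subinterval t n. v s = (\<Sum>i\<le>p n. s ^ i *\<^sub>R c n i))"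
      if v: "v \<in> trial_space (H10 \<Omega>) N t p" for v
    proof (rule bchoice, rule ballI)
      fix n assume "n \<in> {1..N}"
      then obtain q where "q \<in> poly_space (H10 \<Omega>) (p n)" "\<forall>s\<in>subinterval t n. v s = q s"
        using v unfolding trial_space_def by blast
      then show "\<exists>c. (\<forall>i\<le>p n. c i \<in> H10 \<Omega>) \<and> (\<forall>s\<in>subinterval t n. v s = (\<Sum>i\<le>p n. s ^ i *\<^sub>R c i))"
        unfolding poly_space_def by auto
    qed
    obtain cU where cU: "\<forall>n\<in>{1..N}. (\<forall>i\<le>p n. cU n i \<in> H10 \<Omega>) \<and> (\<forall>s\<in>subinterval t n. U s = (\<Sum>i\<le>p n. s ^ i *\<^sub>R cU n i))"
      using coeffs[of U] dg unfolding dg_solution_def by blast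
    obtain cP where cP: "\<forall>n\<in>{1..N}. (\<forall>i\<le>p n. cP n i \<in> H10 \<Omega>) \<and> (\<forall>s\<in>subinterval t n. P s = (\<Sum>i\<le>p n. s ^ i *\<^sub>R cP n i))"
      using coeffs[of P] proj unfolding dg_projection_def by blast
    interpret dg_error \<Omega> \<alpha> T K N t p f u0 u U P \<eta>' cU cP
      by (unfold_locales; (rule assms mesh sol dg proj)?; use p steps weak cU cP in auto)
    have "C = 8 * C1 + 2 * T powr (- \<alpha>) + (2 * (m0 * (4 * C1) + 8 * Cp * C2) + 2 * m0 * T powr (- \<alpha>))"
      by (simp only: C_def A1_def A2_def A3_def)
    note main = error_bound[OF Cp, folded this]
    have "C * M \<le> max 1 C * M" by (rule mult_right_mono) (use M_nonneg in auto)
    then show "(MAX n\<in>{1..N}. max ((norm (fst (right_lim U (t (n - 1)) - u (t (n - 1)))))\<^sup>2)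
                       ((norm (fst (left_lim U (t n) - u (t n))))\<^sup>2))
      + (MIN n\<in>{1..N}. inverse (t n) * step t n ^ min 1 (p n - 1))
        * ((Linf_L2 N t (\<lambda>s. u s - U s))\<^sup>2 / (MAX n\<in>{1..N}. (real (p n))\<^sup>2))
    \<le> max 1 C * (MAX n\<in>{1..N}. step t n powr \<alpha>
            * (LINT s:subinterval t n|lebesgue. norm (\<eta>' s))\<^sup>2)"
      using main unfolding M_def E_def by linarith
  qed simp
qed

end
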